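(* Let $\Lambda$ be a countable finitely aligned left cancellative small category. Then: (1) $C^*(\Lambda)\cong C^*(\mathcal{G}_{tight}(\mathcal{S}_\Lambda))$. (2) For any unital commutative ring $R$, $R\Lambda\cong A_R(\mathcal{G}_{tight}(\mathcal{S}_\Lambda))$.
   Context: Categories. A small category $\Lambda$ is identified with its set of morphisms, and its objects $\Lambda^0$ with the identity morphisms; $s(\alpha)$ is the domain and $r(\alpha)$ the range of $\alpha$; $\alpha\beta$ is defined when $s(\alpha)=r(\beta)$; $\alpha\Lambda=\{\alpha\beta: r(\beta)=s(\alpha)\}$. $\Lambda$ is left cancellative if $\alpha\beta=\alpha\gamma$ implies $\beta=\gamma$. It is finitely aligned if for all $\alpha,\beta$ there is a finite $\Gamma\subset\Lambda$ with $\alpha\Lambda\cap\beta\Lambda=\bigcup_{\gamma\in\Gamma}\gamma\Lambda$; $\alpha\vee\beta$ denotes such a finite set of minimal common extensions (a common extension $\varepsilon$ is minimal if whenever $\gamma$ is a common extension with $\varepsilon\in\gamma\Lambda$, then $\gamma\Lambda=\varepsilon\Lambda$). For $v\in\Lambda^0$, a finite set $F\subset v\Lambda$ is exhaustive if for every $\gamma\in v\Lambda$ there is $\beta\in F$ with $\beta\Lambda\cap\gamma\Lambda\neq\emptyset$. Algebras. $C^*(\Lambda)$ is the universal $C^*$-algebra generated by a family $\{T_\alpha:\alpha\in\Lambda\}$ satisfying: (i) $T_\alpha^*T_\alpha=T_{s(\alpha)}$; (ii) $T_\alpha T_\beta=T_{\alpha\beta}$ if $s(\alpha)=r(\beta)$;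 (iii) $T_\alpha T_\alpha^*T_\beta T_\beta^*=\bigvee_{\gamma\in\alpha\vee\beta}T_\gamma T_\gamma^*$; (iv) $T_v=\bigvee_{\alpha\in F}T_\alpha T_\alpha^*$ for every $v\in\Lambda^0$ and every finite exhaustive set $F\subset v\Lambda$. Here $\bigvee$ is the join of commuting projections ($p\vee q=p+q-pq$; empty join $=0$). For a unital commutative ring $R$, $R\Lambda$ is the universal $R$-algebra (with $R$-linear involution) generated by a family $\{T_\alpha\}$ satisfying the same relations (i)–(iv). Tight groupoid. For $\alpha\in\Lambda$, $\tau^\alpha:s(\alpha)\Lambda\to\alpha\Lambda$, $\beta\mapsto\alpha\beta$, $\sigma^\alpha:=(\tau^\alpha)^{-1}$; $\mathcal{S}_\Lambda$ is the inverse semigroup of partial bijections of $\Lambda$ generated by all of these, $\mathcal{E}$ its semilattice of idempotents ($e\le f$ iff $e=ef$). A filter is a nonempty $\eta\subseteq\mathcal{E}$ not containing the empty map $0$, upward closed and closed under products; the set of filters has the topology with basis $\{\eta: X\subseteq\eta,\ Y\cap\eta=\emptyset\}$, $X,Y\subset\mathcal{E}$ finite; $\hat{\mathcal{E}}_{tight}$ is the closure of the set of ultrafilters (maximal filters). $s\in\mathcal{S}_\Lambda$ acts on $\eta\in\hat{\mathcal{E}}_{tight}$ with $s^*s\in\eta$ by $s\cdot\eta=\{f\in\mathcal{E}: ses^*\le f\text{ for some }e\in\eta\}$. $\mathcal{G}_{tight}(\mathcal{S}_\Lambda)$ is the étale groupoid of germs $[s,\eta]$ ($\eta\in\hat{\mathcal{E}}_{tight}$,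 $s^*s\in\eta$; $[s,\eta]=[t,\eta']$ iff $\eta=\eta'$ and $se=te$ for some $e\in\eta$), with $d[s,\eta]=\eta$, $r[s,\eta]=s\cdot\eta$, $[s,t\cdot\eta][t,\eta]=[st,\eta]$ and basic open sets $\{[s,\eta]:\eta\in U\}$, $U$ open in $\{\eta\in\hat{\mathcal{E}}_{tight}: s^*s\in\eta\}$. $C^*(\mathcal{G})$ is the full groupoid $C^*$-algebra of an étale groupoid $\mathcal{G}$, and $A_R(\mathcal{G})$ the Steinberg algebra over $R$: the $R$-span of the characteristic functions of compact open bisections of $\mathcal{G}$ with convolution product. *)

theory Defs
  imports "HOL-Analysis.Analysis"
begin

section \<open>Left cancellative small categories\<close>

text \<open>A small category is its set of morphisms; the objects are the identity morphisms, so that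
  source and range are maps from morphisms to morphisms. The product \<open>cmp \<Lambda> \<alpha> \<beta>\<close> is
  meaningful only for \<open>src \<Lambda> \<alpha> = rng \<Lambda> \<beta>\<close>.\<close>

record 'a small_cat =
  Mor :: "'a set"
  src :: "'a \<Rightarrow> 'a"
  rng :: "'a \<Rightarrow> 'a"
  cmp :: "'a \<Rightarrow> 'a \<Rightarrow> 'a"

definition small_category :: "'a small_cat \<Rightarrow> bool" where
  "small_category \<Lambda> \<longleftrightarrow>
     (\<forall>\<alpha>\<in>Mor \<Lambda>. src \<Lambda> \<alpha> \<in> Mor \<Lambda> \<and> rng \<Lambda> \<alpha> \<in> Mor \<Lambda> \<and>
        src \<Lambda> (src \<Lambda> \<alpha>) = src \<Lambda> \<alpha> \<and> rng \<Lambda> (src \<Lambda> \<alpha>) = src \<Lambda> \<alpha> \<and>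
        src \<Lambda> (rng \<Lambda> \<alpha>) = rng \<Lambda> \<alpha> \<and> rng \<Lambda> (rng \<Lambda> \<alpha>) = rng \<Lambda> \<alpha> \<and>
        cmp \<Lambda> \<alpha> (src \<Lambda> \<alpha>) = \<alpha> \<and> cmp \<Lambda> (rng \<Lambda> \<alpha>) \<alpha> = \<alpha>) \<and>
     (\<forall>\<alpha>\<in>Mor \<Lambda>. \<forall>\<beta>\<in>Mor \<Lambda>. src \<Lambda> \<alpha> = rng \<Lambda> \<beta> \<longrightarrow>
        cmp \<Lambda> \<alpha> \<beta> \<in> Mor \<Lambda> \<and> src \<Lambda> (cmp \<Lambda> \<alpha> \<beta>) = src \<Lambda> \<beta> \<and>
        rng \<Lambda> (cmp \<Lambda> \<alpha> \<beta>) = rng \<Lambda> \<alpha>) \<and>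
     (\<forall>\<alpha>\<in>Mor \<Lambda>. \<forall>\<beta>\<in>Mor \<Lambda>. \<forall>\<gamma>\<in>Mor \<Lambda>. src \<Lambda> \<alpha> = rng \<Lambda> \<beta> \<and> src \<Lambda> \<beta> = rng \<Lambda> \<gamma> \<longrightarrow>
        cmp \<Lambda> (cmp \<Lambda> \<alpha> \<beta>) \<gamma> = cmp \<Lambda> \<alpha> (cmp \<Lambda> \<beta> \<gamma>))"

definition Obj :: "'a small_cat \<Rightarrow> 'a set" where
  "Obj \<Lambda> = src \<Lambda> ` Mor \<Lambda>"

definition left_cancellative :: "'a small_cat \<Rightarrow> bool" where
  "left_cancellative \<Lambda> \<longleftrightarrow>
     (\<forall>\<alpha>\<in>Mor \<Lambda>. \<forall>\<beta>\<in>Mor \<Lambda>. \<forall>\<gamma>\<in>Mor \<Lambda>.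
        src \<Lambda> \<alpha> = rng \<Lambda> \<beta> \<and> src \<Lambda> \<alpha> = rng \<Lambda> \<gamma> \<and> cmp \<Lambda> \<alpha> \<beta> = cmp \<Lambda> \<alpha> \<gamma> \<longrightarrow> \<beta> = \<gamma>)"

definition right_ideal :: "'a small_cat \<Rightarrow> 'a \<Rightarrow> 'a set" where
  "right_ideal \<Lambda> \<alpha> = {cmp \<Lambda> \<alpha> \<beta> | \<beta>. \<beta> \<in> Mor \<Lambda> \<and> rng \<Lambda> \<beta> = src \<Lambda> \<alpha>}"

definition finitely_aligned :: "'a small_cat \<Rightarrow> bool" where
  "finitely_aligned \<Lambda> \<longleftrightarrow>
     (\<forall>\<alpha>\<in>Mor \<Lambda>. \<forall>\<beta>\<in>Mor \<Lambda>. \<exists>\<Gamma>. finite \<Gamma> \<and> \<Gamma> \<subseteq> Mor \<Lambda> \<and>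
        right_ideal \<Lambda> \<alpha> \<inter> right_ideal \<Lambda> \<beta> = (\<Union>\<gamma>\<in>\<Gamma>. right_ideal \<Lambda> \<gamma>))"

definition min_common_ext :: "'a small_cat \<Rightarrow> 'a \<Rightarrow> 'a \<Rightarrow> 'a \<Rightarrow> bool" where
  "min_common_ext \<Lambda> \<alpha> \<beta> \<epsilon> \<longleftrightarrow>
     \<epsilon> \<in> right_ideal \<Lambda> \<alpha> \<inter> right_ideal \<Lambda> \<beta> \<and>
     (\<forall>\<gamma> \<in> right_ideal \<Lambda> \<alpha> \<inter> right_ideal \<Lambda> \<beta>.
        \<epsilon> \<in> right_ideal \<Lambda> \<gamma> \<longrightarrow> right_ideal \<Lambda> \<gamma> = right_ideal \<Lambda> \<epsilon>)"

text \<open>\<open>is_vee \<Lambda> \<alpha> \<beta> \<Gamma>\<close>: the set \<open>\<Gamma>\<close> is an admissible choice of \<open>\<alpha> \<or> \<beta>\<close>, which is unique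
  only up to right multiplication of its elements by invertible morphisms.\<close>

definition is_vee :: "'a small_cat \<Rightarrow> 'a \<Rightarrow> 'a \<Rightarrow> 'a set \<Rightarrow> bool" where
  "is_vee \<Lambda> \<alpha> \<beta> \<Gamma> \<longleftrightarrow> finite \<Gamma> \<and> (\<forall>\<gamma>\<in>\<Gamma>. min_common_ext \<Lambda> \<alpha> \<beta> \<gamma>) \<and>
     right_ideal \<Lambda> \<alpha> \<inter> right_ideal \<Lambda> \<beta> = (\<Union>\<gamma>\<in>\<Gamma>. right_ideal \<Lambda> \<gamma>)"

definition exhaustive :: "'a small_cat \<Rightarrow> 'a \<Rightarrow> 'a set \<Rightarrow> bool" where
  "exhaustive \<Lambda> v F \<longleftrightarrow> finite F \<and> F \<subseteq> right_ideal \<Lambda> v \<and>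
     (\<forall>\<gamma>\<in>right_ideal \<Lambda> v. \<exists>\<beta>\<in>F. right_ideal \<Lambda> \<beta> \<inter> right_ideal \<Lambda> \<gamma> \<noteq> {})"


section \<open>\<open>*\<close>-algebras\<close>

text \<open>Algebras over a commutative ring \<open>R\<close> are not assumed to be unital. The sort
  \<open>{comm_ring, comm_monoid_mult}\<close> used for \<open>R\<close> is that of unital commutative rings; unlike
  \<open>comm_ring_1\<close> it does not exclude the zero ring. The parameter \<open>cj\<close> is an
  involution of the scalars: \<open>cj = id\<close> gives an \<open>R\<close>-linear involution of the algebra, and
  \<open>cj = cnj\<close> gives a conjugate linear one.\<close>

record ('r, 'b) star_alg =
  carr :: "'b set"
  azero :: 'b
  aadd :: "'b \<Rightarrow> 'b \<Rightarrow> 'b"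
  ascale :: "'r \<Rightarrow> 'b \<Rightarrow> 'b"
  amul :: "'b \<Rightarrow> 'b \<Rightarrow> 'b"
  astar :: "'b \<Rightarrow> 'b"

definition star_alg_hom ::
  "('r, 'b, 'm) star_alg_scheme \<Rightarrow> ('r, 'c, 'n) star_alg_scheme \<Rightarrow> ('b \<Rightarrow> 'c) \<Rightarrow> bool" where
  "star_alg_hom A B h \<longleftrightarrow>
     (\<forall>x\<in>carr A. h x \<in> carr B) \<and>
     (\<forall>x\<in>carr A. \<forall>y\<in>carr A. h (aadd A x y) = aadd B (h x) (h y)) \<and>
     (\<forall>c. \<forall>x\<in>carr A. h (ascale A c x) = ascale B c (h x)) \<and>
     (\<forall>x\<in>carr A. \<forall>y\<in>carr A. h (amul A x y) = amul B (h x) (h y)) \<and>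
     (\<forall>x\<in>carr A. h (astar A x) = astar B (h x))"

definition star_alg_isomorphic ::
  "('r, 'b, 'm) star_alg_scheme \<Rightarrow> ('r, 'c, 'n) star_alg_scheme \<Rightarrow> bool" where
  "star_alg_isomorphic A B \<longleftrightarrow> (\<exists>h. star_alg_hom A B h \<and> bij_betw h (carr A) (carr B))"

definition star_algebra ::
  "('r::{comm_ring, comm_monoid_mult} \<Rightarrow> 'r) \<Rightarrow> ('r, 'b, 'm) star_alg_scheme \<Rightarrow> bool" where
  "star_algebra cj A \<longleftrightarrow>
     azero A \<in> carr A \<and>
     (\<forall>x\<in>carr A. astar A x \<in> carr A \<and> (\<forall>c. ascale A c x \<in> carr A)) \<and>
     (\<forall>x\<in>carr A. \<forall>y\<in>carr A. aadd A x y \<in> carr A \<and> amul A x y \<in> carr A) \<and>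
     (\<forall>x\<in>carr A. \<forall>y\<in>carr A. \<forall>z\<in>carr A.
        aadd A (aadd A x y) z = aadd A x (aadd A y z) \<and>
        amul A (amul A x y) z = amul A x (amul A y z) \<and>
        amul A (aadd A x y) z = aadd A (amul A x z) (amul A y z) \<and>
        amul A x (aadd A y z) = aadd A (amul A x y) (amul A x z)) \<and>
     (\<forall>x\<in>carr A. \<forall>y\<in>carr A. aadd A x y = aadd A y x) \<and>
     (\<forall>x\<in>carr A. aadd A x (azero A) = x \<and> aadd A x (ascale A (- 1) x) = azero A) \<and>
     (\<forall>c d. \<forall>x\<in>carr A. ascale A (c + d) x = aadd A (ascale A c x) (ascale A d x) \<and>
        ascale A (c * d) x = ascale A c (ascale A d x)) \<and>
     (\<forall>x\<in>carr A. ascale A 1 x = x) \<and>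
     (\<forall>c. \<forall>x\<in>carr A. \<forall>y\<in>carr A.
        ascale A c (aadd A x y) = aadd A (ascale A c x) (ascale A c y) \<and>
        amul A (ascale A c x) y = ascale A c (amul A x y) \<and>
        amul A x (ascale A c y) = ascale A c (amul A x y)) \<and>
     (\<forall>x\<in>carr A. astar A (astar A x) = x \<and> (\<forall>c. astar A (ascale A c x) = ascale A (cj c) (astar A x))) \<and>
     (\<forall>x\<in>carr A. \<forall>y\<in>carr A. astar A (aadd A x y) = aadd A (astar A x) (astar A y) \<and>
        astar A (amul A x y) = amul A (astar A y) (astar A x))"


subsection \<open>Universal \<open>*\<close>-algebras given by generators and relations\<close>

datatype ('r, 'a) star_term =
    Gen 'a
  | Zero
  | Add "('r, 'a) star_term" "('r, 'a) star_term"
  | Scale 'r "('r, 'a) star_term"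
  | Mul "('r, 'a) star_term" "('r, 'a) star_term"
  | Star "('r, 'a) star_term"

primrec gens :: "('r, 'a) star_term \<Rightarrow> 'a set" where
  "gens (Gen x) = {x}"
| "gens Zero = {}"
| "gens (Add s t) = gens s \<union> gens t"
| "gens (Scale c t) = gens t"
| "gens (Mul s t) = gens s \<union> gens t"
| "gens (Star t) = gens t"

definition terms_over :: "'a set \<Rightarrow> ('r, 'a) star_term set" where
  "terms_over X = {t. gens t \<subseteq> X}"

text \<open>The congruence generated by the \<open>*\<close>-algebra axioms together with the pairs in \<open>Rel\<close>.\<close>

inductive star_cong ::
  "('r::{comm_ring, comm_monoid_mult} \<Rightarrow> 'r) \<Rightarrow> (('r, 'a) star_term \<times> ('r, 'a) star_term) set
     \<Rightarrow> ('r, 'a) star_term \<Rightarrow> ('r, 'a) star_term \<Rightarrow> bool"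
  for cj Rel where
  rel: "(s, t) \<in> Rel \<Longrightarrow> star_cong cj Rel s t"
| refl: "star_cong cj Rel t t"
| sym: "star_cong cj Rel s t \<Longrightarrow> star_cong cj Rel t s"
| trans: "star_cong cj Rel s t \<Longrightarrow> star_cong cj Rel t u \<Longrightarrow> star_cong cj Rel s u"
| cong_add: "star_cong cj Rel s s' \<Longrightarrow> star_cong cj Rel t t' \<Longrightarrow> star_cong cj Rel (Add s t) (Add s' t')"
| cong_scale: "star_cong cj Rel t t' \<Longrightarrow> star_cong cj Rel (Scale c t) (Scale c t')"
| cong_mul: "star_cong cj Rel s s' \<Longrightarrow> star_cong cj Rel t t' \<Longrightarrow> star_cong cj Rel (Mul s t) (Mul s' t')"
| cong_star: "star_cong cj Rel t t' \<Longrightarrow> star_cong cj Rel (Star t) (Star t')"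
| add_assoc: "star_cong cj Rel (Add (Add s t) u) (Add s (Add t u))"
| add_comm: "star_cong cj Rel (Add s t) (Add t s)"
| add_zero: "star_cong cj Rel (Add t Zero) t"
| add_inverse: "star_cong cj Rel (Add t (Scale (- 1) t)) Zero"
| scale_add: "star_cong cj Rel (Scale c (Add s t)) (Add (Scale c s) (Scale c t))"
| add_scale: "star_cong cj Rel (Scale (c + d) t) (Add (Scale c t) (Scale d t))"
| scale_scale: "star_cong cj Rel (Scale (c * d) t) (Scale c (Scale d t))"
| scale_one: "star_cong cj Rel (Scale 1 t) t"
| mul_assoc: "star_cong cj Rel (Mul (Mul s t) u) (Mul s (Mul t u))"
| mul_add_left: "star_cong cj Rel (Mul (Add s t) u) (Add (Mul s u) (Mul t u))"
| mul_add_right: "star_cong cj Rel (Mul s (Add t u)) (Add (Mul s t) (Mul s u))"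
| mul_scale_left: "star_cong cj Rel (Mul (Scale c s) t) (Scale c (Mul s t))"
| mul_scale_right: "star_cong cj Rel (Mul s (Scale c t)) (Scale c (Mul s t))"
| star_star: "star_cong cj Rel (Star (Star t)) t"
| star_add: "star_cong cj Rel (Star (Add s t)) (Add (Star s) (Star t))"
| star_scale: "star_cong cj Rel (Star (Scale c t)) (Scale (cj c) (Star t))"
| star_mul: "star_cong cj Rel (Star (Mul s t)) (Mul (Star t) (Star s))"

definition term_class ::
  "('r::{comm_ring, comm_monoid_mult} \<Rightarrow> 'r) \<Rightarrow> 'a set \<Rightarrow> (('r, 'a) star_term \<times> ('r, 'a) star_term) set
     \<Rightarrow> ('r, 'a) star_term \<Rightarrow> ('r, 'a) star_term set" where
  "term_class cj X Rel t = {u \<in> terms_over X. star_cong cj Rel t u}"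

definition presented_alg ::
  "('r::{comm_ring, comm_monoid_mult} \<Rightarrow> 'r) \<Rightarrow> 'a set \<Rightarrow> (('r, 'a) star_term \<times> ('r, 'a) star_term) set
     \<Rightarrow> ('r, ('r, 'a) star_term set) star_alg" where
  "presented_alg cj X Rel =
     \<lparr> carr = term_class cj X Rel ` terms_over X,
       azero = term_class cj X Rel Zero,
       aadd = (\<lambda>P Q. \<Union>s\<in>P. \<Union>t\<in>Q. term_class cj X Rel (Add s t)),
       ascale = (\<lambda>c P. \<Union>s\<in>P. term_class cj X Rel (Scale c s)),
       amul = (\<lambda>P Q. \<Union>s\<in>P. \<Union>t\<in>Q. term_class cj X Rel (Mul s t)),
       astar = (\<lambda>P. \<Union>s\<in>P. term_class cj X Rel (Star s)) \<rparr>"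

text \<open>The universal property of \<open>presented_alg\<close>: it is a \<open>*\<close>-algebra generated by a family
  satisfying the relations, and every such family in a \<open>*\<close>-algebra arises from a unique
  homomorphism.\<close>

primrec eval_term ::
  "('r, 'b, 'm) star_alg_scheme \<Rightarrow> ('a \<Rightarrow> 'b) \<Rightarrow> ('r, 'a) star_term \<Rightarrow> 'b" where
  "eval_term A T (Gen x) = T x"
| "eval_term A T Zero = azero A"
| "eval_term A T (Add s t) = aadd A (eval_term A T s) (eval_term A T t)"
| "eval_term A T (Scale c t) = ascale A c (eval_term A T t)"
| "eval_term A T (Mul s t) = amul A (eval_term A T s) (eval_term A T t)"
| "eval_term A T (Star t) = astar A (eval_term A T t)"

lemma term_class_eqI:
  "star_cong cj Rel s t \<Longrightarrow> term_class cj X Rel s = term_class cj X Rel t"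
  unfolding term_class_def by (blast intro: star_cong.sym star_cong.trans)

lemma term_class_self: "t \<in> terms_over X \<Longrightarrow> t \<in> term_class cj X Rel t"
  unfolding term_class_def by (blast intro: star_cong.refl)

lemma UN_term_class:
  assumes "v \<in> terms_over X" "\<And>u. star_cong cj Rel u v \<Longrightarrow> F u = F v"
  shows "(\<Union>u\<in>term_class cj X Rel v. F u) = F v"
proof -
  have "F u = F v" if "u \<in> term_class cj X Rel v" for u
    using that assms(2) by (auto simp: term_class_def intro: star_cong.sym)
  then show ?thesis using term_class_self[OF assms(1), of cj Rel] by blast
qed

lemma presented_alg_zero: "azero (presented_alg cj X Rel) = term_class cj X Rel Zero"
  by (simp add: presented_alg_def)

lemma presented_alg_scale:
  "s \<in> terms_over X \<Longrightarrow>
   ascale (presented_alg cj X Rel) c (term_class cj X Rel s) = term_class cj X Rel (Scale c s)"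
  unfolding presented_alg_def
  by (simp, rule UN_term_class) (assumption, rule term_class_eqI, erule star_cong.cong_scale)

lemma presented_alg_star:
  "s \<in> terms_over X \<Longrightarrow>
   astar (presented_alg cj X Rel) (term_class cj X Rel s) = term_class cj X Rel (Star s)"
  unfolding presented_alg_def
  by (simp, rule UN_term_class) (assumption, rule term_class_eqI, erule star_cong.cong_star)

lemma presented_alg_add:
  assumes "s \<in> terms_over X" "t \<in> terms_over X"
  shows "aadd (presented_alg cj X Rel) (term_class cj X Rel s) (term_class cj X Rel t) =
    term_class cj X Rel (Add s t)"
proof -
  have "(\<Union>v\<in>term_class cj X Rel t. term_class cj X Rel (Add u v)) = term_class cj X Rel (Add u t)" for u
    using assms(2) by (rule UN_term_class) (rule term_class_eqI, erule star_cong.cong_add[OF star_cong.refl])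
  moreover have "(\<Union>u\<in>term_class cj X Rel s. term_class cj X Rel (Add u t)) = term_class cj X Rel (Add s t)"
    using assms(1) by (rule UN_term_class) (rule term_class_eqI, erule star_cong.cong_add[OF _ star_cong.refl])
  ultimately show ?thesis by (simp add: presented_alg_def)
qed

lemma presented_alg_mul:
  assumes "s \<in> terms_over X" "t \<in> terms_over X"
  shows "amul (presented_alg cj X Rel) (term_class cj X Rel s) (term_class cj X Rel t) =
    term_class cj X Rel (Mul s t)"
proof -
  have "(\<Union>v\<in>term_class cj X Rel t. term_class cj X Rel (Mul u v)) = term_class cj X Rel (Mul u t)" for u
    using assms(2) by (rule UN_term_class) (rule term_class_eqI, erule star_cong.cong_mul[OF star_cong.refl])
  moreover have "(\<Union>u\<in>term_class cj X Rel s. term_class cj X Rel (Mul u t)) = term_class cj X Rel (Mul s t)"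
    using assms(1) by (rule UN_term_class) (rule term_class_eqI, erule star_cong.cong_mul[OF _ star_cong.refl])
  ultimately show ?thesis by (simp add: presented_alg_def)
qed

lemmas presented_alg_ops = presented_alg_zero presented_alg_scale presented_alg_star
  presented_alg_add presented_alg_mul

lemma terms_over_simps [simp]:
  "Gen x \<in> terms_over X \<longleftrightarrow> x \<in> X" "Zero \<in> terms_over X"
  "Add s t \<in> terms_over X \<longleftrightarrow> s \<in> terms_over X \<and> t \<in> terms_over X"
  "Mul s t \<in> terms_over X \<longleftrightarrow> s \<in> terms_over X \<and> t \<in> terms_over X"
  "Scale c t \<in> terms_over X \<longleftrightarrow> t \<in> terms_over X" "Star t \<in> terms_over X \<longleftrightarrow> t \<in> terms_over X"
  by (auto simp: terms_over_def)

lemma carr_presented_alg: "carr (presented_alg cj X Rel) = term_class cj X Rel ` terms_over X"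
  by (simp add: presented_alg_def)

lemmas star_axioms =
  star_cong.add_assoc star_cong.add_comm star_cong.add_zero star_cong.add_inverse
  star_cong.scale_add star_cong.add_scale star_cong.scale_scale star_cong.scale_one
  star_cong.mul_assoc star_cong.mul_add_left star_cong.mul_add_right
  star_cong.mul_scale_left star_cong.mul_scale_right
  star_cong.star_star star_cong.star_add star_cong.star_scale star_cong.star_mul

lemma star_algebra_presented_alg: "star_algebra cj (presented_alg cj X Rel)"
  unfolding star_algebra_def carr_presented_alg
  by (auto simp: presented_alg_ops intro!: star_axioms[THEN term_class_eqI])

lemma eval_presented_alg:
  "t \<in> terms_over X \<Longrightarrow>
   eval_term (presented_alg cj X Rel) (\<lambda>x. term_class cj X Rel (Gen x)) t = term_class cj X Rel t"
  by (induction t) (auto simp: presented_alg_ops)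

lemma presented_alg_relations:
  assumes "(s, t) \<in> Rel" "s \<in> terms_over X" "t \<in> terms_over X"
  shows "eval_term (presented_alg cj X Rel) (\<lambda>x. term_class cj X Rel (Gen x)) s =
    eval_term (presented_alg cj X Rel) (\<lambda>x. term_class cj X Rel (Gen x)) t"
  using assms by (auto simp: eval_presented_alg intro!: term_class_eqI star_cong.rel)

lemma eval_term_closed:
  assumes "star_algebra cj A" "\<And>x. T x \<in> carr A"
  shows "eval_term A T t \<in> carr A"
  using assms by (induction t) (auto simp: star_algebra_def)

lemma eval_term_star_cong:
  assumes A: "star_algebra cj A" and T: "\<And>x. T x \<in> carr A"
    and R: "\<And>s t. (s, t) \<in> Rel \<Longrightarrow> eval_term A T s = eval_term A T t"
    and "star_cong cj Rel s t"
  shows "eval_term A T s = eval_term A T t"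
  using assms(4)
proof (induction rule: star_cong.induct)
  case (rel s t)
  then show ?case by (rule R)
next
  case (add_assoc s t u)
  have "\<forall>x\<in>carr A. \<forall>y\<in>carr A. \<forall>z\<in>carr A. aadd A (aadd A x y) z = aadd A x (aadd A y z)"
    using A unfolding star_algebra_def by blast
  then show ?case by (simp add: eval_term_closed[of cj A T, OF A T])
next
  case (add_zero t)
  have "\<forall>x\<in>carr A. aadd A x (azero A) = x"
    using A unfolding star_algebra_def by blast
  then show ?case by (simp add: eval_term_closed[of cj A T, OF A T])
qed (use A eval_term_closed[of cj A T, OF A T] in \<open>simp_all add: star_algebra_def\<close>)

lemma eval_term_cong: "(\<And>x. x \<in> gens t \<Longrightarrow> T x = T' x) \<Longrightarrow> eval_term A T t = eval_term A T' t"
  by (induction t) auto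

theorem presented_alg_universal:
  assumes A: "star_algebra cj A" and T: "\<And>x. x \<in> X \<Longrightarrow> T x \<in> carr A"
    and Rel: "Rel \<subseteq> terms_over X \<times> terms_over X"
    and R: "\<And>s t. (s, t) \<in> Rel \<Longrightarrow> eval_term A T s = eval_term A T t"
  shows "\<exists>h. star_alg_hom (presented_alg cj X Rel) A h \<and> (\<forall>x\<in>X. h (term_class cj X Rel (Gen x)) = T x) \<and>
    (\<forall>h'. star_alg_hom (presented_alg cj X Rel) A h' \<and> (\<forall>x\<in>X. h' (term_class cj X Rel (Gen x)) = T x) \<longrightarrow>
       (\<forall>P\<in>carr (presented_alg cj X Rel). h' P = h P))"
proof -
  let ?P = "presented_alg cj X Rel" and ?c = "term_class cj X Rel"
  define T' where "T' x = (if x \<in> X then T x else azero A)" for x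
  have T': "T' x \<in> carr A" for x
    using T A by (auto simp: T'_def star_algebra_def)
  have ev: "eval_term A T' t = eval_term A T t" if "t \<in> terms_over X" for t
    using that by (intro eval_term_cong) (auto simp: terms_over_def T'_def)
  have R': "eval_term A T' s = eval_term A T' t" if "(s, t) \<in> Rel" for s t
    using R[OF that] that Rel by (auto simp: ev)
  define h where "h P = eval_term A T' (SOME t. t \<in> P)" for P
  have h: "h (?c t) = eval_term A T' t" if "t \<in> terms_over X" for t
  proof -
    have "(SOME u. u \<in> ?c t) \<in> ?c t"
      using term_class_self[OF that] by (rule someI)
    then have "star_cong cj Rel t (SOME u. u \<in> ?c t)" by (simp add: term_class_def)
    from eval_term_star_cong[OF A T' R' this] show ?thesis by (simp add: h_def)
  qed
  have hom: "star_alg_hom ?P A h"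
    unfolding star_alg_hom_def carr_presented_alg
    by (auto simp: presented_alg_ops h intro: eval_term_closed[OF A T'])
  have hc: "h' (?c (Add s t)) = aadd A (h' (?c s)) (h' (?c t))"
      "h' (?c (Mul s t)) = amul A (h' (?c s)) (h' (?c t))"
      "h' (?c (Scale c s)) = ascale A c (h' (?c s))"
      "h' (?c (Star s)) = astar A (h' (?c s))"
      "h' (?c s) \<in> carr A"
    if "star_alg_hom ?P A h'" "s \<in> terms_over X" "t \<in> terms_over X" for h' s t c
  proof -
    have mem: "?c s \<in> carr ?P" "?c t \<in> carr ?P"
      using that by (simp_all add: carr_presented_alg)
    then have "h' (aadd ?P (?c s) (?c t)) = aadd A (h' (?c s)) (h' (?c t))"
      "h' (amul ?P (?c s) (?c t)) = amul A (h' (?c s)) (h' (?c t))"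
      "h' (ascale ?P c (?c s)) = ascale A c (h' (?c s))"
      "h' (astar ?P (?c s)) = astar A (h' (?c s))" "h' (?c s) \<in> carr A"
      using that(1) unfolding star_alg_hom_def by blast+
    with that(2,3) show "h' (?c (Add s t)) = aadd A (h' (?c s)) (h' (?c t))"
      "h' (?c (Mul s t)) = amul A (h' (?c s)) (h' (?c t))"
      "h' (?c (Scale c s)) = ascale A c (h' (?c s))"
      "h' (?c (Star s)) = astar A (h' (?c s))" "h' (?c s) \<in> carr A"
      by (simp_all add: presented_alg_ops)
  qed
  have hz: "h' (?c Zero) = azero A" if "star_alg_hom ?P A h'" for h'
  proof -
    have "?c (Add Zero (Scale (- 1) Zero)) = ?c Zero"
      by (rule term_class_eqI, rule star_cong.add_inverse)
    then have "h' (?c Zero) = aadd A (h' (?c Zero)) (ascale A (- 1) (h' (?c Zero)))"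
      using hc(1)[OF that, of Zero "Scale (- 1) Zero"] hc(3)[OF that, of Zero Zero "- 1"] by simp
    also have "\<dots> = azero A"
    proof -
      have "\<forall>x\<in>carr A. aadd A x (ascale A (- 1) x) = azero A"
        using A unfolding star_algebra_def by blast
      then show ?thesis using hc(5)[OF that, of Zero Zero] by simp
    qed
    finally show ?thesis .
  qed
  have uniq: "h' (?c t) = h (?c t)"
    if h': "star_alg_hom ?P A h'" "\<forall>x\<in>X. h' (?c (Gen x)) = T x" and "t \<in> terms_over X" for h' t
    using \<open>t \<in> terms_over X\<close>
  proof (induction t)
    case (Gen x)
    then show ?case using h'(2) by (simp add: h T'_def)
  next
    case Zero
    then show ?case using hz[OF h'(1)] by (simp add: h)
  next
    case (Add s t)
    then show ?case using hc(1)[OF h'(1), of s t] by (simp add: h)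
  next
    case (Scale c t)
    then show ?case using hc(3)[OF h'(1), of t t] by (simp add: h)
  next
    case (Mul s t)
    then show ?case using hc(2)[OF h'(1), of s t] by (simp add: h)
  next
    case (Star t)
    then show ?case using hc(4)[OF h'(1), of t t] by (simp add: h)
  qed
  have "\<forall>P\<in>carr ?P. h' P = h P"
    if "star_alg_hom ?P A h' \<and> (\<forall>x\<in>X. h' (?c (Gen x)) = T x)" for h'
    using uniq[of h'] that by (auto simp only: carr_presented_alg image_iff)
  moreover have "\<forall>x\<in>X. h (?c (Gen x)) = T x"
    by (simp add: h T'_def)
  ultimately show ?thesis
    using hom by blast
qed


section \<open>The algebras of a category\<close>

text \<open>The join \<open>p \<or> q = p + q - pq\<close>, iterated along an enumeration of the family.\<close>

primrec join_term :: "('r::{comm_ring, comm_monoid_mult}, 'a) star_term list \<Rightarrow> ('r, 'a) star_term" where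
  "join_term [] = Zero"
| "join_term (p # ps) = Add (Add p (join_term ps)) (Scale (- 1) (Mul p (join_term ps)))"

definition range_proj :: "'a \<Rightarrow> ('r, 'a) star_term" where
  "range_proj \<alpha> = Mul (Gen \<alpha>) (Star (Gen \<alpha>))"

text \<open>The relations (i)--(iv), as a union of four sets. In the last two, the join is imposed for every
  enumeration of the finite index set (and, in the third, for every admissible choice of
  \<open>\<alpha> \<or> \<beta>\<close>). As \<open>\<alpha> \<or> \<beta>\<close> is symmetric, the third set forces the range projections to
  commute, which is implicit in speaking of their join.\<close>

definition cat_relations ::
  "'a small_cat \<Rightarrow> (('r::{comm_ring, comm_monoid_mult}, 'a) star_term \<times> ('r, 'a) star_term) set" where
  "cat_relations \<Lambda> =
     {(Mul (Star (Gen \<alpha>)) (Gen \<alpha>), Gen (src \<Lambda> \<alpha>)) | \<alpha>. \<alpha> \<in> Mor \<Lambda>} \<union>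
     {(Mul (Gen \<alpha>) (Gen \<beta>), Gen (cmp \<Lambda> \<alpha> \<beta>)) | \<alpha> \<beta>.
        \<alpha> \<in> Mor \<Lambda> \<and> \<beta> \<in> Mor \<Lambda> \<and> src \<Lambda> \<alpha> = rng \<Lambda> \<beta>} \<union>
     {(Mul (range_proj \<alpha>) (range_proj \<beta>), join_term (map range_proj \<gamma>s)) | \<alpha> \<beta> \<gamma>s.
        \<alpha> \<in> Mor \<Lambda> \<and> \<beta> \<in> Mor \<Lambda> \<and> distinct \<gamma>s \<and> is_vee \<Lambda> \<alpha> \<beta> (set \<gamma>s)} \<union>
     {(Gen v, join_term (map range_proj \<alpha>s)) | v \<alpha>s.
        v \<in> Obj \<Lambda> \<and> distinct \<alpha>s \<and> exhaustive \<Lambda> v (set \<alpha>s)}"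

lemma cat_relations_subset:
  assumes "small_category \<Lambda>"
  shows "cat_relations \<Lambda> \<subseteq> terms_over (Mor \<Lambda>) \<times> terms_over (Mor \<Lambda>)"
proof -
  have cl: "src \<Lambda> \<alpha> \<in> Mor \<Lambda>" "src \<Lambda> \<alpha> = rng \<Lambda> \<beta> \<Longrightarrow> cmp \<Lambda> \<alpha> \<beta> \<in> Mor \<Lambda>"
    if "\<alpha> \<in> Mor \<Lambda>" "\<beta> \<in> Mor \<Lambda>" for \<alpha> \<beta>
    using assms that unfolding small_category_def by blast+
  have ri: "right_ideal \<Lambda> \<alpha> \<subseteq> Mor \<Lambda>" if "\<alpha> \<in> Mor \<Lambda>" for \<alpha>
    using that cl(2) by (auto simp: right_ideal_def)
  have join: "join_term (map range_proj xs) \<in> terms_over (Mor \<Lambda>)" if "set xs \<subseteq> Mor \<Lambda>" for xs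
    using that by (induction xs) (auto simp: range_proj_def)
  have rp: "range_proj \<alpha> \<in> terms_over (Mor \<Lambda>) \<longleftrightarrow> \<alpha> \<in> Mor \<Lambda>" for \<alpha>
    by (simp add: range_proj_def)
  have vee: "join_term (map range_proj xs) \<in> terms_over (Mor \<Lambda>)"
    if "\<alpha> \<in> Mor \<Lambda>" "is_vee \<Lambda> \<alpha> \<beta> (set xs)" for \<alpha> \<beta> xs
    using that ri[of \<alpha>] by (intro join) (auto simp: is_vee_def min_common_ext_def)
  have obj: "v \<in> Mor \<Lambda>" if "v \<in> Obj \<Lambda>" for v
    using that cl(1) by (auto simp: Obj_def)
  have exh: "join_term (map range_proj xs) \<in> terms_over (Mor \<Lambda>)"
    if "v \<in> Obj \<Lambda>" "exhaustive \<Lambda> v (set xs)" for v xs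
    using that(2) ri[OF obj[OF that(1)]] by (intro join) (auto simp: exhaustive_def)
  show ?thesis
    unfolding cat_relations_def
    by (auto simp: rp cl(2) obj intro: cl(1) vee exh)
qed

definition universal_cat_alg ::
  "('r::{comm_ring, comm_monoid_mult} \<Rightarrow> 'r) \<Rightarrow> 'a small_cat \<Rightarrow> ('r, ('r, 'a) star_term set) star_alg" where
  "universal_cat_alg cj \<Lambda> = presented_alg cj (Mor \<Lambda>) (cat_relations \<Lambda>)"

text \<open>The algebra \<open>R\<Lambda>\<close>.\<close>

definition cat_alg ::
  "'a small_cat \<Rightarrow> ('r::{comm_ring, comm_monoid_mult}, ('r, 'a) star_term set) star_alg" where
  "cat_alg \<Lambda> = universal_cat_alg id \<Lambda>"


section \<open>Enveloping C*-algebras\<close>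

text \<open>A C*-seminorm on a complex \<open>*\<close>-algebra is the same thing as the pullback of the norm along a
  \<open>*\<close>-homomorphism into some C*-algebra (namely the Hausdorff completion for the seminorm), or
  equivalently along a \<open>*\<close>-representation on some Hilbert space. The supremum \<open>max_seminorm\<close> over
  all C*-seminorms is therefore the usual universal norm, expressed without quantifying over the
  underlying types of the target algebras. The supremum is one of reals, hence is meaningful
  only if the C*-seminorms are pointwise bounded; this is so for \<open>*\<close>-algebras generated by
  partial isometries and for those of etale groupoids.\<close>

definition asub :: "(complex, 'b, 'm) star_alg_scheme \<Rightarrow> 'b \<Rightarrow> 'b \<Rightarrow> 'b" where
  "asub A x y = aadd A x (ascale A (- 1) y)"

definition cstar_seminorm :: "(complex, 'b, 'm) star_alg_scheme \<Rightarrow> ('b \<Rightarrow> real) \<Rightarrow> bool" where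
  "cstar_seminorm A p \<longleftrightarrow>
     (\<forall>x\<in>carr A. 0 \<le> p x) \<and>
     (\<forall>x\<in>carr A. \<forall>y\<in>carr A. p (aadd A x y) \<le> p x + p y) \<and>
     (\<forall>c. \<forall>x\<in>carr A. p (ascale A c x) = cmod c * p x) \<and>
     (\<forall>x\<in>carr A. \<forall>y\<in>carr A. p (amul A x y) \<le> p x * p y) \<and>
     (\<forall>x\<in>carr A. p (amul A (astar A x) x) = (p x)\<^sup>2)"

definition max_seminorm :: "(complex, 'b, 'm) star_alg_scheme \<Rightarrow> 'b \<Rightarrow> real" where
  "max_seminorm A x = (SUP p\<in>{p. cstar_seminorm A p}. p x)"

definition cauchy_seqs :: "(complex, 'b, 'm) star_alg_scheme \<Rightarrow> (nat \<Rightarrow> 'b) set" where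
  "cauchy_seqs A = {x. (\<forall>n. x n \<in> carr A) \<and>
     (\<forall>\<epsilon>>0. \<exists>N. \<forall>m\<ge>N. \<forall>n\<ge>N. max_seminorm A (asub A (x m) (x n)) < \<epsilon>)}"

definition cauchy_class :: "(complex, 'b, 'm) star_alg_scheme \<Rightarrow> (nat \<Rightarrow> 'b) \<Rightarrow> (nat \<Rightarrow> 'b) set" where
  "cauchy_class A x =
     {y \<in> cauchy_seqs A. (\<lambda>n. max_seminorm A (asub A (x n) (y n))) \<longlonglongrightarrow> 0}"

record 'b normed_star_alg = "(complex, 'b) star_alg" +
  anorm :: "'b \<Rightarrow> real"

text \<open>The Hausdorff completion for the largest C*-seminorm.\<close>

definition enveloping_cstar ::
  "(complex, 'b, 'm) star_alg_scheme \<Rightarrow> (nat \<Rightarrow> 'b) set normed_star_alg" where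
  "enveloping_cstar A =
     \<lparr> carr = cauchy_class A ` cauchy_seqs A,
       azero = cauchy_class A (\<lambda>n. azero A),
       aadd = (\<lambda>P Q. \<Union>x\<in>P. \<Union>y\<in>Q. cauchy_class A (\<lambda>n. aadd A (x n) (y n))),
       ascale = (\<lambda>c P. \<Union>x\<in>P. cauchy_class A (\<lambda>n. ascale A c (x n))),
       amul = (\<lambda>P Q. \<Union>x\<in>P. \<Union>y\<in>Q. cauchy_class A (\<lambda>n. amul A (x n) (y n))),
       astar = (\<lambda>P. \<Union>x\<in>P. cauchy_class A (\<lambda>n. astar A (x n))),
       anorm = (\<lambda>P. the_elem ((\<lambda>x. lim (\<lambda>n. max_seminorm A (x n))) ` P)) \<rparr>"

definition cstar_isomorphic ::
  "('b, 'm) normed_star_alg_scheme \<Rightarrow> ('c, 'n) normed_star_alg_scheme \<Rightarrow> bool" where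
  "cstar_isomorphic A B \<longleftrightarrow>
     (\<exists>h. star_alg_hom A B h \<and> bij_betw h (carr A) (carr B) \<and>
          (\<forall>x\<in>carr A. anorm B (h x) = anorm A x))"

text \<open>The C*-algebra \<open>C*(\<Lambda>)\<close>. The relations (i)--(iv) are polynomial, so \<open>*\<close>-homomorphisms of
  \<open>universal_cat_alg cnj \<Lambda>\<close> into a C*-algebra are families in it satisfying the relations.\<close>

definition cat_cstar :: "'a small_cat \<Rightarrow> (nat \<Rightarrow> (complex, 'a) star_term set) set normed_star_alg" where
  "cat_cstar \<Lambda> = enveloping_cstar (universal_cat_alg cnj \<Lambda>)"


section \<open>Algebras of etale groupoids\<close>

text \<open>The type \<open>'u\<close> of units is kept separate from that of arrows, and only the arrows carry
  a topology.\<close>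

record ('g, 'u) top_groupoid =
  arrows :: "'g set"
  gdom :: "'g \<Rightarrow> 'u"
  gran :: "'g \<Rightarrow> 'u"
  gmul :: "'g \<Rightarrow> 'g \<Rightarrow> 'g"
  ginv :: "'g \<Rightarrow> 'g"
  gtop :: "'g topology"

text \<open>In an etale groupoid, domain and range are local homeomorphisms, so if they are injective on an
  open set then they are homeomorphisms of it onto open sets of units.\<close>

definition open_bisection :: "('g, 'u) top_groupoid \<Rightarrow> 'g set \<Rightarrow> bool" where
  "open_bisection G U \<longleftrightarrow> openin (gtop G) U \<and> inj_on (gdom G) U \<and> inj_on (gran G) U"

text \<open>Functions on \<open>G\<close> are extended by \<open>0\<close> off the arrows. In the algebras below, functions are
  finite combinations of functions supported in bisections, so only finitely many
  factorizations contribute to the sum defining the convolution.\<close>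

definition convolution ::
  "('g, 'u) top_groupoid \<Rightarrow> ('g \<Rightarrow> 'r) \<Rightarrow> ('g \<Rightarrow> 'r) \<Rightarrow> 'g \<Rightarrow> 'r::comm_ring" where
  "convolution G f g \<gamma> =
     (\<Sum>(\<alpha>, \<beta>) \<in> {(\<alpha>, \<beta>). \<alpha> \<in> arrows G \<and> \<beta> \<in> arrows G \<and> gdom G \<alpha> = gran G \<beta> \<and>
                        gmul G \<alpha> \<beta> = \<gamma> \<and> f \<alpha> \<noteq> 0 \<and> g \<beta> \<noteq> 0}. f \<alpha> * g \<beta>)"

inductive_set fun_span :: "('g \<Rightarrow> 'r::comm_ring) set \<Rightarrow> ('g \<Rightarrow> 'r) set" for B where
  zero: "(\<lambda>x. 0) \<in> fun_span B"
| step: "f \<in> fun_span B \<Longrightarrow> b \<in> B \<Longrightarrow> (\<lambda>x. f x + c * b x) \<in> fun_span B"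

definition groupoid_alg ::
  "('r::comm_ring \<Rightarrow> 'r) \<Rightarrow> ('g, 'u) top_groupoid \<Rightarrow> ('g \<Rightarrow> 'r) set \<Rightarrow> ('r, 'g \<Rightarrow> 'r) star_alg" where
  "groupoid_alg cj G B =
     \<lparr> carr = fun_span B,
       azero = (\<lambda>\<gamma>. 0),
       aadd = (\<lambda>f g \<gamma>. f \<gamma> + g \<gamma>),
       ascale = (\<lambda>c f \<gamma>. c * f \<gamma>),
       amul = convolution G,
       astar = (\<lambda>f \<gamma>. if \<gamma> \<in> arrows G then cj (f (ginv G \<gamma>)) else 0) \<rparr>"

definition steinberg_alg ::
  "('g, 'u) top_groupoid \<Rightarrow> ('r::{comm_ring, comm_monoid_mult}, 'g \<Rightarrow> 'r) star_alg" where
  "steinberg_alg G = groupoid_alg id G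
     {\<lambda>\<gamma>. if \<gamma> \<in> U then 1 else 0 | U. open_bisection G U \<and> compactin (gtop G) U}"

text \<open>\<open>G\<close> need not be Hausdorff, so \<open>C\<^sub>c(G)\<close> is replaced as usual by the linear span
  of the spaces \<open>C\<^sub>c(U)\<close>, for \<open>U\<close> an open bisection; such \<open>U\<close> is Hausdorff, being homeomorphic to
  a set of units.\<close>

definition Cc_bisections :: "('g, 'u) top_groupoid \<Rightarrow> ('g \<Rightarrow> complex) set" where
  "Cc_bisections G = {f. \<exists>U K. open_bisection G U \<and>
     continuous_map (subtopology (gtop G) U) euclidean f \<and>
     compactin (gtop G) K \<and> K \<subseteq> U \<and> (\<forall>\<gamma>. \<gamma> \<notin> K \<longrightarrow> f \<gamma> = 0)}"

definition groupoid_cstar :: "('g, 'u) top_groupoid \<Rightarrow> (nat \<Rightarrow> 'g \<Rightarrow> complex) set normed_star_alg" where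
  "groupoid_cstar G = enveloping_cstar (groupoid_alg cnj G (Cc_bisections G))"


section \<open>The tight groupoid\<close>

text \<open>A partial bijection is represented by its graph, so the product \<open>st\<close> (first \<open>t\<close>, then \<open>s\<close>) is
  the relational composition \<open>t O s\<close>, the inverse \<open>s*\<close> is \<open>s\<inverse>\<close>, and the empty map is \<open>{}\<close>.\<close>

type_synonym 'a pbij = "('a \<times> 'a) set"

abbreviation pb_mul :: "'a pbij \<Rightarrow> 'a pbij \<Rightarrow> 'a pbij" (infixl "\<cdot>\<^sub>p" 70) where
  "s \<cdot>\<^sub>p t \<equiv> t O s"

definition tau :: "'a small_cat \<Rightarrow> 'a \<Rightarrow> 'a pbij" where
  "tau \<Lambda> \<alpha> = {(\<beta>, cmp \<Lambda> \<alpha> \<beta>) | \<beta>. \<beta> \<in> Mor \<Lambda> \<and> rng \<Lambda> \<beta> = src \<Lambda> \<alpha>}"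

inductive_set inv_semigroup :: "'a small_cat \<Rightarrow> 'a pbij set" for \<Lambda> where
  tau: "\<alpha> \<in> Mor \<Lambda> \<Longrightarrow> tau \<Lambda> \<alpha> \<in> inv_semigroup \<Lambda>"
| sigma: "\<alpha> \<in> Mor \<Lambda> \<Longrightarrow> (tau \<Lambda> \<alpha>)\<inverse> \<in> inv_semigroup \<Lambda>"
| mul: "s \<in> inv_semigroup \<Lambda> \<Longrightarrow> t \<in> inv_semigroup \<Lambda> \<Longrightarrow> s \<cdot>\<^sub>p t \<in> inv_semigroup \<Lambda>"

definition idems :: "'a small_cat \<Rightarrow> 'a pbij set" where
  "idems \<Lambda> = {e \<in> inv_semigroup \<Lambda>. e \<cdot>\<^sub>p e = e}"

definition idem_le :: "'a pbij \<Rightarrow> 'a pbij \<Rightarrow> bool" where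
  "idem_le e f \<longleftrightarrow> e = e \<cdot>\<^sub>p f"

definition is_filter :: "'a small_cat \<Rightarrow> 'a pbij set \<Rightarrow> bool" where
  "is_filter \<Lambda> \<eta> \<longleftrightarrow> \<eta> \<subseteq> idems \<Lambda> \<and> \<eta> \<noteq> {} \<and> {} \<notin> \<eta> \<and>
     (\<forall>e\<in>\<eta>. \<forall>f\<in>idems \<Lambda>. idem_le e f \<longrightarrow> f \<in> \<eta>) \<and>
     (\<forall>e\<in>\<eta>. \<forall>f\<in>\<eta>. e \<cdot>\<^sub>p f \<in> \<eta>)"

definition is_ultrafilter :: "'a small_cat \<Rightarrow> 'a pbij set \<Rightarrow> bool" where
  "is_ultrafilter \<Lambda> \<eta> \<longleftrightarrow> is_filter \<Lambda> \<eta> \<and> (\<forall>\<eta>'. is_filter \<Lambda> \<eta>' \<and> \<eta> \<subseteq> \<eta>' \<longrightarrow> \<eta>' = \<eta>)"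

definition filter_top :: "'a small_cat \<Rightarrow> 'a pbij set topology" where
  "filter_top \<Lambda> = topology_generated_by
     {{\<eta>. is_filter \<Lambda> \<eta> \<and> X \<subseteq> \<eta> \<and> Y \<inter> \<eta> = {}} | X Y.
        finite X \<and> X \<subseteq> idems \<Lambda> \<and> finite Y \<and> Y \<subseteq> idems \<Lambda>}"

definition tight_filters :: "'a small_cat \<Rightarrow> 'a pbij set set" where
  "tight_filters \<Lambda> = filter_top \<Lambda> closure_of {\<eta>. is_ultrafilter \<Lambda> \<eta>}"

definition act :: "'a small_cat \<Rightarrow> 'a pbij \<Rightarrow> 'a pbij set \<Rightarrow> 'a pbij set" where
  "act \<Lambda> s \<eta> = {f \<in> idems \<Lambda>. \<exists>e\<in>\<eta>. idem_le (s \<cdot>\<^sub>p e \<cdot>\<^sub>p s\<inverse>) f}"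

definition germ_pairs :: "'a small_cat \<Rightarrow> ('a pbij \<times> 'a pbij set) set" where
  "germ_pairs \<Lambda> = {(s, \<eta>). s \<in> inv_semigroup \<Lambda> \<and> \<eta> \<in> tight_filters \<Lambda> \<and> s\<inverse> \<cdot>\<^sub>p s \<in> \<eta>}"

type_synonym 'a germ = "('a pbij \<times> 'a pbij set) set"

definition germ :: "'a small_cat \<Rightarrow> 'a pbij \<Rightarrow> 'a pbij set \<Rightarrow> 'a germ" where
  "germ \<Lambda> s \<eta> = {(t, \<eta>'). (t, \<eta>') \<in> germ_pairs \<Lambda> \<and> \<eta>' = \<eta> \<and> (\<exists>e\<in>\<eta>. s \<cdot>\<^sub>p e = t \<cdot>\<^sub>p e)}"

definition tight_groupoid :: "'a small_cat \<Rightarrow> ('a germ, 'a pbij set) top_groupoid" where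
  "tight_groupoid \<Lambda> =
     \<lparr> arrows = (\<lambda>(s, \<eta>). germ \<Lambda> s \<eta>) ` germ_pairs \<Lambda>,
       gdom = (\<lambda>g. the_elem (snd ` g)),
       gran = (\<lambda>g. the_elem ((\<lambda>(s, \<eta>). act \<Lambda> s \<eta>) ` g)),
       gmul = (\<lambda>g h. \<Union>(s, \<theta>)\<in>g. \<Union>(t, \<eta>)\<in>h. germ \<Lambda> (s \<cdot>\<^sub>p t) \<eta>),
       ginv = (\<lambda>g. \<Union>(s, \<eta>)\<in>g. germ \<Lambda> (s\<inverse>) (act \<Lambda> s \<eta>)),
       gtop = topology_generated_by
         {{germ \<Lambda> s \<eta> | \<eta>. \<eta> \<in> U} | s U. s \<in> inv_semigroup \<Lambda> \<and>
            openin (subtopology (filter_top \<Lambda>) {\<eta> \<in> tight_filters \<Lambda>. s\<inverse> \<cdot>\<^sub>p s \<in> \<eta>}) U} \<rparr>"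

end

theory Submission
  imports Defs
begin

text \<open>Indicator functions of the bisections of germs of \<open>\<tau>\<^sup>\<alpha>\<close> satisfy the relations, whence a
  homomorphism from the universal algebra to the Steinberg algebra; it is onto since the germs of
  the \<open>\<tau>\<^sup>\<alpha>\<sigma>\<^sup>\<beta>\<close> over sets of tight filters containing \<open>\<delta>\<Lambda>\<close> but none of finitely many
  \<open>\<beta>'\<Lambda>\<close> form a basis. For injectivity, every element is a sum of terms
  \<open>T\<^sub>\<alpha> T\<^sub>\<beta>\<^sup>* d\<close> with \<open>d\<close> in the diagonal. If the image of such a sum vanishes, split \<open>d\<close> in the
  last term into scalar multiples of projections (cells); where the scalar is nonzero, every germ of
  that term also occurs in some other term. By compactness and relation (iv), which says that
  a cell containing no tight filter vanishes, the last term can be absorbed into the others.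

  As every C*-seminorm is bounded by the supremum norm on functions supported in a bisection,
  C*-seminorms of the complex Steinberg algebra extend to the span of the \<open>C\<^sub>c(U)\<close>, in which it is
  dense. Hence both \<open>*\<close>-algebras have the same enveloping C*-algebra.\<close>

section \<open>Convolution algebras of ample groupoids\<close>

text \<open>Two obstacles shape the argument. The groupoid need not be Hausdorff: compact open
  bisections may have non-compact intersections, and an element of the algebra cannot simply be
  rewritten over disjoint bisections. Intersections and differences are therefore formed inside one
  surrounding bisection, which is Hausdorff, and the overlap of different bisections is treated by
  absorbing one term of a sum into the others. This happens once analytically, where each absorbed
  term doubles the constant, and once algebraically, for injectivity. Secondly, \<open>R\<close> may
  have zero divisors or be the zero ring, so a diagonal coefficient cannot be inverted or cancelled;
  it is resolved into scalars on cells, and only the cells with a nonzero scalar are compared with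
  the other terms. No Hilbert space occurs. The C*-identity and submultiplicativity alone bound
  every C*-seminorm on functions on units, hence on bisections. The bounds are uniform in the
  seminorm, so that density and extension carry over to the largest one.\<close>

definition smul :: "('g, 'u) top_groupoid \<Rightarrow> 'g set \<Rightarrow> 'g set \<Rightarrow> 'g set" where
  "smul G U V = {gmul G a b | a b. a \<in> U \<and> b \<in> V \<and> gdom G a = gran G b}"

definition cob :: "('g, 'u) top_groupoid \<Rightarrow> 'g set \<Rightarrow> bool" where
  "cob G U \<longleftrightarrow> open_bisection G U \<and> compactin (gtop G) U"

definition ind :: "'g set \<Rightarrow> 'g \<Rightarrow> 'r::{comm_ring, comm_monoid_mult}" where
  "ind U = (\<lambda>g. if g \<in> U then 1 else 0)"

lemma mult_1_0_comm_ring [simp]: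
  fixes c :: "'r::{comm_ring, comm_monoid_mult}"
  shows "- 1 * c = - c" "c * - 1 = - c"
  by (simp_all flip: minus_mult_left minus_mult_right)

section \<open>Spans of functions with values in a commutative ring\<close>

lemma fun_span_add:
  assumes "f \<in> fun_span B" "g \<in> fun_span B"
  shows "(\<lambda>x. f x + g x) \<in> fun_span B"
  using assms(2)
proof (induction rule: fun_span.induct)
  case zero
  then show ?case using assms(1) by simp
next
  case (step g b c)
  then show ?case using fun_span.step[of "\<lambda>x. f x + g x" B b c] by (simp add: add.assoc)
qed

lemma fun_span_base:
  fixes b :: "'g \<Rightarrow> 'r::{comm_ring, comm_monoid_mult}"
  assumes "b \<in> B" shows "b \<in> fun_span B"
  using fun_span.step[OF fun_span.zero assms, of 1] by simp

lemma fun_span_scale: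
  assumes "f \<in> fun_span B" shows "(\<lambda>x. c * f x) \<in> fun_span B"
  using assms
proof (induction rule: fun_span.induct)
  case zero
  then show ?case by (simp add: fun_span.zero)
next
  case (step f b d)
  then show ?case using fun_span.step[of "\<lambda>x. c * f x" B b "c * d"]
    by (simp add: distrib_left mult.assoc)
qed

lemma fun_span_sum:
  assumes "\<And>i. i \<in> I \<Longrightarrow> f i \<in> fun_span B"
  shows "(\<lambda>x. \<Sum>i\<in>I. f i x) \<in> fun_span B"
  using assms
  by (induction I rule: infinite_finite_induct) (auto intro: fun_span_add fun_span.zero)

lemma fun_span_bind:
  assumes "f \<in> fun_span B" "B \<subseteq> fun_span C"
  shows "f \<in> fun_span C"
  using assms(1)
proof (induction rule: fun_span.induct)
  case (step f b c)
  then have "b \<in> fun_span C" using assms(2) by blast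
  from fun_span_add[OF step.IH fun_span_scale[OF this]] show ?case .
qed (rule fun_span.zero)

text \<open>Units are not arrows in the record, so no unit laws can be stated. Cancellation of
  \<open>a\<close> by its inverse takes their place; with \<open>inv_inv\<close> it also gives the
  other cancellation law \<open>mul_inv_cancel\<close>.\<close>

locale groupoid =
  fixes G :: "('g, 'u) top_groupoid"
  assumes mul_closed: "\<lbrakk>a \<in> arrows G; b \<in> arrows G; gdom G a = gran G b\<rbrakk> \<Longrightarrow> gmul G a b \<in> arrows G"
    and dom_mul: "\<lbrakk>a \<in> arrows G; b \<in> arrows G; gdom G a = gran G b\<rbrakk> \<Longrightarrow> gdom G (gmul G a b) = gdom G b"
    and ran_mul: "\<lbrakk>a \<in> arrows G; b \<in> arrows G; gdom G a = gran G b\<rbrakk> \<Longrightarrow> gran G (gmul G a b) = gran G a"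
    and mul_assoc: "\<lbrakk>a \<in> arrows G; b \<in> arrows G; c \<in> arrows G; gdom G a = gran G b; gdom G b = gran G c\<rbrakk>
      \<Longrightarrow> gmul G (gmul G a b) c = gmul G a (gmul G b c)"
    and inv_closed: "a \<in> arrows G \<Longrightarrow> ginv G a \<in> arrows G"
    and dom_inv: "a \<in> arrows G \<Longrightarrow> gdom G (ginv G a) = gran G a"
    and ran_inv: "a \<in> arrows G \<Longrightarrow> gran G (ginv G a) = gdom G a"
    and inv_inv: "a \<in> arrows G \<Longrightarrow> ginv G (ginv G a) = a"
    and inv_mul: "\<lbrakk>a \<in> arrows G; b \<in> arrows G; gdom G a = gran G b\<rbrakk>
      \<Longrightarrow> ginv G (gmul G a b) = gmul G (ginv G b) (ginv G a)"
    and inv_mul_cancel: "\<lbrakk>a \<in> arrows G; b \<in> arrows G; gdom G a = gran G b\<rbrakk>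
      \<Longrightarrow> gmul G (ginv G a) (gmul G a b) = b"
begin

lemmas groupoid_simps [simp] = mul_closed dom_mul ran_mul inv_closed dom_inv ran_inv inv_inv inv_mul_cancel

lemma mul_inv_cancel [simp]:
  "\<lbrakk>a \<in> arrows G; c \<in> arrows G; gran G a = gran G c\<rbrakk> \<Longrightarrow> gmul G a (gmul G (ginv G a) c) = c"
  using inv_mul_cancel[of "ginv G a" c] by simp

text \<open>Finiteness is asked in each fibre and not of the whole support, so that indicators of
  infinite bisections qualify. It keeps the sum in \<open>convolution\<close> finite; over an
  infinite index set that sum would be \<open>0\<close> and bilinearity would fail.\<close>

definition fsupp :: "('g \<Rightarrow> 'r::comm_ring) \<Rightarrow> bool" where
  "fsupp f \<longleftrightarrow> (\<forall>a. a \<notin> arrows G \<longrightarrow> f a = 0) \<and>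
     (\<forall>u. finite {a \<in> arrows G. gran G a = u \<and> f a \<noteq> 0}) \<and>
     (\<forall>u. finite {a \<in> arrows G. gdom G a = u \<and> f a \<noteq> 0})"

abbreviation ranfib :: "('g \<Rightarrow> 'r::comm_ring) \<Rightarrow> 'g \<Rightarrow> 'g set" where
  "ranfib f c \<equiv> {a \<in> arrows G. gran G a = gran G c \<and> f a \<noteq> 0}"

lemma fsupp_zero [simp]: "fsupp (\<lambda>_. 0)"
  by (simp add: fsupp_def)

lemma fsupp_add:
  assumes "fsupp f" "fsupp g" shows "fsupp (\<lambda>x. f x + g x)"
proof -
  have "{a \<in> arrows G. P a \<and> f a + g a \<noteq> 0} \<subseteq>
      {a \<in> arrows G. P a \<and> f a \<noteq> 0} \<union> {a \<in> arrows G. P a \<and> g a \<noteq> 0}" for P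
    by auto
  from finite_subset[OF this finite_UnI] show ?thesis
    using assms unfolding fsupp_def by simp
qed

lemma fsupp_scale:
  assumes "fsupp f" shows "fsupp (\<lambda>x. c * f x)"
proof -
  have "{a \<in> arrows G. P a \<and> c * f a \<noteq> 0} \<subseteq> {a \<in> arrows G. P a \<and> f a \<noteq> 0}" for P
    by auto
  from finite_subset[OF this] show ?thesis using assms unfolding fsupp_def by simp
qed

lemma fsupp_span:
  assumes "f \<in> fun_span B" "B \<subseteq> Collect fsupp" shows "fsupp f"
  using assms(1)
proof (induction rule: fun_span.induct)
  case (step f b c)
  then have "fsupp b" using assms(2) by blast
  from fsupp_add[OF step.IH fsupp_scale[OF this]] show ?case .
qed (rule fsupp_zero)

lemma fsupp_bisection:
  assumes "U \<subseteq> arrows G" "inj_on (gdom G) U" "inj_on (gran G) U" "\<And>a. a \<notin> U \<Longrightarrow> f a = 0"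
  shows "fsupp f"
proof -
  have "finite {a \<in> arrows G. F a = u \<and> f a \<noteq> 0}" if "inj_on F U" for F :: "'g \<Rightarrow> 'u" and u
  proof (rule finite_subset)
    show "{a \<in> arrows G. F a = u \<and> f a \<noteq> 0} \<subseteq> F -` {u} \<inter> U" using assms(4) by auto
    show "finite (F -` {u} \<inter> U)" using that by (intro finite_vimage_IntI) auto
  qed
  then show ?thesis using assms unfolding fsupp_def by (simp add: subset_iff) blast
qed

lemma convolution_off_arrows: "c \<notin> arrows G \<Longrightarrow> convolution G f g c = 0"
  unfolding convolution_def by (rule sum.neutral) (auto dest: mul_closed)

text \<open>A factorization of \<open>c\<close> is determined by its left factor \<open>a\<close>,
  the right one being the inverse of \<open>a\<close> times \<open>c\<close>. The index set
  \<open>F\<close> may be larger than the support, which allows different functions to be summed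
  over a common set.\<close>

lemma convolution_eq:
  assumes c: "c \<in> arrows G" and "finite F" "ranfib f c \<subseteq> F" "F \<subseteq> {a \<in> arrows G. gran G a = gran G c}"
    and g: "\<And>a. a \<notin> arrows G \<Longrightarrow> g a = 0"
  shows "convolution G f g c = (\<Sum>a\<in>F. f a * g (gmul G (ginv G a) c))"
proof -
  let ?S = "{(a, b). a \<in> arrows G \<and> b \<in> arrows G \<and> gdom G a = gran G b \<and>
                     gmul G a b = c \<and> f a \<noteq> 0 \<and> g b \<noteq> 0}"
  let ?F = "{a \<in> F. f a \<noteq> 0 \<and> g (gmul G (ginv G a) c) \<noteq> 0}"
  have "(\<Sum>a\<in>F. f a * g (gmul G (ginv G a) c)) = (\<Sum>a\<in>?F. f a * g (gmul G (ginv G a) c))"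
    using assms(2) by (intro sum.mono_neutral_right) auto
  also have "\<dots> = (\<Sum>(a, b)\<in>?S. f a * g b)"
    by (rule sum.reindex_bij_witness[where i = fst and j = "\<lambda>a. (a, gmul G (ginv G a) c)"])
      (use assms(3,4) c in auto)
  finally show ?thesis by (simp add: convolution_def)
qed

lemma convolution_ranfib:
  assumes "fsupp f" "fsupp g" "c \<in> arrows G"
  shows "convolution G f g c = (\<Sum>a\<in>ranfib f c. f a * g (gmul G (ginv G a) c))"
  by (rule convolution_eq) (use assms in \<open>auto simp: fsupp_def\<close>)

lemma convolution_add_right:
  assumes "fsupp f" "fsupp g" "fsupp h"
  shows "convolution G f (\<lambda>x. g x + h x) = (\<lambda>x. convolution G f g x + convolution G f h x)"
proof
  fix c show "convolution G f (\<lambda>x. g x + h x) c = convolution G f g c + convolution G f h c"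
    using assms fsupp_add[OF assms(2,3)]
    by (cases "c \<in> arrows G")
      (simp_all add: convolution_ranfib convolution_off_arrows distrib_left sum.distrib)
qed

lemma convolution_add_left:
  assumes "fsupp f" "fsupp g" "fsupp h"
  shows "convolution G (\<lambda>x. f x + g x) h = (\<lambda>x. convolution G f h x + convolution G g h x)"
proof
  fix c show "convolution G (\<lambda>x. f x + g x) h c = convolution G f h c + convolution G g h c"
  proof (cases "c \<in> arrows G")
    case True
    \<comment> \<open>The support of \<open>f + g\<close> can be smaller than the union through
      cancellation; the union serves all three convolutions.\<close>
    let ?F = "ranfib f c \<union> ranfib g c"
    have *: "convolution G k h c = (\<Sum>a\<in>?F. k a * h (gmul G (ginv G a) c))" if "ranfib k c \<subseteq> ?F" for k
      using True that assms by (intro convolution_eq) (auto simp: fsupp_def)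
    show ?thesis
      by (subst (1 2 3) *) (auto simp: distrib_right sum.distrib)
  qed (simp add: convolution_off_arrows)
qed

lemma convolution_scale_left:
  assumes "fsupp f" "fsupp h"
  shows "convolution G (\<lambda>x. k * f x) h = (\<lambda>x. k * convolution G f h x)"
proof
  fix c show "convolution G (\<lambda>x. k * f x) h c = k * convolution G f h c"
  proof (cases "c \<in> arrows G")
    case True
    have *: "convolution G g h c = (\<Sum>a\<in>ranfib f c. g a * h (gmul G (ginv G a) c))"
      if "ranfib g c \<subseteq> ranfib f c" for g
      using True that assms by (intro convolution_eq) (auto simp: fsupp_def)
    show ?thesis
      by (subst (1 2) *) (auto simp: sum_distrib_left mult.assoc)
  qed (simp add: convolution_off_arrows)
qed

lemma convolution_scale_right:
  assumes "fsupp f" "fsupp h"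
  shows "convolution G f (\<lambda>x. k * h x) = (\<lambda>x. k * convolution G f h x)"
proof
  fix c show "convolution G f (\<lambda>x. k * h x) c = k * convolution G f h c"
    using assms fsupp_scale[OF assms(2), of k]
    by (cases "c \<in> arrows G")
      (simp_all add: convolution_ranfib convolution_off_arrows sum_distrib_left mult.left_commute)
qed

lemma convolution_zero [simp]:
  "convolution G (\<lambda>_. 0) f = (\<lambda>_. 0)" "convolution G f (\<lambda>_. 0) = (\<lambda>_. 0)"
  by (auto simp: convolution_def)

text \<open>Both sides are double sums over factorizations of \<open>c\<close> into three arrows. On
  the left the products \<open>a b\<close> are collected in the finite set \<open>C\<close>; after
  exchanging the sums, left translation by a fixed \<open>a\<close> turns the inner sum into the
  convolution of \<open>g\<close> and \<open>h\<close>.\<close>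

lemma convolution_assoc:
  assumes "fsupp f" "fsupp g" "fsupp h" "fsupp (convolution G f g)" "fsupp (convolution G g h)"
  shows "convolution G (convolution G f g) h = convolution G f (convolution G g h)"
proof
  fix c show "convolution G (convolution G f g) h c = convolution G f (convolution G g h) c"
  proof (cases "c \<in> arrows G")
    case c: True
    define F where "F = ranfib f c"
    define H where "H a = ranfib g (gmul G (ginv G a) c)" for a
    define C where "C = (\<Union>a\<in>F. gmul G a ` H a)"
    have fin: "finite F" "finite (H a)" for a
      using assms by (auto simp: F_def H_def fsupp_def)
    have F: "a \<in> arrows G" "gran G a = gran G c" if "a \<in> F" for a
      using that by (auto simp: F_def)
    have H: "b \<in> arrows G" "gran G b = gdom G a" if "a \<in> F" "b \<in> H a" for a b
      using that c by (auto simp: F_def H_def)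
    have C: "b \<in> arrows G \<and> gran G b = gran G c" if "b \<in> C" for b
      using that F H by (auto simp: C_def)
    have fg: "convolution G f g b = (\<Sum>a\<in>F. f a * g (gmul G (ginv G a) b))" if "b \<in> arrows G" "gran G b = gran G c" for b
      using that assms fin(1) by (intro convolution_eq) (auto simp: F_def fsupp_def)
    have sub: "ranfib (convolution G f g) c \<subseteq> C"
    proof
      fix b assume b: "b \<in> ranfib (convolution G f g) c"
      then have "(\<Sum>a\<in>F. f a * g (gmul G (ginv G a) b)) \<noteq> 0" using fg by auto
      then obtain a where a: "a \<in> F" "f a * g (gmul G (ginv G a) b) \<noteq> 0" by (meson sum.neutral)
      then have "gmul G (ginv G a) b \<in> H a" using b c F[OF a(1)] by (auto simp: H_def)
      then have "gmul G a (gmul G (ginv G a) b) \<in> C" using a by (auto simp: C_def)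
      then show "b \<in> C" using b F[OF a(1)] by simp
    qed
    have "convolution G (convolution G f g) h c =
        (\<Sum>b\<in>C. convolution G f g b * h (gmul G (ginv G b) c))"
      using c sub C fin assms(3) by (intro convolution_eq) (auto simp: C_def fsupp_def)
    also have "\<dots> = (\<Sum>b\<in>C. \<Sum>a\<in>F. f a * g (gmul G (ginv G a) b) * h (gmul G (ginv G b) c))"
      by (intro sum.cong HOL.refl) (auto simp: fg C sum_distrib_right)
    also have "\<dots> = (\<Sum>a\<in>F. \<Sum>b\<in>C. f a * g (gmul G (ginv G a) b) * h (gmul G (ginv G b) c))"
      by (rule sum.swap)
    also have "\<dots> = (\<Sum>a\<in>F. f a * convolution G g h (gmul G (ginv G a) c))"
    proof (rule sum.cong[OF HOL.refl])
      fix a assume a: "a \<in> F"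
      have a': "a \<in> arrows G" "gran G a = gran G c" using F[OF a] by auto
      have "(\<Sum>b\<in>C. f a * g (gmul G (ginv G a) b) * h (gmul G (ginv G b) c)) =
          (\<Sum>b\<in>gmul G a ` H a. f a * g (gmul G (ginv G a) b) * h (gmul G (ginv G b) c))"
      \<comment> \<open>An element of \<open>C\<close> outside the translate of \<open>H a\<close>
        contributes nothing to the sum for this \<open>a\<close>, because the factor with
        \<open>g\<close> vanishes there.\<close>
      proof (rule sum.mono_neutral_right)
        show "\<forall>b\<in>C - gmul G a ` H a. f a * g (gmul G (ginv G a) b) * h (gmul G (ginv G b) c) = 0"
        proof
          fix b assume b: "b \<in> C - gmul G a ` H a"
          have "b \<in> arrows G" "gran G b = gran G c" using b C by auto
          then have "gmul G (ginv G a) b \<notin> H a"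
            using b a' by (metis DiffD2 imageI mul_inv_cancel)
          then have "g (gmul G (ginv G a) b) = 0"
            using a' C c b by (auto simp: H_def)
          then show "f a * g (gmul G (ginv G a) b) * h (gmul G (ginv G b) c) = 0" by simp
        qed
      qed (use a fin in \<open>auto simp: C_def\<close>)
      also have "\<dots> = (\<Sum>b\<in>H a. f a * g b * h (gmul G (ginv G b) (gmul G (ginv G a) c)))"
      proof (subst sum.reindex)
        show "inj_on (gmul G a) (H a)"
          by (rule inj_on_inverseI[where g = "gmul G (ginv G a)"]) (use a a' H in auto)
        show "sum ((\<lambda>b. f a * g (gmul G (ginv G a) b) * h (gmul G (ginv G b) c)) \<circ> gmul G a) (H a) =
          (\<Sum>b\<in>H a. f a * g b * h (gmul G (ginv G b) (gmul G (ginv G a) c)))"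
          by (rule sum.cong) (use a a' c H in \<open>auto simp: inv_mul mul_assoc\<close>)
      qed
      also have "\<dots> = f a * convolution G g h (gmul G (ginv G a) c)"
        using a' c assms by (subst convolution_ranfib) (auto simp: sum_distrib_left mult.assoc H_def)
      finally show "(\<Sum>b\<in>C. f a * g (gmul G (ginv G a) b) * h (gmul G (ginv G b) c)) =
          f a * convolution G g h (gmul G (ginv G a) c)" .
    qed
    also have "\<dots> = convolution G f (convolution G g h) c"
      using c assms by (simp add: convolution_ranfib F_def)
    finally show ?thesis .
  qed (simp add: convolution_off_arrows)
qed

definition gstar :: "('r \<Rightarrow> 'r) \<Rightarrow> ('g \<Rightarrow> 'r::comm_ring) \<Rightarrow> 'g \<Rightarrow> 'r" where
  "gstar cj f = (\<lambda>c. if c \<in> arrows G then cj (f (ginv G c)) else 0)"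

end

text \<open>An involutive ring automorphism. The instances are \<open>id\<close>, for part (2) of
  the theorem, and \<open>cnj\<close>, for part (1); the algebra is developed for both at
  once.\<close>

definition scalar_inv :: "('r::{comm_ring, comm_monoid_mult} \<Rightarrow> 'r) \<Rightarrow> bool" where
  "scalar_inv cj \<longleftrightarrow> (\<forall>a b. cj (a + b) = cj a + cj b) \<and> (\<forall>a b. cj (a * b) = cj a * cj b) \<and>
     (\<forall>a. cj (cj a) = a)"

lemma scalar_invD:
  assumes "scalar_inv cj"
  shows "cj (a + b) = cj a + cj b" "cj (a * b) = cj a * cj b" "cj (cj a) = a" "cj 0 = 0" "cj 1 = 1"
    "cj (sum f I) = (\<Sum>i\<in>I. cj (f i))" "cj a = 0 \<longleftrightarrow> a = 0"
proof -
  show add: "cj (a + b) = cj a + cj b" and mult: "cj (a * b) = cj a * cj b" and inv: "cj (cj a) = a" for a b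
    using assms by (auto simp: scalar_inv_def)
  have "cj 0 + cj 0 = cj 0" using add[of 0 0] by simp
  then show z: "cj 0 = 0" by simp
  have "cj 1 * cj (cj 1) = cj (cj 1)" using mult[of 1 "cj 1"] by simp
  then show "cj 1 = 1" by (simp add: inv)
  show "cj (sum f I) = (\<Sum>i\<in>I. cj (f i))"
    by (induction I rule: infinite_finite_induct) (auto simp: z add)
  show "cj a = 0 \<longleftrightarrow> a = 0" using z inv by metis
qed

context groupoid
begin

lemma gstar_add:
  assumes "scalar_inv cj" shows "gstar cj (\<lambda>x. f x + g x) = (\<lambda>x. gstar cj f x + gstar cj g x)"
  by (auto simp: gstar_def scalar_invD[OF assms])

lemma gstar_scale:
  assumes "scalar_inv cj" shows "gstar cj (\<lambda>x. k * f x) = (\<lambda>x. cj k * gstar cj f x)"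
  by (auto simp: gstar_def scalar_invD[OF assms])

lemma gstar_zero:
  assumes "scalar_inv cj" shows "gstar cj (\<lambda>_. 0) = (\<lambda>_. 0)"
  by (auto simp: gstar_def scalar_invD[OF assms])

lemma gstar_gstar:
  assumes "scalar_inv cj" "fsupp f" shows "gstar cj (gstar cj f) = f"
  using assms(2) by (auto simp: gstar_def scalar_invD[OF assms(1)] fsupp_def fun_eq_iff)

text \<open>Inverting and swapping the factors is a bijection from the factorizations of the inverse
  of \<open>c\<close> to those of \<open>c\<close>, and \<open>cj\<close> vanishes only at
  \<open>0\<close>, so the supports correspond.\<close>

lemma gstar_convolution:
  assumes cj: "scalar_inv cj"
  shows "gstar cj (convolution G f g) = convolution G (gstar cj g) (gstar cj f)"
proof
  fix c show "gstar cj (convolution G f g) c = convolution G (gstar cj g) (gstar cj f) c"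
  proof (cases "c \<in> arrows G")
    case c: True
    have "gstar cj (convolution G f g) c = (\<Sum>x \<in> {(a, b). a \<in> arrows G \<and> b \<in> arrows G \<and> gdom G a = gran G b \<and>
                        gmul G a b = ginv G c \<and> f a \<noteq> 0 \<and> g b \<noteq> 0}. cj (case x of (a, b) \<Rightarrow> f a * g b))"
      using c by (simp add: gstar_def convolution_def scalar_invD(6)[OF cj])
    also have "\<dots> = convolution G (gstar cj g) (gstar cj f) c"
      unfolding convolution_def
    proof (rule sum.reindex_bij_witness[where i = "\<lambda>(a, b). (ginv G b, ginv G a)" and j = "\<lambda>(a, b). (ginv G b, ginv G a)"];
        clarify, (clarsimp simp: gstar_def scalar_invD[OF cj] mult.commute)?)
      fix a b assume "a \<in> arrows G" "b \<in> arrows G" "gdom G a = gran G b" "gmul G a b = ginv G c"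
      then show "gmul G (ginv G b) (ginv G a) = c" using c by (metis inv_inv inv_mul)
    qed (use c in \<open>auto simp: inv_mul\<close>)
    finally show ?thesis .
  qed (simp add: gstar_def convolution_off_arrows)
qed

text \<open>Bilinear extension from generators, carried out in the right argument for a fixed
  generator on the left and afterwards in the left argument.\<close>

lemma span_convolution_closed:
  assumes "B \<subseteq> Collect fsupp" "C \<subseteq> Collect fsupp"
    and "\<And>f g. f \<in> B \<Longrightarrow> g \<in> C \<Longrightarrow> convolution G f g \<in> fun_span D"
    and f: "f \<in> fun_span B" and g: "g \<in> fun_span C"
  shows "convolution G f g \<in> fun_span D"
proof -
  have 1: "convolution G f g \<in> fun_span D" if f: "f \<in> B" for f
    using g
  proof (induction rule: fun_span.induct)
    case (step g b c)
    then have "fsupp g" "fsupp b" "fsupp f" using assms(1,2) f fsupp_span by blast+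
    then have "convolution G f (\<lambda>x. g x + c * b x) = (\<lambda>x. convolution G f g x + c * convolution G f b x)"
      by (simp add: convolution_add_right fsupp_scale convolution_scale_right)
    then show ?case using step assms(3)[OF f] by (simp add: fun_span_add fun_span_scale)
  qed (auto intro: fun_span.zero)
  have sg: "fsupp g" using assms(2) fsupp_span[OF g] by blast
  show ?thesis
    using f
  proof (induction rule: fun_span.induct)
    case (step f b c)
    then have "fsupp f" "fsupp b" using assms(1,2) fsupp_span by blast+
    then have "convolution G (\<lambda>x. f x + c * b x) g = (\<lambda>x. convolution G f g x + c * convolution G b g x)"
      using sg by (simp add: convolution_add_left fsupp_scale convolution_scale_left)
    then show ?case using step 1 by (simp add: fun_span_add fun_span_scale)
  qed (auto intro: fun_span.zero)
qed

lemma span_gstar_closed: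
  assumes cj: "scalar_inv cj" and "\<And>f. f \<in> B \<Longrightarrow> gstar cj f \<in> fun_span D" and f: "f \<in> fun_span B"
  shows "gstar cj f \<in> fun_span D"
  using f
proof (induction rule: fun_span.induct)
  case (step f b c)
  from fun_span_add[OF step.IH fun_span_scale[OF assms(2)[OF step.hyps(2)], of "cj c"]]
  show ?case by (simp add: gstar_add[OF cj] gstar_scale[OF cj])
qed (simp add: gstar_zero[OF cj] fun_span.zero)

lemma groupoid_alg_simps:
  "carr (groupoid_alg cj G B) = fun_span B" "azero (groupoid_alg cj G B) = (\<lambda>_. 0)"
  "aadd (groupoid_alg cj G B) = (\<lambda>f g x. f x + g x)" "ascale (groupoid_alg cj G B) = (\<lambda>c f x. c * f x)"
  "amul (groupoid_alg cj G B) = convolution G" "astar (groupoid_alg cj G B) = gstar cj"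
  by (auto simp: groupoid_alg_def gstar_def)

lemma star_algebra_groupoid_alg:
  fixes B :: "('g \<Rightarrow> 'r::{comm_ring, comm_monoid_mult}) set"
  assumes cj: "scalar_inv cj" and B: "B \<subseteq> Collect fsupp"
    and conv: "\<And>f g. f \<in> B \<Longrightarrow> g \<in> B \<Longrightarrow> convolution G f g \<in> fun_span B"
    and star: "\<And>f. f \<in> B \<Longrightarrow> gstar cj f \<in> fun_span B"
  shows "star_algebra cj (groupoid_alg cj G B)"
proof -
  have fs: "fsupp f" if "f \<in> fun_span B" for f using fsupp_span[OF that B] .
  have cv: "convolution G f g \<in> fun_span B" if "f \<in> fun_span B" "g \<in> fun_span B" for f g
    using span_convolution_closed[OF B B conv that] by blast
  have st: "gstar cj f \<in> fun_span B" if "f \<in> fun_span B" for f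
    using span_gstar_closed[OF cj star that] by blast
  show ?thesis
    unfolding star_algebra_def groupoid_alg_simps
    by (intro conjI ballI allI)
      (simp_all add: fs cv st cj convolution_add_left convolution_add_right convolution_scale_left
        convolution_scale_right gstar_add[OF cj] gstar_scale[OF cj] gstar_gstar[OF cj] gstar_convolution[OF cj]
        convolution_assoc distrib_left distrib_right add.assoc add.commute add.left_commute mult.assoc
        fun_span_add fun_span_scale fun_span.zero fsupp_scale)
qed

text \<open>As the range map is injective on \<open>U\<close>, at most one left factor from
  \<open>U\<close> has the required range, so the sum has at most one term.\<close>

lemma convolution_bisection:
  fixes f g :: "'g \<Rightarrow> 'r::comm_ring"
  assumes U: "U \<subseteq> arrows G" "inj_on (gran G) U" and f: "\<And>a. a \<notin> U \<Longrightarrow> f a = 0"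
    and V: "V \<subseteq> arrows G" and g: "\<And>a. a \<notin> V \<Longrightarrow> g a = 0"
  shows "\<lbrakk>a \<in> U; b \<in> V; gdom G a = gran G b\<rbrakk> \<Longrightarrow> convolution G f g (gmul G a b) = f a * g b"
    and "c \<notin> smul G U V \<Longrightarrow> convolution G f g c = 0"
proof -
  assume a: "a \<in> U" and b: "b \<in> V" and ab: "gdom G a = gran G b"
  have a': "a \<in> arrows G" "b \<in> arrows G" using a b U V by auto
  have "convolution G f g (gmul G a b) = (\<Sum>x\<in>{a}. f x * g (gmul G (ginv G x) (gmul G a b)))"
  proof (rule convolution_eq)
    show "ranfib f (gmul G a b) \<subseteq> {a}"
    proof
      fix x assume x: "x \<in> ranfib f (gmul G a b)"
      then have "x \<in> U" using f by auto
      with x a ab a' U(2) show "x \<in> {a}" by (auto dest: inj_onD)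
    qed
  qed (use a' ab g V in auto)
  then show "convolution G f g (gmul G a b) = f a * g b" using a' ab by simp
next
  assume "c \<notin> smul G U V"
  moreover have "a \<in> U" if "f a \<noteq> 0" for a using that f by blast
  moreover have "a \<in> V" if "g a \<noteq> 0" for a using that g by blast
  ultimately have "{(a, b). a \<in> arrows G \<and> b \<in> arrows G \<and> gdom G a = gran G b \<and>
      gmul G a b = c \<and> f a \<noteq> 0 \<and> g b \<noteq> 0} = {}"
    unfolding smul_def by blast
  then show "convolution G f g c = 0" unfolding convolution_def by (simp only: sum.empty)
qed

lemma convolution_ind:
  assumes "U \<subseteq> arrows G" "inj_on (gran G) U" "V \<subseteq> arrows G"
  shows "convolution G (ind U) (ind V) = ind (smul G U V)"
proof
  fix c
  show "convolution G (ind U) (ind V) c = ind (smul G U V) c"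
  proof (cases "c \<in> smul G U V")
    case True
    then obtain a b where ab: "a \<in> U" "b \<in> V" "gdom G a = gran G b" "c = gmul G a b"
      by (auto simp: smul_def)
    have "convolution G (ind U) (ind V) (gmul G a b) = ind U a * ind V b"
      using ab by (intro convolution_bisection(1)[OF assms(1,2) _ assms(3)]) (auto simp: ind_def)
    then show ?thesis using ab True by (simp add: ind_def)
  next
    case False
    then show ?thesis
      by (subst convolution_bisection(2)[OF assms(1,2) _ assms(3)]) (auto simp: ind_def)
  qed
qed

lemma gstar_ind:
  assumes "scalar_inv cj" "U \<subseteq> arrows G" shows "gstar cj (ind U) = ind (ginv G ` U)"
proof -
  have "ginv G c \<in> U \<longleftrightarrow> c \<in> ginv G ` U" if "c \<in> arrows G" for c
    using that assms(2) by (force simp: image_iff)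
  moreover have "ginv G ` U \<subseteq> arrows G" using assms(2) by auto
  ultimately show ?thesis
    using scalar_invD(4,5)[OF assms(1)] by (fastforce simp: gstar_def ind_def fun_eq_iff)
qed

end

text \<open>Instead of continuity of the operations, a basis \<open>\<B>\<close> of compact open
  bisections closed under products and inverses is assumed. Every compact open bisection is a finite
  union of basis sets, so products and inverses stay compact and open. As units carry no topology,
  \<open>dom_separated\<close> replaces the Hausdorff property of the unit space.\<close>

locale ample_groupoid = groupoid G for G :: "('g, 'u) top_groupoid" +
  fixes \<B> :: "'g set set"
  assumes topspace_arrows: "topspace (gtop G) = arrows G"
    and basis: "\<lbrakk>openin (gtop G) W; g \<in> W\<rbrakk> \<Longrightarrow> \<exists>U\<in>\<B>. g \<in> U \<and> U \<subseteq> W"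
    and basis_cob: "U \<in> \<B> \<Longrightarrow> cob G U"
    and basis_smul: "\<lbrakk>U \<in> \<B>; V \<in> \<B>\<rbrakk> \<Longrightarrow> smul G U V \<in> \<B>"
    and basis_inv: "U \<in> \<B> \<Longrightarrow> ginv G ` U \<in> \<B>"
    and dom_separated: "\<lbrakk>g \<in> arrows G; h \<in> arrows G; gdom G g \<noteq> gdom G h\<rbrakk>
      \<Longrightarrow> \<exists>V W. openin (gtop G) V \<and> openin (gtop G) W \<and> g \<in> V \<and> h \<in> W \<and> V \<inter> W = {}"
begin

section \<open>Boolean and multiplicative calculus of compact open bisections\<close>

lemma cobD:
  assumes "cob G U"
  shows "openin (gtop G) U" "compactin (gtop G) U" "inj_on (gdom G) U" "inj_on (gran G) U" "U \<subseteq> arrows G"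
  using assms openin_subset[of "gtop G" U] topspace_arrows
  by (auto simp: cob_def open_bisection_def)

lemma cob_empty [simp]: "cob G {}"
  by (simp add: cob_def open_bisection_def)

lemma cob_subset:
  assumes "cob G U" "W \<subseteq> U" "openin (gtop G) W" "compactin (gtop G) W"
  shows "cob G W"
  using assms by (auto simp: cob_def open_bisection_def intro: inj_on_subset)

text \<open>Two points of a bisection have different domains, and arrows with different domains are
  separated by open sets.\<close>

lemma open_bisection_Hausdorff:
  assumes "open_bisection G U"
  shows "Hausdorff_space (subtopology (gtop G) U)"
  unfolding Hausdorff_space_def
proof (intro allI impI)
  fix x y assume *: "x \<in> topspace (subtopology (gtop G) U) \<and> y \<in> topspace (subtopology (gtop G) U) \<and> x \<noteq> y"
  then have "x \<in> arrows G" "y \<in> arrows G" "gdom G x \<noteq> gdom G y"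
    using assms topspace_arrows by (auto simp: open_bisection_def dest: inj_onD)
  then obtain V W where "openin (gtop G) V" "openin (gtop G) W" "x \<in> V" "y \<in> W" "V \<inter> W = {}"
    using dom_separated by metis
  then show "\<exists>V W. openin (subtopology (gtop G) U) V \<and> openin (subtopology (gtop G) U) W \<and> x \<in> V \<and> y \<in> W \<and> disjnt V W"
    using * by (intro exI[of _ "U \<inter> V"] exI[of _ "U \<inter> W"])
      (auto simp: disjnt_def openin_subtopology_Int2)
qed

text \<open>The surrounding bisection \<open>W\<close> is Hausdorff, so compact subsets of it are
  closed in it, and the difference is clopen in \<open>W\<close> and closed in the compact
  \<open>U\<close>. Without a common \<open>W\<close> a difference need not be open or
  compact.\<close>

lemma cob_Diff:
  assumes W: "cob G W" and U: "cob G U" "U \<subseteq> W" and V: "cob G V" "V \<subseteq> W"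
  shows "cob G (U - V)"
proof -
  let ?X = "subtopology (gtop G) W"
  have H: "Hausdorff_space ?X" using open_bisection_Hausdorff W by (simp add: cob_def)
  have c: "compactin ?X U" "compactin ?X V" using U V cobD by (auto simp: compactin_subtopology)
  then have cl: "closedin ?X U" "closedin ?X V" using H by (auto intro: compactin_imp_closedin)
  have op: "openin ?X U" "openin ?X V"
    using U V W cobD(1) by (auto simp: openin_open_subtopology)
  have "openin ?X (U - V)" "closedin ?X (U - V)"
    using cl op by (auto intro: openin_diff closedin_diff)
  then have "openin (gtop G) (U - V)" "compactin ?X (U - V)"
    using W c(1) by (auto simp: openin_open_subtopology cobD intro: closed_compactin)
  then show ?thesis using U(1) by (auto intro: cob_subset simp: compactin_subtopology)
qed

lemma cob_Int:
  assumes "cob G W" "cob G U" "U \<subseteq> W" "cob G V" "V \<subseteq> W"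
  shows "cob G (U \<inter> V)"
proof -
  have "U \<inter> V = U - (U - V)" by auto
  then show ?thesis using assms cob_Diff[of W U "U - V"] cob_Diff[of W U V] by auto
qed

lemma cob_Union:
  assumes "cob G W" "finite F" "\<And>U. U \<in> F \<Longrightarrow> cob G U \<and> U \<subseteq> W"
  shows "cob G (\<Union>F)"
  by (rule cob_subset[OF assms(1)]) (use assms cobD in \<open>auto intro!: compactin_Union\<close>)

lemma cob_Un: "\<lbrakk>cob G W; cob G U; U \<subseteq> W; cob G V; V \<subseteq> W\<rbrakk> \<Longrightarrow> cob G (U \<union> V)"
  using cob_Union[of W "{U, V}"] by auto

lemma compact_cover:
  assumes "compactin (gtop G) K" "openin (gtop G) W" "K \<subseteq> W"
    and B: "\<And>O' g. \<lbrakk>openin (gtop G) O'; g \<in> O'\<rbrakk> \<Longrightarrow> \<exists>U\<in>B. g \<in> U \<and> U \<subseteq> O'"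
    and op: "\<And>U. U \<in> B \<Longrightarrow> openin (gtop G) U"
  shows "\<exists>F. finite F \<and> F \<subseteq> B \<and> \<Union>F \<subseteq> W \<and> K \<subseteq> \<Union>F"
proof -
  let ?C = "{U \<in> B. U \<subseteq> W}"
  have "K \<subseteq> \<Union>?C" using B[OF assms(2)] assms(3) by blast
  moreover have "openin (gtop G) U" if "U \<in> ?C" for U using that op by auto
  ultimately obtain F where "finite F" "F \<subseteq> ?C" "K \<subseteq> \<Union>F"
    using assms(1) unfolding compactin_def by meson
  then show ?thesis by blast
qed

lemma cob_eq_Union:
  assumes "cob G U"
  shows "\<exists>F. finite F \<and> F \<subseteq> \<B> \<and> U = \<Union>F"
proof -
  have "\<exists>F. finite F \<and> F \<subseteq> \<B> \<and> \<Union>F \<subseteq> U \<and> U \<subseteq> \<Union>F"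
    by (rule compact_cover[OF cobD(2)[OF assms] cobD(1)[OF assms] subset_refl basis cobD(1)[OF basis_cob]])
  then show ?thesis by (meson subset_antisym)
qed

lemma inj_smul:
  assumes "U \<subseteq> arrows G" "inj_on (gdom G) U" "inj_on (gran G) U"
    and "V \<subseteq> arrows G" "inj_on (gdom G) V" "inj_on (gran G) V"
  shows "inj_on (gdom G) (smul G U V)" "inj_on (gran G) (smul G U V)"
proof -
  have arr: "a \<in> arrows G" "b \<in> arrows G" if "a \<in> U" "b \<in> V" for a b
    using that assms(1,4) by auto
  show "inj_on (gdom G) (smul G U V)"
  proof (rule inj_onI)
    fix x y assume "x \<in> smul G U V" "y \<in> smul G U V" and eq: "gdom G x = gdom G y"
    then obtain a b a' b' where x: "x = gmul G a b" "a \<in> U" "b \<in> V" "gdom G a = gran G b"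
      and y: "y = gmul G a' b'" "a' \<in> U" "b' \<in> V" "gdom G a' = gran G b'"
      unfolding smul_def by blast
    have "b = b'" using x y eq arr by (intro inj_onD[OF assms(5)]) auto
    moreover have "a = a'" using x y calculation by (intro inj_onD[OF assms(2)]) auto
    ultimately show "x = y" using x y by simp
  qed
  show "inj_on (gran G) (smul G U V)"
  proof (rule inj_onI)
    fix x y assume "x \<in> smul G U V" "y \<in> smul G U V" and eq: "gran G x = gran G y"
    then obtain a b a' b' where x: "x = gmul G a b" "a \<in> U" "b \<in> V" "gdom G a = gran G b"
      and y: "y = gmul G a' b'" "a' \<in> U" "b' \<in> V" "gdom G a' = gran G b'"
      unfolding smul_def by blast
    have "a = a'" using x y eq arr by (intro inj_onD[OF assms(3)]) auto
    moreover have "b = b'" using x y calculation by (intro inj_onD[OF assms(6)]) auto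
    ultimately show "x = y" using x y by simp
  qed
qed

lemma smul_mono: "\<lbrakk>U \<subseteq> U'; V \<subseteq> V'\<rbrakk> \<Longrightarrow> smul G U V \<subseteq> smul G U' V'"
  by (auto simp: smul_def)

lemma cob_smul:
  assumes "cob G U" "cob G V" shows "cob G (smul G U V)"
proof -
  obtain F F' where F: "finite F" "F \<subseteq> \<B>" "U = \<Union>F" and F': "finite F'" "F' \<subseteq> \<B>" "V = \<Union>F'"
    using cob_eq_Union assms by meson
  have eq: "smul G U V = \<Union>((\<lambda>(A, B). smul G A B) ` (F \<times> F'))"
    unfolding smul_def F(3) F'(3) by force
  have cob: "cob G (smul G A B)" if "A \<in> F" "B \<in> F'" for A B
    using that F(2) F'(2) basis_smul basis_cob by blast
  have "openin (gtop G) (smul G U V)" "compactin (gtop G) (smul G U V)"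
    unfolding eq using F(1) F'(1) cob cobD by (auto intro!: compactin_Union)
  then show ?thesis
    using inj_smul assms by (simp add: cob_def open_bisection_def cobD[OF assms(1)] cobD[OF assms(2)])
qed

lemma cob_inv:
  assumes "cob G U" shows "cob G (ginv G ` U)"
proof -
  obtain F where F: "finite F" "F \<subseteq> \<B>" "U = \<Union>F" using cob_eq_Union assms by meson
  have eq: "ginv G ` U = \<Union>((`) (ginv G) ` F)" unfolding F(3) by force
  have cob: "cob G (ginv G ` A)" if "A \<in> F" for A
    using that F(2) basis_inv basis_cob by blast
  have "openin (gtop G) (ginv G ` U)" "compactin (gtop G) (ginv G ` U)"
    unfolding eq using F(1) cob cobD by (auto intro!: compactin_Union)
  moreover have "inj_on (gdom G) (ginv G ` U)" "inj_on (gran G) (ginv G ` U)"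
    using cobD(3-5)[OF assms] by (auto simp: inj_on_def subset_iff)
  ultimately show ?thesis by (simp add: cob_def open_bisection_def)
qed

text \<open>The intersections of \<open>W\<close> with \<open>V i\<close> are open but perhaps not
  compact, so \<open>W\<close> is covered by finitely many basis sets, each inside some
  intersection. Those inside the \<open>i\<close>-th one form the compact \<open>Q i\<close>, and
  subtracting the earlier \<open>Q j\<close> makes the pieces disjoint.\<close>

lemma cob_partition:
  fixes n :: nat
  assumes W: "cob G W" and op: "\<And>i. i < n \<Longrightarrow> openin (gtop G) (V i)" and cov: "W \<subseteq> (\<Union>i<n. V i)"
  obtains P where "\<And>i. i < n \<Longrightarrow> cob G (P i) \<and> P i \<subseteq> W \<inter> V i" "W = (\<Union>i<n. P i)"
    "\<And>i j. \<lbrakk>i < n; j < n; i \<noteq> j\<rbrakk> \<Longrightarrow> P i \<inter> P j = {}"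
proof -
  let ?B = "{U \<in> \<B>. \<exists>i<n. U \<subseteq> W \<inter> V i}"
  have "\<exists>U\<in>?B. g \<in> U" if g: "g \<in> W" for g
  proof -
    obtain i where "i < n" "g \<in> W \<inter> V i" using cov g by blast
    then show ?thesis using basis[of "W \<inter> V i" g] op W cobD(1) by blast
  qed
  then have "W \<subseteq> \<Union>?B" by blast
  moreover have "openin (gtop G) U" if "U \<in> ?B" for U using that basis_cob cobD by blast
  ultimately obtain F where F: "finite F" "F \<subseteq> ?B" "W \<subseteq> \<Union>F"
    using cobD(2)[OF W] unfolding compactin_def by meson
  define Q where "Q i = \<Union>{U \<in> F. U \<subseteq> W \<inter> V i}" for i
  define P where "P i = Q i - (\<Union>j<i. Q j)" for i
  have Q: "cob G (Q i)" "Q i \<subseteq> W \<inter> V i" for i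
    unfolding Q_def using F basis_cob by (auto intro!: cob_Union[OF W])
  have UN: "cob G (\<Union>j<i. Q j)" for i
    using Q by (intro cob_Union[OF W]) auto
  have WQ: "W = (\<Union>i<n. Q i)"
  proof (intro equalityI subsetI)
    fix g assume "g \<in> W"
    then obtain U where "U \<in> F" "g \<in> U" using F(3) by blast
    moreover obtain i where "i < n" "U \<subseteq> W \<inter> V i" using F(2) calculation(1) by blast
    ultimately show "g \<in> (\<Union>i<n. Q i)" by (auto simp: Q_def)
  qed (use Q(2) in blast)
  show ?thesis
  proof
    show "cob G (P i) \<and> P i \<subseteq> W \<inter> V i" if "i < n" for i
    proof -
      have "(\<Union>j<i. Q j) \<subseteq> W" "Q i \<subseteq> W" using Q(2) by blast+
      then show ?thesis using cob_Diff[OF W Q(1) _ UN] Q(2)[of i] by (auto simp: P_def)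
    qed
    show "P i \<inter> P j = {}" if "i < n" "j < n" "i \<noteq> j" for i j
      using that by (cases "i < j") (auto simp: P_def)
    have "\<exists>i<n. g \<in> P i" if g: "g \<in> W" for g
    proof -
      obtain i where i: "i < n" "g \<in> Q i" using WQ g by blast
      define k where "k = (LEAST i. g \<in> Q i)"
      have "g \<in> Q k" "k \<le> i" unfolding k_def using i by (auto intro: LeastI Least_le)
      moreover have "g \<notin> Q j" if "j < k" for j using that not_less_Least k_def by blast
      ultimately show ?thesis using i by (intro exI[of _ k]) (auto simp: P_def)
    qed
    moreover have "P i \<subseteq> W" for i using Q(2) by (auto simp: P_def)
    ultimately show "W = (\<Union>i<n. P i)" by blast
  qed
qed

subsection \<open>Locally constant functions on bisections\<close>

definition LC :: "'g set \<Rightarrow> ('g \<Rightarrow> 'r::{comm_ring, comm_monoid_mult}) set" where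
  "LC U = fun_span {ind W | W. cob G W \<and> W \<subseteq> U}"

lemma LC_off: "\<lbrakk>f \<in> LC U; x \<notin> U\<rbrakk> \<Longrightarrow> f x = 0"
  unfolding LC_def by (induction rule: fun_span.induct) (auto simp: ind_def)

lemma LC_mono: "U \<subseteq> V \<Longrightarrow> f \<in> LC U \<Longrightarrow> f \<in> LC V"
  unfolding LC_def by (erule fun_span_bind) (blast intro: fun_span_base)

lemma LC_ind: "\<lbrakk>cob G W; W \<subseteq> U\<rbrakk> \<Longrightarrow> ind W \<in> LC U"
  unfolding LC_def by (blast intro: fun_span_base)

lemma ind_mult: "ind U x * ind V x = ind (U \<inter> V) x"
  by (simp add: ind_def)

lemma LC_add: "\<lbrakk>f \<in> LC U; g \<in> LC U\<rbrakk> \<Longrightarrow> (\<lambda>x. f x + g x) \<in> LC U"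
  unfolding LC_def by (rule fun_span_add)

lemma LC_scale: "f \<in> LC U \<Longrightarrow> (\<lambda>x. c * f x) \<in> LC U"
  unfolding LC_def by (rule fun_span_scale)

lemma LC_zero: "(\<lambda>x. 0) \<in> LC U"
  unfolding LC_def by (rule fun_span.zero)

lemma LC_induct [consumes 1, case_names zero step]:
  assumes "f \<in> LC U" "P (\<lambda>x. 0)"
    and "\<And>f W c. \<lbrakk>f \<in> LC U; P f; cob G W; W \<subseteq> U\<rbrakk> \<Longrightarrow> P (\<lambda>x. f x + c * ind W x)"
  shows "P f"
  using assms(1) unfolding LC_def
  by (induction rule: fun_span.induct) (auto intro: assms(2,3) simp: LC_def)

lemma LC_mult_ind:
  assumes "f \<in> LC U" "cob G U" "cob G W" "W \<subseteq> U"
  shows "(\<lambda>x. f x * ind W x) \<in> LC W"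
  using assms(1)
proof (induction rule: LC_induct)
  case (step f V c)
  have "cob G (V \<inter> W)" using cob_Int[OF assms(2) step.hyps(2,3) assms(3,4)] .
  then have "ind (V \<inter> W) \<in> LC W" by (intro LC_ind) auto
  from LC_add[OF step.IH LC_scale[OF this, of c]] show ?case
    by (simp add: distrib_right mult.assoc ind_mult)
qed (simp add: LC_zero)

text \<open>The predicate varies in the induction: on \<open>W\<close> the new term shifts the value
  by \<open>c\<close>, which is absorbed into \<open>P\<close>, and off \<open>W\<close> nothing
  changes. All level sets are thus compact and open, although \<open>LC\<close> is defined purely as
  a span.\<close>

lemma LC_level:
  assumes "f \<in> LC U" "cob G U"
  shows "cob G {x \<in> U. P (f x)}"
  using assms(1)
proof (induction arbitrary: P rule: LC_induct)
  case zero
  then show ?case using assms(2) by (cases "P 0") auto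
next
  case (step f W c)
  have eq: "{x \<in> U. P (f x + c * ind W x)} = (W \<inter> {x \<in> U. P (f x + c)}) \<union> ({x \<in> U. P (f x)} - W)"
    using step.hyps by (auto simp: ind_def)
  have 1: "cob G {x \<in> U. P (f x)}" "cob G {x \<in> U. P (f x + c)}"
    using step.IH[of P] step.IH[of "\<lambda>y. P (y + c)"] by auto
  have "cob G (W \<inter> {x \<in> U. P (f x + c)})" "cob G ({x \<in> U. P (f x)} - W)"
    using cob_Int[OF assms(2) step.hyps(2,3) 1(2)] cob_Diff[OF assms(2) 1(1) _ step.hyps(2,3)] by auto
  then show ?case unfolding eq
    using step.hyps by (intro cob_Un[OF assms(2)]) auto
qed

lemma LC_fsupp: "\<lbrakk>f \<in> LC U; cob G U\<rbrakk> \<Longrightarrow> fsupp f"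
  by (rule fsupp_bisection[of U]) (auto simp: cobD LC_off subset_iff dest: cobD)

lemma ind_fsupp: "cob G U \<Longrightarrow> fsupp (ind U)"
  using LC_fsupp[OF LC_ind] by blast

lemma LC_convolution:
  assumes "f \<in> LC U" "g \<in> LC V"
  shows "convolution G f g \<in> LC (smul G U V)"
  unfolding LC_def
proof (rule span_convolution_closed[OF _ _ _ assms[unfolded LC_def]])
  fix f' g' :: "'g \<Rightarrow> 'a" assume "f' \<in> {ind W |W. cob G W \<and> W \<subseteq> U}" "g' \<in> {ind W |W. cob G W \<and> W \<subseteq> V}"
  then obtain A B where AB: "f' = ind A" "g' = ind B" "cob G A" "cob G B" "A \<subseteq> U" "B \<subseteq> V" by blast
  then have "convolution G f' g' = ind (smul G A B)"
    by (simp add: convolution_ind cobD)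
  then show "convolution G f' g' \<in> fun_span {ind W |W. cob G W \<and> W \<subseteq> smul G U V}"
    using AB cob_smul[of A B] smul_mono[of A U B V] by (auto intro!: fun_span_base)
qed (auto intro: ind_fsupp)

lemma LC_gstar:
  assumes cj: "scalar_inv cj" and "f \<in> LC U"
  shows "gstar cj f \<in> LC (ginv G ` U)"
  unfolding LC_def
proof (rule span_gstar_closed[OF cj _ assms(2)[unfolded LC_def]])
  fix f' :: "'g \<Rightarrow> 'a" assume "f' \<in> {ind W |W. cob G W \<and> W \<subseteq> U}"
  then obtain A where A: "f' = ind A" "cob G A" "A \<subseteq> U" by blast
  then show "gstar cj f' \<in> fun_span {ind W |W. cob G W \<and> W \<subseteq> ginv G ` U}"
    using cob_inv[of A] by (auto simp: gstar_ind[OF cj] cobD intro!: fun_span_base)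
qed

abbreviation SB :: "('g \<Rightarrow> 'r::{comm_ring, comm_monoid_mult}) set" where
  "SB \<equiv> {ind U | U. cob G U}"

lemma steinberg_alg_eq: "steinberg_alg G = groupoid_alg id G SB"
  unfolding steinberg_alg_def ind_def cob_def ..

lemma LC_SB: "f \<in> LC U \<Longrightarrow> f \<in> fun_span SB"
  unfolding LC_def by (erule fun_span_bind) (blast intro: fun_span_base)

lemma SB_fsupp: "SB \<subseteq> Collect fsupp"
  using ind_fsupp by blast

lemma star_algebra_steinberg:
  assumes cj: "scalar_inv cj"
  shows "star_algebra cj (groupoid_alg cj G SB)"
proof (rule star_algebra_groupoid_alg[OF cj SB_fsupp])
  fix f g :: "'g \<Rightarrow> 'a" assume "f \<in> SB" "g \<in> SB"
  then obtain A B where "f = ind A" "g = ind B" "cob G A" "cob G B" by blast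
  then show "convolution G f g \<in> fun_span SB"
    using cob_smul by (auto simp: convolution_ind cobD intro!: fun_span_base)
next
  fix f :: "'g \<Rightarrow> 'a" assume "f \<in> SB"
  then obtain A where "f = ind A" "cob G A" by blast
  then show "gstar cj f \<in> fun_span SB"
    using cob_inv by (auto simp: gstar_ind[OF cj] cobD intro!: fun_span_base)
qed

text \<open>The product of the inverse of \<open>B\<close> with \<open>B\<close> consists of the
  units at the domains of \<open>B\<close>. Multiplying \<open>A\<close> by it keeps the arrows of
  \<open>A\<close> whose domain occurs in \<open>B\<close>, and inside the bisection
  \<open>U\<close> these are the arrows of \<open>A\<close> lying in \<open>B\<close>. So an
  intersection is expressed by product and involution.\<close>

lemma bisection_Int_smul:
  assumes "U \<subseteq> arrows G" "inj_on (gdom G) U" "inj_on (gran G) U" "A \<subseteq> U" "B \<subseteq> U"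
  shows "smul G A (smul G (ginv G ` B) B) = A \<inter> B"
proof (intro equalityI subsetI)
  fix x assume "x \<in> smul G A (smul G (ginv G ` B) B)"
  then obtain a b c where x: "a \<in> A" "b \<in> B" "c \<in> B" "gdom G (ginv G b) = gran G c"
      "gdom G a = gran G (gmul G (ginv G b) c)" "x = gmul G a (gmul G (ginv G b) c)"
    unfolding smul_def by blast
  then have m: "a \<in> U" "b \<in> U" "c \<in> U" "a \<in> arrows G" "b \<in> arrows G" "c \<in> arrows G" using assms by auto
  have "b = c" using x m assms(3) by (auto dest: inj_onD)
  moreover have "a = b" using x m assms(2) calculation by (auto dest: inj_onD)
  ultimately show "x \<in> A \<inter> B" using x m by simp
next
  fix x assume x: "x \<in> A \<inter> B"
  then have [simp]: "x \<in> arrows G" using assms by auto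
  have "gmul G (ginv G x) x \<in> smul G (ginv G ` B) B"
    using x unfolding smul_def by force
  moreover have "gmul G x (gmul G (ginv G x) x) = x" "gdom G x = gran G (gmul G (ginv G x) x)" by simp_all
  ultimately show "x \<in> smul G A (smul G (ginv G ` B) B)"
    using x unfolding smul_def by (smt (verit) IntE mem_Collect_eq)
qed

text \<open>A compact open bisection is a finite union of sets from \<open>B\<close> inside it. They
  are adjoined one at a time by inclusion-exclusion, the indicator of each intersection being a
  product that involves a star, by \<open>bisection_Int_smul\<close>.\<close>

lemma steinberg_generated:
  fixes H :: "('g \<Rightarrow> 'r::{comm_ring, comm_monoid_mult}) set"
  assumes cj: "scalar_inv cj"
    and basis': "\<And>W g. \<lbrakk>openin (gtop G) W; g \<in> W\<rbrakk> \<Longrightarrow> \<exists>U\<in>B. g \<in> U \<and> U \<subseteq> W"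
    and B: "\<And>U. U \<in> B \<Longrightarrow> cob G U \<and> ind U \<in> H"
    and zero: "(\<lambda>x. 0) \<in> H"
    and add: "\<And>f g. \<lbrakk>f \<in> H; g \<in> H\<rbrakk> \<Longrightarrow> (\<lambda>x. f x + g x) \<in> H"
    and scale: "\<And>f c. f \<in> H \<Longrightarrow> (\<lambda>x. c * f x) \<in> H"
    and conv: "\<And>f g. \<lbrakk>f \<in> H; g \<in> H\<rbrakk> \<Longrightarrow> convolution G f g \<in> H"
    and star: "\<And>f. f \<in> H \<Longrightarrow> gstar cj f \<in> H"
  shows "fun_span SB \<subseteq> H"
proof -
  have ind: "ind U \<in> H" if U: "cob G U" for U
  proof -
    have "\<exists>F. finite F \<and> F \<subseteq> B \<and> \<Union>F \<subseteq> U \<and> U \<subseteq> \<Union>F"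
      by (rule compact_cover[OF cobD(2)[OF U] cobD(1)[OF U] subset_refl basis']) (use B cobD(1) in auto)
    then obtain F where F: "finite F" "F \<subseteq> B" "U = \<Union>F" by (meson subset_antisym)
    have "ind (\<Union>F') \<in> H \<and> cob G (\<Union>F')" if "finite F'" "F' \<subseteq> F" for F'
      using that
    proof (induction F')
      case empty
      then show ?case using zero by (simp add: ind_def)
    next
      case (insert A F')
      let ?V = "\<Union>F'"
      have sub: "A \<in> F" "F' \<subseteq> F" using insert.prems by auto
      have IH: "ind ?V \<in> H" "cob G ?V" using insert.IH[OF sub(2)] by auto
      have A: "ind A \<in> H" "cob G A" using B F(2) sub(1) by blast+
      have "A \<subseteq> U" "?V \<subseteq> U" using sub unfolding F(3) by blast+
      note A = A this
      have "convolution G (ind A) (convolution G (gstar cj (ind ?V)) (ind ?V)) \<in> H"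
        by (intro conv star IH A)
      also have "convolution G (ind A) (convolution G (gstar cj (ind ?V)) (ind ?V)) = ind (A \<inter> ?V)"
        using IH A cob_inv[OF IH(2)] cob_smul[OF cob_inv[OF IH(2)] IH(2)]
          bisection_Int_smul[OF cobD(5,3,4)[OF U] A(3,4)]
        by (simp add: gstar_ind[OF cj] cobD convolution_ind)
      finally have "ind (A \<inter> ?V) \<in> H" .
      then have "(\<lambda>x. (ind A x + ind ?V x) + (- 1) * ind (A \<inter> ?V) x) \<in> H"
        by (intro add scale IH A)
      also have "(\<lambda>x. (ind A x + ind ?V x) + (- 1) * ind (A \<inter> ?V) x) = (ind (A \<union> ?V) :: 'g \<Rightarrow> 'r)"
        by (auto simp: ind_def)
      finally show ?case using cob_Un[OF U A(2,3) IH(2) A(4)] by simp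
    qed
    then show ?thesis using F by auto
  qed
  show ?thesis
  proof
    fix f :: "'g \<Rightarrow> 'r" assume "f \<in> fun_span SB"
    then show "f \<in> H"
    proof (induction rule: fun_span.induct)
      case (step f b c)
      then have "b \<in> H" using ind by blast
      from add[OF step.IH scale[OF this, of c]] show ?case .
    qed (rule zero)
  qed
qed

end

section \<open>C*-seminorms on the convolution algebra\<close>

lemma scalar_inv_cnj: "scalar_inv cnj"
  by (simp add: scalar_inv_def)

lemma cstar_seminormD:
  assumes "cstar_seminorm A p"
  shows "x \<in> carr A \<Longrightarrow> 0 \<le> p x"
    and "\<lbrakk>x \<in> carr A; y \<in> carr A\<rbrakk> \<Longrightarrow> p (aadd A x y) \<le> p x + p y"
    and "x \<in> carr A \<Longrightarrow> p (ascale A c x) = cmod c * p x"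
    and "\<lbrakk>x \<in> carr A; y \<in> carr A\<rbrakk> \<Longrightarrow> p (amul A x y) \<le> p x * p y"
    and "x \<in> carr A \<Longrightarrow> p (amul A (astar A x) x) = (p x)\<^sup>2"
  using assms unfolding cstar_seminorm_def by blast+

lemma continuous_map_euclidean_metric:
  fixes f :: "'g \<Rightarrow> 'm::metric_space"
  shows "continuous_map X euclidean f \<longleftrightarrow>
    (\<forall>x\<in>topspace X. \<forall>e>0. \<exists>N. openin X N \<and> x \<in> N \<and> (\<forall>y\<in>N. dist (f y) (f x) < e))"
proof
  assume f: "continuous_map X euclidean f"
  show "\<forall>x\<in>topspace X. \<forall>e>0. \<exists>N. openin X N \<and> x \<in> N \<and> (\<forall>y\<in>N. dist (f y) (f x) < e)"
  proof (intro ballI allI impI)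
    fix x and e :: real assume x: "x \<in> topspace X" "e > 0"
    have "openin X {y \<in> topspace X. f y \<in> ball (f x) e}"
      using f by (intro openin_continuous_map_preimage[of X euclidean]) auto
    then show "\<exists>N. openin X N \<and> x \<in> N \<and> (\<forall>y\<in>N. dist (f y) (f x) < e)"
      using x by (intro exI[of _ "{y \<in> topspace X. f y \<in> ball (f x) e}"]) (auto simp: dist_commute)
  qed
next
  assume R: "\<forall>x\<in>topspace X. \<forall>e>0. \<exists>N. openin X N \<and> x \<in> N \<and> (\<forall>y\<in>N. dist (f y) (f x) < e)"
  show "continuous_map X euclidean f"
    unfolding continuous_map_def
  proof (intro conjI allI impI)
    fix V :: "'m set" assume "openin euclidean V"
    then have V: "open V" by simp
    have "\<exists>N. openin X N \<and> x \<in> N \<and> N \<subseteq> {x \<in> topspace X. f x \<in> V}" if x: "x \<in> topspace X" "f x \<in> V" for x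
    proof -
      obtain e where e: "e > 0" "\<And>z. dist z (f x) < e \<Longrightarrow> z \<in> V"
        using V x(2) unfolding open_dist by blast
      obtain N where "openin X N" "x \<in> N" "\<forall>y\<in>N. dist (f y) (f x) < e"
        using R x(1) e(1) by blast
      then show ?thesis using e(2) openin_subset[of X N] by blast
    qed
    then show "openin X {x \<in> topspace X. f x \<in> V}"
      by (subst openin_subopen) blast
  qed simp
qed

context ample_groupoid
begin

text \<open>The uniform closure of the locally constant functions on a compact open bisection \<open>U\<close>
  consists of the functions that are continuous on \<open>U\<close>.\<close>

definition UC :: "'g set \<Rightarrow> ('g \<Rightarrow> complex) set" where
  "UC U = {f. \<forall>e>0. \<exists>g\<in>LC U. \<forall>x. cmod (f x - g x) \<le> e}"

lemma UC_approx:
  assumes "f \<in> UC U" "e > 0"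
  obtains g where "g \<in> LC U" "\<And>x. cmod (f x - g x) \<le> e"
  using assms unfolding UC_def by blast

lemma LC_UC: "f \<in> LC U \<Longrightarrow> f \<in> UC U"
  unfolding UC_def by (auto intro!: bexI[of _ f])

lemma UC_off:
  assumes "f \<in> UC U" "x \<notin> U" shows "f x = 0"
proof -
  have "cmod (f x) \<le> e" if e: "e > 0" for e
  proof -
    obtain g where "g \<in> LC U" "\<And>x. cmod (f x - g x) \<le> e" using UC_approx[OF assms(1) e] by blast
    then show ?thesis using LC_off[of g U x] assms(2) by (metis diff_zero)
  qed
  then have "cmod (f x) \<le> 0" by (rule dense_ge)
  then show ?thesis by simp
qed

lemma UC_fsupp: "\<lbrakk>f \<in> UC U; cob G U\<rbrakk> \<Longrightarrow> fsupp f"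
  by (rule fsupp_bisection[of U]) (auto simp: cobD(3,4) UC_off dest: subsetD[OF cobD(5)])

lemma UC_add:
  assumes "f \<in> UC U" "g \<in> UC U" shows "(\<lambda>x. f x + g x) \<in> UC U"
  unfolding UC_def
proof (intro CollectI allI impI)
  fix e :: real assume e: "e > 0"
  obtain f' where f': "f' \<in> LC U" "\<And>x. cmod (f x - f' x) \<le> e/2" using UC_approx[OF assms(1), of "e/2"] e by auto
  obtain g' where g': "g' \<in> LC U" "\<And>x. cmod (g x - g' x) \<le> e/2" using UC_approx[OF assms(2), of "e/2"] e by auto
  have "cmod ((f x + g x) - (f' x + g' x)) \<le> e" for x
    using norm_triangle_ineq[of "f x - f' x" "g x - g' x"] f'(2)[of x] g'(2)[of x]
    by (simp add: algebra_simps)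
  then show "\<exists>h\<in>LC U. \<forall>x. cmod (f x + g x - h x) \<le> e"
    using LC_add[OF f'(1) g'(1)] by (intro bexI) auto
qed

lemma UC_scale:
  assumes "f \<in> UC U" shows "(\<lambda>x. c * f x) \<in> UC U"
  unfolding UC_def
proof (intro CollectI allI impI)
  fix e :: real assume e: "e > 0"
  have pos: "cmod c + 1 > 0" by (simp add: add_nonneg_pos)
  obtain f' where f': "f' \<in> LC U" "\<And>x. cmod (f x - f' x) \<le> e / (cmod c + 1)"
    using UC_approx[OF assms, of "e / (cmod c + 1)"] e pos by auto
  have "cmod (c * f x - c * f' x) \<le> e" for x
  proof -
    have "cmod (c * f x - c * f' x) = cmod c * cmod (f x - f' x)"
      by (simp add: right_diff_distrib[symmetric] norm_mult)
    also have "\<dots> \<le> (cmod c + 1) * (e / (cmod c + 1))"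
      using f'(2)[of x] by (intro mult_mono) auto
    also have "\<dots> = e" using pos by simp
    finally show ?thesis .
  qed
  then show "\<exists>h\<in>LC U. \<forall>x. cmod (c * f x - h x) \<le> e"
    using LC_scale[OF f'(1)] by (intro bexI) auto
qed

lemma LC_bounded:
  fixes f :: "'g \<Rightarrow> complex"
  assumes "f \<in> LC U" shows "\<exists>M\<ge>0. \<forall>x. cmod (f x) \<le> M"
  using assms
proof (induction rule: LC_induct)
  case (step f W c)
  then obtain M where M: "M \<ge> 0" "\<And>x. cmod (f x) \<le> M" by blast
  have "cmod (f x + c * ind W x) \<le> M + cmod c" for x
    using norm_triangle_ineq[of "f x" "c * ind W x"] M(2)[of x] norm_ge_zero[of c]
    by (auto simp: ind_def norm_mult simp del: norm_ge_zero)
  then show ?case using M(1) by (intro exI[of _ "M + cmod c"]) auto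
qed auto

lemma UC_bounded:
  assumes "f \<in> UC U" shows "\<exists>M\<ge>0. \<forall>x. cmod (f x) \<le> M"
proof -
  obtain g where g: "g \<in> LC U" "\<And>x. cmod (f x - g x) \<le> 1" using UC_approx[OF assms, of 1] by auto
  obtain M where M: "M \<ge> 0" "\<And>x. cmod (g x) \<le> M" using LC_bounded[OF g(1)] by blast
  have "cmod (f x) \<le> M + 1" for x
    using norm_triangle_ineq[of "f x - g x" "g x"] g(2)[of x] M(2)[of x] by simp
  then show ?thesis using M(1) by (intro exI[of _ "M + 1"]) auto
qed

text \<open>A uniform limit of locally constant functions is continuous. Conversely, compactness
  covers \<open>U\<close> by finitely many preimages of balls; a disjoint refinement into compact
  open sets exists by \<open>cob_partition\<close>, and the step function with the values at the
  centres is within \<open>e\<close>.\<close>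

lemma UC_iff_continuous:
  assumes U: "cob G U"
  shows "f \<in> UC U \<longleftrightarrow> (\<forall>x. x \<notin> U \<longrightarrow> f x = 0) \<and> continuous_map (subtopology (gtop G) U) euclidean f"
proof
  assume f: "f \<in> UC U"
  have "continuous_map (subtopology (gtop G) U) euclidean f"
    unfolding continuous_map_euclidean_metric
  proof (intro ballI allI impI)
    fix x and e :: real assume x: "x \<in> topspace (subtopology (gtop G) U)" and e: "e > 0"
    obtain g where g: "g \<in> LC U" "\<And>x. cmod (f x - g x) \<le> e/3" using UC_approx[OF f, of "e/3"] e by auto
    let ?N = "{y \<in> U. g y = g x}"
    have "cob G ?N" using LC_level[OF g(1) U, of "\<lambda>z. z = g x"] .
    then have "openin (subtopology (gtop G) U) ?N"
      using cobD(1)[OF U] cobD(1)[of ?N] by (subst openin_open_subtopology) auto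
    moreover have "dist (f y) (f x) < e" if "g y = g x" for y
    proof -
      have "f y - f x = (f y - g y) - (f x - g x)" using that by simp
      then show ?thesis
        using norm_triangle_ineq4[of "f y - g y" "f x - g x"] g(2)[of x] g(2)[of y] e by (simp add: dist_norm)
    qed
    moreover have "x \<in> U" using x by simp
    ultimately show "\<exists>N. openin (subtopology (gtop G) U) N \<and> x \<in> N \<and> (\<forall>y\<in>N. dist (f y) (f x) < e)"
      by (intro exI[of _ ?N]) auto
  qed
  then show "(\<forall>x. x \<notin> U \<longrightarrow> f x = 0) \<and> continuous_map (subtopology (gtop G) U) euclidean f"
    using UC_off[OF f] by blast
next
  assume "(\<forall>x. x \<notin> U \<longrightarrow> f x = 0) \<and> continuous_map (subtopology (gtop G) U) euclidean f"
  then have off: "\<And>x. x \<notin> U \<Longrightarrow> f x = 0" and cont: "continuous_map (subtopology (gtop G) U) euclidean f" by auto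
  show "f \<in> UC U"
    unfolding UC_def
  proof (intro CollectI allI impI)
    fix e :: real assume e: "e > 0"
    define V where "V y = {x \<in> U. f x \<in> ball (f y) e}" for y
    have V: "openin (gtop G) (V y)" for y
    proof -
      have "topspace (subtopology (gtop G) U) = U"
        using cobD(5)[OF U] topspace_arrows by auto
      then have "openin (subtopology (gtop G) U) (V y)"
        using openin_continuous_map_preimage[OF cont, of "ball (f y) e"] by (simp add: V_def)
      then show ?thesis using cobD(1)[OF U] by (simp add: openin_open_subtopology)
    qed
    have "U \<subseteq> \<Union>(V ` U)" using e by (auto simp: V_def)
    moreover have "openin (gtop G) W" if "W \<in> V ` U" for W using that V by auto
    ultimately obtain F where F: "finite F" "F \<subseteq> V ` U" "U \<subseteq> \<Union>F"
      using cobD(2)[OF U] unfolding compactin_def by meson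
    obtain S where S: "finite S" "S \<subseteq> U" "F = V ` S" using F(1,2) by (meson finite_subset_image)
    obtain n and s :: "nat \<Rightarrow> 'g" where s: "S = s ` {..<n}"
      using S(1) by (metis atLeast0LessThan ex_bij_betw_nat_finite bij_betw_imp_surj_on)
    have "U \<subseteq> (\<Union>i<n. V (s i))" using F(3) S(3) s by auto
    then obtain P where P: "\<And>i. i < n \<Longrightarrow> cob G (P i) \<and> P i \<subseteq> U \<inter> V (s i)" "U = (\<Union>i<n. P i)"
        "\<And>i j. \<lbrakk>i < n; j < n; i \<noteq> j\<rbrakk> \<Longrightarrow> P i \<inter> P j = {}"
      using cob_partition[OF U, of n "\<lambda>i. V (s i)"] V by metis
    let ?g = "\<lambda>x. \<Sum>i<n. f (s i) * ind (P i) x"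
    have "?g \<in> LC U"
      unfolding LC_def
      by (intro fun_span_sum fun_span_scale fun_span_base) (use P(1) in blast)
    moreover have "cmod (f x - ?g x) \<le> e" for x
    proof (cases "x \<in> U")
      case True
      then obtain i where i: "i < n" "x \<in> P i" using P(2) by blast
      have "?g x = (\<Sum>j\<in>{i}. f (s j) * ind (P j) x)"
        using i P(3) by (intro sum.mono_neutral_right) (auto simp: ind_def)
      then have "?g x = f (s i)" using i(2) by (simp add: ind_def)
      moreover have "x \<in> V (s i)" using i P(1) by blast
      ultimately show ?thesis by (simp add: V_def dist_norm norm_minus_commute)
    next
      case False
      then have "ind (P i) x = (0::complex)" if "i < n" for i using P(1)[OF that] by (auto simp: ind_def)
      then have "?g x = 0" by (intro sum.neutral) auto
      then show ?thesis using off[OF False] e by simp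
    qed
    ultimately show "\<exists>g\<in>LC U. \<forall>x. cmod (f x - g x) \<le> e" by (intro bexI[of _ ?g] allI)
  qed
qed

lemma UC_compose:
  assumes f: "f \<in> UC U" and U: "cob G U" and \<phi>: "continuous_on UNIV \<phi>"
  shows "(\<lambda>x. \<phi> (f x) * ind U x) \<in> UC U"
proof -
  have c: "continuous_map (subtopology (gtop G) U) euclidean f" using f UC_iff_continuous[OF U] by blast
  have "continuous_map (subtopology (gtop G) U) euclidean (\<phi> \<circ> f)"
    by (rule continuous_map_compose[OF c]) (use \<phi> in auto)
  then have "continuous_map (subtopology (gtop G) U) euclidean (\<lambda>x. \<phi> (f x) * ind U x)"
    by (rule continuous_map_eq) (auto simp: ind_def)
  then show ?thesis using UC_iff_continuous[OF U] by (auto simp: ind_def)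
qed

text \<open>No condition such as \<open>\<phi> 0 = 0\<close> is imposed, which is why the result is
  cut off by \<open>ind U\<close>. In the inductive step \<open>\<phi>\<close> is applied to
  \<open>f + c\<close> on \<open>W\<close> and to \<open>f\<close> elsewhere, so it has to
  vary.\<close>

lemma LC_compose:
  assumes f: "f \<in> LC U" and U: "cob G U"
  shows "(\<lambda>x. \<phi> (f x) * ind U x) \<in> LC U"
  using f
proof (induction arbitrary: \<phi> rule: LC_induct)
  case zero
  show ?case using LC_scale[OF LC_ind[OF U subset_refl], of "\<phi> 0"] .
next
  case (step f W c)
  have 1: "(\<lambda>x. \<phi> (f x) * ind U x) \<in> LC U" using step.IH .
  have 2: "(\<lambda>x. \<phi> (f x + c) * ind U x) \<in> LC U" using step.IH[of "\<lambda>z. \<phi> (z + c)"] .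
  note m = LC_mono[OF step.hyps(3) LC_mult_ind[OF _ U step.hyps(2,3)]]
  have "(\<lambda>x. (\<phi> (f x) * ind U x + \<phi> (f x + c) * ind U x * ind W x) + (- 1) * (\<phi> (f x) * ind U x * ind W x)) \<in> LC U"
    by (intro LC_add LC_scale m 1 2)
  also have "(\<lambda>x. (\<phi> (f x) * ind U x + \<phi> (f x + c) * ind U x * ind W x) + (- 1) * (\<phi> (f x) * ind U x * ind W x)) =
      (\<lambda>x. \<phi> (f x + c * ind W x) * ind U x)"
    by (auto simp: ind_def)
  finally show ?case .
qed

subsection \<open>Convolution estimates\<close>

text \<open>The sum for one arrow has at most \<open>n\<close> terms, one for each point of the
  support of \<open>f\<close> with the same range.\<close>

lemma convolution_bound:
  fixes f g :: "'g \<Rightarrow> complex"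
  assumes f: "fsupp f" and g: "fsupp g" and n: "\<And>c. card (ranfib f c) \<le> n"
    and a: "\<And>x. cmod (f x) \<le> a" and b: "\<And>x. cmod (g x) \<le> b"
  shows "cmod (convolution G f g c) \<le> real n * a * b"
proof (cases "c \<in> arrows G")
  case True
  have ab: "0 \<le> a" "0 \<le> b" using a b norm_ge_zero order_trans by blast+
  have "cmod (convolution G f g c) \<le> (\<Sum>x\<in>ranfib f c. cmod (f x * g (gmul G (ginv G x) c)))"
    by (simp add: convolution_ranfib[OF f g True] norm_sum)
  also have "\<dots> \<le> (\<Sum>x\<in>ranfib f c. a * b)"
    by (intro sum_mono) (simp add: norm_mult mult_mono a b ab)
  also have "\<dots> \<le> real n * (a * b)"
    using n[of c] ab by (simp add: mult_right_mono)
  finally show ?thesis by (simp add: mult.assoc)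
next
  case False
  have ab: "0 \<le> a" "0 \<le> b" using a b norm_ge_zero order_trans by blast+
  then show ?thesis using False by (simp add: convolution_off_arrows)
qed

lemma card_ranfib_bisection:
  assumes "inj_on (gran G) U" "\<And>x. x \<notin> U \<Longrightarrow> f x = 0"
  shows "card (ranfib f c) \<le> 1"
proof -
  have "x = y" if "x \<in> ranfib f c" "y \<in> ranfib f c" for x y
    using that assms by (intro inj_onD[OF assms(1)]) auto
  then have "\<exists>z. ranfib f c \<subseteq> {z}" by blast
  then show ?thesis using card_mono[of "{_}" "ranfib f c"] by force
qed

lemma card_ranfib_sum:
  fixes F :: "nat \<Rightarrow> 'g \<Rightarrow> 'r::comm_ring"
  assumes "\<And>i. i < n \<Longrightarrow> fsupp (F i) \<and> card (ranfib (F i) c) \<le> 1"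
  shows "card (ranfib (\<lambda>x. \<Sum>i<n. F i x) c) \<le> n"
proof -
  have "ranfib (\<lambda>x. \<Sum>i<n. F i x) c \<subseteq> (\<Union>i<n. ranfib (F i) c)"
    by (auto elim!: sum.not_neutral_contains_not_neutral)
  then have "card (ranfib (\<lambda>x. \<Sum>i<n. F i x) c) \<le> card (\<Union>i<n. ranfib (F i) c)"
    using assms by (intro card_mono) (auto simp: fsupp_def)
  also have "\<dots> \<le> (\<Sum>i<n. card (ranfib (F i) c))" by (rule card_UN_le) simp
  also have "\<dots> \<le> (\<Sum>i<n. 1)" using assms by (intro sum_mono) auto
  finally show ?thesis by simp
qed

lemma UC_convolution:
  assumes f: "f \<in> UC U" and g: "g \<in> UC V" and U: "cob G U" and V: "cob G V"
  shows "convolution G f g \<in> UC (smul G U V)"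
  unfolding UC_def
proof (intro CollectI allI impI)
  fix e :: real assume e: "e > 0"
  obtain M where M: "M \<ge> 0" "\<And>x. cmod (f x) \<le> M" using UC_bounded[OF f] by blast
  obtain N where N: "N \<ge> 0" "\<And>x. cmod (g x) \<le> N" using UC_bounded[OF g] by blast
  \<comment> \<open>The difference of the products is \<open>f * (g - g')\<close> plus
    \<open>(f - f') * g'\<close>. As \<open>d \<le> 1\<close>, the function \<open>g'\<close> is
    bounded by \<open>N + 1\<close>, so the error is at most
    \<open>M * d + d * (N + 1)\<close>.\<close>
  define d where "d = min 1 (e / (M + N + 1))"
  have d: "d > 0" "d \<le> 1" "d * (M + N + 1) \<le> e" proof -
    have "M + N + 1 > 0" using M(1) N(1) by simp
    then show "d > 0" "d \<le> 1" "d * (M + N + 1) \<le> e"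
      using e by (auto simp: d_def min_def pos_le_divide_eq[symmetric] not_le intro: less_imp_le)
  qed
  obtain f' where f': "f' \<in> LC U" "\<And>x. cmod (f x - f' x) \<le> d" using UC_approx[OF f d(1)] by blast
  obtain g' where g': "g' \<in> LC V" "\<And>x. cmod (g x - g' x) \<le> d" using UC_approx[OF g d(1)] by blast
  have fs: "fsupp f" "fsupp g" "fsupp f'" "fsupp g'"
    using UC_fsupp LC_fsupp f g f' g' U V by blast+
  let ?df = "\<lambda>x. f x + (- 1) * f' x" and ?dg = "\<lambda>x. g x + (- 1) * g' x"
  have fsd: "fsupp ?df" "fsupp ?dg" by (rule fsupp_add fsupp_scale fs)+
  have c: "card (ranfib f x) \<le> 1" "card (ranfib f' x) \<le> 1" "card (ranfib ?df x) \<le> 1" for x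
    by (rule card_ranfib_bisection[OF cobD(4)[OF U]]; simp add: UC_off[OF f] LC_off[OF f'(1)])+
  have g'b: "cmod (g' x) \<le> N + 1" for x
    using norm_triangle_ineq[of "g x" "g' x - g x"] N(2)[of x] g'(2)[of x] d(2) by (simp add: norm_minus_commute)
  have "cmod (convolution G f g x - convolution G f' g' x) \<le> e" for x
  proof -
    have 1: "convolution G f ?dg = (\<lambda>x. convolution G f g x + (- 1) * convolution G f g' x)"
      using fs by (simp only: convolution_add_right convolution_scale_right fsupp_scale)
    have 2: "convolution G ?df g' = (\<lambda>x. convolution G f g' x + (- 1) * convolution G f' g' x)"
      using fs by (simp only: convolution_add_left convolution_scale_left fsupp_scale)
    have "convolution G f g x - convolution G f' g' x = convolution G f ?dg x + convolution G ?df g' x"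
      unfolding 1 2 by simp
    also have "cmod \<dots> \<le> real 1 * M * d + real 1 * d * (N + 1)"
      using fs fsd c M g' f' g'b
      by (intro norm_triangle_mono convolution_bound) auto
    also have "\<dots> = d * (M + N + 1)" by (simp add: algebra_simps)
    also have "\<dots> \<le> e" by (rule d)
    finally show ?thesis .
  qed
  then show "\<exists>h\<in>LC (smul G U V). \<forall>x. cmod (convolution G f g x - h x) \<le> e"
    using LC_convolution[OF f'(1) g'(1)] by blast
qed

lemma UC_gstar:
  assumes f: "f \<in> UC U" shows "gstar cnj f \<in> UC (ginv G ` U)"
  unfolding UC_def
proof (intro CollectI allI impI)
  fix e :: real assume e: "e > 0"
  obtain g where g: "g \<in> LC U" "\<And>x. cmod (f x - g x) \<le> e" using UC_approx[OF f e] by blast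
  have "cmod (gstar cnj f x - gstar cnj g x) \<le> e" for x
  proof (cases "x \<in> arrows G")
    case True
    then have "gstar cnj f x - gstar cnj g x = cnj (f (ginv G x) - g (ginv G x))" by (simp add: gstar_def)
    then show ?thesis using g(2)[of "ginv G x"] by (simp only: complex_mod_cnj)
  qed (use e in \<open>simp add: gstar_def\<close>)
  then show "\<exists>h\<in>LC (ginv G ` U). \<forall>x. cmod (gstar cnj f x - h x) \<le> e"
    using LC_gstar[OF scalar_inv_cnj g(1)] by blast
qed

subsection \<open>C*-seminorms are dominated by the supremum norm on bisections\<close>

text \<open>A set of unit arrows, recognised by being idempotent and self-inverse. On functions
  supported in it, convolution is the pointwise product and the star is complex conjugation.\<close>

definition units :: "'g set \<Rightarrow> bool" where
  "units V \<longleftrightarrow> V \<subseteq> arrows G \<and> inj_on (gran G) V \<and>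
     (\<forall>v\<in>V. gdom G v = gran G v \<and> ginv G v = v \<and> gmul G v v = v)"

lemma units_inv_smul:
  assumes "U \<subseteq> arrows G" "inj_on (gdom G) U" "inj_on (gran G) U"
  shows "units (smul G (ginv G ` U) U)"
    and "x \<in> smul G (ginv G ` U) U \<Longrightarrow> \<exists>b\<in>U. x = gmul G (ginv G b) b"
proof -
  have ex: "\<exists>b\<in>U. x = gmul G (ginv G b) b" if x: "x \<in> smul G (ginv G ` U) U" for x
  proof -
    obtain a b where ab: "a \<in> U" "b \<in> U" "gdom G (ginv G a) = gran G b" "x = gmul G (ginv G a) b"
      using x unfolding smul_def by blast
    moreover have "a = b" using ab assms(1) by (intro inj_onD[OF assms(3)]) auto
    ultimately show ?thesis by blast
  qed
  then show "x \<in> smul G (ginv G ` U) U \<Longrightarrow> \<exists>b\<in>U. x = gmul G (ginv G b) b" .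
  have "v \<in> arrows G \<and> gdom G v = gran G v \<and> ginv G v = v \<and> gmul G v v = v" if "v \<in> smul G (ginv G ` U) U" for v
  proof -
    obtain b where b: "b \<in> U" "v = gmul G (ginv G b) b" using ex \<open>v \<in> _\<close> by blast
    then have "b \<in> arrows G" using assms(1) by blast
    then show ?thesis using b by (simp add: inv_mul mul_assoc)
  qed
  moreover have "inj_on (gran G) (smul G (ginv G ` U) U)"
  proof (rule inj_onI)
    fix x y assume "x \<in> smul G (ginv G ` U) U" "y \<in> smul G (ginv G ` U) U" and eq: "gran G x = gran G y"
    then obtain b c where bc: "b \<in> U" "c \<in> U" "x = gmul G (ginv G b) b" "y = gmul G (ginv G c) c"
      using ex by meson
    moreover have "b \<in> arrows G" "c \<in> arrows G" using bc(1,2) assms(1) by auto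
    ultimately have "b = c" using eq by (intro inj_onD[OF assms(2)]) auto
    then show "x = y" using bc by simp
  qed
  ultimately show "units (smul G (ginv G ` U) U)" unfolding units_def by blast
qed

lemma units_convolution:
  fixes f g :: "'g \<Rightarrow> 'r::comm_ring"
  assumes V: "units V" and f: "\<And>x. x \<notin> V \<Longrightarrow> f x = 0" and g: "\<And>x. x \<notin> V \<Longrightarrow> g x = 0"
  shows "convolution G f g = (\<lambda>x. f x * g x)"
proof
  fix x
  have V': "V \<subseteq> arrows G" "inj_on (gran G) V" using V by (auto simp: units_def)
  show "convolution G f g x = f x * g x"
  proof (cases "x \<in> V")
    case True
    then have "gdom G x = gran G x" "gmul G x x = x" using V by (auto simp: units_def)
    then show ?thesis
      using convolution_bisection(1)[OF V' _ V'(1), of f g x x] f g True by auto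
  next
    case False
    have "x \<notin> smul G V V"
    proof
      assume "x \<in> smul G V V"
      then obtain a b where ab: "a \<in> V" "b \<in> V" "gdom G a = gran G b" "x = gmul G a b" unfolding smul_def by blast
      then have "a = b" using V by (intro inj_onD[OF V'(2)]) (auto simp: units_def)
      then show False using ab V False by (auto simp: units_def)
    qed
    then show ?thesis using convolution_bisection(2)[OF V' _ V'(1), of f g x] f g False by auto
  qed
qed

lemma units_gstar:
  assumes V: "units V" and f: "\<And>x. x \<notin> V \<Longrightarrow> f x = 0"
  shows "gstar cnj f = (\<lambda>x. cnj (f x))"
proof
  fix x
  show "gstar cnj f x = cnj (f x)"
  proof (cases "x \<in> V")
    case False
    then have "ginv G x \<notin> V \<or> x \<notin> arrows G"
      using V by (metis inv_inv units_def)
    then show ?thesis using f False by (auto simp: gstar_def)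
  qed (use V in \<open>auto simp: gstar_def units_def\<close>)
qed

text \<open>A self-adjoint contraction \<open>a\<close> on a set of units is the average of the unitary
  \<open>a + \<i> sqrt (1 - a\<^sup>2)\<close> and its adjoint; this replaces the positivity of \<open>x* x\<close> in a C*-algebra.\<close>

lemma cstar_seminorm_le_sup:
  fixes p :: "('g \<Rightarrow> complex) \<Rightarrow> real" and \<F> :: "'g set \<Rightarrow> ('g \<Rightarrow> complex) set"
  assumes p: "cstar_seminorm (groupoid_alg cnj G B) p"
    and FB: "\<And>U h. \<lbrakk>cob G U; h \<in> \<F> U\<rbrakk> \<Longrightarrow> h \<in> fun_span B"
    and off: "\<And>U h x. \<lbrakk>h \<in> \<F> U; x \<notin> U\<rbrakk> \<Longrightarrow> h x = 0"
    and star: "\<And>U h. \<lbrakk>cob G U; h \<in> \<F> U\<rbrakk> \<Longrightarrow> convolution G (gstar cnj h) h \<in> \<F> (smul G (ginv G ` U) U)"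
    and comp: "\<And>U h \<phi>. \<lbrakk>cob G U; h \<in> \<F> U; continuous_on UNIV \<phi>\<rbrakk> \<Longrightarrow> (\<lambda>x. \<phi> (h x) * ind U x) \<in> \<F> U"
    and U: "cob G U" and f: "f \<in> \<F> U" and M: "\<And>x. cmod (f x) \<le> M"
  shows "p f \<le> M"
proof -
  let ?A = "groupoid_alg cnj G B"
  note pD = cstar_seminormD[OF p, unfolded groupoid_alg_simps]
  have contr: "p a \<le> 1" if V: "cob G V" "units V" and a: "a \<in> \<F> V" "\<And>x. a x \<in> \<real>" "\<And>x. cmod (a x) \<le> 1" for V a
  proof -
    define \<phi> where "\<phi> = (\<lambda>z. z + \<i> * complex_of_real (sqrt (1 - (Re z)\<^sup>2)))"
    define u where "u = (\<lambda>x. \<phi> (a x) * ind V x)"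
    define u' where "u' = (\<lambda>x. cnj (\<phi> (a x)) * ind V x)"
    have "continuous_on UNIV \<phi>" unfolding \<phi>_def by (intro continuous_intros)
    moreover from this have "continuous_on UNIV (\<lambda>z. cnj (\<phi> z))" by (intro continuous_intros)
    ultimately have uF: "u \<in> \<F> V" "u' \<in> \<F> V"
      unfolding u_def u'_def using comp[OF V(1) a(1)] by blast+
    have oneF: "ind V \<in> \<F> V" using comp[OF V(1) a(1), of "\<lambda>_. 1"] by simp
    have u0: "u x = 0" "u' x = 0" "ind V x = (0::complex)" if "x \<notin> V" for x
      using that by (auto simp: u_def u'_def ind_def)
    have st: "gstar cnj u = u'" "gstar cnj u' = u" "gstar cnj (ind V) = ind V"
      by (subst units_gstar[OF V(2)]; auto simp: u_def u'_def ind_def)+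
    have Re1: "(Re (a x))\<^sup>2 \<le> 1" for x
      using a(3)[of x] abs_Re_le_cmod[of "a x"] by (simp add: abs_square_le_1)
    have sq: "cnj (\<phi> (a x)) * \<phi> (a x) = 1" for x
    proof -
      have "\<phi> (a x) = Complex (Re (a x)) (sqrt (1 - (Re (a x))\<^sup>2))"
        using a(2)[of x] by (simp add: \<phi>_def complex_eq_iff complex_is_Real_iff)
      then have "\<phi> (a x) * cnj (\<phi> (a x)) = complex_of_real ((Re (a x))\<^sup>2 + (sqrt (1 - (Re (a x))\<^sup>2))\<^sup>2)"
        by (simp only: complex_mult_cnj complex.sel)
      then show ?thesis using Re1[of x] by (simp add: mult.commute)
    qed
    have cv: "convolution G u' u = ind V" "convolution G u u' = ind V" "convolution G (ind V) (ind V) = (ind V :: 'g \<Rightarrow> complex)"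
      using units_convolution[OF V(2) u0(2) u0(1)] units_convolution[OF V(2) u0(1) u0(2)]
        units_convolution[OF V(2) u0(3) u0(3)] sq sq[unfolded mult.commute[of "cnj _"]]
      by (auto simp: u_def u'_def ind_def fun_eq_iff)
    note in_B = FB[OF V(1) uF(1)] FB[OF V(1) uF(2)] FB[OF V(1) oneF]
    \<comment> \<open>The indicator is a projection, so the C*-identity leaves only the values
      \<open>0\<close> and \<open>1\<close> for its seminorm; this in turn bounds the unitaries
      \<open>u\<close> and \<open>u'\<close>.\<close>
    have "p (ind V) = (p (ind V))\<^sup>2" using pD(5)[OF in_B(3)] st cv by simp
    then have p1: "p (ind V) \<le> 1" by (auto simp: power2_eq_square)
    have "(p u)\<^sup>2 \<le> 1" "(p u')\<^sup>2 \<le> 1"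
      using pD(5)[OF in_B(1)] pD(5)[OF in_B(2)] st cv p1 by simp_all
    then have pu: "p u \<le> 1" "p u' \<le> 1" using abs_square_le_1[of "p u"] abs_square_le_1[of "p u'"] by auto
    have a_eq: "a = (\<lambda>x. (1/2) * u x + (1/2) * u' x)"
    proof
      fix x show "a x = (1/2) * u x + (1/2) * u' x"
      proof (cases "x \<in> V")
        case True
        have "\<phi> (a x) + cnj (\<phi> (a x)) = 2 * a x"
          using a(2)[of x] by (simp add: \<phi>_def complex_eq_iff complex_is_Real_iff)
        then have "a x = (\<phi> (a x) + cnj (\<phi> (a x))) / 2" by simp
        then show ?thesis using True by (simp add: u_def u'_def ind_def add_divide_distrib)
      qed (use off[OF a(1)] u0 in simp)
    qed
    have "p (\<lambda>x. (1/2) * u x + (1/2) * u' x) \<le> p (\<lambda>x. (1/2) * u x) + p (\<lambda>x. (1/2) * u' x)"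
      by (intro pD(2) fun_span_scale in_B)
    also have "\<dots> = (1/2) * p u + (1/2) * p u'"
      using pD(3)[OF in_B(1), of "1/2"] pD(3)[OF in_B(2), of "1/2"] by simp
    also have "\<dots> \<le> 1" using pu by simp
    finally show ?thesis unfolding a_eq[symmetric] .
  qed
  \<comment> \<open>The function \<open>?h\<close>, the star of \<open>f\<close> times
    \<open>f\<close>, lives on units and has real values of modulus at most
    \<open>N\<^sup>2\<close>; divided by \<open>N\<^sup>2\<close> it is a contraction as in
    \<open>contr\<close>, and the C*-identity returns to \<open>f\<close>. The division requires
    \<open>N > 0\<close>, so \<open>M\<close> itself is reached through
    \<open>M + e\<close>.\<close>
  have pos: "p f \<le> N" if N: "N > 0" "\<And>x. cmod (f x) \<le> N" for N
  proof -
    let ?V = "smul G (ginv G ` U) U"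
    let ?h = "convolution G (gstar cnj f) f"
    have V: "cob G ?V" "units ?V"
      using cob_smul[OF cob_inv[OF U] U] units_inv_smul[OF cobD(5,3,4)[OF U]] by auto
    have hF: "?h \<in> \<F> ?V" using star[OF U f] .
    have val: "?h x \<in> \<real> \<and> cmod (?h x) \<le> N\<^sup>2" for x
    proof (cases "x \<in> ?V")
      case True
      then obtain b where b: "b \<in> U" "x = gmul G (ginv G b) b" using units_inv_smul(2)[OF cobD(5,3,4)[OF U]] by blast
      have bA: "b \<in> arrows G" using b(1) cobD(5)[OF U] by blast
      have "?h x = gstar cnj f (ginv G b) * f b"
        unfolding b(2)
      proof (rule convolution_bisection(1)[where U = "ginv G ` U" and V = U])
        show "gstar cnj f a = 0" if "a \<notin> ginv G ` U" for a
        proof (cases "a \<in> arrows G")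
          case True
          then have "ginv G a \<notin> U" using that by (metis image_eqI inv_inv)
          then show ?thesis using off[OF f] by (simp add: gstar_def)
        qed (simp add: gstar_def)
      qed (use cobD[OF cob_inv[OF U]] cobD[OF U] off[OF f] b(1) bA in auto)
      also have "\<dots> = complex_of_real ((cmod (f b))\<^sup>2)"
        using bA complex_norm_square[of "f b"] by (simp add: gstar_def mult.commute)
      finally show ?thesis using N(2)[of b] by (simp add: norm_power power_mono)
    qed (use off[OF hF] in auto)
    define \<psi> where "\<psi> = (\<lambda>z::complex. complex_of_real (1 / N\<^sup>2) * z)"
    define a where "a = (\<lambda>x. \<psi> (?h x) * ind ?V x)"
    have aF: "a \<in> \<F> ?V" unfolding a_def
      by (rule comp[OF V(1) hF], unfold \<psi>_def, intro continuous_intros)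
    have "p a \<le> 1"
    proof (rule contr[OF V aF])
      show "a x \<in> \<real>" for x using val[of x] by (auto simp: a_def \<psi>_def ind_def)
      show "cmod (a x) \<le> 1" for x
        using val[of x] N(1) N(1)[THEN less_imp_neq, symmetric]
        by (simp add: a_def \<psi>_def ind_def norm_mult norm_divide norm_power)
    qed
    moreover have "?h = (\<lambda>x. complex_of_real (N\<^sup>2) * a x)"
      using N(1)[THEN less_imp_neq, symmetric] off[OF hF] by (auto simp: a_def \<psi>_def ind_def fun_eq_iff)
    ultimately have "p ?h \<le> N\<^sup>2"
      using pD(3)[OF FB[OF V(1) aF], of "complex_of_real (N\<^sup>2)"] N(1) by (simp add: norm_power mult_le_cancel_left1)
    then have "(p f)\<^sup>2 \<le> N\<^sup>2" using pD(5)[OF FB[OF U f]] by simp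
    then show ?thesis using N(1) by (simp add: power2_le_iff_abs_le)
  qed
  have "0 \<le> M" using M norm_ge_zero order_trans by blast
  show ?thesis
  proof (rule field_le_epsilon)
    fix e :: real assume "e > 0"
    then show "p f \<le> M + e" using pos[of "M + e"] M \<open>0 \<le> M\<close> by (smt (verit))
  qed
qed

end

context ample_groupoid
begin

subsection \<open>Extending C*-seminorms from the Steinberg algebra\<close>

abbreviation SA :: "(complex, 'g \<Rightarrow> complex) star_alg" where
  "SA \<equiv> groupoid_alg cnj G SB"

abbreviation CA :: "(complex, 'g \<Rightarrow> complex) star_alg" where
  "CA \<equiv> groupoid_alg cnj G (Cc_bisections G)"

lemma seminorm_LC_le:
  assumes p: "cstar_seminorm SA p" and U: "cob G U" and f: "f \<in> LC U" and M: "\<And>x. cmod (f x) \<le> M"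
  shows "p f \<le> M"
proof (rule cstar_seminorm_le_sup[where \<F> = LC, OF p _ _ _ _ U f M])
  show "convolution G (gstar cnj h) h \<in> LC (smul G (ginv G ` U) U)" if "h \<in> LC U" for U h
    using LC_convolution[OF LC_gstar[OF scalar_inv_cnj that] that] .
qed (auto intro: LC_SB LC_off LC_compose)

lemma SA_zero: assumes "cstar_seminorm SA p" shows "p (\<lambda>_. 0) = 0"
  using cstar_seminormD(3)[OF assms, unfolded groupoid_alg_simps, OF fun_span.zero, of 0] by simp

text \<open>The constant depends only on the number of bisections needed, which makes up for the
  functions of the algebra not being continuous when the groupoid is not Hausdorff. In the inductive
  step, the points of the last bisection where \<open>f n\<close> exceeds \<open>\<delta>\<close> lie in the other ones.\<close>

lemma seminorm_le_sum:
  fixes f :: "nat \<Rightarrow> 'g \<Rightarrow> complex"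
  assumes p: "cstar_seminorm SA p"
    and "\<And>i. i < n \<Longrightarrow> cob G (U i) \<and> f i \<in> LC (U i)" and "\<And>x. cmod (\<Sum>i<n. f i x) \<le> \<delta>"
  shows "p (\<lambda>x. \<Sum>i<n. f i x) \<le> (2 ^ n - 1) * \<delta>"
  using assms(2,3)
proof (induction n arbitrary: f \<delta>)
  case 0
  then show ?case using SA_zero[OF p] by simp
next
  case (Suc n)
  note pD = cstar_seminormD[OF p, unfolded groupoid_alg_simps]
  have \<delta>: "\<delta> \<ge> 0" using Suc.prems(2) norm_ge_zero order_trans by blast
  have Un: "cob G (U n)" "f n \<in> LC (U n)" and Ui: "\<And>i. i < n \<Longrightarrow> cob G (U i) \<and> f i \<in> LC (U i)"
    using Suc.prems(1) by auto
  define W where "W = {x \<in> U n. cmod (f n x) > \<delta>}"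
  have W: "cob G W" "W \<subseteq> U n" using LC_level[OF Un(2,1), of "\<lambda>z. cmod z > \<delta>"] by (auto simp: W_def)
  have cov: "W \<subseteq> (\<Union>i<n. U i)"
  proof
    fix x assume x: "x \<in> W"
    show "x \<in> (\<Union>i<n. U i)"
    proof (rule ccontr)
      assume "x \<notin> (\<Union>i<n. U i)"
      then have "f i x = 0" if "i < n" for i using LC_off Ui[OF that] that by blast
      then have "(\<Sum>i<Suc n. f i x) = f n x" by simp
      then show False using Suc.prems(2)[of x] x by (simp add: W_def)
    qed
  qed
  obtain P where P: "\<And>i. i < n \<Longrightarrow> cob G (P i) \<and> P i \<subseteq> W \<inter> U i" "W = (\<Union>i<n. P i)"
      "\<And>i j. \<lbrakk>i < n; j < n; i \<noteq> j\<rbrakk> \<Longrightarrow> P i \<inter> P j = {}"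
    using cob_partition[OF W(1), of n U] cov Ui cobD(1) by blast
  \<comment> \<open>The part of \<open>f n\<close> where it is large is distributed over the other
    bisections along the disjoint pieces \<open>P i\<close>; the remainder \<open>r\<close> is
    bounded by \<open>\<delta>\<close>.\<close>
  define g where "g i = (\<lambda>x. f i x + f n x * ind (P i) x)" for i
  define r where "r = (\<lambda>x. f n x + (- 1) * (f n x * ind W x))"
  have fW: "(\<lambda>x. f n x * ind W x) \<in> LC (U n)"
    by (rule LC_mono[OF W(2) LC_mult_ind[OF Un(2,1) W]])
  have r: "r \<in> LC (U n)" unfolding r_def by (rule LC_add[OF Un(2) LC_scale[OF fW]])
  have rb: "cmod (r x) \<le> \<delta>" for x
    using \<delta> LC_off[OF Un(2), of x] by (cases "x \<in> U n") (auto simp: r_def ind_def W_def)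
  have gL: "g i \<in> LC (U i)" if "i < n" for i
  proof -
    have Pi: "P i \<subseteq> U n" "P i \<subseteq> U i" "cob G (P i)" using P(1)[OF that] W(2) by auto
    have "f i \<in> LC (U i)" using Ui[OF that] by blast
    from LC_add[OF this LC_mono[OF Pi(2) LC_mult_ind[OF Un(2,1) Pi(3,1)]]]
    show ?thesis unfolding g_def .
  qed
  have indW: "ind W x = (\<Sum>i<n. ind (P i) x :: complex)" for x
  proof (cases "x \<in> W")
    case True
    then obtain i where i: "i < n" "x \<in> P i" using P(2) by blast
    have "(\<Sum>j<n. ind (P j) x :: complex) = (\<Sum>j\<in>{i}. ind (P j) x)"
      using i P(3) by (intro sum.mono_neutral_right) (auto simp: ind_def)
    then show ?thesis using i True by (simp add: ind_def)
  next
    case False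
    then have "x \<notin> P i" if "i < n" for i using P(1)[OF that] by blast
    then show ?thesis using False by (simp add: ind_def)
  qed
  have split: "(\<Sum>i<Suc n. f i x) = (\<Sum>i<n. g i x) + r x" for x
    by (simp add: g_def r_def sum.distrib indW sum_distrib_left sum_negf)
  \<comment> \<open>The new sum is the old one minus \<open>r\<close>, hence bounded by
    \<open>2 * \<delta>\<close>. Induction contributes \<open>(2 ^ n - 1) * (2 * \<delta>)\<close>
    and \<open>r\<close> another \<open>\<delta>\<close>, which adds up to
    \<open>(2 ^ Suc n - 1) * \<delta>\<close>.\<close>
  have gb: "cmod (\<Sum>i<n. g i x) \<le> 2 * \<delta>" for x
    using norm_triangle_ineq4[of "\<Sum>i<Suc n. f i x" "r x"] split[of x] Suc.prems(2)[of x] rb[of x] by simp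
  have "p (\<lambda>x. \<Sum>i<n. g i x) \<le> (2 ^ n - 1) * (2 * \<delta>)"
    using Ui gL gb by (intro Suc.IH) auto
  moreover have "p r \<le> 1 * \<delta>" using seminorm_LC_le[OF p Un(1) r rb] by simp
  moreover have "p (\<lambda>x. (\<Sum>i<n. g i x) + r x) \<le> p (\<lambda>x. \<Sum>i<n. g i x) + p r"
    by (intro pD(2) fun_span_sum LC_SB[OF r]) (auto intro: LC_SB gL)
  ultimately have "p (\<lambda>x. \<Sum>i<Suc n. f i x) \<le> (2 ^ n - 1) * (2 * \<delta>) + 1 * \<delta>" unfolding split by linarith
  then show ?case by (simp add: algebra_simps)
qed

text \<open>The number of bisections needed is the measure of complexity: it determines the constant
  \<open>2 ^ n\<close> by which the supremum norm dominates every C*-seminorm in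
  \<open>seminorm_tame_le\<close>.\<close>

definition tame :: "nat \<Rightarrow> ('g \<Rightarrow> complex) \<Rightarrow> bool" where
  "tame n h \<longleftrightarrow> (\<exists>f U. (\<forall>i<n. cob G (U i) \<and> f i \<in> LC (U i)) \<and> h = (\<lambda>x. \<Sum>i<n. f i x))"

lemma tameI: "\<lbrakk>\<And>i. i < n \<Longrightarrow> cob G (U i) \<and> f i \<in> LC (U i)\<rbrakk> \<Longrightarrow> tame n (\<lambda>x. \<Sum>i<n. f i x)"
  unfolding tame_def by blast

lemma tame_SB:
  assumes "tame n h" shows "h \<in> fun_span SB"
proof -
  obtain f U where f: "\<forall>i<n. cob G (U i) \<and> f i \<in> LC (U i)" "h = (\<lambda>x. \<Sum>i<n. f i x)"
    using assms unfolding tame_def by blast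
  show ?thesis unfolding f(2)
    by (rule fun_span_sum) (use f(1) in \<open>auto dest: LC_SB\<close>)
qed

lemma tame_fsupp: "tame n h \<Longrightarrow> fsupp h"
  using fsupp_span[OF tame_SB SB_fsupp] .

lemma tame_ranfib: "tame n h \<Longrightarrow> card (ranfib h c) \<le> n"
  unfolding tame_def
proof clarify
  fix f :: "nat \<Rightarrow> 'g \<Rightarrow> complex" and U assume *: "\<forall>i<n. cob G (U i) \<and> f i \<in> LC (U i)"
  show "card (ranfib (\<lambda>x. \<Sum>i<n. f i x) c) \<le> n"
  proof (rule card_ranfib_sum)
    fix i assume "i < n"
    then have i: "cob G (U i)" "f i \<in> LC (U i)" using * by auto
    show "fsupp (f i) \<and> card (ranfib (f i) c) \<le> 1"
      using LC_fsupp[OF i(2,1)] card_ranfib_bisection[OF cobD(4)[OF i(1)], of "f i"] LC_off[OF i(2)] by blast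
  qed
qed

lemma tame_LC: "\<lbrakk>cob G U; f \<in> LC U\<rbrakk> \<Longrightarrow> tame 1 f"
  using tameI[of 1 "\<lambda>_. U" "\<lambda>_. f"] by simp

lemma tame_zero: "tame n (\<lambda>_. 0)"
  using tameI[of n "\<lambda>_. {}" "\<lambda>_ _. 0"] by (simp add: LC_zero)

lemma tame_add:
  assumes "tame n h" "tame m k" shows "tame (n + m) (\<lambda>x. h x + k x)"
proof -
  obtain f U where f: "\<forall>i<n. cob G (U i) \<and> f i \<in> LC (U i)" "h = (\<lambda>x. \<Sum>i<n. f i x)"
    using assms(1) unfolding tame_def by blast
  obtain g V where g: "\<forall>i<m. cob G (V i) \<and> g i \<in> LC (V i)" "k = (\<lambda>x. \<Sum>i<m. g i x)"
    using assms(2) unfolding tame_def by blast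
  let ?W = "\<lambda>i. if i < n then U i else V (i - n)" and ?F = "\<lambda>i. if i < n then f i else g (i - n)"
  have "tame (n + m) (\<lambda>x. \<Sum>i<n+m. ?F i x)"
    by (rule tameI[of _ ?W]) (use f(1) g(1) in auto)
  also have "(\<lambda>x. \<Sum>i<n+m. ?F i x) = (\<lambda>x. h x + k x)"
  proof
    fix x
    have "(\<Sum>i<n+m. ?F i x) = (\<Sum>i<n. ?F i x) + (\<Sum>i<m. ?F (n + i) x)"
      by (induction m) (auto simp: add.assoc)
    then show "(\<Sum>i<n+m. ?F i x) = h x + k x" by (simp add: f(2) g(2))
  qed
  finally show ?thesis .
qed

lemma tame_scale:
  assumes "tame n h" shows "tame n (\<lambda>x. c * h x)"
proof -
  obtain f U where f: "\<forall>i<n. cob G (U i) \<and> f i \<in> LC (U i)" "h = (\<lambda>x. \<Sum>i<n. f i x)"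
    using assms(1) unfolding tame_def by blast
  have "tame n (\<lambda>x. \<Sum>i<n. c * f i x)"
    using f(1) by (intro tameI[of _ U]) (auto intro: LC_scale)
  then show ?thesis by (simp add: f(2) sum_distrib_left)
qed

lemma tame_diff: "\<lbrakk>tame n h; tame m k\<rbrakk> \<Longrightarrow> tame (n + m) (\<lambda>x. h x + (- 1) * k x)"
  by (intro tame_add tame_scale)

lemma tame_gstar:
  assumes "tame n h" shows "tame n (gstar cnj h)"
proof -
  obtain f U where f: "\<forall>i<n. cob G (U i) \<and> f i \<in> LC (U i)" "h = (\<lambda>x. \<Sum>i<n. f i x)"
    using assms(1) unfolding tame_def by blast
  have "tame n (\<lambda>x. \<Sum>i<n. gstar cnj (f i) x)"
    using f(1) by (intro tameI[of _ "\<lambda>i. ginv G ` U i"]) (auto intro: LC_gstar[OF scalar_inv_cnj] cob_inv)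
  also have "(\<lambda>x. \<Sum>i<n. gstar cnj (f i) x) = gstar cnj h"
    by (auto simp: f(2) gstar_def fun_eq_iff)
  finally show ?thesis .
qed

lemma tame_Suc: "\<lbrakk>tame n h; cob G U; f \<in> LC U\<rbrakk> \<Longrightarrow> tame (Suc n) (\<lambda>x. h x + f x)"
  using tame_add[OF _ tame_LC] by simp

lemma tame_SucE:
  assumes "tame (Suc n) h"
  obtains h' U f where "tame n h'" "cob G U" "f \<in> LC U" "h = (\<lambda>x. h' x + f x)"
proof -
  obtain f U where f: "\<forall>i<Suc n. cob G (U i) \<and> f i \<in> LC (U i)" "h = (\<lambda>x. \<Sum>i<Suc n. f i x)"
    using assms unfolding tame_def by blast
  have "tame n (\<lambda>x. \<Sum>i<n. f i x)" using f(1) by (intro tameI[of _ U]) auto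
  then show ?thesis using that[of "\<lambda>x. \<Sum>i<n. f i x" "U n" "f n"] f by simp
qed

lemma tame_convolution:
  assumes "tame n h" "tame m k" shows "tame (n * m) (convolution G h k)"
proof -
  have 1: "tame m (convolution G f k)" if f: "cob G U" "f \<in> LC U" and k: "tame m k" for U f m k
    using k
  proof (induction m arbitrary: k)
    case 0
    then have "k = (\<lambda>_. 0)" by (simp add: tame_def)
    then show ?case by (simp add: tame_zero)
  next
    case (Suc m)
    obtain k' V g where k: "tame m k'" "cob G V" "g \<in> LC V" "k = (\<lambda>x. k' x + g x)"
      using tame_SucE[OF Suc.prems] .
    have "convolution G f k = (\<lambda>x. convolution G f k' x + convolution G f g x)"
      unfolding k(4) by (rule convolution_add_right[OF LC_fsupp[OF f(2,1)] tame_fsupp[OF k(1)] LC_fsupp[OF k(3,2)]])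
    then show ?case
      using tame_Suc[OF Suc.IH[OF k(1)] cob_smul[OF f(1) k(2)] LC_convolution[OF f(2) k(3)]] by simp
  qed
  show ?thesis
    using assms(1)
  proof (induction n arbitrary: h)
    case 0
    then have "h = (\<lambda>_. 0)" by (simp add: tame_def)
    then show ?case by (simp add: tame_zero)
  next
    case (Suc n)
    obtain h' V g where h: "tame n h'" "cob G V" "g \<in> LC V" "h = (\<lambda>x. h' x + g x)"
      using tame_SucE[OF Suc.prems] .
    have "convolution G h k = (\<lambda>x. convolution G h' k x + convolution G g k x)"
      unfolding h(4) by (rule convolution_add_left[OF tame_fsupp[OF h(1)] LC_fsupp[OF h(3,2)] tame_fsupp[OF assms(2)]])
    then show ?case
      using tame_add[OF Suc.IH[OF h(1)] 1[OF h(2,3) assms(2)]] by (simp add: add.commute)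
  qed
qed

lemma SB_tame: "h \<in> fun_span SB \<Longrightarrow> \<exists>n. tame n h"
proof (induction rule: fun_span.induct)
  case (step f b c)
  then obtain n U where n: "tame n f" "b = ind U" "cob G U" by blast
  have "(\<lambda>x. c * b x) \<in> LC U" using n by (auto intro: LC_scale LC_ind)
  from tame_Suc[OF n(1,3) this] show ?case by blast
qed (blast intro: tame_zero)

lemma seminorm_tame_le:
  assumes p: "cstar_seminorm SA p" and h: "tame n h" and "\<And>x. cmod (h x) \<le> \<delta>"
  shows "p h \<le> 2 ^ n * \<delta>"
proof -
  obtain f U where f: "\<forall>i<n. cob G (U i) \<and> f i \<in> LC (U i)" "h = (\<lambda>x. \<Sum>i<n. f i x)"
    using h unfolding tame_def by blast
  have "\<delta> \<ge> 0" using assms(3) norm_ge_zero order_trans by blast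
  moreover have "p h \<le> (2 ^ n - 1) * \<delta>"
    unfolding f(2) by (rule seminorm_le_sum[OF p, of _ U]) (use f assms(3) in auto)
  ultimately show ?thesis by (simp add: algebra_simps)
qed

text \<open>Uniform convergence with a bound on the number of bisections that is the same along the
  whole sequence. Uniform convergence without such a bound would give no control over C*-seminorms,
  as the constant \<open>2 ^ n\<close> could grow.\<close>

definition tends :: "(nat \<Rightarrow> 'g \<Rightarrow> complex) \<Rightarrow> ('g \<Rightarrow> complex) \<Rightarrow> bool" where
  "tends h f \<longleftrightarrow> (\<exists>n e. (\<forall>k. tame n (h k)) \<and> e \<longlonglongrightarrow> 0 \<and> (\<forall>k x. cmod (f x - h k x) \<le> e k))"

lemma tendsE:
  assumes "tends h f"
  obtains n e where "\<And>k. tame n (h k)" "e \<longlonglongrightarrow> 0" "\<And>k x. cmod (f x - h k x) \<le> e k"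
  using assms unfolding tends_def by blast

lemma tendsI:
  assumes "\<And>k. tame n (h k)" "e \<longlonglongrightarrow> 0" "\<And>k x. cmod (f x - h k x) \<le> e k"
  shows "tends h f"
  using assms unfolding tends_def by blast

lemma tends_const:
  assumes "h \<in> fun_span SB" shows "tends (\<lambda>_. h) h"
proof -
  obtain n where "tame n h" using SB_tame[OF assms] by blast
  then show ?thesis by (intro tendsI[where n = n and e = "\<lambda>_. 0"]) auto
qed

lemma tends_add:
  assumes "tends h f" "tends k g" shows "tends (\<lambda>i x. h i x + k i x) (\<lambda>x. f x + g x)"
proof -
  obtain n e where 1: "\<And>k. tame n (h k)" "e \<longlonglongrightarrow> 0" "\<And>k x. cmod (f x - h k x) \<le> e k"
    using tendsE[OF assms(1)] by blast
  obtain m d where 2: "\<And>i. tame m (k i)" "d \<longlonglongrightarrow> 0" "\<And>i x. cmod (g x - k i x) \<le> d i"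
    using tendsE[OF assms(2)] by blast
  show ?thesis
  proof (rule tendsI)
    show "tame (n + m) (\<lambda>x. h i x + k i x)" for i using tame_add[OF 1(1) 2(1)] .
    show "(\<lambda>i. e i + d i) \<longlonglongrightarrow> 0" using tendsto_add[OF 1(2) 2(2)] by simp
    show "cmod (f x + g x - (h i x + k i x)) \<le> e i + d i" for i x
      using norm_triangle_ineq[of "f x - h i x" "g x - k i x"] 1(3)[of x i] 2(3)[of x i]
      by (simp add: algebra_simps)
  qed
qed

lemma tends_scale:
  assumes "tends h f" shows "tends (\<lambda>i x. c * h i x) (\<lambda>x. c * f x)"
proof -
  obtain n e where 1: "\<And>k. tame n (h k)" "e \<longlonglongrightarrow> 0" "\<And>k x. cmod (f x - h k x) \<le> e k"
    using tendsE[OF assms(1)] by blast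
  show ?thesis
  proof (rule tendsI)
    show "tame n (\<lambda>x. c * h i x)" for i using tame_scale[OF 1(1)] .
    show "(\<lambda>i. cmod c * e i) \<longlonglongrightarrow> 0" using tendsto_mult_right_zero[OF 1(2)] .
    show "cmod (c * f x - c * h i x) \<le> cmod c * e i" for i x
      using 1(3)[of x i] by (simp add: right_diff_distrib[symmetric] norm_mult mult_left_mono)
  qed
qed

lemma tends_gstar:
  assumes "tends h f" shows "tends (\<lambda>i. gstar cnj (h i)) (gstar cnj f)"
proof -
  obtain n e where 1: "\<And>k. tame n (h k)" "e \<longlonglongrightarrow> 0" "\<And>k x. cmod (f x - h k x) \<le> e k"
    using tendsE[OF assms(1)] by blast
  show ?thesis
  proof (rule tendsI)
    show "tame n (gstar cnj (h i))" for i using tame_gstar[OF 1(1)] .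
    show "cmod (gstar cnj f x - gstar cnj (h i) x) \<le> e i" for i x
    proof (cases "x \<in> arrows G")
      case True
      then have "gstar cnj f x - gstar cnj (h i) x = cnj (f (ginv G x) - h i (ginv G x))" by (simp add: gstar_def)
      then show ?thesis using 1(3)[of "ginv G x" i] by (simp only: complex_mod_cnj)
    next
      case False
      have "0 \<le> e i" using order_trans[OF norm_ge_zero 1(3)] .
      then show ?thesis using False by (simp add: gstar_def)
    qed
  qed (rule 1)
qed

lemma tends_bounded:
  assumes "tends h f" shows "\<exists>M\<ge>0. \<forall>x. cmod (f x) \<le> M"
proof -
  obtain n e where 1: "\<And>k. tame n (h k)" "e \<longlonglongrightarrow> 0" "\<And>k x. cmod (f x - h k x) \<le> e k"
    using tendsE[OF assms(1)] by blast
  have "\<exists>M\<ge>0. \<forall>x. cmod (h 0 x) \<le> M" using tame_SB[OF 1(1)]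
  proof (induction rule: fun_span.induct)
    case (step f b c)
    then obtain M where M: "M \<ge> 0" "\<forall>x. cmod (f x) \<le> M" by blast
    obtain U where "b = ind U" using step.hyps(2) by blast
    then have "cmod (f x + c * b x) \<le> M + cmod c" for x
      using norm_triangle_ineq[of "f x" "c * b x"] M(2)[THEN spec, of x] norm_ge_zero[of c]
      by (auto simp: ind_def norm_mult simp del: norm_ge_zero)
    then show ?case using M(1) by (intro exI[of _ "M + cmod c"]) auto
  qed auto
  then obtain M where M: "M \<ge> 0" "\<And>x. cmod (h 0 x) \<le> M" by blast
  have "cmod (f x) \<le> M + \<bar>e 0\<bar>" for x
    using norm_triangle_ineq[of "f x - h 0 x" "h 0 x"] M(2)[of x] 1(3)[of x 0] by simp
  then show ?thesis using M(1) by (intro exI[of _ "M + \<bar>e 0\<bar>"]) auto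
qed

text \<open>The difference is split into \<open>f\<close> times an error of \<open>g\<close> and an
  error of \<open>f\<close> times the approximant of \<open>g\<close>. The limit \<open>f\<close> is
  not tame, so the size of its fibres is bounded separately by \<open>n'\<close>, and that of
  \<open>f - h i\<close> by \<open>n' + n\<close>.\<close>

lemma tends_convolution:
  assumes f: "tends h f" "fsupp f" "\<And>c. card (ranfib f c) \<le> n'" and g: "tends k g" "fsupp g"
  shows "tends (\<lambda>i. convolution G (h i) (k i)) (convolution G f g)"
proof -
  obtain n e where 1: "\<And>k. tame n (h k)" "e \<longlonglongrightarrow> 0" "\<And>k x. cmod (f x - h k x) \<le> e k"
    using tendsE[OF f(1)] by blast
  obtain m d where 2: "\<And>i. tame m (k i)" "d \<longlonglongrightarrow> 0" "\<And>i x. cmod (g x - k i x) \<le> d i"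
    using tendsE[OF g(1)] by blast
  obtain M where M: "M \<ge> 0" "\<And>x. cmod (f x) \<le> M" using tends_bounded[OF f(1)] by blast
  obtain N where N: "N \<ge> 0" "\<And>x. cmod (g x) \<le> N" using tends_bounded[OF g(1)] by blast
  show ?thesis
  proof (rule tendsI)
    show "tame (n * m) (convolution G (h i) (k i))" for i using tame_convolution[OF 1(1) 2(1)] .
    have "(\<lambda>i. real n' * M * d i + real (n' + n) * e i * (N + d i)) \<longlonglongrightarrow> real n' * M * 0 + real (n' + n) * 0 * (N + 0)"
      by (intro tendsto_intros 1 2)
    then show "(\<lambda>i. real n' * M * d i + real (n' + n) * e i * (N + d i)) \<longlonglongrightarrow> 0" by simp
    show "cmod (convolution G f g x - convolution G (h i) (k i) x) \<le>
        real n' * M * d i + real (n' + n) * e i * (N + d i)" for i x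
    proof -
      let ?df = "\<lambda>x. f x + (- 1) * h i x" and ?dg = "\<lambda>x. g x + (- 1) * k i x"
      have fs: "fsupp f" "fsupp g" "fsupp (h i)" "fsupp (k i)" using f g 1 2 tame_fsupp by blast+
      have fsd: "fsupp ?df" "fsupp ?dg" by (rule fsupp_add fsupp_scale fs)+
      have c: "card (ranfib ?df y) \<le> n' + n" for y
      proof -
        have "ranfib ?df y \<subseteq> ranfib f y \<union> ranfib (h i) y" by auto
        then have "card (ranfib ?df y) \<le> card (ranfib f y \<union> ranfib (h i) y)"
          using fs by (intro card_mono) (auto simp: fsupp_def)
        also have "\<dots> \<le> n' + n"
          using card_Un_le[of "ranfib f y" "ranfib (h i) y"] f(3)[of y] tame_ranfib[OF 1(1), of y i] by linarith
        finally show ?thesis .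
      qed
      have kb: "cmod (k i y) \<le> N + d i" for y
        using norm_triangle_ineq[of "g y" "k i y - g y"] N(2)[of y] 2(3)[of y i] by (simp add: norm_minus_commute)
      have 3: "convolution G f ?dg = (\<lambda>x. convolution G f g x + (- 1) * convolution G f (k i) x)"
        using fs by (simp only: convolution_add_right convolution_scale_right fsupp_scale)
      have 4: "convolution G ?df (k i) = (\<lambda>x. convolution G f (k i) x + (- 1) * convolution G (h i) (k i) x)"
        using fs by (simp only: convolution_add_left convolution_scale_left fsupp_scale)
      have "convolution G f g x - convolution G (h i) (k i) x = convolution G f ?dg x + convolution G ?df (k i) x"
        unfolding 3 4 by simp
      also have "cmod \<dots> \<le> real n' * M * d i + real (n' + n) * e i * (N + d i)"
        by (intro norm_triangle_mono convolution_bound fs fsd c f(3) kb M(2)) (use 1(3) 2(3) in simp_all)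
      finally show ?thesis .
    qed
  qed
qed

text \<open>The compact set \<open>K\<close> outside which \<open>f\<close> vanishes is enlarged to
  a compact open subset of the same bisection, namely a finite union of basis sets. There continuity
  is described by \<open>UC\<close>.\<close>

lemma CcE:
  assumes "f \<in> Cc_bisections G"
  obtains U where "cob G U" "f \<in> UC U"
proof -
  obtain U K where U: "open_bisection G U" "continuous_map (subtopology (gtop G) U) euclidean f"
     "compactin (gtop G) K" "K \<subseteq> U" "\<forall>\<gamma>. \<gamma> \<notin> K \<longrightarrow> f \<gamma> = 0"
    using assms unfolding Cc_bisections_def by blast
  have oU: "openin (gtop G) U" using U(1) by (simp add: open_bisection_def)
  have "\<exists>F. finite F \<and> F \<subseteq> \<B> \<and> \<Union>F \<subseteq> U \<and> K \<subseteq> \<Union>F"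
    by (rule compact_cover[OF U(3) oU U(4) basis cobD(1)[OF basis_cob]])
  then obtain F where F: "finite F" "F \<subseteq> \<B>" "\<Union>F \<subseteq> U" "K \<subseteq> \<Union>F" by (elim exE conjE)
  have F': "cob G A" if "A \<in> F" for A using subsetD[OF F(2) that] by (rule basis_cob)
  have "openin (gtop G) (\<Union>F)" "compactin (gtop G) (\<Union>F)"
    using F(1) F' cobD(1,2) by (auto intro!: compactin_Union)
  then have c: "cob G (\<Union>F)"
    using U(1) inj_on_subset[OF _ F(3), of "gdom G"] inj_on_subset[OF _ F(3), of "gran G"] by (simp add: cob_def open_bisection_def)
  have "f \<in> UC (\<Union>F)"
    using continuous_map_from_subtopology_mono[OF U(2) F(3)] U(5) subsetD[OF F(4)]
    by (subst UC_iff_continuous[OF c]) metis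
  then show ?thesis using that c by metis
qed

lemma UC_Cc: "\<lbrakk>cob G U; f \<in> UC U\<rbrakk> \<Longrightarrow> f \<in> Cc_bisections G"
  using UC_iff_continuous[of U f] unfolding Cc_bisections_def cob_def by blast

lemma SB_Cc: "f \<in> fun_span SB \<Longrightarrow> f \<in> fun_span (Cc_bisections G)"
  by (erule fun_span_bind) (auto intro!: fun_span_base UC_Cc LC_UC LC_ind)

lemma Cc_fsupp: "Cc_bisections G \<subseteq> Collect fsupp"
  using CcE UC_fsupp by blast

lemma star_algebra_CA: "star_algebra cnj CA"
proof (rule star_algebra_groupoid_alg[OF scalar_inv_cnj Cc_fsupp])
  fix f g assume "f \<in> Cc_bisections G" "g \<in> Cc_bisections G"
  then obtain U V where "cob G U" "f \<in> UC U" "cob G V" "g \<in> UC V" by (meson CcE)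
  then show "convolution G f g \<in> fun_span (Cc_bisections G)"
    by (intro fun_span_base UC_Cc[OF cob_smul UC_convolution])
next
  fix f assume "f \<in> Cc_bisections G"
  then obtain U where "cob G U" "f \<in> UC U" by (meson CcE)
  then show "gstar cnj f \<in> fun_span (Cc_bisections G)"
    by (intro fun_span_base UC_Cc[OF cob_inv UC_gstar])
qed

lemma UC_tends:
  assumes "cob G U" "f \<in> UC U" shows "\<exists>h. tends h f"
proof -
  have "\<forall>k::nat. \<exists>g\<in>LC U. \<forall>x. cmod (f x - g x) \<le> 1 / Suc k"
    using assms(2) unfolding UC_def by simp
  then obtain h where h: "\<And>k. h k \<in> LC U" "\<And>k x. cmod (f x - h k x) \<le> 1 / Suc k" by metis
  have "tends h f"
    by (rule tendsI[OF tame_LC[OF assms(1) h(1)] _ h(2)]) (rule LIMSEQ_Suc[OF lim_1_over_n])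
  then show ?thesis by blast
qed

lemma Cc_tends:
  assumes "f \<in> fun_span (Cc_bisections G)"
  shows "\<exists>h. tends h f"
  using assms
proof (induction rule: fun_span.induct)
  case (step f b c)
  then obtain h k where "tends h f" "tends k b" by (meson CcE UC_tends)
  from tends_add[OF this(1) tends_scale[OF this(2), of c]] show ?case by blast
qed (blast intro: tends_const fun_span.zero)

lemma Cc_ranfib:
  assumes "f \<in> fun_span (Cc_bisections G)"
  shows "\<exists>n. \<forall>c. card (ranfib f c) \<le> n"
  using assms
proof (induction rule: fun_span.induct)
  case (step f b d)
  then obtain n where n: "\<And>c. card (ranfib f c) \<le> n" by blast
  obtain U where U: "cob G U" "b \<in> UC U" using step.hyps(2) by (meson CcE)
  have b: "card (ranfib b c) \<le> 1" for c
    using card_ranfib_bisection[OF cobD(4)[OF U(1)] UC_off[OF U(2)]] .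
  have fs: "fsupp f" "fsupp b" using fsupp_span[OF step.hyps(1) Cc_fsupp] step.hyps(2) Cc_fsupp by blast+
  have "card (ranfib (\<lambda>x. f x + d * b x) c) \<le> n + 1" for c
  proof -
    have "ranfib (\<lambda>x. f x + d * b x) c \<subseteq> ranfib f c \<union> ranfib b c" by auto
    then have "card (ranfib (\<lambda>x. f x + d * b x) c) \<le> card (ranfib f c \<union> ranfib b c)"
      using fs by (intro card_mono) (auto simp: fsupp_def)
    also have "\<dots> \<le> n + 1"
      using card_Un_le[of "ranfib f c" "ranfib b c"] n[of c] b[of c] by linarith
    finally show ?thesis .
  qed
  then show ?case by blast
qed simp

text \<open>Extension by continuity along an arbitrarily chosen approximating sequence;
  \<open>pext_tends\<close> shows that every other sequence has the same limit.\<close>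

definition pext :: "(('g \<Rightarrow> complex) \<Rightarrow> real) \<Rightarrow> ('g \<Rightarrow> complex) \<Rightarrow> real" where
  "pext p f = lim (\<lambda>k. p ((SOME h. tends h f) k))"

lemma seminorm_diff_le:
  assumes p: "cstar_seminorm SA p" and "h \<in> fun_span SB" "k \<in> fun_span SB"
  shows "\<bar>p h - p k\<bar> \<le> p (\<lambda>x. h x + (- 1) * k x)"
proof -
  note pD = cstar_seminormD[OF p, unfolded groupoid_alg_simps]
  let ?d = "\<lambda>x. h x + (- 1) * k x"
  have d: "?d \<in> fun_span SB" by (rule fun_span_add fun_span_scale assms)+
  have "p (\<lambda>x. ?d x + k x) \<le> p ?d + p k" using pD(2)[OF d assms(3)] .
  moreover have "p (\<lambda>x. (- 1) * ?d x + h x) \<le> p (\<lambda>x. (- 1) * ?d x) + p h"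
    using pD(2)[OF fun_span_scale[OF d] assms(2)] .
  moreover have "p (\<lambda>x. (- 1) * ?d x) = p ?d" using pD(3)[OF d, of "- 1"] by simp
  ultimately show ?thesis by simp
qed

text \<open>Approximants of \<open>f\<close> from two sequences differ uniformly by at most the sum
  of their errors, and their difference is a sum over boundedly many bisections. Hence their
  seminorms are close. Applied to one sequence twice this is the Cauchy property, applied to two
  sequences it is independence of the choice.\<close>

lemma pext_tends:
  assumes p: "cstar_seminorm SA p" and h: "tends h f"
  shows "(\<lambda>k. p (h k)) \<longlonglongrightarrow> pext p f"
proof -
  have close: "\<exists>C e. C \<ge> 0 \<and> e \<longlonglongrightarrow> 0 \<and> (\<forall>i j. \<bar>p (h i) - p (k j)\<bar> \<le> C * (e i + e j))"
    if h: "tends h f" and k: "tends k f" for h k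
  proof -
    obtain n e where 1: "\<And>k. tame n (h k)" "e \<longlonglongrightarrow> 0" "\<And>k x. cmod (f x - h k x) \<le> e k"
      using tendsE[OF h] by blast
    obtain m d where 2: "\<And>i. tame m (k i)" "d \<longlonglongrightarrow> 0" "\<And>i x. cmod (f x - k i x) \<le> d i"
      using tendsE[OF k] by blast
    have pos: "0 \<le> e i" "0 \<le> d i" for i using 1(3)[of undefined i] 2(3)[of undefined i] norm_ge_zero order_trans by blast+
    \<comment> \<open>The bound is symmetrised so that a single null sequence, \<open>e + d\<close>,
      serves both indices.\<close>
    have "\<bar>p (h i) - p (k j)\<bar> \<le> 2 ^ (n + m) * ((e i + d i) + (e j + d j))" for i j
    proof -
      have "cmod (h i x + (- 1) * k j x) \<le> e i + d j" for x
        using norm_triangle_ineq4[of "f x - k j x" "f x - h i x"] 1(3)[of x i] 2(3)[of x j] by (simp add: algebra_simps)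
      then have "p (\<lambda>x. h i x + (- 1) * k j x) \<le> 2 ^ (n + m) * (e i + d j)"
        using seminorm_tame_le[OF p tame_diff[OF 1(1) 2(1)]] by blast
      also have "\<dots> \<le> 2 ^ (n + m) * ((e i + d i) + (e j + d j))" using pos by (intro mult_left_mono) (auto intro: add_mono)
      finally show ?thesis using seminorm_diff_le[OF p tame_SB[OF 1(1)] tame_SB[OF 2(1)], of i j] by linarith
    qed
    moreover have "(\<lambda>i. e i + d i) \<longlonglongrightarrow> 0" using tendsto_add[OF 1(2) 2(2)] by simp
    ultimately show ?thesis by (intro exI[of _ "2 ^ (n + m)"] exI[of _ "\<lambda>i. e i + d i"]) auto
  qed
  define h' where "h' = (SOME h. tends h f)"
  have h': "tends h' f" unfolding h'_def by (rule someI[where P = "\<lambda>h. tends h f", OF h])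
  have "Cauchy (\<lambda>k. p (h' k))"
  proof -
    obtain C e where C: "C \<ge> 0" "e \<longlonglongrightarrow> 0" "\<And>i j. \<bar>p (h' i) - p (h' j)\<bar> \<le> C * (e i + e j)"
      using close[OF h' h'] by blast
    show ?thesis
    proof (rule metric_CauchyI)
      fix r :: real assume r: "r > 0"
      have "(\<lambda>i. C * e i) \<longlonglongrightarrow> 0" using tendsto_mult_right_zero[OF C(2)] .
      then obtain N where N: "\<And>i. i \<ge> N \<Longrightarrow> \<bar>C * e i\<bar> < r / 2"
        using r LIMSEQ_iff[of "\<lambda>i. C * e i" 0] half_gt_zero by (metis diff_zero real_norm_def)
      show "\<exists>M. \<forall>m\<ge>M. \<forall>n\<ge>M. dist (p (h' m)) (p (h' n)) < r"
      proof (intro exI allI impI)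
        fix m n assume "N \<le> m" "N \<le> n"
        then show "dist (p (h' m)) (p (h' n)) < r"
          using C(3)[of m n] N[of m] N[of n] by (simp add: dist_real_def distrib_left)
      qed
    qed
  qed
  then have lim: "(\<lambda>k. p (h' k)) \<longlonglongrightarrow> pext p f"
    using convergent_LIMSEQ_iff real_Cauchy_convergent unfolding pext_def h'_def[symmetric] by blast
  obtain C e where C: "C \<ge> 0" "e \<longlonglongrightarrow> 0" "\<And>i j. \<bar>p (h i) - p (h' j)\<bar> \<le> C * (e i + e j)"
    using close[OF h h'] by blast
  have "(\<lambda>i. C * (e i + e i)) \<longlonglongrightarrow> C * (0 + 0)"
    by (rule tendsto_mult_left[OF tendsto_add[OF C(2) C(2)]])
  then have null: "(\<lambda>i. C * (e i + e i)) \<longlonglongrightarrow> 0" by simp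
  have "(\<lambda>i. p (h i) - p (h' i)) \<longlonglongrightarrow> 0"
    by (rule Lim_null_comparison[OF always_eventually null]) (use C(3) in \<open>simp only: real_norm_def\<close>, blast)
  from tendsto_add[OF this lim] show ?thesis by simp
qed

text \<open>Every clause of the definition is an equation or weak inequality between continuous
  expressions, and survives the limit because sums, multiples, stars and convolutions of
  approximants approximate those of the limits.\<close>

lemma cstar_seminorm_pext:
  assumes p: "cstar_seminorm SA p" shows "cstar_seminorm CA (pext p)"
  unfolding cstar_seminorm_def groupoid_alg_simps
proof (intro conjI ballI allI)
  note pD = cstar_seminormD[OF p, unfolded groupoid_alg_simps]
  have SBt: "h i \<in> fun_span SB" if "tends h f" for h f i using that tame_SB by (auto elim!: tendsE)
  fix f assume f: "f \<in> fun_span (Cc_bisections G)"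
  obtain h where h: "tends h f" using Cc_tends[OF f] by blast
  obtain n where n: "\<And>c. card (ranfib f c) \<le> n" using Cc_ranfib[OF f] by blast
  have fs: "fsupp f" using fsupp_span[OF f Cc_fsupp] .
  note lim = pext_tends[OF p]
  show "0 \<le> pext p f" using LIMSEQ_le_const[OF lim[OF h], of 0] pD(1) SBt[OF h] by blast
  show "pext p (\<lambda>x. c * f x) = cmod c * pext p f" for c
  proof (rule LIMSEQ_unique[OF lim[OF tends_scale[OF h]]])
    show "(\<lambda>k. p (\<lambda>x. c * h k x)) \<longlonglongrightarrow> cmod c * pext p f"
      unfolding pD(3)[OF SBt[OF h]] by (intro tendsto_mult_left lim h)
  qed
  have fs': "fsupp (gstar cnj f)" "\<exists>n. \<forall>c. card (ranfib (gstar cnj f) c) \<le> n"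
  proof -
    have "gstar cnj f \<in> fun_span (Cc_bisections G)"
      using star_algebra_CA f unfolding star_algebra_def groupoid_alg_simps by blast
    then show "fsupp (gstar cnj f)" "\<exists>n. \<forall>c. card (ranfib (gstar cnj f) c) \<le> n"
      using Cc_ranfib fsupp_span[OF _ Cc_fsupp] by blast+
  qed
  obtain n' where n': "\<And>c. card (ranfib (gstar cnj f) c) \<le> n'" using fs'(2) by blast
  show "pext p (convolution G (gstar cnj f) f) = (pext p f)\<^sup>2"
  proof (rule LIMSEQ_unique[OF lim[OF tends_convolution[OF tends_gstar[OF h] fs'(1) n' h fs]]])
    show "(\<lambda>k. p (convolution G (gstar cnj (h k)) (h k))) \<longlonglongrightarrow> (pext p f)\<^sup>2"
      unfolding pD(5)[OF SBt[OF h]] by (intro tendsto_power lim h)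
  qed
  fix g assume g: "g \<in> fun_span (Cc_bisections G)"
  obtain k where k: "tends k g" using Cc_tends[OF g] by blast
  have gs: "fsupp g" using fsupp_span[OF g Cc_fsupp] .
  show "pext p (\<lambda>x. f x + g x) \<le> pext p f + pext p g"
    by (rule LIMSEQ_le[OF lim[OF tends_add[OF h k]] tendsto_add[OF lim[OF h] lim[OF k]]])
      (use pD(2)[OF SBt[OF h] SBt[OF k]] in blast)
  show "pext p (convolution G f g) \<le> pext p f * pext p g"
    by (rule LIMSEQ_le[OF lim[OF tends_convolution[OF h fs n k gs]] tendsto_mult[OF lim[OF h] lim[OF k]]])
      (use pD(4)[OF SBt[OF h] SBt[OF k]] in blast)
qed

lemma pext_eq: "\<lbrakk>cstar_seminorm SA p; h \<in> fun_span SB\<rbrakk> \<Longrightarrow> pext p h = p h"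
  using LIMSEQ_unique[OF pext_tends[OF _ tends_const] tendsto_const] by blast

lemma cstar_seminorm_restrict: "cstar_seminorm CA p \<Longrightarrow> cstar_seminorm SA p"
  unfolding cstar_seminorm_def groupoid_alg_simps using SB_Cc by blast

text \<open>Restriction and \<open>pext\<close> make the sets of values of the C*-seminorms at
  \<open>h\<close> equal, so their suprema agree.\<close>

lemma max_seminorm_SA_CA:
  assumes "h \<in> fun_span SB" shows "max_seminorm CA h = max_seminorm SA h"
proof -
  have "(\<lambda>p. p h) ` {p. cstar_seminorm CA p} = (\<lambda>p. p h) ` {p. cstar_seminorm SA p}"
  proof (intro equalityI subsetI)
    fix r assume "r \<in> (\<lambda>p. p h) ` {p. cstar_seminorm SA p}"
    then obtain p where p: "cstar_seminorm SA p" "r = p h" by blast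
    then have "r = pext p h" "cstar_seminorm CA (pext p)" using pext_eq[OF p(1) assms] cstar_seminorm_pext by auto
    then show "r \<in> (\<lambda>p. p h) ` {p. cstar_seminorm CA p}" by blast
  qed (use cstar_seminorm_restrict in blast)
  then show ?thesis by (simp add: max_seminorm_def)
qed

lemma seminorm_UC_le:
  assumes p: "cstar_seminorm CA p" and U: "cob G U" and f: "f \<in> UC U" and M: "\<And>x. cmod (f x) \<le> M"
  shows "p f \<le> M"
proof (rule cstar_seminorm_le_sup[where \<F> = UC, OF p _ _ _ _ U f M])
  show "convolution G (gstar cnj h) h \<in> UC (smul G (ginv G ` U) U)" if "cob G U" "h \<in> UC U" for U h
    using UC_convolution[OF UC_gstar[OF that(2)] that(2) cob_inv[OF that(1)] that(1)] .
qed (auto intro: fun_span_base UC_Cc UC_off UC_compose)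

lemma CA_seminorms_bounded:
  assumes "f \<in> carr CA" shows "\<exists>M. \<forall>p. cstar_seminorm CA p \<longrightarrow> p f \<le> M"
  using assms unfolding groupoid_alg_simps
proof (induction rule: fun_span.induct)
  case zero
  have "p (\<lambda>_. 0) = 0" if "cstar_seminorm CA p" for p
    using cstar_seminormD(3)[OF that, unfolded groupoid_alg_simps, OF fun_span.zero, of 0] by simp
  then show ?case by (intro exI[of _ 0] allI impI eq_refl)
next
  case (step f b c)
  then obtain M where M: "\<And>p. cstar_seminorm CA p \<Longrightarrow> p f \<le> M" by blast
  obtain U where U: "cob G U" "b \<in> UC U" using step.hyps(2) by (meson CcE)
  obtain N where N: "\<And>x. cmod (c * b x) \<le> N" using UC_bounded[OF UC_scale[OF U(2)]] by blast
  have "p (\<lambda>x. f x + c * b x) \<le> M + N" if p: "cstar_seminorm CA p" for p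
  proof -
    have "p (\<lambda>x. f x + c * b x) \<le> p f + p (\<lambda>x. c * b x)"
      by (rule cstar_seminormD(2)[OF p, unfolded groupoid_alg_simps, OF step.hyps(1)
          fun_span_scale[OF fun_span_base[OF step.hyps(2)]]])
    then show ?thesis using M[OF p] seminorm_UC_le[OF p U(1) UC_scale[OF U(2)] N] by linarith
  qed
  then show ?case by blast
qed

text \<open>The approximation is uniform on a bisection, and \<open>seminorm_UC_le\<close> converts
  it into a bound valid for all C*-seminorms at once. One \<open>h\<close> therefore works for the
  largest seminorm.\<close>

lemma SB_dense:
  assumes "f \<in> fun_span (Cc_bisections G)" "\<epsilon> > 0"
  shows "\<exists>h\<in>fun_span SB. \<forall>p. cstar_seminorm CA p \<longrightarrow> p (asub CA f h) \<le> \<epsilon>"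
  using assms
proof (induction arbitrary: \<epsilon> rule: fun_span.induct)
  case zero
  have "p (asub CA (\<lambda>_. 0) (\<lambda>_. 0)) \<le> \<epsilon>" if "cstar_seminorm CA p" for p
    using cstar_seminormD(3)[OF that, unfolded groupoid_alg_simps, OF fun_span.zero, of 0] zero
    by (simp add: asub_def groupoid_alg_simps)
  then show ?case using fun_span.zero by blast
next
  case (step f b c)
  obtain h where h: "h \<in> fun_span SB" "\<And>p. cstar_seminorm CA p \<Longrightarrow> p (asub CA f h) \<le> \<epsilon> / 2"
    using step.IH[of "\<epsilon> / 2"] step.prems by auto
  obtain U where U: "cob G U" "b \<in> UC U" using step.hyps(2) by (meson CcE)
  have cb: "(\<lambda>x. c * b x) \<in> UC U" using UC_scale[OF U(2)] .
  obtain g where g: "g \<in> LC U" "\<And>x. cmod (c * b x - g x) \<le> \<epsilon> / 2"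
    using UC_approx[OF cb, of "\<epsilon> / 2"] step.prems by auto
  have d: "(\<lambda>x. c * b x + (- 1) * g x) \<in> UC U" by (rule UC_add UC_scale LC_UC g U)+
  have "p (asub CA (\<lambda>x. f x + c * b x) (\<lambda>x. h x + g x)) \<le> \<epsilon>" if p: "cstar_seminorm CA p" for p
  proof -
    have "asub CA (\<lambda>x. f x + c * b x) (\<lambda>x. h x + g x) =
        (\<lambda>x. asub CA f h x + (c * b x + (- 1) * g x))"
      by (simp add: asub_def groupoid_alg_simps algebra_simps)
    moreover have "asub CA f h \<in> fun_span (Cc_bisections G)"
      using step.hyps(1) SB_Cc[OF h(1)] unfolding asub_def groupoid_alg_simps
      by (intro fun_span_add fun_span_scale)
    moreover have "(\<lambda>x. c * b x + (- 1) * g x) \<in> fun_span (Cc_bisections G)"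
      using UC_Cc[OF U(1) d] by (rule fun_span_base)
    ultimately have "p (asub CA (\<lambda>x. f x + c * b x) (\<lambda>x. h x + g x)) \<le>
        p (asub CA f h) + p (\<lambda>x. c * b x + (- 1) * g x)"
      using cstar_seminormD(2)[OF p, unfolded groupoid_alg_simps] by simp
    moreover have "p (\<lambda>x. c * b x + (- 1) * g x) \<le> \<epsilon> / 2"
      using seminorm_UC_le[OF p U(1) d, of "\<epsilon> / 2"] g(2) by simp
    ultimately show ?thesis using h(2)[OF p] by linarith
  qed
  moreover have "(\<lambda>x. h x + g x) \<in> fun_span SB" using fun_span_add[OF h(1) LC_SB[OF g(1)]] .
  ultimately show ?case by blast
qed

end

section \<open>Isometric homomorphisms with dense range\<close>

locale star_alg_on =
  fixes cj :: "'r::{comm_ring, comm_monoid_mult} \<Rightarrow> 'r" and A :: "('r, 'b, 'm) star_alg_scheme"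
  assumes sa: "star_algebra cj A"
begin

abbreviation pl (infixl "\<oplus>" 65) where "x \<oplus> y \<equiv> aadd A x y"
abbreviation sc (infixr "\<cdot>" 75) where "c \<cdot> x \<equiv> ascale A c x"
abbreviation ti (infixl "\<otimes>" 70) where "x \<otimes> y \<equiv> amul A x y"

lemma closed [simp]:
  "azero A \<in> carr A" "x \<in> carr A \<Longrightarrow> astar A x \<in> carr A" "x \<in> carr A \<Longrightarrow> c \<cdot> x \<in> carr A"
  "\<lbrakk>x \<in> carr A; y \<in> carr A\<rbrakk> \<Longrightarrow> x \<oplus> y \<in> carr A" "\<lbrakk>x \<in> carr A; y \<in> carr A\<rbrakk> \<Longrightarrow> x \<otimes> y \<in> carr A"
  using sa by (simp_all add: star_algebra_def)

lemma pl_assoc: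
  assumes "x \<in> carr A" "y \<in> carr A" "z \<in> carr A" shows "(x \<oplus> y) \<oplus> z = x \<oplus> (y \<oplus> z)"
proof -
  have "\<forall>x\<in>carr A. \<forall>y\<in>carr A. \<forall>z\<in>carr A.
      (x \<oplus> y) \<oplus> z = x \<oplus> (y \<oplus> z) \<and> (x \<otimes> y) \<otimes> z = x \<otimes> (y \<otimes> z) \<and>
      (x \<oplus> y) \<otimes> z = x \<otimes> z \<oplus> y \<otimes> z \<and> x \<otimes> (y \<oplus> z) = x \<otimes> y \<oplus> x \<otimes> z"
    using sa unfolding star_algebra_def by (elim conjE)
  then show ?thesis using assms by blast
qed

lemma ti_assoc: "\<lbrakk>x \<in> carr A; y \<in> carr A; z \<in> carr A\<rbrakk> \<Longrightarrow> (x \<otimes> y) \<otimes> z = x \<otimes> (y \<otimes> z)"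
  and ti_pl_left: "\<lbrakk>x \<in> carr A; y \<in> carr A; z \<in> carr A\<rbrakk> \<Longrightarrow> (x \<oplus> y) \<otimes> z = x \<otimes> z \<oplus> y \<otimes> z"
  and ti_pl_right: "\<lbrakk>x \<in> carr A; y \<in> carr A; z \<in> carr A\<rbrakk> \<Longrightarrow> x \<otimes> (y \<oplus> z) = x \<otimes> y \<oplus> x \<otimes> z"
  and pl_comm: "\<lbrakk>x \<in> carr A; y \<in> carr A\<rbrakk> \<Longrightarrow> x \<oplus> y = y \<oplus> x"
  and pl_zero: "x \<in> carr A \<Longrightarrow> x \<oplus> azero A = x"
  and pl_neg: "x \<in> carr A \<Longrightarrow> x \<oplus> (- 1) \<cdot> x = azero A"
  and sc_pl: "\<lbrakk>x \<in> carr A; y \<in> carr A\<rbrakk> \<Longrightarrow> c \<cdot> (x \<oplus> y) = c \<cdot> x \<oplus> c \<cdot> y"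
  and sc_sc: "x \<in> carr A \<Longrightarrow> (c * d) \<cdot> x = c \<cdot> (d \<cdot> x)"
  and sc_ti_left: "\<lbrakk>x \<in> carr A; y \<in> carr A\<rbrakk> \<Longrightarrow> (c \<cdot> x) \<otimes> y = c \<cdot> (x \<otimes> y)"
  and sc_ti_right: "\<lbrakk>x \<in> carr A; y \<in> carr A\<rbrakk> \<Longrightarrow> x \<otimes> (c \<cdot> y) = c \<cdot> (x \<otimes> y)"
  and sc_one: "x \<in> carr A \<Longrightarrow> 1 \<cdot> x = x"
  and star_star: "x \<in> carr A \<Longrightarrow> astar A (astar A x) = x"
  and star_pl: "\<lbrakk>x \<in> carr A; y \<in> carr A\<rbrakk> \<Longrightarrow> astar A (x \<oplus> y) = astar A x \<oplus> astar A y"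
  and star_sc: "x \<in> carr A \<Longrightarrow> astar A (c \<cdot> x) = cj c \<cdot> astar A x"
  using sa by (simp_all add: star_algebra_def)

lemma pl_left_comm: "\<lbrakk>x \<in> carr A; y \<in> carr A; z \<in> carr A\<rbrakk> \<Longrightarrow> x \<oplus> (y \<oplus> z) = y \<oplus> (x \<oplus> z)"
  by (metis pl_assoc pl_comm)

lemma pl_cancel:
  assumes "x \<in> carr A" "y \<in> carr A"
  shows "x \<oplus> ((- 1) \<cdot> x \<oplus> y) = y" "(- 1) \<cdot> x \<oplus> (x \<oplus> y) = y"
proof -
  show "x \<oplus> ((- 1) \<cdot> x \<oplus> y) = y"
    using assms pl_assoc[of x "(- 1) \<cdot> x" y] pl_comm[of "azero A" y] by (simp add: pl_neg pl_zero)
  then show "(- 1) \<cdot> x \<oplus> (x \<oplus> y) = y" using assms by (simp add: pl_left_comm)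
qed

end

locale bounded_star_alg = star_alg_on cnj A for A :: "(complex, 'b, 'm) star_alg_scheme" +
  assumes bounded: "x \<in> carr A \<Longrightarrow> \<exists>M. \<forall>p. cstar_seminorm A p \<longrightarrow> p x \<le> M"
begin

abbreviation M :: "'b \<Rightarrow> real" where "M \<equiv> max_seminorm A"
abbreviation D :: "'b \<Rightarrow> 'b \<Rightarrow> real" where "D x y \<equiv> max_seminorm A (asub A x y)"

lemma le_max: "\<lbrakk>cstar_seminorm A p; x \<in> carr A\<rbrakk> \<Longrightarrow> p x \<le> M x"
  unfolding max_seminorm_def using bounded[of x]
  by (intro cSUP_upper) (auto simp: bdd_above_def)

lemma max_le: "(\<And>p. cstar_seminorm A p \<Longrightarrow> p x \<le> r) \<Longrightarrow> M x \<le> r"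
proof -
  have "cstar_seminorm A (\<lambda>_. 0)" by (simp add: cstar_seminorm_def)
  then show "(\<And>p. cstar_seminorm A p \<Longrightarrow> p x \<le> r) \<Longrightarrow> M x \<le> r"
    unfolding max_seminorm_def by (intro cSUP_least) auto
qed

text \<open>Each clause passes to the supremum. The lower bound in the C*-identity comes from
  bounding \<open>p x\<close> by the square root of \<open>M (astar A x \<otimes> x)\<close> for
  every \<open>p\<close>; the zero seminorm supplies non-negativity.\<close>

lemma M_seminorm: "cstar_seminorm A M"
  unfolding cstar_seminorm_def
proof (intro conjI ballI allI)
  fix x assume x: "x \<in> carr A"
  have zero: "cstar_seminorm A (\<lambda>_. 0)" by (simp add: cstar_seminorm_def)
  show nn: "0 \<le> M x" using le_max[OF zero x] by simp
  show "M (c \<cdot> x) = cmod c * M x" for c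
  proof (rule antisym)
    show "M (c \<cdot> x) \<le> cmod c * M x"
      by (rule max_le) (use x in \<open>simp add: cstar_seminormD(3) le_max mult_left_mono\<close>)
    show "cmod c * M x \<le> M (c \<cdot> x)"
    proof (cases "c = 0")
      case True
      then show ?thesis using le_max[OF zero, of "c \<cdot> x"] x by simp
    next
      case False
      have "M x \<le> M (c \<cdot> x) / cmod c"
      proof (rule max_le)
        fix p assume p: "cstar_seminorm A p"
        then show "p x \<le> M (c \<cdot> x) / cmod c"
          using le_max[OF p, of "c \<cdot> x"] x False by (simp add: cstar_seminormD(3)[OF p] field_simps)
      qed
      then show ?thesis using False by (simp add: field_simps)
    qed
  qed
  show "M (astar A x \<otimes> x) = (M x)\<^sup>2"
  proof (rule antisym)
    show "M (astar A x \<otimes> x) \<le> (M x)\<^sup>2"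
      by (rule max_le) (use x in \<open>simp add: cstar_seminormD(5) le_max power_mono cstar_seminormD(1)\<close>)
    have "0 \<le> M (astar A x \<otimes> x)" using le_max[OF zero, of "astar A x \<otimes> x"] x by simp
    moreover have "M x \<le> sqrt (M (astar A x \<otimes> x))"
    proof (rule max_le)
      fix p assume p: "cstar_seminorm A p"
      then have "(p x)\<^sup>2 \<le> M (astar A x \<otimes> x)"
        using le_max[OF p, of "astar A x \<otimes> x"] x by (simp add: cstar_seminormD(5)[OF p])
      then show "p x \<le> sqrt (M (astar A x \<otimes> x))" by (rule real_le_rsqrt)
    qed
    ultimately show "(M x)\<^sup>2 \<le> M (astar A x \<otimes> x)"
      using nn power_mono[of "M x" _ 2] by (metis real_sqrt_pow2)
  qed
  fix y assume y: "y \<in> carr A"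
  show "M (x \<oplus> y) \<le> M x + M y"
  proof (rule max_le)
    fix p assume p: "cstar_seminorm A p"
    show "p (x \<oplus> y) \<le> M x + M y"
      using cstar_seminormD(2)[OF p x y] le_max[OF p x] le_max[OF p y] by linarith
  qed
  show "M (x \<otimes> y) \<le> M x * M y"
  proof (rule max_le)
    fix p assume p: "cstar_seminorm A p"
    have "p x * p y \<le> M x * M y"
      using le_max[OF p x] le_max[OF p y] cstar_seminormD(1)[OF p] x y nn by (intro mult_mono) auto
    then show "p (x \<otimes> y) \<le> M x * M y" using cstar_seminormD(4)[OF p x y] by linarith
  qed
qed

section \<open>The pseudometric of the largest seminorm\<close>

lemmas MD = cstar_seminormD[OF M_seminorm]

lemma asub_closed [simp]: "\<lbrakk>x \<in> carr A; y \<in> carr A\<rbrakk> \<Longrightarrow> asub A x y \<in> carr A"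
  by (simp add: asub_def)

text \<open>The C*-identity and submultiplicativity bound the square of \<open>M x\<close> by
  \<open>M (astar A x) * M x\<close>; cancelling gives one inequality, and applying it to the
  adjoint gives the other.\<close>

lemma M_star: assumes "x \<in> carr A" shows "M (astar A x) = M x"
proof -
  have *: "M x \<le> M (astar A x)" if "x \<in> carr A" for x
  proof -
    have "(M x)\<^sup>2 \<le> M (astar A x) * M x" using MD(4)[of "astar A x" x] MD(5)[of x] that by simp
    then show ?thesis
      using MD(1)[of x] MD(1)[of "astar A x"] that by (cases "M x = 0") (auto simp: power2_eq_square)
  qed
  show ?thesis using *[OF assms] *[of "astar A x"] assms by (simp add: star_star)
qed

lemma M_zero: "M (azero A) = 0"
proof -
  \<comment> \<open>\<open>star_algebra\<close> lists no law for the scalar \<open>0\<close>; this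
    instance is derived so that homogeneity of \<open>M\<close> applies.\<close>
  have "azero A = 0 \<cdot> azero A"
    using pl_neg[of "0 \<cdot> azero A"] sc_sc[of "azero A" "- 1" 0] pl_zero
    by (metis closed(1,3) mult_zero_right pl_cancel(2) pl_comm pl_neg sc_pl)
  then show ?thesis using MD(3)[of "azero A" 0] by simp
qed

lemma D_self: "x \<in> carr A \<Longrightarrow> D x x = 0"
  by (simp add: asub_def pl_neg M_zero)

lemma D_nonneg: "\<lbrakk>x \<in> carr A; y \<in> carr A\<rbrakk> \<Longrightarrow> 0 \<le> D x y"
  by (simp add: MD(1))

lemma D_sym: assumes "x \<in> carr A" "y \<in> carr A" shows "D x y = D y x"
proof -
  have "asub A y x = (- 1) \<cdot> asub A x y"
    using assms sc_sc[of y "- 1" "- 1"] by (simp add: asub_def sc_pl pl_comm sc_one)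
  then show ?thesis using MD(3)[of "asub A x y" "- 1"] assms by simp
qed

lemma D_triangle: assumes "x \<in> carr A" "y \<in> carr A" "z \<in> carr A" shows "D x z \<le> D x y + D y z"
proof -
  have "asub A x z = asub A x y \<oplus> asub A y z"
    using assms by (simp add: asub_def pl_assoc pl_cancel)
  then show ?thesis using MD(2)[of "asub A x y" "asub A y z"] assms by simp
qed

lemma M_le_D: assumes "x \<in> carr A" "y \<in> carr A" shows "\<bar>M x - M y\<bar> \<le> D x y"
proof -
  have "M x \<le> M y + D x y" if "x \<in> carr A" "y \<in> carr A" for x y
  proof -
    have "x = asub A x y \<oplus> y"
      using that by (simp add: asub_def pl_assoc pl_comm[of "(- 1) \<cdot> y" y] pl_neg pl_zero)
    then show ?thesis using MD(2)[of "asub A x y" y] that by simp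
  qed
  from this[OF assms] this[OF assms(2,1)] D_sym[OF assms] show ?thesis by linarith
qed

lemma D_add:
  assumes "x \<in> carr A" "y \<in> carr A" "x' \<in> carr A" "y' \<in> carr A"
  shows "D (x \<oplus> y) (x' \<oplus> y') \<le> D x x' + D y y'"
proof -
  have "asub A (x \<oplus> y) (x' \<oplus> y') = asub A x x' \<oplus> asub A y y'"
    using assms by (simp add: asub_def sc_pl pl_assoc pl_left_comm)
  then show ?thesis using MD(2)[of "asub A x x'" "asub A y y'"] assms by simp
qed

lemma D_scale:
  assumes "x \<in> carr A" "x' \<in> carr A" shows "D (c \<cdot> x) (c \<cdot> x') = cmod c * D x x'"
proof -
  have "asub A (c \<cdot> x) (c \<cdot> x') = c \<cdot> asub A x x'"
    using assms by (simp add: asub_def sc_pl sc_sc[symmetric])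
  then show ?thesis using MD(3)[of "asub A x x'"] assms by simp
qed

lemma D_star:
  assumes "x \<in> carr A" "x' \<in> carr A" shows "D (astar A x) (astar A x') = D x x'"
proof -
  have "asub A (astar A x) (astar A x') = astar A (asub A x x')"
    using assms by (simp add: asub_def star_pl star_sc)
  then show ?thesis using M_star[of "asub A x x'"] assms by simp
qed

lemma D_mul:
  assumes "x \<in> carr A" "y \<in> carr A" "x' \<in> carr A" "y' \<in> carr A"
  shows "D (x \<otimes> y) (x' \<otimes> y') \<le> M x * D y y' + D x x' * M y'"
proof -
  have "asub A (x \<otimes> y) (x' \<otimes> y') = x \<otimes> asub A y y' \<oplus> asub A x x' \<otimes> y'"
    using assms by (simp add: asub_def ti_pl_left ti_pl_right sc_ti_left sc_ti_right pl_assoc pl_cancel)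
  then show ?thesis
    using MD(2)[of "x \<otimes> asub A y y'" "asub A x x' \<otimes> y'"] MD(4)[of x "asub A y y'"] MD(4)[of "asub A x x'" y'] assms
    by simp
qed

section \<open>Cauchy sequences, their classes and the operations of the completion on
  representatives\<close>

abbreviation CS :: "(nat \<Rightarrow> 'b) set" where "CS \<equiv> cauchy_seqs A"
abbreviation cl :: "(nat \<Rightarrow> 'b) \<Rightarrow> (nat \<Rightarrow> 'b) set" where "cl \<equiv> cauchy_class A"

lemma CS_carr: "x \<in> CS \<Longrightarrow> x n \<in> carr A"
  by (simp add: cauchy_seqs_def)

lemma CS_I:
  assumes "\<And>n. x n \<in> carr A" "\<And>e. e > 0 \<Longrightarrow> \<exists>N. \<forall>m\<ge>N. \<forall>n\<ge>N. D (x m) (x n) < e"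
  shows "x \<in> CS"
  using assms by (simp add: cauchy_seqs_def)

lemma CS_D: "\<lbrakk>x \<in> CS; e > 0\<rbrakk> \<Longrightarrow> \<exists>N. \<forall>m\<ge>N. \<forall>n\<ge>N. D (x m) (x n) < e"
  by (simp add: cauchy_seqs_def)

lemma CS_convergent: assumes x: "x \<in> CS" shows "convergent (\<lambda>n. M (x n))"
proof -
  have "Cauchy (\<lambda>n. M (x n))"
  proof (rule metric_CauchyI)
    fix e :: real assume "e > 0"
    from CS_D[OF x this] obtain N where N: "\<And>m n. \<lbrakk>m \<ge> N; n \<ge> N\<rbrakk> \<Longrightarrow> D (x m) (x n) < e" by blast
    have "dist (M (x m)) (M (x n)) < e" if "m \<ge> N" "n \<ge> N" for m n
      using M_le_D[OF CS_carr[OF x] CS_carr[OF x], of m n] N[OF that] by (simp add: dist_real_def)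
    then show "\<exists>N. \<forall>m\<ge>N. \<forall>n\<ge>N. dist (M (x m)) (M (x n)) < e" by blast
  qed
  then show ?thesis by (simp add: Cauchy_convergent_iff)
qed

lemma CS_bounded: assumes x: "x \<in> CS" shows "\<exists>K>0. \<forall>n. M (x n) \<le> K"
  using convergent_imp_Bseq[OF CS_convergent[OF x]] unfolding Bseq_def by (auto simp: abs_le_iff)

lemma cl_memD: "y \<in> cl x \<Longrightarrow> y \<in> CS" "y \<in> cl x \<Longrightarrow> (\<lambda>n. D (x n) (y n)) \<longlonglongrightarrow> 0"
  by (auto simp: cauchy_class_def)

lemma cl_self: "x \<in> CS \<Longrightarrow> x \<in> cl x"
  by (simp add: cauchy_class_def D_self CS_carr)

lemma cl_eqI:
  assumes "\<And>n. x n \<in> carr A" "\<And>n. y n \<in> carr A" "(\<lambda>n. D (x n) (y n)) \<longlonglongrightarrow> 0"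
  shows "cl x = cl y"
proof -
  have *: "(\<lambda>n. D (v n) (z n)) \<longlonglongrightarrow> 0"
    if "z \<in> CS" "(\<lambda>n. D (u n) (z n)) \<longlonglongrightarrow> 0" "(\<lambda>n. D (u n) (v n)) \<longlonglongrightarrow> 0" "\<And>n. u n \<in> carr A" "\<And>n. v n \<in> carr A"
    for u v z
  proof (rule Lim_null_comparison)
    show "(\<lambda>n. D (u n) (v n) + D (u n) (z n)) \<longlonglongrightarrow> 0" using tendsto_add[OF that(3,2)] by simp
    show "\<forall>\<^sub>F n in sequentially. norm (D (v n) (z n)) \<le> D (u n) (v n) + D (u n) (z n)"
      using D_triangle[OF that(5,4) CS_carr[OF that(1)]] D_sym[OF that(4,5)] D_nonneg[OF that(5) CS_carr[OF that(1)]]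
      by (intro always_eventually) simp
  qed
  have "(\<lambda>n. D (y n) (x n)) \<longlonglongrightarrow> 0" using assms D_sym by simp
  then show ?thesis
    using *[of _ x y] *[of _ y x] assms unfolding cauchy_class_def by blast
qed

lemma cl_eqD:
  assumes "x \<in> CS" "y \<in> CS" "cl x = cl y" shows "(\<lambda>n. D (x n) (y n)) \<longlonglongrightarrow> 0"
  using cl_memD(2)[of y x] cl_self[OF assms(2)] assms(3) by simp

lemma UN_cl:
  assumes "x \<in> CS" "\<And>y. y \<in> cl x \<Longrightarrow> F y = F x"
  shows "(\<Union>y\<in>cl x. F y) = F x"
  using cl_self[OF assms(1)] assms(2) by blast

abbreviation env :: "(nat \<Rightarrow> 'b) set normed_star_alg" where "env \<equiv> enveloping_cstar A"

lemma CS_add: assumes "x \<in> CS" "y \<in> CS" shows "(\<lambda>n. x n \<oplus> y n) \<in> CS"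
proof (rule CS_I)
  fix e :: real assume e: "e > 0"
  obtain N where N: "\<And>m n. \<lbrakk>m \<ge> N; n \<ge> N\<rbrakk> \<Longrightarrow> D (x m) (x n) < e / 2" using CS_D[OF assms(1), of "e / 2"] e by auto
  obtain K where K: "\<And>m n. \<lbrakk>m \<ge> K; n \<ge> K\<rbrakk> \<Longrightarrow> D (y m) (y n) < e / 2" using CS_D[OF assms(2), of "e / 2"] e by auto
  have "D (x m \<oplus> y m) (x n \<oplus> y n) < e" if "m \<ge> max N K" "n \<ge> max N K" for m n
    using D_add[of "x m" "y m" "x n" "y n"] N[of m n] K[of m n] that assms by (simp add: CS_carr)
  then show "\<exists>N. \<forall>m\<ge>N. \<forall>n\<ge>N. D (x m \<oplus> y m) (x n \<oplus> y n) < e" by blast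
qed (use assms in \<open>simp add: CS_carr\<close>)

lemma CS_mul: assumes "x \<in> CS" "y \<in> CS" shows "(\<lambda>n. x n \<otimes> y n) \<in> CS"
proof (rule CS_I)
  fix e :: real assume e: "e > 0"
  obtain B where B: "B > 0" "\<And>n. M (x n) \<le> B" using CS_bounded[OF assms(1)] by blast
  obtain C where C: "C > 0" "\<And>n. M (y n) \<le> C" using CS_bounded[OF assms(2)] by blast
  have BC: "B + C > 0" using B C by simp
  obtain N where N: "\<And>m n. \<lbrakk>m \<ge> N; n \<ge> N\<rbrakk> \<Longrightarrow> D (x m) (x n) < e / (B + C)"
    using CS_D[OF assms(1), of "e / (B + C)"] e BC by auto
  obtain K where K: "\<And>m n. \<lbrakk>m \<ge> K; n \<ge> K\<rbrakk> \<Longrightarrow> D (y m) (y n) < e / (B + C)"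
    using CS_D[OF assms(2), of "e / (B + C)"] e BC by auto
  have "D (x m \<otimes> y m) (x n \<otimes> y n) < e" if "m \<ge> max N K" "n \<ge> max N K" for m n
  proof -
    have "D (x m \<otimes> y m) (x n \<otimes> y n) \<le> M (x m) * D (y m) (y n) + D (x m) (x n) * M (y n)"
      using assms by (intro D_mul CS_carr)
    also have "\<dots> \<le> B * D (y m) (y n) + D (x m) (x n) * C"
      using B C assms by (intro add_mono mult_mono) (auto simp: D_nonneg CS_carr MD(1))
    also have "\<dots> < B * (e / (B + C)) + (e / (B + C)) * C"
      using B C N[of m n] K[of m n] that by (intro add_strict_mono mult_strict_left_mono mult_strict_right_mono) auto
    also have "\<dots> = (B + C) * (e / (B + C))" by (simp only: distrib_right mult.commute)
    also have "\<dots> = e" using BC by simp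
    finally show ?thesis .
  qed
  then show "\<exists>N. \<forall>m\<ge>N. \<forall>n\<ge>N. D (x m \<otimes> y m) (x n \<otimes> y n) < e" by blast
qed (use assms in \<open>simp add: CS_carr\<close>)

lemma CS_scale: assumes "x \<in> CS" shows "(\<lambda>n. c \<cdot> x n) \<in> CS"
proof (rule CS_I)
  fix e :: real assume e: "e > 0"
  have pos: "cmod c + 1 > 0" by (simp add: add_nonneg_pos)
  obtain N where N: "\<And>m n. \<lbrakk>m \<ge> N; n \<ge> N\<rbrakk> \<Longrightarrow> D (x m) (x n) < e / (cmod c + 1)"
    using CS_D[OF assms, of "e / (cmod c + 1)"] e pos by auto
  have "D (c \<cdot> x m) (c \<cdot> x n) < e" if "m \<ge> N" "n \<ge> N" for m n
  proof -
    have "cmod c * D (x m) (x n) \<le> (cmod c + 1) * D (x m) (x n)"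
      using assms by (intro mult_right_mono) (auto simp: D_nonneg CS_carr)
    also have "\<dots> < (cmod c + 1) * (e / (cmod c + 1))" using N[OF that] pos by (rule mult_strict_left_mono)
    finally show ?thesis using pos assms by (simp add: D_scale CS_carr)
  qed
  then show "\<exists>N. \<forall>m\<ge>N. \<forall>n\<ge>N. D (c \<cdot> x m) (c \<cdot> x n) < e" by blast
qed (use assms in \<open>simp add: CS_carr\<close>)

lemma CS_star: "x \<in> CS \<Longrightarrow> (\<lambda>n. astar A (x n)) \<in> CS"
  using CS_D[of x] by (intro CS_I) (simp_all add: CS_carr D_star)

lemma env_carr: "carr env = cl ` CS"
  by (simp add: enveloping_cstar_def)

lemma env_add: assumes "x \<in> CS" "y \<in> CS" shows "aadd env (cl x) (cl y) = cl (\<lambda>n. x n \<oplus> y n)"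
proof -
  have "cl (\<lambda>n. u n \<oplus> v n) = cl (\<lambda>n. x n \<oplus> y n)" if uv: "u \<in> cl x" "v \<in> cl y" for u v
  proof (rule HOL.sym, rule cl_eqI)
    have c: "u n \<in> carr A" "v n \<in> carr A" "x n \<in> carr A" "y n \<in> carr A" for n
      using cl_memD(1) uv assms CS_carr by blast+
    show "(\<lambda>n. D (x n \<oplus> y n) (u n \<oplus> v n)) \<longlonglongrightarrow> 0"
    proof (rule Lim_null_comparison[OF always_eventually])
      show "(\<lambda>n. D (x n) (u n) + D (y n) (v n)) \<longlonglongrightarrow> 0"
        using tendsto_add[OF cl_memD(2)[OF uv(1)] cl_memD(2)[OF uv(2)]] by simp
      show "\<forall>n. norm (D (x n \<oplus> y n) (u n \<oplus> v n)) \<le> D (x n) (u n) + D (y n) (v n)"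
        using D_add c D_nonneg by simp
    qed
    show "x n \<oplus> y n \<in> carr A" "u n \<oplus> v n \<in> carr A" for n using c by simp_all
  qed
  then have "(\<Union>u\<in>cl x. \<Union>v\<in>cl y. cl (\<lambda>n. u n \<oplus> v n)) = (\<Union>u\<in>cl x. \<Union>v\<in>cl y. cl (\<lambda>n. x n \<oplus> y n))" by simp
  also have "\<dots> = cl (\<lambda>n. x n \<oplus> y n)" using cl_self assms by blast
  finally show ?thesis by (simp add: enveloping_cstar_def)
qed

lemma env_mul: assumes "x \<in> CS" "y \<in> CS" shows "amul env (cl x) (cl y) = cl (\<lambda>n. x n \<otimes> y n)"
proof -
  have "cl (\<lambda>n. u n \<otimes> v n) = cl (\<lambda>n. x n \<otimes> y n)" if uv: "u \<in> cl x" "v \<in> cl y" for u v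
  proof (rule HOL.sym, rule cl_eqI)
    have c: "u n \<in> carr A" "v n \<in> carr A" "x n \<in> carr A" "y n \<in> carr A" for n
      using cl_memD(1) uv assms CS_carr by blast+
    show "(\<lambda>n. D (x n \<otimes> y n) (u n \<otimes> v n)) \<longlonglongrightarrow> 0"
    proof (rule Lim_null_comparison[OF always_eventually])
      obtain a b where "(\<lambda>n. M (x n)) \<longlonglongrightarrow> a" "(\<lambda>n. M (v n)) \<longlonglongrightarrow> b"
        using CS_convergent[OF assms(1)] CS_convergent[OF cl_memD(1)[OF uv(2)]] unfolding convergent_def by blast
      from tendsto_add[OF tendsto_mult[OF this(1) cl_memD(2)[OF uv(2)]] tendsto_mult[OF cl_memD(2)[OF uv(1)] this(2)]]
      show "(\<lambda>n. M (x n) * D (y n) (v n) + D (x n) (u n) * M (v n)) \<longlonglongrightarrow> 0" by simp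
      show "\<forall>n. norm (D (x n \<otimes> y n) (u n \<otimes> v n)) \<le> M (x n) * D (y n) (v n) + D (x n) (u n) * M (v n)"
        using D_mul c D_nonneg by simp
    qed
    show "x n \<otimes> y n \<in> carr A" "u n \<otimes> v n \<in> carr A" for n using c by simp_all
  qed
  then have "(\<Union>u\<in>cl x. \<Union>v\<in>cl y. cl (\<lambda>n. u n \<otimes> v n)) = (\<Union>u\<in>cl x. \<Union>v\<in>cl y. cl (\<lambda>n. x n \<otimes> y n))" by simp
  also have "\<dots> = cl (\<lambda>n. x n \<otimes> y n)" using cl_self assms by blast
  finally show ?thesis by (simp add: enveloping_cstar_def)
qed

lemma env_scale: assumes "x \<in> CS" shows "ascale env c (cl x) = cl (\<lambda>n. c \<cdot> x n)"
proof -
  have "cl (\<lambda>n. c \<cdot> u n) = cl (\<lambda>n. c \<cdot> x n)" if u: "u \<in> cl x" for u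
  proof (rule HOL.sym, rule cl_eqI)
    have c: "u n \<in> carr A" "x n \<in> carr A" for n using cl_memD(1) u assms CS_carr by blast+
    show "(\<lambda>n. D (c \<cdot> x n) (c \<cdot> u n)) \<longlonglongrightarrow> 0"
      using tendsto_mult_right_zero[OF cl_memD(2)[OF u], of "cmod c"] by (simp add: D_scale c)
    show "c \<cdot> x n \<in> carr A" "c \<cdot> u n \<in> carr A" for n using c by simp_all
  qed
  from UN_cl[where F = "\<lambda>u. cl (\<lambda>n. c \<cdot> u n)", OF assms this] show ?thesis by (simp add: enveloping_cstar_def)
qed

lemma env_star: assumes "x \<in> CS" shows "astar env (cl x) = cl (\<lambda>n. astar A (x n))"
proof -
  have "cl (\<lambda>n. astar A (u n)) = cl (\<lambda>n. astar A (x n))" if u: "u \<in> cl x" for u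
  proof (rule HOL.sym, rule cl_eqI)
    have c: "u n \<in> carr A" "x n \<in> carr A" for n using cl_memD(1) u assms CS_carr by blast+
    show "(\<lambda>n. D (astar A (x n)) (astar A (u n))) \<longlonglongrightarrow> 0"
      using cl_memD(2)[OF u] by (simp add: D_star c)
    show "astar A (x n) \<in> carr A" "astar A (u n) \<in> carr A" for n using c by simp_all
  qed
  from UN_cl[where F = "\<lambda>u. cl (\<lambda>n. astar A (u n))", OF assms this] show ?thesis by (simp add: enveloping_cstar_def)
qed

lemma env_norm: assumes x: "x \<in> CS" shows "anorm env (cl x) = lim (\<lambda>n. M (x n))"
proof -
  have "lim (\<lambda>n. M (y n)) = lim (\<lambda>n. M (x n))" if y: "y \<in> cl x" for y
  proof -
    have y': "y \<in> CS" using cl_memD(1)[OF y] .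
    have lim: "(\<lambda>n. M (x n)) \<longlonglongrightarrow> lim (\<lambda>n. M (x n))"
      using CS_convergent[OF x] convergent_LIMSEQ_iff by blast
    have "(\<lambda>n. M (x n) - M (y n)) \<longlonglongrightarrow> 0"
      by (rule Lim_null_comparison[OF always_eventually cl_memD(2)[OF y]]) (simp add: M_le_D CS_carr[OF x] CS_carr[OF y'])
    from tendsto_diff[OF lim this] have "(\<lambda>n. M (y n)) \<longlonglongrightarrow> lim (\<lambda>n. M (x n))" by simp
    then show ?thesis by (rule limI)
  qed
  then have "(\<lambda>x. lim (\<lambda>n. M (x n))) ` cl x = {lim (\<lambda>n. M (x n))}" using cl_self[OF x] by blast
  then show ?thesis by (simp add: enveloping_cstar_def)
qed

end

text \<open>Uniqueness of completions: \<open>\<iota>\<close> is applied termwise to Cauchy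
  sequences. Preservation of the seminorm makes this well defined, isometric and injective on
  classes; density provides preimages of classes.\<close>

lemma enveloping_isomorphic:
  assumes A: "bounded_star_alg A" and C: "bounded_star_alg C" and \<iota>: "star_alg_hom A C \<iota>"
    and isom: "\<And>x. x \<in> carr A \<Longrightarrow> max_seminorm C (\<iota> x) = max_seminorm A x"
    and dense: "\<And>y \<epsilon>. \<lbrakk>y \<in> carr C; \<epsilon> > 0\<rbrakk> \<Longrightarrow> \<exists>x\<in>carr A. max_seminorm C (asub C y (\<iota> x)) \<le> \<epsilon>"
  shows "cstar_isomorphic (enveloping_cstar A) (enveloping_cstar C)"
proof -
  interpret A: bounded_star_alg A by (rule A)
  interpret C: bounded_star_alg C by (rule C)
  have hom: "\<iota> x \<in> carr C" "\<iota> (aadd A x y) = aadd C (\<iota> x) (\<iota> y)" "\<iota> (ascale A c x) = ascale C c (\<iota> x)"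
    "\<iota> (amul A x y) = amul C (\<iota> x) (\<iota> y)" "\<iota> (astar A x) = astar C (\<iota> x)"
    if "x \<in> carr A" "y \<in> carr A" for x y c
    using \<iota> that unfolding star_alg_hom_def by blast+
  have hom1: "\<iota> x \<in> carr C" "\<iota> (ascale A c x) = ascale C c (\<iota> x)" "\<iota> (astar A x) = astar C (\<iota> x)"
    if "x \<in> carr A" for x c
    using hom[OF that that] by auto
  have D: "C.D (\<iota> x) (\<iota> y) = A.D x y" if "x \<in> carr A" "y \<in> carr A" for x y
    using isom[of "asub A x y"] that by (simp add: asub_def hom)
  have \<iota>CS: "(\<lambda>n. \<iota> (x n)) \<in> C.CS" if x: "x \<in> A.CS" for x
    using A.CS_D[OF x] hom(1)[OF A.CS_carr[OF x] A.CS_carr[OF x]]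
    by (intro C.CS_I) (simp_all add: D A.CS_carr[OF x])
  define H where "H P = (\<Union>x\<in>P. cauchy_class C (\<lambda>n. \<iota> (x n)))" for P
  have H: "H (A.cl x) = C.cl (\<lambda>n. \<iota> (x n))" if x: "x \<in> A.CS" for x
    unfolding H_def
  proof (rule A.UN_cl[OF x])
    fix y assume y: "y \<in> A.cl x"
    note c = A.CS_carr[OF x] A.CS_carr[OF A.cl_memD(1)[OF y]]
    show "C.cl (\<lambda>n. \<iota> (y n)) = C.cl (\<lambda>n. \<iota> (x n))"
      by (rule HOL.sym, rule C.cl_eqI[OF hom(1)[OF c(1) c(1)] hom(1)[OF c(2) c(2)]])
        (use A.cl_memD(2)[OF y] c in \<open>simp add: D\<close>)
  qed
  have "star_alg_hom A.env C.env H"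
    unfolding star_alg_hom_def A.env_carr C.env_carr
    by (auto simp: H \<iota>CS A.env_add C.env_add A.env_mul C.env_mul A.env_scale C.env_scale A.env_star C.env_star
        A.CS_add A.CS_mul A.CS_scale A.CS_star A.CS_carr hom(2,4) hom1)
  moreover have "bij_betw H (carr A.env) (carr C.env)"
  proof (rule bij_betw_imageI)
    show "inj_on H (carr A.env)"
      unfolding A.env_carr
    proof (rule inj_onI, clarify)
      fix x y assume xy: "x \<in> A.CS" "y \<in> A.CS" "H (A.cl x) = H (A.cl y)"
      have "(\<lambda>n. C.D (\<iota> (x n)) (\<iota> (y n))) \<longlonglongrightarrow> 0"
        using C.cl_eqD[OF \<iota>CS[OF xy(1)] \<iota>CS[OF xy(2)]] xy H by simp
      then show "A.cl x = A.cl y"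
        by (intro A.cl_eqI) (simp_all add: A.CS_carr xy D)
    qed
    show "H ` carr A.env = carr C.env"
    proof (intro equalityI subsetI)
      fix P assume "P \<in> carr C.env"
      then obtain y where y: "y \<in> C.CS" "P = C.cl y" by (auto simp: C.env_carr)
      have "\<exists>x\<in>carr A. C.D (y n) (\<iota> x) \<le> 1 / Suc n" for n
        using dense[OF C.CS_carr[OF y(1)]] by simp
      \<comment> \<open>Approximating the \<open>n\<close>-th term to within
        \<open>1 / Suc n\<close> makes the images of the \<open>x n\<close> equivalent to
        \<open>y\<close>; since distances are preserved, the \<open>x n\<close> are themselves
        Cauchy.\<close>
      then obtain x where x: "\<And>n. x n \<in> carr A" "\<And>n. C.D (y n) (\<iota> (x n)) \<le> 1 / Suc n" by metis
      have small: "(\<lambda>n. 1 / real (Suc n)) \<longlonglongrightarrow> 0" by (rule LIMSEQ_Suc[OF lim_1_over_n])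
      have null: "(\<lambda>n. C.D (y n) (\<iota> (x n))) \<longlonglongrightarrow> 0"
        by (rule Lim_null_comparison[OF always_eventually small])
          (use x C.D_nonneg C.CS_carr[OF y(1)] hom1(1) in simp)
      have xCS: "x \<in> A.CS"
      proof (rule A.CS_I[OF x(1)])
        fix e :: real assume e: "e > 0"
        obtain N where N: "\<And>m n. \<lbrakk>m \<ge> N; n \<ge> N\<rbrakk> \<Longrightarrow> C.D (y m) (y n) < e / 3"
          using C.CS_D[OF y(1), of "e / 3"] e by auto
        obtain K where K: "\<And>n. n \<ge> K \<Longrightarrow> \<bar>C.D (y n) (\<iota> (x n))\<bar> < e / 3"
          using LIMSEQ_D[OF null, of "e / 3"] e by auto
        have "A.D (x m) (x n) < e" if "m \<ge> max N K" "n \<ge> max N K" for m n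
        proof -
          have c: "y m \<in> carr C" "y n \<in> carr C" "\<iota> (x m) \<in> carr C" "\<iota> (x n) \<in> carr C"
            using x(1) hom(1) C.CS_carr[OF y(1)] by auto
          have "A.D (x m) (x n) = C.D (\<iota> (x m)) (\<iota> (x n))" using D x(1) by simp
          also have "\<dots> \<le> C.D (y m) (\<iota> (x m)) + (C.D (y m) (y n) + C.D (y n) (\<iota> (x n)))"
            using C.D_triangle[OF c(3,1,4)] C.D_triangle[OF c(1,2,4)] C.D_sym[OF c(3,1)] by linarith
          finally show ?thesis using N[of m n] K[of m] K[of n] that by simp
        qed
        then show "\<exists>N. \<forall>m\<ge>N. \<forall>n\<ge>N. A.D (x m) (x n) < e" by blast
      qed
      have "C.cl y = C.cl (\<lambda>n. \<iota> (x n))"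
        by (rule C.cl_eqI[OF C.CS_carr[OF y(1)] hom(1)[OF x(1) x(1)] null])
      then have "P = H (A.cl x)" using H[OF xCS] y(2) by simp
      then show "P \<in> H ` carr A.env" using xCS by (simp add: A.env_carr)
    qed (use H \<iota>CS in \<open>auto simp: A.env_carr C.env_carr\<close>)
  qed
  moreover have "anorm C.env (H P) = anorm A.env P" if P: "P \<in> carr A.env" for P
  proof -
    obtain x where x: "x \<in> A.CS" "P = A.cl x" using P by (auto simp: A.env_carr)
    then show ?thesis by (simp add: H \<iota>CS C.env_norm A.env_norm isom A.CS_carr)
  qed
  ultimately show ?thesis unfolding cstar_isomorphic_def by blast
qed

section \<open>Finitely aligned left cancellative small categories\<close>

locale lcsc =
  fixes \<Lambda> :: "'a small_cat"
  assumes cat: "small_category \<Lambda>" and left_cancel: "left_cancellative \<Lambda>" and fin_aligned: "finitely_aligned \<Lambda>"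
begin

abbreviation "Mo \<equiv> Mor \<Lambda>"
abbreviation "so \<equiv> src \<Lambda>"
abbreviation "ra \<equiv> rng \<Lambda>"
abbreviation comp (infixl "\<bullet>\<bullet>" 70) where "\<alpha> \<bullet>\<bullet> \<beta> \<equiv> cmp \<Lambda> \<alpha> \<beta>"
abbreviation "RI \<equiv> right_ideal \<Lambda>"
abbreviation "S\<^sub>\<Lambda> \<equiv> inv_semigroup \<Lambda>"

lemma cat_simps [simp]:
  assumes "\<alpha> \<in> Mo"
  shows "so \<alpha> \<in> Mo" "ra \<alpha> \<in> Mo" "so (so \<alpha>) = so \<alpha>" "ra (so \<alpha>) = so \<alpha>" "so (ra \<alpha>) = ra \<alpha>" "ra (ra \<alpha>) = ra \<alpha>"
    "\<alpha> \<bullet>\<bullet> so \<alpha> = \<alpha>" "ra \<alpha> \<bullet>\<bullet> \<alpha> = \<alpha>"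
  using cat assms by (simp_all add: small_category_def)

lemma comp_simps [simp]:
  assumes "\<alpha> \<in> Mo" "\<beta> \<in> Mo" "so \<alpha> = ra \<beta>"
  shows "\<alpha> \<bullet>\<bullet> \<beta> \<in> Mo" "so (\<alpha> \<bullet>\<bullet> \<beta>) = so \<beta>" "ra (\<alpha> \<bullet>\<bullet> \<beta>) = ra \<alpha>"
  using cat assms by (simp_all add: small_category_def)

lemma comp_assoc:
  assumes "\<alpha> \<in> Mo" "\<beta> \<in> Mo" "\<gamma> \<in> Mo" "so \<alpha> = ra \<beta>" "so \<beta> = ra \<gamma>"
  shows "(\<alpha> \<bullet>\<bullet> \<beta>) \<bullet>\<bullet> \<gamma> = \<alpha> \<bullet>\<bullet> (\<beta> \<bullet>\<bullet> \<gamma>)"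
proof -
  have "\<forall>\<alpha>\<in>Mo. \<forall>\<beta>\<in>Mo. \<forall>\<gamma>\<in>Mo. so \<alpha> = ra \<beta> \<and> so \<beta> = ra \<gamma> \<longrightarrow> (\<alpha> \<bullet>\<bullet> \<beta>) \<bullet>\<bullet> \<gamma> = \<alpha> \<bullet>\<bullet> (\<beta> \<bullet>\<bullet> \<gamma>)"
    using cat unfolding small_category_def by (elim conjE)
  then show ?thesis using assms by simp
qed

lemma comp_cancel:
  "\<lbrakk>\<alpha> \<bullet>\<bullet> \<beta> = \<alpha> \<bullet>\<bullet> \<gamma>; \<alpha> \<in> Mo; \<beta> \<in> Mo; \<gamma> \<in> Mo; so \<alpha> = ra \<beta>; so \<alpha> = ra \<gamma>\<rbrakk> \<Longrightarrow> \<beta> = \<gamma>"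
  using left_cancel unfolding left_cancellative_def by blast

lemma RI_iff: "x \<in> RI \<alpha> \<longleftrightarrow> (\<exists>\<beta>\<in>Mo. ra \<beta> = so \<alpha> \<and> x = \<alpha> \<bullet>\<bullet> \<beta>)"
  by (auto simp: right_ideal_def)

lemma RI_E:
  assumes "x \<in> RI \<alpha>" "\<alpha> \<in> Mo"
  obtains \<beta> where "\<beta> \<in> Mo" "ra \<beta> = so \<alpha>" "x = \<alpha> \<bullet>\<bullet> \<beta>" "x \<in> Mo" "so x = so \<beta>" "ra x = ra \<alpha>"
  using assms by (auto simp: RI_iff)

lemma RI_I: "\<lbrakk>\<beta> \<in> Mo; ra \<beta> = so \<alpha>\<rbrakk> \<Longrightarrow> \<alpha> \<bullet>\<bullet> \<beta> \<in> RI \<alpha>"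
  by (auto simp: RI_iff)

lemma RI_self: "\<alpha> \<in> Mo \<Longrightarrow> \<alpha> \<in> RI \<alpha>"
  using RI_I[of "so \<alpha>" \<alpha>] by simp

lemma RI_Mo: "\<alpha> \<in> Mo \<Longrightarrow> RI \<alpha> \<subseteq> Mo"
  by (auto simp: RI_iff)

lemma RI_mono:
  assumes "\<delta> \<in> RI \<alpha>" "\<alpha> \<in> Mo" shows "RI \<delta> \<subseteq> RI \<alpha>"
proof
  fix x assume x: "x \<in> RI \<delta>"
  obtain \<beta> where b: "\<beta> \<in> Mo" "ra \<beta> = so \<alpha>" "\<delta> = \<alpha> \<bullet>\<bullet> \<beta>" "\<delta> \<in> Mo" "so \<delta> = so \<beta>" using assms by (elim RI_E) auto
  then obtain \<gamma> where "\<gamma> \<in> Mo" "ra \<gamma> = so \<beta>" "x = \<delta> \<bullet>\<bullet> \<gamma>" using x by (elim RI_E) auto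
  then have "x = \<alpha> \<bullet>\<bullet> (\<beta> \<bullet>\<bullet> \<gamma>)" using b assms(2) by (simp add: comp_assoc)
  then show "x \<in> RI \<alpha>" using b \<open>\<gamma> \<in> Mo\<close> \<open>ra \<gamma> = so \<beta>\<close> RI_I[of "\<beta> \<bullet>\<bullet> \<gamma>" \<alpha>] by simp
qed

text \<open>A family of least cardinality among the finite families whose ideals cover the
  intersection consists of minimal extensions: if \<open>\<gamma>\<close> extends
  \<open>\<delta>\<close>, and \<open>\<delta>\<close> extends another member
  \<open>\<gamma>'\<close>, then \<open>\<gamma>\<close> could be dropped.\<close>

lemma vee_exists:
  assumes "\<alpha> \<in> Mo" "\<beta> \<in> Mo" shows "\<exists>\<gamma>s. distinct \<gamma>s \<and> is_vee \<Lambda> \<alpha> \<beta> (set \<gamma>s)"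
proof -
  define P where "P \<Gamma> \<longleftrightarrow> finite \<Gamma> \<and> \<Gamma> \<subseteq> Mo \<and> RI \<alpha> \<inter> RI \<beta> = (\<Union>\<gamma>\<in>\<Gamma>. RI \<gamma>)" for \<Gamma>
  have "\<exists>\<Gamma>. P \<Gamma>" using fin_aligned assms unfolding finitely_aligned_def P_def by blast
  then obtain \<Gamma> where \<Gamma>0: "P \<Gamma>" and least: "\<And>\<Gamma>'. P \<Gamma>' \<Longrightarrow> card \<Gamma> \<le> card \<Gamma>'"
    using ex_has_least_nat[of P _ card] by metis
  have \<Gamma>: "finite \<Gamma>" "\<Gamma> \<subseteq> Mo" "RI \<alpha> \<inter> RI \<beta> = (\<Union>\<gamma>\<in>\<Gamma>. RI \<gamma>)"
    using \<Gamma>0 by (simp_all add: P_def)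
  have sub: "\<Gamma> \<subseteq> RI \<alpha> \<inter> RI \<beta>" using \<Gamma>(2,3) RI_self by blast
  have "min_common_ext \<Lambda> \<alpha> \<beta> \<gamma>" if g: "\<gamma> \<in> \<Gamma>" for \<gamma>
    unfolding min_common_ext_def
  proof (intro conjI ballI impI)
    show "\<gamma> \<in> RI \<alpha> \<inter> RI \<beta>" using g sub by blast
    fix \<delta> assume d: "\<delta> \<in> RI \<alpha> \<inter> RI \<beta>" "\<gamma> \<in> RI \<delta>"
    have dM: "\<delta> \<in> Mo" "\<gamma> \<in> Mo" using d(1) RI_Mo[OF assms(1)] g \<Gamma>(2) by auto
    obtain \<gamma>' where g': "\<gamma>' \<in> \<Gamma>" "\<delta> \<in> RI \<gamma>'" using d(1) \<Gamma>(3) by blast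
    have "\<gamma>' \<in> Mo" using g' \<Gamma>(2) by blast
    then have le: "RI \<gamma> \<subseteq> RI \<delta>" "RI \<delta> \<subseteq> RI \<gamma>'" using RI_mono d(2) g'(2) dM by auto
    have "\<gamma>' = \<gamma>"
    proof (rule ccontr)
      assume ne: "\<gamma>' \<noteq> \<gamma>"
      have "(\<Union>\<gamma>\<in>\<Gamma>. RI \<gamma>) \<subseteq> (\<Union>\<gamma>\<in>\<Gamma> - {\<gamma>}. RI \<gamma>)" using ne g' le by blast
      then have "(\<Union>\<gamma>\<in>\<Gamma>. RI \<gamma>) = (\<Union>\<gamma>\<in>\<Gamma> - {\<gamma>}. RI \<gamma>)" by blast
      then have "P (\<Gamma> - {\<gamma>})" using \<Gamma> by (auto simp: P_def)
      then show False using least[of "\<Gamma> - {\<gamma>}"] \<Gamma>(1) g card_Diff1_less[of \<Gamma> \<gamma>] by simp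
    qed
    then show "RI \<delta> = RI \<gamma>" using le by blast
  qed
  then have "is_vee \<Lambda> \<alpha> \<beta> \<Gamma>" using \<Gamma>(1,3) unfolding is_vee_def by blast
  then show ?thesis using \<Gamma>(1) finite_distinct_list[of \<Gamma>] by metis
qed

lemma is_veeD:
  assumes "is_vee \<Lambda> \<alpha> \<beta> \<Gamma>" "\<alpha> \<in> Mo"
  shows "finite \<Gamma>" "\<Gamma> \<subseteq> Mo" "\<Gamma> \<subseteq> RI \<alpha>" "\<Gamma> \<subseteq> RI \<beta>" "RI \<alpha> \<inter> RI \<beta> = (\<Union>\<gamma>\<in>\<Gamma>. RI \<gamma>)"
proof -
  show "finite \<Gamma>" "RI \<alpha> \<inter> RI \<beta> = (\<Union>\<gamma>\<in>\<Gamma>. RI \<gamma>)" using assms(1) by (simp_all add: is_vee_def)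
  show 1: "\<Gamma> \<subseteq> RI \<alpha>" "\<Gamma> \<subseteq> RI \<beta>" using assms(1) unfolding is_vee_def min_common_ext_def by blast+
  then show "\<Gamma> \<subseteq> Mo" using RI_Mo[OF assms(2)] by blast
qed

lemma is_vee_commute: "is_vee \<Lambda> \<alpha> \<beta> \<Gamma> \<Longrightarrow> is_vee \<Lambda> \<beta> \<alpha> \<Gamma>"
  unfolding is_vee_def min_common_ext_def Int_commute[of "RI \<beta>" "RI \<alpha>"] .

section \<open>The inverse semigroup\<close>

lemma tau_iff: "(x, y) \<in> tau \<Lambda> \<alpha> \<longleftrightarrow> x \<in> Mo \<and> ra x = so \<alpha> \<and> y = \<alpha> \<bullet>\<bullet> x"
  by (auto simp: tau_def)

definition pbij :: "'a pbij \<Rightarrow> bool" where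
  "pbij s \<longleftrightarrow> (\<forall>x y z. (x, y) \<in> s \<longrightarrow> (x, z) \<in> s \<longrightarrow> y = z) \<and> (\<forall>x y z. (x, z) \<in> s \<longrightarrow> (y, z) \<in> s \<longrightarrow> x = y)"

lemma pbij_S: "s \<in> S\<^sub>\<Lambda> \<Longrightarrow> pbij s"
proof (induction rule: inv_semigroup.induct)
  case (tau \<alpha>)
  then show ?case unfolding pbij_def by (auto simp: tau_iff intro: comp_cancel)
next
  case (sigma \<alpha>)
  then show ?case unfolding pbij_def by (auto simp: tau_iff intro: comp_cancel)
next
  case (mul s t)
  then show ?case unfolding pbij_def relcomp_unfold by blast
qed

lemma pbijD: "\<lbrakk>s \<in> S\<^sub>\<Lambda>; (x, y) \<in> s; (x, z) \<in> s\<rbrakk> \<Longrightarrow> y = z"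
  "\<lbrakk>s \<in> S\<^sub>\<Lambda>; (x, z) \<in> s; (y, z) \<in> s\<rbrakk> \<Longrightarrow> x = y"
  using pbij_S unfolding pbij_def by blast+

lemma S_converse: "s \<in> S\<^sub>\<Lambda> \<Longrightarrow> s\<inverse> \<in> S\<^sub>\<Lambda>"
proof (induction rule: inv_semigroup.induct)
  case (mul s t)
  then show ?case using inv_semigroup.mul[of "t\<inverse>" \<Lambda> "s\<inverse>"] by (simp add: converse_relcomp)
qed (auto intro: inv_semigroup.intros)

text \<open>This is \<open>\<tau>\<^sup>\<alpha>\<sigma>\<^sup>\<beta>\<close>, the map sending
  \<open>\<beta> \<bullet>\<bullet> x\<close> to \<open>\<alpha> \<bullet>\<bullet> x\<close>. It is
  empty if the sources of \<alpha> and \<beta> differ.\<close>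

definition ts :: "'a \<Rightarrow> 'a \<Rightarrow> 'a pbij" where
  "ts \<alpha> \<beta> = (tau \<Lambda> \<beta>)\<inverse> O tau \<Lambda> \<alpha>"

lemma ts_iff: "(y, z) \<in> ts \<alpha> \<beta> \<longleftrightarrow> (\<exists>x\<in>Mo. ra x = so \<alpha> \<and> ra x = so \<beta> \<and> y = \<beta> \<bullet>\<bullet> x \<and> z = \<alpha> \<bullet>\<bullet> x)"
  unfolding ts_def by (auto simp: tau_iff)

lemma ts_I: "\<lbrakk>x \<in> Mo; ra x = so \<alpha>; so \<alpha> = so \<beta>\<rbrakk> \<Longrightarrow> (\<beta> \<bullet>\<bullet> x, \<alpha> \<bullet>\<bullet> x) \<in> ts \<alpha> \<beta>"
  unfolding ts_iff by force

lemma ts_S: "\<lbrakk>\<alpha> \<in> Mo; \<beta> \<in> Mo\<rbrakk> \<Longrightarrow> ts \<alpha> \<beta> \<in> S\<^sub>\<Lambda>"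
  unfolding ts_def by (intro inv_semigroup.intros)

lemma ts_Domain: "so \<alpha> = so \<beta> \<Longrightarrow> Domain (ts \<alpha> \<beta>) = RI \<beta>"
  by (auto simp: Domain_iff ts_iff RI_iff; metis)

lemma ts_self: "ts \<alpha> \<alpha> = Id_on (RI \<alpha>)"
  by (auto simp: ts_iff RI_iff; metis)

lemma tau_ts: "\<alpha> \<in> Mo \<Longrightarrow> tau \<Lambda> \<alpha> = ts \<alpha> (so \<alpha>)"
  by (auto simp: tau_iff ts_iff) (metis cat_simps(2,8))+

abbreviation pairs :: "('a \<times> 'a) set" where
  "pairs \<equiv> {(\<alpha>, \<beta>). \<alpha> \<in> Mo \<and> \<beta> \<in> Mo \<and> so \<alpha> = so \<beta>}"

definition ts_union :: "'a pbij \<Rightarrow> bool" where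
  "ts_union s \<longleftrightarrow> (\<exists>P. finite P \<and> P \<subseteq> pairs \<and> s = (\<Union>(\<alpha>, \<beta>)\<in>P. ts \<alpha> \<beta>))"

lemma ts_unionI: "\<lbrakk>finite P; P \<subseteq> pairs; s = (\<Union>(\<alpha>, \<beta>)\<in>P. ts \<alpha> \<beta>)\<rbrakk> \<Longrightarrow> ts_union s"
  unfolding ts_union_def by (rule exI) (intro conjI)

lemma ts_union_UN:
  assumes "finite I" "\<And>i. i \<in> I \<Longrightarrow> ts_union (s i)" shows "ts_union (\<Union>i\<in>I. s i)"
  using assms
proof (induction I)
  case empty
  show ?case by (rule ts_unionI[of "{}"]) auto
next
  case (insert i I)
  obtain P where P: "finite P" "P \<subseteq> pairs" "s i = (\<Union>(\<alpha>, \<beta>)\<in>P. ts \<alpha> \<beta>)"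
    using insert.prems[of i] unfolding ts_union_def by auto
  obtain Q where Q: "finite Q" "Q \<subseteq> pairs" "(\<Union>i\<in>I. s i) = (\<Union>(\<alpha>, \<beta>)\<in>Q. ts \<alpha> \<beta>)"
    using insert.IH insert.prems unfolding ts_union_def by auto
  show ?case by (rule ts_unionI[of "P \<union> Q"]) (use P Q in auto)
qed

text \<open>The composite is controlled by the common extensions of \<beta> and \<gamma>. Each
  \<epsilon> in a finite set of minimal ones is written as
  \<open>\<beta> \<bullet>\<bullet> x\<close> and as \<open>\<gamma> \<bullet>\<bullet> y\<close>,
  and contributes the map \<open>ts (\<alpha> \<bullet>\<bullet> x) (\<delta> \<bullet>\<bullet>
  y)\<close>. Finite alignment thus keeps products finite unions.\<close>

lemma ts_mult:
  assumes "(\<alpha>, \<beta>) \<in> pairs" "(\<gamma>, \<delta>) \<in> pairs"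
  shows "ts_union (ts \<gamma> \<delta> O ts \<alpha> \<beta>)"
proof -
  have M: "\<alpha> \<in> Mo" "\<beta> \<in> Mo" "\<gamma> \<in> Mo" "\<delta> \<in> Mo" and e: "so \<alpha> = so \<beta>" "so \<gamma> = so \<delta>" using assms by auto
  obtain \<Gamma> where \<Gamma>: "is_vee \<Lambda> \<beta> \<gamma> \<Gamma>" using vee_exists M by blast
  note v = is_veeD[OF \<Gamma> M(2)]
  have "\<exists>xy. fst xy \<in> Mo \<and> snd xy \<in> Mo \<and> ra (fst xy) = so \<beta> \<and> ra (snd xy) = so \<gamma> \<and> \<epsilon> = \<beta> \<bullet>\<bullet> fst xy \<and> \<epsilon> = \<gamma> \<bullet>\<bullet> snd xy"
    if "\<epsilon> \<in> \<Gamma>" for \<epsilon>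
  proof -
    have "\<epsilon> \<in> RI \<beta>" "\<epsilon> \<in> RI \<gamma>" using v that by auto
    then show ?thesis unfolding RI_iff by (metis fst_conv snd_conv)
  qed
  then obtain f where f: "\<And>\<epsilon>. \<epsilon> \<in> \<Gamma> \<Longrightarrow> fst (f \<epsilon>) \<in> Mo \<and> snd (f \<epsilon>) \<in> Mo \<and> ra (fst (f \<epsilon>)) = so \<beta> \<and>
      ra (snd (f \<epsilon>)) = so \<gamma> \<and> \<epsilon> = \<beta> \<bullet>\<bullet> fst (f \<epsilon>) \<and> \<epsilon> = \<gamma> \<bullet>\<bullet> snd (f \<epsilon>)"
    by metis
  define P where "P = (\<lambda>\<epsilon>. (\<alpha> \<bullet>\<bullet> fst (f \<epsilon>), \<delta> \<bullet>\<bullet> snd (f \<epsilon>))) ` \<Gamma>"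
  have src_eq: "so (fst (f \<epsilon>)) = so \<epsilon>" "so (snd (f \<epsilon>)) = so \<epsilon>" if "\<epsilon> \<in> \<Gamma>" for \<epsilon>
    using f[OF that] M by (metis comp_simps(2))+
  have "P \<subseteq> pairs" unfolding P_def using f src_eq M e by auto
  moreover have "ts \<gamma> \<delta> O ts \<alpha> \<beta> = (\<Union>(\<alpha>, \<beta>)\<in>P. ts \<alpha> \<beta>)"
  proof (intro equalityI subsetI)
    fix w assume "w \<in> ts \<gamma> \<delta> O ts \<alpha> \<beta>"
    then obtain y x where w: "w = (\<delta> \<bullet>\<bullet> y, \<alpha> \<bullet>\<bullet> x)" "y \<in> Mo" "x \<in> Mo" "ra y = so \<gamma>" "ra x = so \<beta>" "\<gamma> \<bullet>\<bullet> y = \<beta> \<bullet>\<bullet> x"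
      unfolding relcomp_unfold by (auto simp: ts_iff)
    have "\<beta> \<bullet>\<bullet> x \<in> RI \<beta> \<inter> RI \<gamma>" using w RI_I[of x \<beta>] RI_I[of y \<gamma>] by auto
    then obtain \<epsilon> where \<epsilon>: "\<epsilon> \<in> \<Gamma>" "\<beta> \<bullet>\<bullet> x \<in> RI \<epsilon>" using v(5) by blast
    then obtain z where z: "z \<in> Mo" "ra z = so \<epsilon>" "\<beta> \<bullet>\<bullet> x = \<epsilon> \<bullet>\<bullet> z" by (auto simp: RI_iff)
    note fe = f[OF \<epsilon>(1)]
    have "\<beta> \<bullet>\<bullet> x = \<beta> \<bullet>\<bullet> (fst (f \<epsilon>) \<bullet>\<bullet> z)" "\<gamma> \<bullet>\<bullet> y = \<gamma> \<bullet>\<bullet> (snd (f \<epsilon>) \<bullet>\<bullet> z)"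
      using z w(6) M fe src_eq[OF \<epsilon>(1)] by (metis comp_assoc)+
    then have "x = fst (f \<epsilon>) \<bullet>\<bullet> z" "y = snd (f \<epsilon>) \<bullet>\<bullet> z"
      using w M fe src_eq[OF \<epsilon>(1)] z by (auto intro!: comp_cancel[of \<beta> x] comp_cancel[of \<gamma> y])
    then have "w = ((\<delta> \<bullet>\<bullet> snd (f \<epsilon>)) \<bullet>\<bullet> z, (\<alpha> \<bullet>\<bullet> fst (f \<epsilon>)) \<bullet>\<bullet> z)"
      using w M e fe src_eq[OF \<epsilon>(1)] z by (simp add: comp_assoc)
    then have "w \<in> ts (\<alpha> \<bullet>\<bullet> fst (f \<epsilon>)) (\<delta> \<bullet>\<bullet> snd (f \<epsilon>))"
      using M e fe src_eq[OF \<epsilon>(1)] z by (auto intro!: ts_I)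
    then show "w \<in> (\<Union>(\<alpha>, \<beta>)\<in>P. ts \<alpha> \<beta>)" using \<epsilon>(1) by (auto simp: P_def)
  next
    fix w assume "w \<in> (\<Union>(\<alpha>, \<beta>)\<in>P. ts \<alpha> \<beta>)"
    then obtain \<epsilon> where \<epsilon>: "\<epsilon> \<in> \<Gamma>" "w \<in> ts (\<alpha> \<bullet>\<bullet> fst (f \<epsilon>)) (\<delta> \<bullet>\<bullet> snd (f \<epsilon>))" by (auto simp: P_def)
    note fe = f[OF \<epsilon>(1)]
    obtain z where z: "z \<in> Mo" "ra z = so \<epsilon>" "w = ((\<delta> \<bullet>\<bullet> snd (f \<epsilon>)) \<bullet>\<bullet> z, (\<alpha> \<bullet>\<bullet> fst (f \<epsilon>)) \<bullet>\<bullet> z)"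
      using \<epsilon>(2) fe M e src_eq[OF \<epsilon>(1)] by (cases w) (auto simp: ts_iff)
    let ?y = "snd (f \<epsilon>) \<bullet>\<bullet> z" and ?x = "fst (f \<epsilon>) \<bullet>\<bullet> z"
    have "w = (\<delta> \<bullet>\<bullet> ?y, \<alpha> \<bullet>\<bullet> ?x)" using z fe M e src_eq[OF \<epsilon>(1)] by (simp add: comp_assoc)
    moreover have "\<gamma> \<bullet>\<bullet> ?y = \<beta> \<bullet>\<bullet> ?x" using z fe M src_eq[OF \<epsilon>(1)] by (metis comp_assoc)
    moreover have "(\<delta> \<bullet>\<bullet> ?y, \<gamma> \<bullet>\<bullet> ?y) \<in> ts \<gamma> \<delta>" "(\<beta> \<bullet>\<bullet> ?x, \<alpha> \<bullet>\<bullet> ?x) \<in> ts \<alpha> \<beta>"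
      using z fe M e src_eq[OF \<epsilon>(1)] by (auto intro!: ts_I)
    ultimately show "w \<in> ts \<gamma> \<delta> O ts \<alpha> \<beta>" by auto
  qed
  ultimately show ?thesis using v(1) by (intro ts_unionI[of P]) (simp_all add: P_def)
qed

lemma S_decomp: "s \<in> S\<^sub>\<Lambda> \<Longrightarrow> ts_union s"
proof (induction rule: inv_semigroup.induct)
  case (tau \<alpha>)
  then show ?case by (intro ts_unionI[of "{(\<alpha>, so \<alpha>)}"]) (auto simp: tau_ts)
next
  case (sigma \<alpha>)
  have "(ts \<alpha> (so \<alpha>))\<inverse> = ts (so \<alpha>) \<alpha>" by (auto simp: ts_iff)
  then show ?case using sigma by (intro ts_unionI[of "{(so \<alpha>, \<alpha>)}"]) (auto simp: tau_ts)
next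
  case (mul s t)
  obtain P where P: "finite P" "P \<subseteq> pairs" "s = (\<Union>(\<alpha>, \<beta>)\<in>P. ts \<alpha> \<beta>)"
    using mul.IH(1) unfolding ts_union_def by auto
  obtain Q where Q: "finite Q" "Q \<subseteq> pairs" "t = (\<Union>(\<alpha>, \<beta>)\<in>Q. ts \<alpha> \<beta>)"
    using mul.IH(2) unfolding ts_union_def by auto
  have "t O s = (\<Union>q\<in>Q. \<Union>p\<in>P. ts (fst q) (snd q) O ts (fst p) (snd p))"
    unfolding P(3) Q(3) case_prod_beta relcomp_UNION_distrib relcomp_UNION_distrib2 by (rule HOL.refl SUP_commute)
  moreover have "ts_union (ts (fst q) (snd q) O ts (fst p) (snd p))" if "p \<in> P" "q \<in> Q" for p q
    using ts_mult subsetD[OF P(2) that(1)] subsetD[OF Q(2) that(2)] by (simp add: case_prod_beta)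
  ultimately show ?case using P(1) Q(1) by (simp add: ts_union_UN)
qed

subsection \<open>Idempotents as sets\<close>

text \<open>Idempotents are identity relations, so each is replaced by its domain: products become
  intersections and \<open>idem_le\<close> becomes inclusion.\<close>

definition DD :: "'a set set" where
  "DD = {D. Id_on D \<in> S\<^sub>\<Lambda>}"

lemma idems_eq: "idems \<Lambda> = Id_on ` DD"
proof (intro equalityI subsetI)
  fix e assume "e \<in> idems \<Lambda>"
  then have e: "e \<in> S\<^sub>\<Lambda>" "e O e = e" by (auto simp: idems_def)
  have "x = y \<and> (x, x) \<in> e" if xy: "(x, y) \<in> e" for x y
  proof -
    obtain z where z: "(x, z) \<in> e" "(z, y) \<in> e" using xy e(2) by blast
    then have "z = y" using pbijD(1)[OF e(1)] xy by blast
    then show ?thesis using z xy pbijD(2)[OF e(1)] by blast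
  qed
  then have "e = Id_on (Domain e)" by auto
  then show "e \<in> Id_on ` DD" using e(1) unfolding DD_def by auto
qed (auto simp: DD_def idems_def)

lemma Id_on_inject [simp]: "Id_on D = Id_on D' \<longleftrightarrow> D = D'"
  by (auto simp: Id_on_def)

lemma Id_on_empty_iff [simp]: "Id_on D = {} \<longleftrightarrow> D = {}" "{} = Id_on D \<longleftrightarrow> D = {}"
  by auto

lemma Id_on_O [simp]: "Id_on D O Id_on D' = Id_on (D \<inter> D')"
  by auto

lemma idem_le_Id_on [simp]: "idem_le (Id_on D) (Id_on D') \<longleftrightarrow> D \<subseteq> D'"
  by (auto simp: idem_le_def)

lemma Id_on_idems [simp]: "Id_on D \<in> idems \<Lambda> \<longleftrightarrow> D \<in> DD"
  by (auto simp: idems_eq)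

lemma DD_Int: "\<lbrakk>D \<in> DD; D' \<in> DD\<rbrakk> \<Longrightarrow> D \<inter> D' \<in> DD"
  unfolding DD_def using inv_semigroup.mul[of "Id_on D'" \<Lambda> "Id_on D"] by simp

lemma DD_RI: "\<alpha> \<in> Mo \<Longrightarrow> RI \<alpha> \<in> DD"
  unfolding DD_def using ts_S[of \<alpha> \<alpha>] by (simp add: ts_self)

lemma conj_Id_on: "s \<in> S\<^sub>\<Lambda> \<Longrightarrow> s\<inverse> O (Id_on D O s) = Id_on (s `` D)"
  using pbijD(1) by blast

lemma DD_Image: "\<lbrakk>s \<in> S\<^sub>\<Lambda>; D \<in> DD\<rbrakk> \<Longrightarrow> s `` D \<in> DD"
  unfolding DD_def using conj_Id_on[of s D] inv_semigroup.mul S_converse by (metis mem_Collect_eq)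

lemma S_Domain: "s \<in> S\<^sub>\<Lambda> \<Longrightarrow> s O s\<inverse> = Id_on (Domain s)"
  using pbijD(2)[of s] by (auto simp: Domain_iff Id_on_iff)

lemma DD_Domain: "s \<in> S\<^sub>\<Lambda> \<Longrightarrow> Domain s \<in> DD"
  unfolding DD_def using S_Domain[of s] inv_semigroup.mul S_converse by (metis mem_Collect_eq)

lemma DD_decomp:
  assumes "D \<in> DD" shows "\<exists>F. finite F \<and> F \<subseteq> Mo \<and> D = (\<Union>\<alpha>\<in>F. RI \<alpha>)"
proof -
  obtain P where P: "finite P" "P \<subseteq> pairs" "Id_on D = (\<Union>(\<alpha>, \<beta>)\<in>P. ts \<alpha> \<beta>)"
    using S_decomp[of "Id_on D"] assms unfolding DD_def ts_union_def by auto
  have "D = Domain (Id_on D)" by auto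
  also have "\<dots> = (\<Union>p\<in>P. Domain (ts (fst p) (snd p)))" unfolding P(3) by (simp add: case_prod_beta Domain_Union)
  also have "\<dots> = (\<Union>p\<in>P. RI (snd p))"
    by (rule SUP_cong[OF HOL.refl], rule ts_Domain) (use subsetD[OF P(2)] in fastforce)
  finally show ?thesis using P(1,2) by (intro exI[of _ "snd ` P"]) auto
qed

lemma DD_right_ideal: assumes "D \<in> DD" "x \<in> D" shows "x \<in> Mo" "RI x \<subseteq> D"
proof -
  obtain F where F: "F \<subseteq> Mo" "D = (\<Union>\<alpha>\<in>F. RI \<alpha>)" using DD_decomp[OF assms(1)] by blast
  then obtain \<alpha> where "\<alpha> \<in> F" "x \<in> RI \<alpha>" using assms(2) by blast
  then show "x \<in> Mo" "RI x \<subseteq> D" using F RI_mono RI_Mo by blast+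
qed

section \<open>Filters\<close>

abbreviation filt :: "'a pbij set \<Rightarrow> bool" where "filt \<equiv> is_filter \<Lambda>"
abbreviation ultra :: "'a pbij set \<Rightarrow> bool" where "ultra \<equiv> is_ultrafilter \<Lambda>"

lemma filtD:
  assumes "filt \<eta>"
  shows "Id_on D \<in> \<eta> \<Longrightarrow> D \<in> DD" "Id_on D \<in> \<eta> \<Longrightarrow> D \<noteq> {}"
    "\<lbrakk>Id_on D \<in> \<eta>; D \<subseteq> D'; D' \<in> DD\<rbrakk> \<Longrightarrow> Id_on D' \<in> \<eta>"
    "\<lbrakk>Id_on D \<in> \<eta>; Id_on D' \<in> \<eta>\<rbrakk> \<Longrightarrow> Id_on (D \<inter> D') \<in> \<eta>"
    "e \<in> \<eta> \<Longrightarrow> \<exists>D\<in>DD. e = Id_on D"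
    "\<exists>D\<in>DD. Id_on D \<in> \<eta>"
proof -
  have f: "\<eta> \<subseteq> idems \<Lambda>" "\<eta> \<noteq> {}" "{} \<notin> \<eta>"
     "\<And>e f. \<lbrakk>e \<in> \<eta>; f \<in> idems \<Lambda>; idem_le e f\<rbrakk> \<Longrightarrow> f \<in> \<eta>"
     "\<And>e f. \<lbrakk>e \<in> \<eta>; f \<in> \<eta>\<rbrakk> \<Longrightarrow> f O e \<in> \<eta>"
    using assms unfolding is_filter_def by simp_all
  show "D \<in> DD" if "Id_on D \<in> \<eta>" for D using subsetD[OF f(1) that] by simp
  show "Id_on D \<in> \<eta> \<Longrightarrow> D \<noteq> {}" using f(3) by auto
  show "\<lbrakk>Id_on D \<in> \<eta>; D \<subseteq> D'; D' \<in> DD\<rbrakk> \<Longrightarrow> Id_on D' \<in> \<eta>" using f(4)[of "Id_on D" "Id_on D'"] by simp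
  show "\<lbrakk>Id_on D \<in> \<eta>; Id_on D' \<in> \<eta>\<rbrakk> \<Longrightarrow> Id_on (D \<inter> D') \<in> \<eta>" using f(5)[of "Id_on D'" "Id_on D"] by simp
  show e: "\<exists>D\<in>DD. e = Id_on D" if "e \<in> \<eta>" for e using subsetD[OF f(1) that] unfolding idems_eq by auto
  obtain e where "e \<in> \<eta>" using f(2) by auto
  with e[OF this] show "\<exists>D\<in>DD. Id_on D \<in> \<eta>" by auto
qed

lemma filtI:
  assumes sub: "\<eta> \<subseteq> Id_on ` DD" and ne: "\<eta> \<noteq> {}" "Id_on {} \<notin> \<eta>"
    and up: "\<And>D D'. \<lbrakk>D \<in> DD; D' \<in> DD; Id_on D \<in> \<eta>; D \<subseteq> D'\<rbrakk> \<Longrightarrow> Id_on D' \<in> \<eta>"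
    and int: "\<And>D D'. \<lbrakk>D \<in> DD; D' \<in> DD; Id_on D \<in> \<eta>; Id_on D' \<in> \<eta>\<rbrakk> \<Longrightarrow> Id_on (D \<inter> D') \<in> \<eta>"
  shows "filt \<eta>"
proof -
  have e: "\<exists>D\<in>DD. e = Id_on D" if "e \<in> \<eta>" for e using subsetD[OF sub that] by auto
  have 1: "\<forall>e\<in>\<eta>. \<forall>f\<in>idems \<Lambda>. idem_le e f \<longrightarrow> f \<in> \<eta>"
  proof (intro ballI impI)
    fix e f assume a: "e \<in> \<eta>" "f \<in> idems \<Lambda>" "idem_le e f"
    obtain D where D: "D \<in> DD" "e = Id_on D" using e[OF a(1)] by (elim bexE)
    obtain D' where D': "D' \<in> DD" "f = Id_on D'" using a(2) unfolding idems_eq by (elim imageE)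
    show "f \<in> \<eta>" using up[of D D'] a D D' by simp
  qed
  have 2: "\<forall>e\<in>\<eta>. \<forall>f\<in>\<eta>. f O e \<in> \<eta>"
  proof (intro ballI)
    fix e f assume a: "e \<in> \<eta>" "f \<in> \<eta>"
    obtain D where D: "D \<in> DD" "e = Id_on D" using e[OF a(1)] by (elim bexE)
    obtain D' where D': "D' \<in> DD" "f = Id_on D'" using e[OF a(2)] by (elim bexE)
    show "f O e \<in> \<eta>" using int[of D' D] a D D' by simp
  qed
  show ?thesis unfolding is_filter_def using 1 2 sub ne by (simp add: idems_eq)
qed

lemma filt_eqI:
  assumes "filt \<eta>" "filt \<eta>'" "\<And>D. D \<in> DD \<Longrightarrow> Id_on D \<in> \<eta> \<longleftrightarrow> Id_on D \<in> \<eta>'"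
  shows "\<eta> = \<eta>'"
proof (intro equalityI subsetI)
  show "e \<in> \<eta>'" if "e \<in> \<eta>" for e using filtD(5)[OF assms(1) that] assms(3) that by auto
  show "e \<in> \<eta>" if "e \<in> \<eta>'" for e using filtD(5)[OF assms(2) that] assms(3) that by auto
qed

lemma filt_Inter:
  assumes "filt \<eta>" "finite F" "F \<noteq> {}" "\<And>D. D \<in> F \<Longrightarrow> Id_on D \<in> \<eta>"
  shows "Id_on (\<Inter>F) \<in> \<eta>"
  using assms(2-4) by (induction rule: finite_ne_induct) (auto intro: filtD(4)[OF assms(1)])

lemma filt_extend:
  assumes "filt \<eta>" "D \<in> DD" "\<And>D'. Id_on D' \<in> \<eta> \<Longrightarrow> D \<inter> D' \<noteq> {}"
  shows "\<exists>\<eta>'. filt \<eta>' \<and> \<eta> \<subseteq> \<eta>' \<and> Id_on D \<in> \<eta>'"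
proof -
  define \<eta>' where "\<eta>' = Id_on ` {E \<in> DD. \<exists>D'. Id_on D' \<in> \<eta> \<and> D \<inter> D' \<subseteq> E}"
  have mem: "Id_on E \<in> \<eta>' \<longleftrightarrow> E \<in> DD \<and> (\<exists>D'. Id_on D' \<in> \<eta> \<and> D \<inter> D' \<subseteq> E)" for E
    by (auto simp: \<eta>'_def)
  obtain D0 where D0: "D0 \<in> DD" "Id_on D0 \<in> \<eta>" using filtD(6)[OF assms(1)] by blast
  have "filt \<eta>'"
  proof (rule filtI)
    show "\<eta>' \<subseteq> Id_on ` DD" by (auto simp: \<eta>'_def)
    have "Id_on D \<in> \<eta>'" using D0 assms(2) mem[of D] by auto
    then show "\<eta>' \<noteq> {}" by blast
    show "Id_on {} \<notin> \<eta>'" using mem[of "{}"] assms(3) by simp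
    show "Id_on E' \<in> \<eta>'" if "E' \<in> DD" "Id_on E \<in> \<eta>'" "E \<subseteq> E'" for E E'
      using that mem[of E] mem[of E'] by (meson subset_trans)
    show "Id_on (E \<inter> E') \<in> \<eta>'" if E: "E \<in> DD" "E' \<in> DD" "Id_on E \<in> \<eta>'" "Id_on E' \<in> \<eta>'" for E E'
    proof -
      obtain A A' where "Id_on A \<in> \<eta>" "D \<inter> A \<subseteq> E" "Id_on A' \<in> \<eta>" "D \<inter> A' \<subseteq> E'" using E mem[of E] mem[of E'] by metis
      then have "Id_on (A \<inter> A') \<in> \<eta>" "D \<inter> (A \<inter> A') \<subseteq> E \<inter> E'"
        using filtD(4)[OF assms(1)] by auto
      then show ?thesis using DD_Int[OF E(1,2)] unfolding mem by (intro conjI exI)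
    qed
  qed
  moreover have "\<eta> \<subseteq> \<eta>'"
  proof
    fix e assume e: "e \<in> \<eta>"
    obtain E where E: "E \<in> DD" "e = Id_on E" using filtD(5)[OF assms(1) e] by (elim bexE)
    have "D \<inter> E \<subseteq> E" by simp
    then show "e \<in> \<eta>'" using E e mem[of E] by auto
  qed
  moreover have "Id_on D \<in> \<eta>'" using D0 assms(2) mem[of D] by auto
  ultimately show ?thesis by (intro exI conjI)
qed

lemma ultra_filt: "ultra \<eta> \<Longrightarrow> filt \<eta>"
  by (simp add: is_ultrafilter_def)

lemma ultra_exists:
  assumes "D \<in> DD" "D \<noteq> {}" shows "\<exists>\<zeta>. ultra \<zeta> \<and> Id_on D \<in> \<zeta>"
proof -
  let ?A = "{\<eta>. filt \<eta> \<and> Id_on D \<in> \<eta>}"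
  have "filt (Id_on ` {E \<in> DD. D \<subseteq> E})"
    by (rule filtI) (use assms DD_Int in auto)
  moreover have "Id_on D \<in> Id_on ` {E \<in> DD. D \<subseteq> E}" using assms(1) by blast
  ultimately have ne: "?A \<noteq> {}" by (metis (mono_tags, lifting) empty_iff mem_Collect_eq)
  have "\<exists>\<zeta>\<in>?A. \<forall>X\<in>?A. \<zeta> \<subseteq> X \<longrightarrow> X = \<zeta>"
  proof (rule subset_Zorn_nonempty[OF ne])
    fix C assume C: "C \<noteq> {}" "subset.chain ?A C"
    have CA: "filt \<eta>" "Id_on D \<in> \<eta>" if "\<eta> \<in> C" for \<eta> using C(2) that unfolding subset_chain_def by blast+
    have "filt (\<Union>C)"
    proof (rule filtI)
      show "\<Union>C \<subseteq> Id_on ` DD"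
      proof
        fix e assume "e \<in> \<Union>C"
        then obtain a where "a \<in> C" "e \<in> a" by (elim UnionE)
        then show "e \<in> Id_on ` DD" using filtD(5)[OF CA(1)] by auto
      qed
      obtain a where "a \<in> C" using C(1) by auto
      then show "\<Union>C \<noteq> {}" using CA(2)[of a] by auto
      show "Id_on {} \<notin> \<Union>C"
      proof
        assume "Id_on {} \<in> \<Union>C"
        then obtain a where "a \<in> C" "Id_on {} \<in> a" by (elim UnionE)
        then show False using filtD(2)[OF CA(1), of a "{}"] by simp
      qed
      show "Id_on E' \<in> \<Union>C" if E: "E' \<in> DD" "Id_on E \<in> \<Union>C" "E \<subseteq> E'" for E E'
      proof -
        obtain a where "a \<in> C" "Id_on E \<in> a" using E(2) by (elim UnionE)
        then show ?thesis using filtD(3)[OF CA(1), of a E E'] E by auto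
      qed
      show "Id_on (E \<inter> E') \<in> \<Union>C" if E: "Id_on E \<in> \<Union>C" "Id_on E' \<in> \<Union>C" for E E'
      proof -
        obtain a where a: "a \<in> C" "Id_on E \<in> a" using E(1) by (elim UnionE)
        obtain b where b: "b \<in> C" "Id_on E' \<in> b" using E(2) by (elim UnionE)
        have "a \<subseteq> b \<or> b \<subseteq> a" using C(2) a(1) b(1) unfolding subset_chain_def by simp
        then have "Id_on (E \<inter> E') \<in> a \<or> Id_on (E \<inter> E') \<in> b"
          using filtD(4)[OF CA(1)[OF a(1)], of E E'] filtD(4)[OF CA(1)[OF b(1)], of E E'] a b by auto
        then show ?thesis using UnionI[OF a(1)] UnionI[OF b(1)] by auto
      qed
    qed
    moreover obtain a where "a \<in> C" using C(1) by auto
    with CA(2)[OF this] have "Id_on D \<in> \<Union>C" by auto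
    ultimately show "\<Union>C \<in> ?A" by blast
  qed
  then obtain \<zeta> where z: "filt \<zeta>" "Id_on D \<in> \<zeta>" "\<And>X. \<lbrakk>filt X; Id_on D \<in> X; \<zeta> \<subseteq> X\<rbrakk> \<Longrightarrow> X = \<zeta>" by auto
  \<comment> \<open>Any filter above \<open>\<zeta>\<close> contains \<open>D\<close> as well, so
    maximality among the filters containing \<open>D\<close> is maximality among all
    filters.\<close>
  then have "ultra \<zeta>" unfolding is_ultrafilter_def by (auto dest: subsetD)
  then show ?thesis using z(2) by (intro exI conjI)
qed

lemma ultra_not_mem:
  assumes "ultra \<zeta>" "D \<in> DD" "Id_on D \<notin> \<zeta>"
  shows "\<exists>D'. Id_on D' \<in> \<zeta> \<and> D \<inter> D' = {}"
proof (rule ccontr)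
  assume "\<not> ?thesis"
  then have meets: "D \<inter> D' \<noteq> {}" if "Id_on D' \<in> \<zeta>" for D' using that by auto
  have "\<exists>\<eta>'. filt \<eta>' \<and> \<zeta> \<subseteq> \<eta>' \<and> Id_on D \<in> \<eta>'"
    by (rule filt_extend[OF ultra_filt[OF assms(1)] assms(2)]) (rule meets)
  then obtain \<eta>' where "filt \<eta>'" "\<zeta> \<subseteq> \<eta>'" "Id_on D \<in> \<eta>'" by (elim exE conjE)
  then show False using assms(1,3) unfolding is_ultrafilter_def by auto
qed

text \<open>If no member of \<open>F\<close> belonged to the ultrafilter, each would be disjoint
  from some member of it. Intersecting these finitely many sets with \<open>D\<close> gives a
  nonempty set below \<open>D\<close> that misses all of \<open>F\<close>.\<close>

lemma ultra_cover:
  assumes "ultra \<zeta>" "Id_on D \<in> \<zeta>" "finite F" "F \<subseteq> DD"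
    and cov: "\<And>D'. \<lbrakk>D' \<in> DD; D' \<noteq> {}; D' \<subseteq> D\<rbrakk> \<Longrightarrow> \<exists>E\<in>F. D' \<inter> E \<noteq> {}"
  shows "\<exists>E\<in>F. Id_on E \<in> \<zeta>"
proof (rule ccontr)
  note fz = ultra_filt[OF assms(1)]
  assume "\<not> ?thesis"
  then have "\<forall>E\<in>F. \<exists>D'. Id_on D' \<in> \<zeta> \<and> E \<inter> D' = {}"
    using ultra_not_mem[OF assms(1) subsetD[OF assms(4)]] by simp
  then obtain f where f: "\<And>E. E \<in> F \<Longrightarrow> Id_on (f E) \<in> \<zeta> \<and> E \<inter> f E = {}" by metis
  have "Id_on (\<Inter>(insert D (f ` F))) \<in> \<zeta>"
    by (rule filt_Inter[OF fz]) (use assms(2,3) f in auto)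
  moreover have "\<Inter>(insert D (f ` F)) \<inter> E = {}" if "E \<in> F" for E using f[OF that] that by auto
  ultimately show False using cov[of "\<Inter>(insert D (f ` F))"] filtD(1,2)[OF fz] by (metis Inter_lower insertI1)
qed

end

text \<open>\<open>topology_generated_by\<close> treats its argument as a subbase. Under the
  refinement hypothesis the family is already a base, so finite intersections disappear from the
  description of open sets.\<close>

lemma openin_generated_base:
  assumes "\<And>A B x. \<lbrakk>A \<in> S; B \<in> S; x \<in> A; x \<in> B\<rbrakk> \<Longrightarrow> \<exists>C\<in>S. x \<in> C \<and> C \<subseteq> A \<inter> B"
  shows "openin (topology_generated_by S) W \<longleftrightarrow> (\<forall>x\<in>W. \<exists>C\<in>S. x \<in> C \<and> C \<subseteq> W)"
proof
  assume "openin (topology_generated_by S) W"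
  then have "generate_topology_on S W" by (rule openin_topology_generated_by)
  then show "\<forall>x\<in>W. \<exists>C\<in>S. x \<in> C \<and> C \<subseteq> W"
  proof (induction rule: generate_topology_on.induct)
    case (Int a b)
    show ?case
    proof
      fix x assume x: "x \<in> a \<inter> b"
      obtain A B where AB: "A \<in> S" "x \<in> A" "A \<subseteq> a" "B \<in> S" "x \<in> B" "B \<subseteq> b" using Int.IH x by blast
      obtain C where "C \<in> S" "x \<in> C" "C \<subseteq> A \<inter> B" using assms AB by metis
      then show "\<exists>C\<in>S. x \<in> C \<and> C \<subseteq> a \<inter> b" using AB by blast
    qed
  next
    case (UN K)
    show ?case
    proof
      fix x assume "x \<in> \<Union>K"
      then obtain k where k: "k \<in> K" "x \<in> k" by blast
      then obtain C where "C \<in> S" "x \<in> C" "C \<subseteq> k" using UN.IH by blast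
      then show "\<exists>C\<in>S. x \<in> C \<and> C \<subseteq> \<Union>K" using k by blast
    qed
  qed auto
next
  assume R: "\<forall>x\<in>W. \<exists>C\<in>S. x \<in> C \<and> C \<subseteq> W"
  have "W = \<Union>{C \<in> S. C \<subseteq> W}" using R by blast
  also have "openin (topology_generated_by S) \<dots>" by (rule openin_Union) (auto intro: topology_generated_by_Basis)
  finally show "openin (topology_generated_by S) W" .
qed

context lcsc
begin

subsection \<open>The space of tight filters\<close>

abbreviation tight :: "'a pbij set set" where "tight \<equiv> tight_filters \<Lambda>"
abbreviation fin :: "'a pbij set \<Rightarrow> bool" where "fin X \<equiv> finite X \<and> X \<subseteq> idems \<Lambda>"
definition FN :: "'a pbij set \<Rightarrow> 'a pbij set \<Rightarrow> 'a pbij set set" where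
  "FN X Y = {\<eta>. filt \<eta> \<and> X \<subseteq> \<eta> \<and> Y \<inter> \<eta> = {}}"
definition N :: "'a pbij set \<Rightarrow> 'a pbij set \<Rightarrow> 'a pbij set set" where
  "N X Y = tight \<inter> FN X Y"

lemma filter_top_base:
  "openin (filter_top \<Lambda>) W \<longleftrightarrow> (\<forall>\<eta>\<in>W. \<exists>X Y. fin X \<and> fin Y \<and> \<eta> \<in> FN X Y \<and> FN X Y \<subseteq> W)"
proof -
  let ?S = "{FN X Y | X Y. fin X \<and> fin Y}"
  have eq: "filter_top \<Lambda> = topology_generated_by ?S"
    unfolding filter_top_def FN_def by (simp add: conj_assoc)
  have "openin (topology_generated_by ?S) W \<longleftrightarrow> (\<forall>\<eta>\<in>W. \<exists>C\<in>?S. \<eta> \<in> C \<and> C \<subseteq> W)"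
  proof (rule openin_generated_base)
    fix A B \<eta> assume "A \<in> ?S" "B \<in> ?S" and \<eta>: "\<eta> \<in> A" "\<eta> \<in> B"
    then obtain X Y X' Y' where A: "A = FN X Y" "fin X" "fin Y" and B: "B = FN X' Y'" "fin X'" "fin Y'" by auto
    have "A \<inter> B = FN (X \<union> X') (Y \<union> Y')" unfolding A B FN_def by auto
    moreover have "fin (X \<union> X')" "fin (Y \<union> Y')" using A B by auto
    then have "FN (X \<union> X') (Y \<union> Y') \<in> ?S" by blast
    ultimately show "\<exists>C\<in>?S. \<eta> \<in> C \<and> C \<subseteq> A \<inter> B" using \<eta> by auto
  qed
  also have "\<dots> \<longleftrightarrow> (\<forall>\<eta>\<in>W. \<exists>X Y. fin X \<and> fin Y \<and> \<eta> \<in> FN X Y \<and> FN X Y \<subseteq> W)"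
    by (rule ball_cong[OF HOL.refl]) auto
  finally show ?thesis unfolding eq .
qed

lemma openin_FN: "\<lbrakk>fin X; fin Y\<rbrakk> \<Longrightarrow> openin (filter_top \<Lambda>) (FN X Y)"
  unfolding filter_top_base by (intro ballI exI[of _ X] exI[of _ Y]) simp

lemma topspace_filter_top: "topspace (filter_top \<Lambda>) = Collect filt"
proof (intro equalityI subsetI)
  fix \<eta> assume "\<eta> \<in> topspace (filter_top \<Lambda>)"
  then show "\<eta> \<in> Collect filt" using openin_topspace[of "filter_top \<Lambda>"] unfolding filter_top_base FN_def by auto
next
  fix \<eta> assume "\<eta> \<in> Collect filt"
  then have "\<eta> \<in> FN {} {}" by (simp add: FN_def)
  then show "\<eta> \<in> topspace (filter_top \<Lambda>)" using openin_subset[OF openin_FN, of "{}" "{}"] by auto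
qed

lemma tight_iff:
  "\<eta> \<in> tight \<longleftrightarrow> filt \<eta> \<and> (\<forall>X Y. fin X \<longrightarrow> fin Y \<longrightarrow> \<eta> \<in> FN X Y \<longrightarrow> (\<exists>\<zeta>. ultra \<zeta> \<and> \<zeta> \<in> FN X Y))"
proof -
  have "\<eta> \<in> tight \<longleftrightarrow> filt \<eta> \<and> (\<forall>T. \<eta> \<in> T \<and> openin (filter_top \<Lambda>) T \<longrightarrow> (\<exists>\<zeta>. ultra \<zeta> \<and> \<zeta> \<in> T))"
    unfolding tight_filters_def in_closure_of topspace_filter_top by simp
  also have "\<dots> \<longleftrightarrow> filt \<eta> \<and> (\<forall>X Y. fin X \<longrightarrow> fin Y \<longrightarrow> \<eta> \<in> FN X Y \<longrightarrow> (\<exists>\<zeta>. ultra \<zeta> \<and> \<zeta> \<in> FN X Y))"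
  proof (intro conj_cong HOL.refl iffI allI impI; (elim conjE)?)
    fix X Y assume "\<forall>T. \<eta> \<in> T \<and> openin (filter_top \<Lambda>) T \<longrightarrow> (\<exists>\<zeta>. ultra \<zeta> \<and> \<zeta> \<in> T)"
      "finite X" "X \<subseteq> idems \<Lambda>" "finite Y" "Y \<subseteq> idems \<Lambda>" "\<eta> \<in> FN X Y"
    then show "\<exists>\<zeta>. ultra \<zeta> \<and> \<zeta> \<in> FN X Y" using openin_FN[of X Y] by simp
  next
    fix T assume R: "\<forall>X Y. fin X \<longrightarrow> fin Y \<longrightarrow> \<eta> \<in> FN X Y \<longrightarrow> (\<exists>\<zeta>. ultra \<zeta> \<and> \<zeta> \<in> FN X Y)"
      and T: "\<eta> \<in> T" "openin (filter_top \<Lambda>) T"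
    obtain X Y where XY: "fin X" "fin Y" "\<eta> \<in> FN X Y" "FN X Y \<subseteq> T"
      using T unfolding filter_top_base by metis
    obtain \<zeta> where "ultra \<zeta>" "\<zeta> \<in> FN X Y" using R XY(1-3) by metis
    then show "\<exists>\<zeta>. ultra \<zeta> \<and> \<zeta> \<in> T" using XY(4) by auto
  qed
  finally show ?thesis .
qed

lemma tight_filt: "\<eta> \<in> tight \<Longrightarrow> filt \<eta>"
  unfolding tight_iff by simp

lemma ultra_tight: "ultra \<eta> \<Longrightarrow> \<eta> \<in> tight"
  unfolding tight_iff using ultra_filt by auto

text \<open>Containing \<open>D\<close> and no member of the finite family \<open>F\<close> is an
  open condition on filters. A tight filter satisfying it would have an ultrafilter satisfying it
  nearby, against \<open>ultra_cover\<close>.\<close>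

lemma tight_cover:
  assumes "\<eta> \<in> tight" "Id_on D \<in> \<eta>" "finite F" "F \<subseteq> DD"
    and cov: "\<And>D'. \<lbrakk>D' \<in> DD; D' \<noteq> {}; D' \<subseteq> D\<rbrakk> \<Longrightarrow> \<exists>E\<in>F. D' \<inter> E \<noteq> {}"
  shows "\<exists>E\<in>F. Id_on E \<in> \<eta>"
proof (rule ccontr)
  assume not: "\<not> ?thesis"
  have f: "fin {Id_on D}" "fin (Id_on ` F)"
    using assms(3,4) filtD(1)[OF tight_filt[OF assms(1)] assms(2)] by auto
  have "\<eta> \<in> FN {Id_on D} (Id_on ` F)" using not assms(2) tight_filt[OF assms(1)] by (auto simp: FN_def)
  then obtain \<zeta> where z: "ultra \<zeta>" "\<zeta> \<in> FN {Id_on D} (Id_on ` F)"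
    using assms(1) f unfolding tight_iff by metis
  have "\<exists>E\<in>F. Id_on E \<in> \<zeta>"
    by (rule ultra_cover[OF z(1) _ assms(3,4) cov]) (use z(2) in \<open>auto simp: FN_def\<close>)
  then show False using z(2) by (auto simp: FN_def)
qed

lemma tight_Union:
  assumes "\<eta> \<in> tight" "Id_on D \<in> \<eta>" "finite F" "F \<subseteq> Mo" "D \<subseteq> (\<Union>\<alpha>\<in>F. RI \<alpha>)"
  shows "\<exists>\<alpha>\<in>F. Id_on (RI \<alpha>) \<in> \<eta>"
proof -
  have "\<exists>E\<in>RI ` F. Id_on E \<in> \<eta>"
  proof (rule tight_cover[OF assms(1,2)])
    fix D' assume "D' \<noteq> {}" "D' \<subseteq> D"
    then obtain x where "x \<in> D'" "x \<in> (\<Union>\<alpha>\<in>F. RI \<alpha>)" using assms(5) by (meson ex_in_conv subsetD)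
    then show "\<exists>E\<in>RI ` F. D' \<inter> E \<noteq> {}" by auto
  qed (use assms DD_RI in auto)
  then show ?thesis by auto
qed

text \<open>\<open>D\<close> is a finite union of principal ideals, and a tight filter has to choose
  one of them. Tight filters are therefore determined by the principal ideals that they
  contain.\<close>

lemma tight_RI:
  assumes "\<eta> \<in> tight" "Id_on D \<in> \<eta>"
  shows "\<exists>\<alpha>\<in>Mo. RI \<alpha> \<subseteq> D \<and> Id_on (RI \<alpha>) \<in> \<eta>"
proof -
  have "D \<in> DD" using filtD(1)[OF tight_filt[OF assms(1)] assms(2)] .
  then obtain F where F: "finite F" "F \<subseteq> Mo" "D = (\<Union>\<alpha>\<in>F. RI \<alpha>)" using DD_decomp by metis
  then obtain \<alpha> where "\<alpha> \<in> F" "Id_on (RI \<alpha>) \<in> \<eta>" using tight_Union[OF assms F(1,2)] by auto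
  then show ?thesis using F by auto
qed

lemma closed_FN:
  assumes "fin X" "fin Y" shows "closedin (filter_top \<Lambda>) (FN X Y)"
proof -
  have "openin (filter_top \<Lambda>) (Collect filt - FN X Y)"
    unfolding filter_top_base
  proof
    fix \<eta> assume \<eta>: "\<eta> \<in> Collect filt - FN X Y"
    then consider e where "e \<in> X" "e \<notin> \<eta>" | e where "e \<in> Y" "e \<in> \<eta>" by (auto simp: FN_def)
    then show "\<exists>X' Y'. fin X' \<and> fin Y' \<and> \<eta> \<in> FN X' Y' \<and> FN X' Y' \<subseteq> Collect filt - FN X Y"
    proof cases
      case 1
      have "fin {}" "fin {e}" "\<eta> \<in> FN {} {e}" "FN {} {e} \<subseteq> Collect filt - FN X Y" using 1 \<eta> assms by (auto simp: FN_def)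
      then show ?thesis by metis
    next
      case 2
      have "fin {e}" "fin {}" "\<eta> \<in> FN {e} {}" "FN {e} {} \<subseteq> Collect filt - FN X Y" using 2 \<eta> assms by (auto simp: FN_def)
      then show ?thesis by metis
    qed
  qed
  moreover have "FN X Y \<subseteq> Collect filt" by (auto simp: FN_def)
  ultimately show ?thesis unfolding closedin_def topspace_filter_top by simp
qed

text \<open>Compactness by Alexander's subbase theorem: if subbasic sets cover the filters containing
  \<open>D0\<close>, they cover the one generated by \<open>D0\<close> and the \<open>D\<close> whose absence defines a member of the
  cover, unless \<open>D0\<close> and finitely many of these \<open>D\<close> have empty intersection.\<close>

lemma compact_filters:
  assumes D0: "D0 \<in> DD"
  shows "compactin (filter_top \<Lambda>) (FN {Id_on D0} {})"
proof -
  let ?K = "FN {Id_on D0} {}"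
  define A where "A D = {\<eta>::'a pbij set. Id_on D \<in> \<eta>}" for D :: "'a set"
  define B where "B D = {\<eta>::'a pbij set. Id_on D \<notin> \<eta>}" for D :: "'a set"
  define Sb where "Sb = A ` DD \<union> B ` DD"
  \<comment> \<open>Alexander's theorem is applied to the topology on \<open>?K\<close> whose
    subbase consists of the conditions that \<open>D\<close> is present or absent. Later
    \<open>fine\<close> shows that it refines the filter topology, so compactness is transported by
    the identity map.\<close>
  define X where "X = topology (arbitrary union_of (finite intersection_of (\<lambda>x. x \<in> Sb) relative_to ?K))"
  have "compact_space X"
  proof (rule Alexander_subbase_alt[OF _ _ X_def[symmetric]])
    show "?K \<subseteq> \<Union>Sb" using D0 by (auto simp: Sb_def A_def FN_def)
    fix C assume C: "C \<subseteq> Sb" "?K \<subseteq> \<Union>C"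
    define Q where "Q = {D \<in> DD. B D \<in> C}"
    define m where "m E \<longleftrightarrow> (\<exists>F. finite F \<and> F \<subseteq> Q \<and> D0 \<inter> \<Inter>F \<subseteq> E)" for E
    have cov: "?K \<subseteq> A E \<union> \<Union>(B ` F)" if F: "finite F" "F \<subseteq> Q" "D0 \<inter> \<Inter>F \<subseteq> E" "E \<in> DD" for E F
    proof
      fix \<eta> assume \<eta>: "\<eta> \<in> ?K"
      then have f: "filt \<eta>" "Id_on D0 \<in> \<eta>" by (auto simp: FN_def)
      show "\<eta> \<in> A E \<union> \<Union>(B ` F)"
      proof (rule ccontr)
        assume "\<eta> \<notin> A E \<union> \<Union>(B ` F)"
        then have n: "Id_on E \<notin> \<eta>" "\<And>D. D \<in> F \<Longrightarrow> Id_on D \<in> \<eta>" by (auto simp: A_def B_def)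
        have "Id_on (\<Inter>(insert D0 F)) \<in> \<eta>"
          by (rule filt_Inter[OF f(1)]) (use F n f in auto)
        then show False using filtD(3)[OF f(1) _ _ F(4)] F(3) n(1) by simp
      qed
    qed
    show "\<exists>C'. finite C' \<and> C' \<subseteq> C \<and> ?K \<subseteq> \<Union>C'"
    proof (cases "m {}")
      case True
      then obtain F where F: "finite F" "F \<subseteq> Q" "D0 \<inter> \<Inter>F \<subseteq> {}" unfolding m_def by metis
      have "?K \<subseteq> \<Union>(B ` F)"
      proof
        fix \<eta> assume \<eta>: "\<eta> \<in> ?K"
        then have f: "filt \<eta>" "Id_on D0 \<in> \<eta>" by (auto simp: FN_def)
        show "\<eta> \<in> \<Union>(B ` F)"
        proof (rule ccontr)
          assume "\<eta> \<notin> \<Union>(B ` F)"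
          then have n: "\<And>D. D \<in> F \<Longrightarrow> Id_on D \<in> \<eta>" by (auto simp: B_def)
          have "Id_on (\<Inter>(insert D0 F)) \<in> \<eta>"
            by (rule filt_Inter[OF f(1)]) (use F n f in auto)
          then show False using filtD(2)[OF f(1)] F(3) by auto
        qed
      qed
      moreover have "B ` F \<subseteq> C" using F(2) by (auto simp: Q_def)
      ultimately show ?thesis using F(1) by (intro exI[of _ "B ` F"]) simp
    next
      case False
      define \<eta> where "\<eta> = Id_on ` {E \<in> DD. m E}"
      have mem: "Id_on E \<in> \<eta> \<longleftrightarrow> E \<in> DD \<and> m E" for E by (auto simp: \<eta>_def)
      have mI: "m E" if "finite F" "F \<subseteq> Q" "D0 \<inter> \<Inter>F \<subseteq> E" for E F using that unfolding m_def by (intro exI conjI)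
      have mD0: "m D0" by (rule mI[of "{}"]) auto
      have "filt \<eta>"
      proof (rule filtI)
        show "Id_on {} \<notin> \<eta>" unfolding mem using False by blast
        have "Id_on D0 \<in> \<eta>" using mem mD0 D0 by simp
        then show "\<eta> \<noteq> {}" by auto
        show "Id_on D' \<in> \<eta>" if D: "D' \<in> DD" "Id_on D \<in> \<eta>" "D \<subseteq> D'" for D D'
        proof -
          obtain F where "finite F" "F \<subseteq> Q" "D0 \<inter> \<Inter>F \<subseteq> D" using D(2) unfolding mem m_def by auto
          then show ?thesis using mI[of F D'] D mem by auto
        qed
        show "Id_on (D \<inter> D') \<in> \<eta>" if D: "D \<in> DD" "D' \<in> DD" "Id_on D \<in> \<eta>" "Id_on D' \<in> \<eta>" for D D'
        proof -
          obtain F where F: "finite F" "F \<subseteq> Q" "D0 \<inter> \<Inter>F \<subseteq> D" using D(3) unfolding mem m_def by auto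
          obtain F' where F': "finite F'" "F' \<subseteq> Q" "D0 \<inter> \<Inter>F' \<subseteq> D'" using D(4) unfolding mem m_def by auto
          have "m (D \<inter> D')" by (rule mI[of "F \<union> F'"]) (use F F' in auto)
          then show ?thesis using DD_Int[OF D(1,2)] mem by simp
        qed
      qed (auto simp: \<eta>_def)
      then have "\<eta> \<in> ?K" using mem mD0 D0 by (auto simp: FN_def)
      then obtain c where c: "c \<in> C" "\<eta> \<in> c" using C(2) by auto
      then consider D where "D \<in> DD" "c = A D" | D where "D \<in> DD" "c = B D" using C(1) unfolding Sb_def by auto
      then show ?thesis
      proof cases
        case 1
        then have "m D" using c(2) mem by (simp add: A_def)
        then obtain F where F: "finite F" "F \<subseteq> Q" "D0 \<inter> \<Inter>F \<subseteq> D" unfolding m_def by metis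
        have "?K \<subseteq> \<Union>(insert (A D) (B ` F))" using cov[OF F 1(1)] by simp
        moreover have "insert (A D) (B ` F) \<subseteq> C" using F(2) c(1) 1(2) by (auto simp: Q_def)
        ultimately show ?thesis using F(1) by (intro exI[of _ "insert (A D) (B ` F)"]) simp
      next
        case 2
        then have "m D" using c(1) by (intro mI[of "{D}"]) (auto simp: Q_def)
        then show ?thesis using 2 c(2) mem by (simp add: B_def)
      qed
    qed
  qed
  have tX: "topspace X = ?K" unfolding X_def topspace_subbase ..
  have oX: "openin X (?K \<inter> b)" if b: "b \<in> Sb" for b
    unfolding X_def openin_subbase
  proof (rule arbitrary_union_of_inc)
    have "(finite intersection_of (\<lambda>x. x \<in> Sb)) b" using b by (rule finite_intersection_of_inc)
    then show "((finite intersection_of (\<lambda>x. x \<in> Sb)) relative_to ?K) (?K \<inter> b)" by (rule relative_to_inc)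
  qed
  have oA: "openin X {\<eta> \<in> ?K. Z \<subseteq> \<eta>}" if "fin Z" for Z
  proof -
    have "finite Z" "Z \<subseteq> idems \<Lambda>" using that by auto
    then show ?thesis
    proof (induction Z)
      case empty
      then show ?case using openin_topspace[of X] tX by simp
    next
      case (insert e Z)
      obtain D where D: "D \<in> DD" "e = Id_on D" using insert.prems idems_eq by auto
      have "{\<eta> \<in> ?K. insert e Z \<subseteq> \<eta>} = (?K \<inter> A D) \<inter> {\<eta> \<in> ?K. Z \<subseteq> \<eta>}" using D by (auto simp: A_def)
      moreover have "openin X (?K \<inter> A D)" using oX D by (simp add: Sb_def)
      moreover have "openin X {\<eta> \<in> ?K. Z \<subseteq> \<eta>}" using insert by simp
      ultimately show ?case by (simp only: openin_Int)
    qed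
  qed
  have oB: "openin X {\<eta> \<in> ?K. Z \<inter> \<eta> = {}}" if "fin Z" for Z
  proof -
    have "finite Z" "Z \<subseteq> idems \<Lambda>" using that by auto
    then show ?thesis
    proof (induction Z)
      case empty
      then show ?case using openin_topspace[of X] tX by simp
    next
      case (insert e Z)
      obtain D where D: "D \<in> DD" "e = Id_on D" using insert.prems idems_eq by auto
      have "{\<eta> \<in> ?K. insert e Z \<inter> \<eta> = {}} = (?K \<inter> B D) \<inter> {\<eta> \<in> ?K. Z \<inter> \<eta> = {}}" using D by (auto simp: B_def)
      moreover have "openin X (?K \<inter> B D)" using oX D by (simp add: Sb_def)
      moreover have "openin X {\<eta> \<in> ?K. Z \<inter> \<eta> = {}}" using insert by simp
      ultimately show ?case by (simp only: openin_Int)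
    qed
  qed
  have fine: "openin X (?K \<inter> W)" if W: "openin (filter_top \<Lambda>) W" for W
  proof (subst openin_subopen, intro ballI)
    fix \<eta> assume \<eta>: "\<eta> \<in> ?K \<inter> W"
    then obtain Z Y where Z: "fin Z" "fin Y" "\<eta> \<in> FN Z Y" "FN Z Y \<subseteq> W"
      using W unfolding filter_top_base by (metis IntD2)
    have "openin X ({\<eta> \<in> ?K. Z \<subseteq> \<eta>} \<inter> {\<eta> \<in> ?K. Y \<inter> \<eta> = {}})" using oA[OF Z(1)] oB[OF Z(2)] by (rule openin_Int)
    moreover have "{\<eta> \<in> ?K. Z \<subseteq> \<eta>} \<inter> {\<eta> \<in> ?K. Y \<inter> \<eta> = {}} \<subseteq> ?K \<inter> W" using Z(4) by (auto simp: FN_def)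
    moreover have "\<eta> \<in> {\<eta> \<in> ?K. Z \<subseteq> \<eta>} \<inter> {\<eta> \<in> ?K. Y \<inter> \<eta> = {}}" using \<eta> Z(3) by (auto simp: FN_def)
    ultimately show "\<exists>T. openin X T \<and> \<eta> \<in> T \<and> T \<subseteq> ?K \<inter> W" by (intro exI conjI)
  qed
  have "continuous_map X (filter_top \<Lambda>) id"
    unfolding continuous_map_def tX topspace_filter_top
  proof (intro conjI allI impI)
    show "id \<in> ?K \<rightarrow> Collect filt" by (auto simp: FN_def)
    fix U assume "openin (filter_top \<Lambda>) U"
    from fine[OF this] show "openin X {x \<in> ?K. id x \<in> U}" by (simp add: Int_def)
  qed
  then have "compactin (filter_top \<Lambda>) (id ` ?K)"
    using \<open>compact_space X\<close> tX by (metis compact_space_def image_compactin)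
  then show ?thesis by simp
qed

text \<open>A member of \<open>X\<close> places the set, which is closed, inside the compact set of
  filters containing that idempotent. The space of all tight filters may fail to be compact, whence
  \<open>X \<noteq> {}\<close>.\<close>

lemma compact_N:
  assumes "fin X" "fin Y" "X \<noteq> {}" shows "compactin (filter_top \<Lambda>) (N X Y)"
proof -
  obtain e where e: "e \<in> X" using assms(3) by auto
  then obtain D where D: "D \<in> DD" "e = Id_on D" using assms(1) idems_eq by auto
  have "closedin (filter_top \<Lambda>) (N X Y)"
    unfolding N_def tight_filters_def using closed_FN[OF assms(1,2)] by (intro closedin_Int closedin_closure_of)
  moreover have "N X Y \<subseteq> FN {Id_on D} {}" using e D by (auto simp: N_def FN_def)
  ultimately show ?thesis using closed_compactin[OF compact_filters[OF D(1)]] by metis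
qed

subsection \<open>The action\<close>

text \<open>Membership in the translated filter is tested on preimages: \<open>s\<close> carries
  \<open>E\<close> into \<open>D\<close> exactly if \<open>E \<inter> Domain s\<close> lies in the
  preimage of \<open>D\<close>. The properties of the action thereby reduce to the behaviour of
  preimages of sets.\<close>

lemma mem_act:
  assumes "s \<in> S\<^sub>\<Lambda>" "filt \<eta>" "Id_on (Domain s) \<in> \<eta>"
  shows "Id_on D \<in> act \<Lambda> s \<eta> \<longleftrightarrow> D \<in> DD \<and> Id_on (s\<inverse> `` D) \<in> \<eta>"
proof
  assume "Id_on D \<in> act \<Lambda> s \<eta>"
  then obtain e where e: "D \<in> DD" "e \<in> \<eta>" "idem_le (s\<inverse> O (e O s)) (Id_on D)" unfolding act_def by auto
  obtain E where E: "E \<in> DD" "e = Id_on E" using filtD(5)[OF assms(2) e(2)] by (elim bexE)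
  have "s `` E \<subseteq> D" using e(3) unfolding E(2) conj_Id_on[OF assms(1)] by simp
  then have "E \<inter> Domain s \<subseteq> s\<inverse> `` D" by auto
  moreover have "Id_on (E \<inter> Domain s) \<in> \<eta>" using filtD(4)[OF assms(2)] assms(3) e(2) E by simp
  moreover have "s\<inverse> `` D \<in> DD" using DD_Image[OF S_converse[OF assms(1)] e(1)] .
  ultimately show "D \<in> DD \<and> Id_on (s\<inverse> `` D) \<in> \<eta>" using filtD(3)[OF assms(2)] e(1) by simp
next
  assume D: "D \<in> DD \<and> Id_on (s\<inverse> `` D) \<in> \<eta>"
  have "s `` (s\<inverse> `` D) \<subseteq> D" using pbijD(1)[OF assms(1)] by auto
  then have "idem_le (s\<inverse> O (Id_on (s\<inverse> `` D) O s)) (Id_on D)" unfolding conj_Id_on[OF assms(1)] by simp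
  then show "Id_on D \<in> act \<Lambda> s \<eta>" unfolding act_def using D by auto
qed

lemma act_subset: "act \<Lambda> s \<eta> \<subseteq> Id_on ` DD"
  unfolding act_def idems_eq by auto

lemma act_filt:
  assumes "s \<in> S\<^sub>\<Lambda>" "filt \<eta>" "Id_on (Domain s) \<in> \<eta>"
  shows "filt (act \<Lambda> s \<eta>)" "Id_on (Range s) \<in> act \<Lambda> s \<eta>"
proof -
  note mem = mem_act[OF assms]
  have "s\<inverse> `` Range s = Domain s" by auto
  moreover have R: "Range s \<in> DD" using DD_Domain[OF S_converse[OF assms(1)]] by simp
  ultimately show 1: "Id_on (Range s) \<in> act \<Lambda> s \<eta>" unfolding mem using assms(3) by simp
  show "filt (act \<Lambda> s \<eta>)"
  proof (rule filtI[OF act_subset])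
    show "act \<Lambda> s \<eta> \<noteq> {}" using 1 by auto
    show "Id_on {} \<notin> act \<Lambda> s \<eta>" unfolding mem using filtD(2)[OF assms(2), of "{}"] by auto
    fix D D' assume D: "D \<in> DD" "D' \<in> DD" "Id_on D \<in> act \<Lambda> s \<eta>"
    have pD': "s\<inverse> `` D' \<in> DD" using DD_Image[OF S_converse[OF assms(1)] D(2)] .
    show "Id_on D' \<in> act \<Lambda> s \<eta>" if "D \<subseteq> D'"
    proof -
      have "s\<inverse> `` D \<subseteq> s\<inverse> `` D'" using that by auto
      then show ?thesis using filtD(3)[OF assms(2) _ _ pD'] D unfolding mem by auto
    qed
    show "Id_on (D \<inter> D') \<in> act \<Lambda> s \<eta>" if "Id_on D' \<in> act \<Lambda> s \<eta>"
    proof -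
      have "s\<inverse> `` (D \<inter> D') = s\<inverse> `` D \<inter> s\<inverse> `` D'" using pbijD(1)[OF assms(1)] by auto
      then show ?thesis using filtD(4)[OF assms(2)] D that DD_Int unfolding mem by simp
    qed
  qed
qed

lemma act_act:
  assumes s: "s \<in> S\<^sub>\<Lambda>" and t: "t \<in> S\<^sub>\<Lambda>" and \<eta>: "filt \<eta>" "Id_on (Domain t) \<in> \<eta>" "Id_on (Domain s) \<in> act \<Lambda> t \<eta>"
  shows "Id_on (Domain (t O s)) \<in> \<eta>" "act \<Lambda> s (act \<Lambda> t \<eta>) = act \<Lambda> (t O s) \<eta>"
proof -
  have st: "t O s \<in> S\<^sub>\<Lambda>" using inv_semigroup.mul[OF s t] .
  have "Domain (t O s) = t\<inverse> `` Domain s" by auto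
  then show D: "Id_on (Domain (t O s)) \<in> \<eta>" using \<eta>(3) unfolding mem_act[OF t \<eta>(1,2)] by simp
  note f = act_filt(1)[OF t \<eta>(1,2)]
  show "act \<Lambda> s (act \<Lambda> t \<eta>) = act \<Lambda> (t O s) \<eta>"
  proof (rule filt_eqI)
    show "filt (act \<Lambda> s (act \<Lambda> t \<eta>))" using act_filt(1)[OF s f \<eta>(3)] .
    show "filt (act \<Lambda> (t O s) \<eta>)" using act_filt(1)[OF st \<eta>(1) D] .
    fix E assume E: "E \<in> DD"
    have "s\<inverse> `` E \<in> DD" using DD_Image[OF S_converse[OF s] E] .
    moreover have "(t O s)\<inverse> `` E = t\<inverse> `` (s\<inverse> `` E)" by auto
    ultimately show "Id_on E \<in> act \<Lambda> s (act \<Lambda> t \<eta>) \<longleftrightarrow> Id_on E \<in> act \<Lambda> (t O s) \<eta>"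
      unfolding mem_act[OF s f \<eta>(3)] mem_act[OF t \<eta>(1,2)] mem_act[OF st \<eta>(1) D] by simp
  qed
qed

lemma act_Id_on:
  assumes "filt \<eta>" "Id_on D \<in> \<eta>" shows "act \<Lambda> (Id_on D) \<eta> = \<eta>"
proof -
  have D: "Id_on D \<in> S\<^sub>\<Lambda>" "Domain (Id_on D) = D" using filtD(1)[OF assms] by (auto simp: DD_def)
  have f: "filt (act \<Lambda> (Id_on D) \<eta>)" using act_filt(1)[OF D(1) assms(1)] D(2) assms(2) by simp
  show ?thesis
  proof (rule filt_eqI[OF f assms(1)])
    fix E assume E: "E \<in> DD"
    have "(Id_on D)\<inverse> `` E = D \<inter> E" by auto
    then show "Id_on E \<in> act \<Lambda> (Id_on D) \<eta> \<longleftrightarrow> Id_on E \<in> \<eta>"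
      using mem_act[OF D(1) assms(1), of E] D(2) assms(2) E filtD(3)[OF assms(1), of "D \<inter> E" E] filtD(4)[OF assms(1,2), of E]
      by auto
  qed
qed

lemma act_inverse:
  assumes "s \<in> S\<^sub>\<Lambda>" "filt \<eta>" "Id_on (Domain s) \<in> \<eta>"
  shows "act \<Lambda> (s\<inverse>) (act \<Lambda> s \<eta>) = \<eta>"
  using act_act(2)[OF S_converse[OF assms(1)] assms] act_filt(2)[OF assms] act_Id_on[OF assms(2,3)]
    S_Domain[OF assms(1)] by simp

text \<open>This is contravariant: each set is replaced by its preimage under \<open>s\<close>, so
  that conditions on \<open>act \<Lambda> s \<eta>\<close> become conditions on
  \<open>\<eta>\<close>.\<close>

definition push :: "'a pbij \<Rightarrow> 'a pbij set \<Rightarrow> 'a pbij set" where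
  "push s X = (\<lambda>e. Id_on (s\<inverse> `` Domain e)) ` X"

lemma push_fin: assumes "s \<in> S\<^sub>\<Lambda>" "fin X" shows "fin (push s X)"
  using assms DD_Image[OF S_converse[OF assms(1)]] by (auto simp: push_def idems_eq)

lemma act_FN:
  assumes s: "s \<in> S\<^sub>\<Lambda>" and \<eta>: "filt \<eta>" "Id_on (Domain s) \<in> \<eta>" and X: "X \<subseteq> idems \<Lambda>" "Y \<subseteq> idems \<Lambda>"
  shows "act \<Lambda> s \<eta> \<in> FN X Y \<longleftrightarrow> \<eta> \<in> FN (push s X) (push s Y)"
proof -
  have *: "e \<in> act \<Lambda> s \<eta> \<longleftrightarrow> Id_on (s\<inverse> `` Domain e) \<in> \<eta>" if e: "e \<in> idems \<Lambda>" for e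
  proof -
    obtain D where D: "D \<in> DD" "e = Id_on D" using e unfolding idems_eq by (elim imageE)
    then show ?thesis using mem_act[OF s \<eta>, of D] by simp
  qed
  have "X \<subseteq> act \<Lambda> s \<eta> \<longleftrightarrow> push s X \<subseteq> \<eta>"
    unfolding push_def image_subset_iff subset_eq[of X] using *[OF subsetD[OF X(1)]] by simp
  moreover have "Y \<inter> act \<Lambda> s \<eta> = {} \<longleftrightarrow> (\<forall>e\<in>Y. Id_on (s\<inverse> `` Domain e) \<notin> \<eta>)"
    unfolding disjoint_iff Ball_def using *[OF subsetD[OF X(2)]] by simp
  moreover have "push s Y \<inter> \<eta> = {} \<longleftrightarrow> (\<forall>e\<in>Y. Id_on (s\<inverse> `` Domain e) \<notin> \<eta>)"
    unfolding push_def disjoint_iff by auto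
  ultimately show ?thesis using act_filt(1)[OF s \<eta>] \<eta>(1) by (simp add: FN_def)
qed

text \<open>A filter above the translate, moved back by the inverse of \<open>s\<close>, lies above
  \<open>\<zeta>\<close> and hence equals it; moving forward again identifies it with the
  translate.\<close>

lemma act_ultra:
  assumes s: "s \<in> S\<^sub>\<Lambda>" and z: "ultra \<zeta>" "Id_on (Domain s) \<in> \<zeta>"
  shows "ultra (act \<Lambda> s \<zeta>)"
  unfolding is_ultrafilter_def
proof (intro conjI allI impI; (elim conjE)?)
  note f = ultra_filt[OF z(1)]
  note a = act_filt[OF s f z(2)]
  note s' = S_converse[OF s]
  show "filt (act \<Lambda> s \<zeta>)" by (rule a)
  fix \<eta>' assume \<eta>': "filt \<eta>'" "act \<Lambda> s \<zeta> \<subseteq> \<eta>'"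
  have R: "Id_on (Domain (s\<inverse>)) \<in> \<eta>'" "Id_on (Domain (s\<inverse>)) \<in> act \<Lambda> s \<zeta>" using a(2) \<eta>'(2) by auto
  have f': "filt (act \<Lambda> (s\<inverse>) \<eta>')" using act_filt(1)[OF s' \<eta>'(1) R(1)] .
  have "act \<Lambda> (s\<inverse>) (act \<Lambda> s \<zeta>) \<subseteq> act \<Lambda> (s\<inverse>) \<eta>'"
    using \<eta>'(2) unfolding act_def by auto
  then have "\<zeta> \<subseteq> act \<Lambda> (s\<inverse>) \<eta>'" using act_inverse[OF s f z(2)] by simp
  then have eq: "act \<Lambda> (s\<inverse>) \<eta>' = \<zeta>" using z(1) f' unfolding is_ultrafilter_def by simp
  show "\<eta>' = act \<Lambda> s \<zeta>"
    using act_inverse[OF s' \<eta>'(1) R(1)] eq by simp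
qed

text \<open>A basic neighbourhood of the translate corresponds under \<open>push\<close> to one of
  \<open>\<eta>\<close>, which contains an ultrafilter; the action preserves ultrafilters. Adding
  \<open>Id_on (Domain s)\<close> to the conditions ensures that this ultrafilter lies in the domain
  of the action.\<close>

lemma act_tight:
  assumes s: "s \<in> S\<^sub>\<Lambda>" and \<eta>: "\<eta> \<in> tight" "Id_on (Domain s) \<in> \<eta>"
  shows "act \<Lambda> s \<eta> \<in> tight"
  unfolding tight_iff
proof (intro conjI allI impI)
  note f = tight_filt[OF \<eta>(1)]
  show "filt (act \<Lambda> s \<eta>)" using act_filt(1)[OF s f \<eta>(2)] .
  fix X Y assume XY: "fin X" "fin Y" "act \<Lambda> s \<eta> \<in> FN X Y"
  let ?X = "insert (Id_on (Domain s)) (push s X)"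
  have fi: "fin ?X" "fin (push s Y)" using push_fin[OF s] XY DD_Domain[OF s] by auto
  have "\<eta> \<in> FN ?X (push s Y)" using XY(3) act_FN[OF s f \<eta>(2)] XY \<eta>(2) by (auto simp: FN_def)
  then obtain \<zeta> where z: "ultra \<zeta>" "\<zeta> \<in> FN ?X (push s Y)" using \<eta>(1) fi unfolding tight_iff by metis
  then have D: "Id_on (Domain s) \<in> \<zeta>" "\<zeta> \<in> FN (push s X) (push s Y)" by (auto simp: FN_def)
  then have "act \<Lambda> s \<zeta> \<in> FN X Y" using act_FN[OF s ultra_filt[OF z(1)] D(1)] XY by simp
  then show "\<exists>\<zeta>. ultra \<zeta> \<and> \<zeta> \<in> FN X Y" using act_ultra[OF s z(1) D(1)] by (intro exI conjI)
qed

lemma act_N: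
  assumes s: "s \<in> S\<^sub>\<Lambda>" and X: "X \<subseteq> idems \<Lambda>" "Y \<subseteq> idems \<Lambda>"
  shows "{\<eta> \<in> tight. Id_on (Domain s) \<in> \<eta> \<and> act \<Lambda> s \<eta> \<in> N X Y} = N (insert (Id_on (Domain s)) (push s X)) (push s Y)"
proof (intro equalityI subsetI)
  fix \<eta> assume "\<eta> \<in> {\<eta> \<in> tight. Id_on (Domain s) \<in> \<eta> \<and> act \<Lambda> s \<eta> \<in> N X Y}"
  then have \<eta>: "\<eta> \<in> tight" "Id_on (Domain s) \<in> \<eta>" "act \<Lambda> s \<eta> \<in> N X Y" by auto
  then show "\<eta> \<in> N (insert (Id_on (Domain s)) (push s X)) (push s Y)"
    using act_FN[OF s tight_filt[OF \<eta>(1)] \<eta>(2) X] by (auto simp: N_def FN_def)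
next
  fix \<eta> assume \<eta>: "\<eta> \<in> N (insert (Id_on (Domain s)) (push s X)) (push s Y)"
  then have 1: "\<eta> \<in> tight" "Id_on (Domain s) \<in> \<eta>" by (auto simp: N_def FN_def)
  moreover have "\<eta> \<in> FN (push s X) (push s Y)" using \<eta> by (auto simp: N_def FN_def)
  ultimately show "\<eta> \<in> {\<eta> \<in> tight. Id_on (Domain s) \<in> \<eta> \<and> act \<Lambda> s \<eta> \<in> N X Y}"
    using act_FN[OF s tight_filt[OF 1(1)] 1(2) X] act_tight[OF s 1] by (simp add: N_def)
qed

end

section \<open>The tight groupoid is ample\<close>

lemma image_const: "\<lbrakk>a \<in> A; \<And>x. x \<in> A \<Longrightarrow> F x = c\<rbrakk> \<Longrightarrow> F ` A = {c}"
  by (auto simp: image_iff)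

lemma UN_const: "\<lbrakk>a \<in> A; \<And>x. x \<in> A \<Longrightarrow> F x = c\<rbrakk> \<Longrightarrow> (\<Union>x\<in>A. F x) = c"
  by auto

context lcsc
begin

abbreviation "TG \<equiv> tight_groupoid \<Lambda>"
abbreviation "GP \<equiv> germ_pairs \<Lambda>"
definition \<Theta> :: "'a pbij \<Rightarrow> 'a pbij set set \<Rightarrow> 'a germ set" where
  "\<Theta> s V = germ \<Lambda> s ` V"
definition dom_filters :: "'a pbij \<Rightarrow> 'a pbij set set" where
  "dom_filters s = {\<eta> \<in> tight. Id_on (Domain s) \<in> \<eta>}"

lemma GP_iff: "(s, \<eta>) \<in> GP \<longleftrightarrow> s \<in> S\<^sub>\<Lambda> \<and> \<eta> \<in> dom_filters s"
  unfolding germ_pairs_def dom_filters_def using S_Domain[of s] by auto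

lemma germ_mem: "(t, \<eta>') \<in> germ \<Lambda> s \<eta> \<longleftrightarrow> (t, \<eta>') \<in> GP \<and> \<eta>' = \<eta> \<and> (\<exists>e\<in>\<eta>. e O s = e O t)"
  by (simp add: germ_def)

lemma restrict_iff:
  fixes s t :: "('b \<times> 'c) set"
  shows "Id_on E O s = Id_on E O t \<longleftrightarrow> (\<forall>x\<in>E. \<forall>y. (x, y) \<in> s \<longleftrightarrow> (x, y) \<in> t)"
proof -
  have "Id_on E O v = {(x, y). x \<in> E \<and> (x, y) \<in> v}" for v :: "('b \<times> 'c) set" by auto
  then show ?thesis by (simp add: set_eq_iff) blast
qed

lemma germ_eqI:
  assumes \<eta>: "filt \<eta>" and E: "Id_on E \<in> \<eta>" "Id_on E O s = Id_on E O t"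
  shows "germ \<Lambda> s \<eta> = germ \<Lambda> t \<eta>"
proof -
  have *: "\<exists>e\<in>\<eta>. e O t = e O u" if st: "Id_on E O s = Id_on E O t" and ex: "\<exists>e\<in>\<eta>. e O s = e O u" for s t u
  proof -
    obtain e where e: "e \<in> \<eta>" "e O s = e O u" using ex by (elim bexE)
    obtain F where F: "F \<in> DD" "e = Id_on F" using filtD(5)[OF \<eta> e(1)] by (elim bexE)
    have "Id_on (E \<inter> F) O t = Id_on (E \<inter> F) O u" using st e(2) unfolding F(2) restrict_iff by (metis IntE)
    moreover have "Id_on (E \<inter> F) \<in> \<eta>" using filtD(4)[OF \<eta> E(1)] e(1) F(2) by simp
    ultimately show ?thesis by (intro bexI)
  qed
  have "(\<exists>e\<in>\<eta>. e O s = e O u) \<longleftrightarrow> (\<exists>e\<in>\<eta>. e O t = e O u)" for u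
    using *[OF E(2)] *[OF E(2)[symmetric]] by metis
  then show ?thesis unfolding germ_def by simp
qed

lemma germ_self:
  assumes "(s, \<eta>) \<in> GP" shows "(s, \<eta>) \<in> germ \<Lambda> s \<eta>"
proof -
  have "filt \<eta>" using assms tight_filt by (simp add: GP_iff dom_filters_def)
  then obtain D where "Id_on D \<in> \<eta>" using filtD(6) by metis
  then show ?thesis unfolding germ_mem using assms by auto
qed

lemma germ_memD:
  assumes "(t, \<eta>') \<in> germ \<Lambda> s \<eta>" "filt \<eta>"
  shows "(t, \<eta>) \<in> GP" "\<eta>' = \<eta>" "\<exists>E. Id_on E \<in> \<eta> \<and> Id_on E O s = Id_on E O t"
proof -
  show "(t, \<eta>) \<in> GP" "\<eta>' = \<eta>" using assms(1) unfolding germ_mem by auto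
  obtain e where e: "e \<in> \<eta>" "e O s = e O t" using assms(1) unfolding germ_mem by auto
  obtain E where E: "e = Id_on E" using filtD(5)[OF assms(2) e(1)] by metis
  show "\<exists>E. Id_on E \<in> \<eta> \<and> Id_on E O s = Id_on E O t" by (intro exI[of _ E]) (use e E in simp)
qed

lemma GP_D: assumes "(s, \<eta>) \<in> GP" shows "s \<in> S\<^sub>\<Lambda>" "\<eta> \<in> tight" "filt \<eta>" "Id_on (Domain s) \<in> \<eta>"
  using assms tight_filt by (auto simp: GP_iff dom_filters_def)

lemma germ_eqD:
  assumes "germ \<Lambda> s \<eta> = germ \<Lambda> t \<eta>'" "(s, \<eta>) \<in> GP" "(t, \<eta>') \<in> GP"
  shows "\<eta>' = \<eta>" "\<exists>E. Id_on E \<in> \<eta> \<and> Id_on E O s = Id_on E O t"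
  using germ_memD(2,3)[of t \<eta>' s \<eta>] germ_self[OF assms(3)] GP_D(3)[OF assms(2)] assms(1) by simp_all

lemma agree_pre:
  assumes "Id_on E O s = Id_on E O t" shows "E \<inter> s\<inverse> `` D = E \<inter> t\<inverse> `` D"
proof -
  have "x \<in> E \<Longrightarrow> (x, y) \<in> s \<longleftrightarrow> (x, y) \<in> t" for x y
    using assms unfolding restrict_iff by simp
  then show ?thesis by auto
qed

text \<open>Well-definedness of the range of a germ: maps agreeing on \<open>E\<close> have the same
  preimages inside \<open>E\<close>, and preimages decide membership in the translated
  filter.\<close>

lemma act_agree:
  assumes "(s, \<eta>) \<in> GP" "(t, \<eta>) \<in> GP" "Id_on E \<in> \<eta>" "Id_on E O s = Id_on E O t"
  shows "act \<Lambda> s \<eta> = act \<Lambda> t \<eta>"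
proof -
  note s = GP_D[OF assms(1)] and t = GP_D[OF assms(2)]
  have *: "Id_on (t\<inverse> `` D) \<in> \<eta>" if "Id_on (s\<inverse> `` D) \<in> \<eta>" "D \<in> DD" "Id_on E O s = Id_on E O t" "t \<in> S\<^sub>\<Lambda>" for s t D
  proof -
    have "Id_on (E \<inter> s\<inverse> `` D) \<in> \<eta>" using filtD(4)[OF s(3) assms(3) that(1)] .
    then have "Id_on (E \<inter> t\<inverse> `` D) \<in> \<eta>" using agree_pre[OF that(3)] by simp
    then show ?thesis using filtD(3)[OF s(3)] DD_Image[OF S_converse[OF that(4)] that(2)] by simp
  qed
  show ?thesis
  proof (rule filt_eqI)
    show "filt (act \<Lambda> s \<eta>)" "filt (act \<Lambda> t \<eta>)" using act_filt(1) s t by auto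
    fix D assume D: "D \<in> DD"
    show "Id_on D \<in> act \<Lambda> s \<eta> \<longleftrightarrow> Id_on D \<in> act \<Lambda> t \<eta>"
      unfolding mem_act[OF s(1,3,4)] mem_act[OF t(1,3,4)]
      using *[OF _ D assms(4) t(1)] *[OF _ D assms(4)[symmetric] s(1)] D by auto
  qed
qed

lemma arrows_TG: "arrows TG = (\<lambda>(s, \<eta>). germ \<Lambda> s \<eta>) ` GP"
  by (simp add: tight_groupoid_def)

lemma arrowsE:
  assumes "g \<in> arrows TG" obtains s \<eta> where "g = germ \<Lambda> s \<eta>" "(s, \<eta>) \<in> GP"
  using assms unfolding arrows_TG by auto

lemma arrowsI: "(s, \<eta>) \<in> GP \<Longrightarrow> germ \<Lambda> s \<eta> \<in> arrows TG"
  unfolding arrows_TG by force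

lemma gdom_germ: assumes "(s, \<eta>) \<in> GP" shows "gdom TG (germ \<Lambda> s \<eta>) = \<eta>"
proof -
  have "snd ` germ \<Lambda> s \<eta> = {\<eta>}"
    by (rule image_const[OF germ_self[OF assms]]) (auto simp: germ_def)
  then show ?thesis by (simp add: tight_groupoid_def)
qed

lemma gran_germ: assumes "(s, \<eta>) \<in> GP" shows "gran TG (germ \<Lambda> s \<eta>) = act \<Lambda> s \<eta>"
proof -
  have "act \<Lambda> t \<eta>' = act \<Lambda> s \<eta>" if "(t, \<eta>') \<in> germ \<Lambda> s \<eta>" for t \<eta>'
  proof -
    note d = germ_memD[OF that GP_D(3)[OF assms]]
    obtain E where E: "Id_on E \<in> \<eta>" "Id_on E O s = Id_on E O t" using d(3) by metis
    show ?thesis using act_agree[OF assms d(1) E] d(2) by simp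
  qed
  then have "(\<lambda>(s, \<eta>). act \<Lambda> s \<eta>) ` germ \<Lambda> s \<eta> = {act \<Lambda> s \<eta>}"
    by (intro image_const[OF germ_self[OF assms]]) (auto split: prod.splits)
  then show ?thesis by (simp add: tight_groupoid_def)
qed

lemma GP_mult:
  assumes "(s, act \<Lambda> t \<eta>) \<in> GP" "(t, \<eta>) \<in> GP" shows "(t O s, \<eta>) \<in> GP" "act \<Lambda> s (act \<Lambda> t \<eta>) = act \<Lambda> (t O s) \<eta>"
proof -
  note s = GP_D[OF assms(1)] and t = GP_D[OF assms(2)]
  note a = act_act[OF s(1) t(1,3,4) s(4)]
  show "(t O s, \<eta>) \<in> GP" using a(1) inv_semigroup.mul[OF s(1) t(1)] t(2) by (simp add: GP_iff dom_filters_def)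
  show "act \<Lambda> s (act \<Lambda> t \<eta>) = act \<Lambda> (t O s) \<eta>" by (rule a(2))
qed

text \<open>The union in \<open>gmul\<close> runs over all representatives, which must have the same
  product germ. If the left factors agree on \<open>E\<close> and the right ones on
  \<open>F\<close>, the composites agree on the part of \<open>F\<close> that \<open>t\<close> sends
  into \<open>E\<close>, which belongs to \<open>\<eta>\<close>.\<close>

lemma gmul_germ:
  assumes s: "(s, act \<Lambda> t \<eta>) \<in> GP" and t: "(t, \<eta>) \<in> GP"
  shows "gmul TG (germ \<Lambda> s (act \<Lambda> t \<eta>)) (germ \<Lambda> t \<eta>) = germ \<Lambda> (t O s) \<eta>"
proof -
  let ?g = "germ \<Lambda> s (act \<Lambda> t \<eta>)" and ?h = "germ \<Lambda> t \<eta>"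
  note s' = GP_D[OF s] and t' = GP_D[OF t]
  have *: "germ \<Lambda> (v O u) \<eta>' = germ \<Lambda> (t O s) \<eta>" if u: "(u, \<theta>) \<in> ?g" and v: "(v, \<eta>') \<in> ?h" for u \<theta> v \<eta>'
  proof -
    note du = germ_memD[OF u s'(3)] and dv = germ_memD[OF v t'(3)]
    obtain E where E: "Id_on E \<in> act \<Lambda> t \<eta>" "Id_on E O s = Id_on E O u" using du(3) by metis
    obtain F where F: "Id_on F \<in> \<eta>" "Id_on F O t = Id_on F O v" using dv(3) by metis
    have m: "Id_on (F \<inter> t\<inverse> `` E) \<in> \<eta>"
      using filtD(4)[OF t'(3) F(1)] E(1) unfolding mem_act[OF t'(1,3,4)] by simp
    have sv: "x \<in> F \<Longrightarrow> (x, y) \<in> t \<longleftrightarrow> (x, y) \<in> v" for x y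
      using F(2) unfolding restrict_iff by simp
    have su: "x \<in> E \<Longrightarrow> (x, y) \<in> s \<longleftrightarrow> (x, y) \<in> u" for x y
      using E(2) unfolding restrict_iff by simp
    have ag: "(x, y) \<in> t O s \<longleftrightarrow> (x, y) \<in> v O u" if x: "x \<in> F \<inter> t\<inverse> `` E" for x y
    proof -
      have "z \<in> E" if "(x, z) \<in> t" for z
      proof -
        obtain z' where "(x, z') \<in> t" "z' \<in> E" using x by auto
        then show ?thesis using pbijD(1)[OF t'(1) that] by auto
      qed
      then have "(\<exists>z. (x, z) \<in> t \<and> (z, y) \<in> s) \<longleftrightarrow> (\<exists>z. (x, z) \<in> v \<and> (z, y) \<in> u)" using sv[of x] su x by (metis IntD1)
      then show ?thesis by (simp add: relcomp_unfold)
    qed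
    have "Id_on (F \<inter> t\<inverse> `` E) O (t O s) = Id_on (F \<inter> t\<inverse> `` E) O (v O u)"
      unfolding restrict_iff by (intro ballI allI ag)
    from germ_eqI[OF t'(3) m this] show ?thesis unfolding dv(2) by (rule HOL.sym)
  qed
  have "(\<Union>(u, \<theta>)\<in>?g. \<Union>(v, \<eta>')\<in>?h. germ \<Lambda> (v O u) \<eta>') = germ \<Lambda> (t O s) \<eta>"
  proof (rule UN_const[OF germ_self[OF s]], clarify)
    fix u \<theta> assume u: "(u, \<theta>) \<in> ?g"
    show "(\<Union>(v, \<eta>')\<in>?h. germ \<Lambda> (v O u) \<eta>') = germ \<Lambda> (t O s) \<eta>"
      by (rule UN_const[OF germ_self[OF t]]) (use *[OF u] in \<open>auto split: prod.splits\<close>)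
  qed
  then show ?thesis by (simp add: tight_groupoid_def)
qed

lemma GP_inv:
  assumes "(s, \<eta>) \<in> GP" shows "(s\<inverse>, act \<Lambda> s \<eta>) \<in> GP" "act \<Lambda> (s\<inverse>) (act \<Lambda> s \<eta>) = \<eta>"
proof -
  note s = GP_D[OF assms]
  show "(s\<inverse>, act \<Lambda> s \<eta>) \<in> GP"
    using S_converse[OF s(1)] act_tight[OF s(1,2,4)] act_filt(2)[OF s(1,3,4)] by (simp add: GP_iff dom_filters_def)
  show "act \<Lambda> (s\<inverse>) (act \<Lambda> s \<eta>) = \<eta>" using act_inverse[OF s(1,3,4)] .
qed

text \<open>If \<open>s\<close> and \<open>t\<close> agree on \<open>E\<close>, injectivity makes
  their inverses agree on the common image of \<open>E\<close>, which belongs to the translated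
  filter.\<close>

lemma ginv_germ:
  assumes s: "(s, \<eta>) \<in> GP" shows "ginv TG (germ \<Lambda> s \<eta>) = germ \<Lambda> (s\<inverse>) (act \<Lambda> s \<eta>)"
proof -
  note s' = GP_D[OF s]
  have *: "germ \<Lambda> (t\<inverse>) (act \<Lambda> t \<eta>') = germ \<Lambda> (s\<inverse>) (act \<Lambda> s \<eta>)" if t: "(t, \<eta>') \<in> germ \<Lambda> s \<eta>" for t \<eta>'
  proof -
    note d = germ_memD[OF t s'(3)]
    note t' = GP_D[OF d(1)]
    obtain E where E: "Id_on E \<in> \<eta>" "Id_on E O s = Id_on E O t" using d(3) by metis
    have eq: "act \<Lambda> t \<eta> = act \<Lambda> s \<eta>" using act_agree[OF s d(1) E] by simp
    have st: "x \<in> E \<Longrightarrow> (x, y) \<in> s \<longleftrightarrow> (x, y) \<in> t" for x y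
      using E(2) unfolding restrict_iff by simp
    have ED: "E \<in> DD" using filtD(1)[OF s'(3) E(1)] .
    let ?F = "s `` E \<inter> t `` E"
    have "s `` E = t `` E" using st by auto
    moreover have "s\<inverse> `` (s `` E) = E \<inter> Domain s" using pbijD(2)[OF s'(1)] by auto
    then have "Id_on (s `` E) \<in> act \<Lambda> s \<eta>"
      unfolding mem_act[OF s'(1,3,4)] using DD_Image[OF s'(1) ED] filtD(4)[OF s'(3) E(1) s'(4)] by simp
    ultimately have m: "Id_on (s `` E) \<in> act \<Lambda> s \<eta>" "s `` E = t `` E" by auto
    have ag: "(y, x) \<in> s\<inverse> \<longleftrightarrow> (y, x) \<in> t\<inverse>" if y: "y \<in> s `` E" for x y
    proof -
      obtain z where z: "z \<in> E" "(z, y) \<in> s" using y by auto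
      then have t: "(z, y) \<in> t" using st by simp
      have "(x, y) \<in> s \<longleftrightarrow> x = z" using pbijD(2)[OF s'(1), of x y z] z(2) by metis
      moreover have "(x, y) \<in> t \<longleftrightarrow> x = z" using pbijD(2)[OF t'(1), of x y z] t by metis
      ultimately show ?thesis by simp
    qed
    have "Id_on (s `` E) O s\<inverse> = Id_on (s `` E) O t\<inverse>"
      unfolding restrict_iff by (intro ballI allI ag)
    from germ_eqI[OF act_filt(1)[OF s'(1,3,4)] m(1) this] show ?thesis unfolding d(2) eq by (rule HOL.sym)
  qed
  have "(\<Union>(t, \<eta>')\<in>germ \<Lambda> s \<eta>. germ \<Lambda> (t\<inverse>) (act \<Lambda> t \<eta>')) = germ \<Lambda> (s\<inverse>) (act \<Lambda> s \<eta>)"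
    by (rule UN_const[OF germ_self[OF s]]) (use * in \<open>auto split: prod.splits\<close>)
  then show ?thesis by (simp add: tight_groupoid_def)
qed

lemma composableE:
  assumes "a \<in> arrows TG" "b \<in> arrows TG" "gdom TG a = gran TG b"
  obtains s t \<eta> where "a = germ \<Lambda> s (act \<Lambda> t \<eta>)" "b = germ \<Lambda> t \<eta>" "(s, act \<Lambda> t \<eta>) \<in> GP" "(t, \<eta>) \<in> GP"
proof -
  obtain s \<theta> where a: "a = germ \<Lambda> s \<theta>" "(s, \<theta>) \<in> GP" using assms(1) by (elim arrowsE)
  obtain t \<eta> where b: "b = germ \<Lambda> t \<eta>" "(t, \<eta>) \<in> GP" using assms(2) by (elim arrowsE)
  have "\<theta> = act \<Lambda> t \<eta>" using assms(3) gdom_germ[OF a(2)] gran_germ[OF b(2)] a(1) b(1) by simp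
  then show ?thesis using that a b by simp
qed

lemma groupoid_TG: "groupoid TG"
proof
  fix a b assume ab: "a \<in> arrows TG" "b \<in> arrows TG" "gdom TG a = gran TG b"
  obtain s t \<eta> where e: "a = germ \<Lambda> s (act \<Lambda> t \<eta>)" "b = germ \<Lambda> t \<eta>" "(s, act \<Lambda> t \<eta>) \<in> GP" "(t, \<eta>) \<in> GP"
    by (rule composableE[OF ab])
  note m = gmul_germ[OF e(3,4)] and st = GP_mult[OF e(3,4)]
  note t' = GP_D[OF e(4)] and s' = GP_D[OF e(3)]
  show "gmul TG a b \<in> arrows TG" unfolding e m using arrowsI[OF st(1)] .
  show "gdom TG (gmul TG a b) = gdom TG b" unfolding e m using gdom_germ st e by simp
  show "gran TG (gmul TG a b) = gran TG a" unfolding e m using gran_germ st e by simp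
  have ist: "ginv TG (gmul TG a b) = germ \<Lambda> ((t O s)\<inverse>) (act \<Lambda> (t O s) \<eta>)" unfolding e m by (rule ginv_germ[OF st(1)])
  have ia: "ginv TG a = germ \<Lambda> (s\<inverse>) (act \<Lambda> (t O s) \<eta>)" unfolding e using ginv_germ[OF e(3)] st(2) by simp
  have ib: "ginv TG b = germ \<Lambda> (t\<inverse>) (act \<Lambda> t \<eta>)" unfolding e by (rule ginv_germ[OF e(4)])
  have gs: "(s\<inverse>, act \<Lambda> (t O s) \<eta>) \<in> GP" "act \<Lambda> (s\<inverse>) (act \<Lambda> (t O s) \<eta>) = act \<Lambda> t \<eta>"
    using GP_inv[OF e(3)] st(2) by auto
  have gt: "(t\<inverse>, act \<Lambda> t \<eta>) \<in> GP" "act \<Lambda> (t\<inverse>) (act \<Lambda> t \<eta>) = \<eta>" using GP_inv[OF e(4)] by auto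
  show "ginv TG (gmul TG a b) = gmul TG (ginv TG b) (ginv TG a)"
    using gmul_germ[of "t\<inverse>" "s\<inverse>" "act \<Lambda> (t O s) \<eta>"] gs gt ist ia ib by (simp add: converse_relcomp)
  have "gmul TG (ginv TG a) (gmul TG a b) = germ \<Lambda> ((t O s) O s\<inverse>) \<eta>"
    using gmul_germ[of "s\<inverse>" "t O s" \<eta>] gs st ia m e by simp
  \<comment> \<open>The composite is \<open>t\<close> followed by the identity on
    \<open>Domain s\<close>. It agrees with \<open>t\<close> on the preimage of
    \<open>Domain s\<close>, which belongs to \<open>\<eta>\<close> because the arrows are
    composable.\<close>
  also have "\<dots> = germ \<Lambda> t \<eta>"
  proof (rule germ_eqI[OF t'(3)])
    show "Id_on (t\<inverse> `` Domain s) \<in> \<eta>" using s'(4) unfolding mem_act[OF t'(1,3,4)] by simp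
    have *: "s O s\<inverse> = Id_on (Domain s)" by (rule S_Domain[OF s'(1)])
    have "Id_on (t\<inverse> `` Domain s) O (t O Id_on (Domain s)) = Id_on (t\<inverse> `` Domain s) O t"
    proof -
      have ds: "y \<in> Domain s" if x: "x \<in> t\<inverse> `` Domain s" and xy: "(x, y) \<in> t" for x y
      proof -
        obtain z where z: "z \<in> Domain s" "(x, z) \<in> t" using x by (elim ImageE) simp
        then show ?thesis using pbijD(1)[OF t'(1) xy z(2)] by simp
      qed
      show ?thesis unfolding restrict_iff
      proof (intro ballI allI)
        fix x y assume "x \<in> t\<inverse> `` Domain s"
        from ds[OF this] show "(x, y) \<in> t O Id_on (Domain s) \<longleftrightarrow> (x, y) \<in> t" by auto
      qed
    qed
    then show "Id_on (t\<inverse> `` Domain s) O ((t O s) O s\<inverse>) = Id_on (t\<inverse> `` Domain s) O t"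
      by (simp add: O_assoc *)
  qed
  finally show "gmul TG (ginv TG a) (gmul TG a b) = b" using e(2) by simp
  fix c assume c: "c \<in> arrows TG" "gdom TG b = gran TG c"
  obtain v \<zeta> where v: "c = germ \<Lambda> v \<zeta>" "(v, \<zeta>) \<in> GP" using c(1) by (elim arrowsE)
  have \<eta>: "\<eta> = act \<Lambda> v \<zeta>" using c(2) gdom_germ[OF e(4)] gran_germ[OF v(2)] e(2) v(1) by simp
  have tv: "(t, act \<Lambda> v \<zeta>) \<in> GP" "(s, act \<Lambda> t (act \<Lambda> v \<zeta>)) \<in> GP" using e(3,4) \<eta> by auto
  note vt = GP_mult[OF tv(1) v(2)]
  have svt: "(s, act \<Lambda> (v O t) \<zeta>) \<in> GP" using tv(2) vt(2) by simp
  have stv: "(t O s, act \<Lambda> v \<zeta>) \<in> GP" using st(1) \<eta> by simp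
  have "gmul TG (gmul TG a b) c = germ \<Lambda> (v O (t O s)) \<zeta>"
    using gmul_germ[OF stv v(2)] m \<eta> v(1) e by simp
  moreover have "gmul TG a (gmul TG b c) = germ \<Lambda> ((v O t) O s) \<zeta>"
    using gmul_germ[OF svt vt(1)] gmul_germ[OF tv(1) v(2)] \<eta> v(1) e vt(2) by simp
  ultimately show "gmul TG (gmul TG a b) c = gmul TG a (gmul TG b c)" by (simp add: O_assoc)
next
  fix a assume "a \<in> arrows TG"
  then obtain s \<eta> where a: "a = germ \<Lambda> s \<eta>" "(s, \<eta>) \<in> GP" by (elim arrowsE)
  note i = GP_inv[OF a(2)] and ig = ginv_germ[OF a(2)]
  show "ginv TG a \<in> arrows TG" unfolding a(1) ig by (rule arrowsI[OF i(1)])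
  show "gdom TG (ginv TG a) = gran TG a" unfolding a(1) ig using gdom_germ[OF i(1)] gran_germ[OF a(2)] by simp
  show "gran TG (ginv TG a) = gdom TG a" unfolding a(1) ig using gran_germ[OF i(1)] gdom_germ[OF a(2)] i(2) by simp
  show "ginv TG (ginv TG a) = a" unfolding a(1) ig using ginv_germ[OF i(1)] i(2) by simp
qed

text \<open>Requiring the domain idempotent in \<open>X\<close> keeps the filters inside the domain
  of \<open>s\<close> and makes \<open>X\<close> nonempty, so that these sets are compact as well as
  open.\<close>

definition basic :: "'a germ set set" where
  "basic = {\<Theta> s (N X Y) | s X Y. s \<in> S\<^sub>\<Lambda> \<and> fin X \<and> fin Y \<and> Id_on (Domain s) \<in> X}"

lemma basicE:
  assumes "U \<in> basic"
  obtains s X Y where "U = \<Theta> s (N X Y)" "s \<in> S\<^sub>\<Lambda>" "fin X" "fin Y" "Id_on (Domain s) \<in> X"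
  using assms unfolding basic_def by blast

lemma basicI: "\<lbrakk>s \<in> S\<^sub>\<Lambda>; fin X; fin Y; Id_on (Domain s) \<in> X\<rbrakk> \<Longrightarrow> \<Theta> s (N X Y) \<in> basic"
  unfolding basic_def by blast

lemma N_dom: "Id_on (Domain s) \<in> X \<Longrightarrow> N X Y \<subseteq> dom_filters s"
  by (auto simp: N_def FN_def dom_filters_def)

lemma N_open: "\<lbrakk>s \<in> S\<^sub>\<Lambda>; fin X; fin Y; Id_on (Domain s) \<in> X\<rbrakk> \<Longrightarrow>
    openin (subtopology (filter_top \<Lambda>) (dom_filters s)) (N X Y)"
  unfolding openin_subtopology
  by (rule exI[of _ "FN X Y"]) (auto simp: N_def FN_def dom_filters_def openin_FN[unfolded FN_def])

lemma dom_open_base: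
  assumes "openin (subtopology (filter_top \<Lambda>) (dom_filters s)) U" "\<eta> \<in> U" "s \<in> S\<^sub>\<Lambda>"
  shows "\<exists>X Y. fin X \<and> fin Y \<and> Id_on (Domain s) \<in> X \<and> \<eta> \<in> N X Y \<and> N X Y \<subseteq> U"
proof -
  obtain T where T: "openin (filter_top \<Lambda>) T" "U = T \<inter> dom_filters s" using assms(1) unfolding openin_subtopology by metis
  then obtain X Y where XY: "fin X" "fin Y" "\<eta> \<in> FN X Y" "FN X Y \<subseteq> T" using assms(2) unfolding filter_top_base by (metis IntD1)
  have "fin (insert (Id_on (Domain s)) X)" using XY DD_Domain[OF assms(3)] by auto
  moreover have "\<eta> \<in> N (insert (Id_on (Domain s)) X) Y" "N (insert (Id_on (Domain s)) X) Y \<subseteq> U"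
    using XY assms(2) T(2) by (auto simp: N_def FN_def dom_filters_def)
  ultimately show ?thesis using XY(2) by (metis insertI1)
qed

text \<open>Equality of germs at \<open>\<eta>\<close> is witnessed by an idempotent in
  \<open>\<eta>\<close>, and the same idempotent witnesses it at all filters containing it. This
  openness makes the sets of germs a base and \<open>germ \<Lambda> s\<close> continuous.\<close>

lemma germ_nbhd:
  assumes s: "s \<in> S\<^sub>\<Lambda>" "fin X" "fin Y" "Id_on (Domain s) \<in> X"
    and t: "(t, \<eta>) \<in> GP" and g: "germ \<Lambda> t \<eta> \<in> \<Theta> s (N X Y)"
  shows "\<exists>X' Y'. fin X' \<and> fin Y' \<and> Id_on (Domain t) \<in> X' \<and> \<eta> \<in> N X' Y' \<and> N X' Y' \<subseteq> N X Y \<and>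
    (\<forall>\<theta>\<in>N X' Y'. germ \<Lambda> t \<theta> = germ \<Lambda> s \<theta>)"
proof -
  obtain \<eta>' where \<eta>': "\<eta>' \<in> N X Y" "germ \<Lambda> t \<eta> = germ \<Lambda> s \<eta>'" using g unfolding \<Theta>_def by auto
  have sG: "(s, \<eta>') \<in> GP" using \<eta>'(1) N_dom[OF s(4), of Y] s(1) by (auto simp: GP_iff)
  have eq: "\<eta>' = \<eta>" using germ_eqD(1)[OF \<eta>'(2) t sG] .
  obtain E where E: "Id_on E \<in> \<eta>" "Id_on E O t = Id_on E O s" using germ_eqD(2)[OF \<eta>'(2) t sG] by metis
  note t' = GP_D[OF t]
  let ?X = "{Id_on (Domain t), Id_on E} \<union> X"
  have "fin ?X" using s(2) filtD(1)[OF t'(3)] t'(4) E(1) by auto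
  moreover have "\<eta> \<in> N ?X Y" using \<eta>'(1) eq t'(4) E(1) by (auto simp: N_def FN_def)
  moreover have "N ?X Y \<subseteq> N X Y" by (auto simp: N_def FN_def)
  moreover have "germ \<Lambda> t \<theta> = germ \<Lambda> s \<theta>" if "\<theta> \<in> N ?X Y" for \<theta>
    by (rule germ_eqI[OF _ _ E(2)]) (use that in \<open>auto simp: N_def FN_def\<close>)
  ultimately show ?thesis using s(3) by (intro exI[of _ ?X] exI[of _ Y]) simp
qed

text \<open>The generating sets are already a base, by \<open>germ_nbhd\<close>, and each of their
  points has a smaller neighbourhood given by finitely many conditions on filters.\<close>

lemma gtop_base: "openin (gtop TG) W \<longleftrightarrow> (\<forall>g\<in>W. \<exists>C\<in>basic. g \<in> C \<and> C \<subseteq> W)"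
proof -
  let ?S = "{{germ \<Lambda> s \<eta> | \<eta>. \<eta> \<in> U} | s U. s \<in> S\<^sub>\<Lambda> \<and>
            openin (subtopology (filter_top \<Lambda>) {\<eta> \<in> tight. s O s\<inverse> \<in> \<eta>}) U}"
  have S: "?S = {\<Theta> s U | s U. s \<in> S\<^sub>\<Lambda> \<and> openin (subtopology (filter_top \<Lambda>) (dom_filters s)) U}"
  proof (rule Collect_cong, intro ex_cong1)
    fix A s U
    have eq: "{\<eta> \<in> tight. s O s\<inverse> \<in> \<eta>} = dom_filters s" if "s \<in> S\<^sub>\<Lambda>"
      using S_Domain[OF that] by (simp add: dom_filters_def)
    show "(A = {germ \<Lambda> s \<eta> | \<eta>. \<eta> \<in> U} \<and> s \<in> S\<^sub>\<Lambda> \<and>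
          openin (subtopology (filter_top \<Lambda>) {\<eta> \<in> tight. s O s\<inverse> \<in> \<eta>}) U) =
        (A = \<Theta> s U \<and> s \<in> S\<^sub>\<Lambda> \<and> openin (subtopology (filter_top \<Lambda>) (dom_filters s)) U)"
      by (cases "s \<in> S\<^sub>\<Lambda>") (simp_all add: eq \<Theta>_def Setcompr_eq_image)
  qed
  let ?B = "{\<Theta> s U | s U. s \<in> S\<^sub>\<Lambda> \<and> openin (subtopology (filter_top \<Lambda>) (dom_filters s)) U}"
  have basic_B: "basic \<subseteq> ?B" unfolding basic_def using N_open by blast
  have refine: "\<exists>C\<in>basic. g \<in> C \<and> C \<subseteq> A" if A: "A \<in> ?B" "g \<in> A" for A g
  proof -
    obtain s U where sU: "A = \<Theta> s U" "s \<in> S\<^sub>\<Lambda>" "openin (subtopology (filter_top \<Lambda>) (dom_filters s)) U" using A(1) by blast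
    obtain \<eta> where \<eta>: "\<eta> \<in> U" "g = germ \<Lambda> s \<eta>" using A(2) sU(1) unfolding \<Theta>_def by auto
    obtain X Y where XY: "fin X" "fin Y" "Id_on (Domain s) \<in> X" "\<eta> \<in> N X Y" "N X Y \<subseteq> U"
      using dom_open_base[OF sU(3) \<eta>(1) sU(2)] by metis
    have "\<Theta> s (N X Y) \<in> basic" unfolding basic_def using sU(2) XY by blast
    moreover have "g \<in> \<Theta> s (N X Y)" "\<Theta> s (N X Y) \<subseteq> A" using \<eta> XY sU(1) unfolding \<Theta>_def by auto
    ultimately show ?thesis by (intro bexI conjI)
  qed
  have "gtop TG = topology_generated_by ?B" unfolding S[symmetric] by (simp add: tight_groupoid_def)
  moreover have "openin (topology_generated_by ?B) W \<longleftrightarrow> (\<forall>g\<in>W. \<exists>C\<in>?B. g \<in> C \<and> C \<subseteq> W)"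
  proof (rule openin_generated_base)
    fix A B g assume A: "A \<in> ?B" "B \<in> ?B" "g \<in> A" "g \<in> B"
    obtain C C' where C: "C \<in> basic" "g \<in> C" "C \<subseteq> A" and C': "C' \<in> basic" "g \<in> C'" "C' \<subseteq> B"
      using refine[OF A(1,3)] refine[OF A(2,4)] by metis
    obtain s X Y where s: "C = \<Theta> s (N X Y)" "s \<in> S\<^sub>\<Lambda>" "fin X" "fin Y" "Id_on (Domain s) \<in> X" using C(1) by (elim basicE)
    obtain t X' Y' where t: "C' = \<Theta> t (N X' Y')" "t \<in> S\<^sub>\<Lambda>" "fin X'" "fin Y'" "Id_on (Domain t) \<in> X'" using C'(1) by (elim basicE)
    obtain \<eta> where \<eta>: "g = germ \<Lambda> t \<eta>" "\<eta> \<in> N X' Y'" using C'(2) t(1) unfolding \<Theta>_def by auto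
    have tG: "(t, \<eta>) \<in> GP" using \<eta>(2) N_dom[OF t(5), of Y'] t(2) by (auto simp: GP_iff)
    obtain X1 Y1 where n: "fin X1" "fin Y1" "Id_on (Domain t) \<in> X1" "\<eta> \<in> N X1 Y1" "N X1 Y1 \<subseteq> N X Y"
        "\<forall>\<theta>\<in>N X1 Y1. germ \<Lambda> t \<theta> = germ \<Lambda> s \<theta>"
      using germ_nbhd[OF s(2-5) tG] C(2) s(1) \<eta>(1) by metis
    let ?D = "\<Theta> t (N (X1 \<union> X') (Y1 \<union> Y'))"
    have sub: "N (X1 \<union> X') (Y1 \<union> Y') \<subseteq> N X1 Y1" "N (X1 \<union> X') (Y1 \<union> Y') \<subseteq> N X' Y'"
      by (auto simp: N_def FN_def)
    have "?D \<in> basic" unfolding basic_def using t n by blast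
    moreover have "g \<in> ?D" unfolding \<Theta>_def using \<eta> n(4) by (auto simp: N_def FN_def)
    moreover have "?D \<subseteq> A"
    proof
      fix x assume "x \<in> ?D"
      then obtain \<theta> where th: "\<theta> \<in> N X1 Y1" "x = germ \<Lambda> t \<theta>" using sub unfolding \<Theta>_def by auto
      then have "x = germ \<Lambda> s \<theta>" "\<theta> \<in> N X Y" using n(5,6) by auto
      then show "x \<in> A" using C(3) s(1) unfolding \<Theta>_def by auto
    qed
    moreover have "?D \<subseteq> B" using sub(2) C'(3) t(1) unfolding \<Theta>_def by auto
    ultimately show "\<exists>C\<in>?B. g \<in> C \<and> C \<subseteq> A \<inter> B" using basic_B by (meson Int_greatest subsetD)
  qed
  moreover have "(\<exists>C\<in>?B. g \<in> C \<and> C \<subseteq> W) \<longleftrightarrow> (\<exists>C\<in>basic. g \<in> C \<and> C \<subseteq> W)" for g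
    using refine basic_B by (meson subsetD order_trans)
  ultimately show ?thesis by simp
qed

lemma basic_open: "U \<in> basic \<Longrightarrow> openin (gtop TG) U"
  unfolding gtop_base by (intro ballI bexI[of _ U] conjI subset_refl)

lemma \<Theta>_arrows: assumes "s \<in> S\<^sub>\<Lambda>" "V \<subseteq> dom_filters s" shows "\<Theta> s V \<subseteq> arrows TG"
  unfolding \<Theta>_def using assms by (auto intro!: arrowsI simp: GP_iff)

lemma topspace_TG: "topspace (gtop TG) = arrows TG"
proof (intro equalityI subsetI)
  fix g assume "g \<in> topspace (gtop TG)"
  then obtain C where C: "C \<in> basic" "g \<in> C" using openin_topspace[of "gtop TG"] unfolding gtop_base by metis
  obtain s X Y where s: "C = \<Theta> s (N X Y)" "s \<in> S\<^sub>\<Lambda>" "fin X" "fin Y" "Id_on (Domain s) \<in> X" using C(1) by (elim basicE)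
  show "g \<in> arrows TG" using \<Theta>_arrows[OF s(2) N_dom[OF s(5)]] C(2) s(1) by auto
next
  fix g assume "g \<in> arrows TG"
  then obtain s \<eta> where a: "g = germ \<Lambda> s \<eta>" "(s, \<eta>) \<in> GP" by (elim arrowsE)
  note s = GP_D[OF a(2)]
  have "\<Theta> s (N {Id_on (Domain s)} {}) \<in> basic" unfolding basic_def using s(1) DD_Domain[OF s(1)] by fastforce
  moreover have "g \<in> \<Theta> s (N {Id_on (Domain s)} {})" unfolding \<Theta>_def using a(1) s by (auto simp: N_def FN_def)
  ultimately show "g \<in> topspace (gtop TG)" using openin_subset[OF basic_open] by auto
qed

text \<open>The set is the image of the compact \<open>N X Y\<close> under
  \<open>germ \<Lambda> s\<close>, whose continuity on the domain of \<open>s\<close> follows from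
  \<open>germ_nbhd\<close>.\<close>

lemma compact_\<Theta>:
  assumes s: "s \<in> S\<^sub>\<Lambda>" "fin X" "fin Y" "Id_on (Domain s) \<in> X"
  shows "compactin (gtop TG) (\<Theta> s (N X Y))"
proof -
  have N: "N X Y \<subseteq> dom_filters s" using N_dom[OF s(4)] .
  have dt: "dom_filters s \<subseteq> Collect filt" using tight_filt by (auto simp: dom_filters_def)
  have "continuous_map (subtopology (filter_top \<Lambda>) (dom_filters s)) (gtop TG) (germ \<Lambda> s)"
    unfolding continuous_map_def
  proof (intro conjI allI impI)
    have ts: "topspace (subtopology (filter_top \<Lambda>) (dom_filters s)) = dom_filters s"
      using dt by (auto simp: topspace_filter_top)
    show "germ \<Lambda> s \<in> topspace (subtopology (filter_top \<Lambda>) (dom_filters s)) \<rightarrow> topspace (gtop TG)"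
      unfolding ts topspace_TG using s(1) arrowsI by (auto simp: GP_iff)
    fix W assume W: "openin (gtop TG) W"
    show "openin (subtopology (filter_top \<Lambda>) (dom_filters s))
        {\<eta> \<in> topspace (subtopology (filter_top \<Lambda>) (dom_filters s)). germ \<Lambda> s \<eta> \<in> W}"
      unfolding ts
    proof (subst openin_subopen, intro ballI)
      fix \<eta> assume \<eta>: "\<eta> \<in> {\<eta> \<in> dom_filters s. germ \<Lambda> s \<eta> \<in> W}"
      then have sG: "(s, \<eta>) \<in> GP" using s(1) by (simp add: GP_iff)
      obtain C where C: "C \<in> basic" "germ \<Lambda> s \<eta> \<in> C" "C \<subseteq> W" using W \<eta> unfolding gtop_base by auto
      obtain t X' Y' where t: "C = \<Theta> t (N X' Y')" "t \<in> S\<^sub>\<Lambda>" "fin X'" "fin Y'" "Id_on (Domain t) \<in> X'" using C(1) by (elim basicE)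
      obtain X1 Y1 where n: "fin X1" "fin Y1" "Id_on (Domain s) \<in> X1" "\<eta> \<in> N X1 Y1" "N X1 Y1 \<subseteq> N X' Y'"
          "\<forall>\<theta>\<in>N X1 Y1. germ \<Lambda> s \<theta> = germ \<Lambda> t \<theta>"
        using germ_nbhd[OF t(2-5) sG] C(2) t(1) by metis
      have "N X1 Y1 \<subseteq> {\<eta> \<in> dom_filters s. germ \<Lambda> s \<eta> \<in> W}"
      proof
        fix \<theta> assume th: "\<theta> \<in> N X1 Y1"
        then have "germ \<Lambda> s \<theta> \<in> C" using n(5,6) t(1) unfolding \<Theta>_def by auto
        then show "\<theta> \<in> {\<eta> \<in> dom_filters s. germ \<Lambda> s \<eta> \<in> W}" using C(3) N_dom[OF n(3)] th by auto
      qed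
      then show "\<exists>T. openin (subtopology (filter_top \<Lambda>) (dom_filters s)) T \<and> \<eta> \<in> T \<and>
          T \<subseteq> {\<eta> \<in> dom_filters s. germ \<Lambda> s \<eta> \<in> W}"
        using N_open[OF s(1) n(1-3)] n(4) by (intro exI conjI)
    qed
  qed
  moreover have "X \<noteq> {}" using s(4) by auto
  then have "compactin (subtopology (filter_top \<Lambda>) (dom_filters s)) (N X Y)"
    using compact_N[OF s(2,3)] N by (simp add: compactin_subtopology)
  ultimately show ?thesis unfolding \<Theta>_def by (rule image_compactin[rotated])
qed

text \<open>The domain of a germ is its filter, and from its range the filter is recovered by acting
  with the inverse of \<open>s\<close>.\<close>

lemma inj_\<Theta>:
  assumes s: "s \<in> S\<^sub>\<Lambda>" "V \<subseteq> dom_filters s"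
  shows "inj_on (gdom TG) (\<Theta> s V)" "inj_on (gran TG) (\<Theta> s V)"
proof -
  have G: "(s, \<eta>) \<in> GP" if "\<eta> \<in> V" for \<eta> using that s by (auto simp: GP_iff)
  show "inj_on (gdom TG) (\<Theta> s V)" unfolding \<Theta>_def by (rule inj_onI) (use gdom_germ[OF G] in auto)
  show "inj_on (gran TG) (\<Theta> s V)" unfolding \<Theta>_def
  proof (rule inj_onI, clarify)
    fix \<eta> \<theta> assume v: "\<eta> \<in> V" "\<theta> \<in> V" and "gran TG (germ \<Lambda> s \<eta>) = gran TG (germ \<Lambda> s \<theta>)"
    then have "act \<Lambda> s \<eta> = act \<Lambda> s \<theta>" using gran_germ[OF G[OF v(1)]] gran_germ[OF G[OF v(2)]] by simp
    then have "\<eta> = \<theta>" using GP_inv(2)[OF G[OF v(1)]] GP_inv(2)[OF G[OF v(2)]] by metis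
    then show "germ \<Lambda> s \<eta> = germ \<Lambda> s \<theta>" by simp
  qed
qed

lemma \<Theta>_smul:
  assumes "s \<in> S\<^sub>\<Lambda>" "t \<in> S\<^sub>\<Lambda>" "V \<subseteq> dom_filters s" "W \<subseteq> dom_filters t"
  shows "smul TG (\<Theta> s V) (\<Theta> t W) = \<Theta> (t O s) {\<eta> \<in> W. act \<Lambda> t \<eta> \<in> V}"
proof (intro equalityI subsetI)
  have sG: "(s, \<eta>) \<in> GP" if "\<eta> \<in> V" for \<eta> using that assms by (auto simp: GP_iff)
  have tG: "(t, \<eta>) \<in> GP" if "\<eta> \<in> W" for \<eta> using that assms by (auto simp: GP_iff)
  {
    fix x assume "x \<in> smul TG (\<Theta> s V) (\<Theta> t W)"
    then obtain \<theta> \<eta> where e: "x = gmul TG (germ \<Lambda> s \<theta>) (germ \<Lambda> t \<eta>)" "\<theta> \<in> V" "\<eta> \<in> W"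
        "gdom TG (germ \<Lambda> s \<theta>) = gran TG (germ \<Lambda> t \<eta>)" unfolding smul_def \<Theta>_def by auto
    then have th: "\<theta> = act \<Lambda> t \<eta>" using gdom_germ[OF sG[OF e(2)]] gran_germ[OF tG[OF e(3)]] by simp
    have "x = germ \<Lambda> (t O s) \<eta>" using gmul_germ[of s t \<eta>] sG[OF e(2)] tG[OF e(3)] th e(1) by simp
    then show "x \<in> \<Theta> (t O s) {\<eta> \<in> W. act \<Lambda> t \<eta> \<in> V}" using e th unfolding \<Theta>_def by auto
  next
    fix x assume "x \<in> \<Theta> (t O s) {\<eta> \<in> W. act \<Lambda> t \<eta> \<in> V}"
    then obtain \<eta> where e: "\<eta> \<in> W" "act \<Lambda> t \<eta> \<in> V" "x = germ \<Lambda> (t O s) \<eta>" unfolding \<Theta>_def by auto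
    have "x = gmul TG (germ \<Lambda> s (act \<Lambda> t \<eta>)) (germ \<Lambda> t \<eta>)" using gmul_germ[OF sG[OF e(2)] tG[OF e(1)]] e(3) by simp
    moreover have "gdom TG (germ \<Lambda> s (act \<Lambda> t \<eta>)) = gran TG (germ \<Lambda> t \<eta>)"
      using gdom_germ[OF sG[OF e(2)]] gran_germ[OF tG[OF e(1)]] by simp
    ultimately show "x \<in> smul TG (\<Theta> s V) (\<Theta> t W)" unfolding smul_def \<Theta>_def using e(1,2) by blast
  }
qed

lemma \<Theta>_inv:
  assumes "s \<in> S\<^sub>\<Lambda>" "V \<subseteq> dom_filters s"
  shows "ginv TG ` \<Theta> s V = \<Theta> (s\<inverse>) (act \<Lambda> s ` V)"
proof -
  have G: "(s, \<eta>) \<in> GP" if "\<eta> \<in> V" for \<eta> using that assms by (auto simp: GP_iff)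
  show ?thesis unfolding \<Theta>_def image_image by (rule image_cong[OF HOL.refl]) (rule ginv_germ[OF G])
qed

text \<open>Products and inverses of basic sets are basic because \<open>act_N\<close> turns
  conditions on a translated filter into conditions on the filter. Arrows with different domains are
  separated by a single \<open>D\<close> that belongs to only one of the two filters.\<close>

sublocale G: ample_groupoid TG basic
proof (rule ample_groupoid.intro[OF groupoid_TG], unfold_locales)
  show "topspace (gtop TG) = arrows TG" by (rule topspace_TG)
  show "\<exists>U\<in>basic. g \<in> U \<and> U \<subseteq> W" if "openin (gtop TG) W" "g \<in> W" for W g using that unfolding gtop_base by simp
  show "cob TG U" if U: "U \<in> basic" for U
  proof -
    obtain s X Y where s: "U = \<Theta> s (N X Y)" "s \<in> S\<^sub>\<Lambda>" "fin X" "fin Y" "Id_on (Domain s) \<in> X" using U by (elim basicE)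
    show ?thesis unfolding cob_def open_bisection_def
      using basic_open[OF U] compact_\<Theta>[OF s(2-5)] inj_\<Theta>[OF s(2) N_dom[OF s(5)], of Y] s(1) by simp
  qed
  show "smul TG U V \<in> basic" if U: "U \<in> basic" and V: "V \<in> basic" for U V
  proof -
    obtain s X Y where s: "U = \<Theta> s (N X Y)" "s \<in> S\<^sub>\<Lambda>" "fin X" "fin Y" "Id_on (Domain s) \<in> X" using U by (elim basicE)
    obtain t X' Y' where t: "V = \<Theta> t (N X' Y')" "t \<in> S\<^sub>\<Lambda>" "fin X'" "fin Y'" "Id_on (Domain t) \<in> X'" using V by (elim basicE)
    have eq: "smul TG U V = \<Theta> (t O s) {\<eta> \<in> N X' Y'. act \<Lambda> t \<eta> \<in> N X Y}"
      unfolding s(1) t(1) by (rule \<Theta>_smul[OF s(2) t(2) N_dom[OF s(5)] N_dom[OF t(5)]])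
    have "{\<eta> \<in> N X' Y'. act \<Lambda> t \<eta> \<in> N X Y} = N X' Y' \<inter> {\<eta> \<in> tight. Id_on (Domain t) \<in> \<eta> \<and> act \<Lambda> t \<eta> \<in> N X Y}"
      using t(5) by (auto simp: N_def FN_def)
    also have "\<dots> = N (X' \<union> insert (Id_on (Domain t)) (push t X)) (Y' \<union> push t Y)"
      unfolding act_N[OF t(2) conjunct2[OF s(3)] conjunct2[OF s(4)]] by (auto simp: N_def FN_def)
    finally have eq2: "smul TG U V = \<Theta> (t O s) (N (X' \<union> insert (Id_on (Domain t)) (push t X)) (Y' \<union> push t Y))"
      unfolding eq by simp
    have "t\<inverse> `` Domain s = Domain (t O s)" by auto
    then have m: "Id_on (Domain (t O s)) \<in> push t X"
      unfolding push_def by (intro image_eqI[OF _ s(5)]) simp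
    have f: "fin (X' \<union> insert (Id_on (Domain t)) (push t X))" "fin (Y' \<union> push t Y)"
      using push_fin[OF t(2) s(3)] push_fin[OF t(2) s(4)] t(3,4) DD_Domain[OF t(2)] by auto
    show ?thesis unfolding eq2
      by (rule basicI[OF inv_semigroup.mul[OF s(2) t(2)] f]) (use m in simp)
  qed
  show "ginv TG ` U \<in> basic" if U: "U \<in> basic" for U
  proof -
    obtain s X Y where s: "U = \<Theta> s (N X Y)" "s \<in> S\<^sub>\<Lambda>" "fin X" "fin Y" "Id_on (Domain s) \<in> X" using U by (elim basicE)
    note s' = S_converse[OF s(2)]
    let ?X = "insert (Id_on (Domain (s\<inverse>))) (push (s\<inverse>) X)"
    have "act \<Lambda> s ` N X Y = {\<eta> \<in> tight. Id_on (Domain (s\<inverse>)) \<in> \<eta> \<and> act \<Lambda> (s\<inverse>) \<eta> \<in> N X Y}"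
    proof (intro equalityI subsetI)
      fix \<theta> assume "\<theta> \<in> act \<Lambda> s ` N X Y"
      then obtain \<eta> where e: "\<theta> = act \<Lambda> s \<eta>" "\<eta> \<in> N X Y" by (elim imageE)
      then have "(s, \<eta>) \<in> GP" using N_dom[OF s(5)] s(2) by (auto simp: GP_iff)
      from GP_inv[OF this] show "\<theta> \<in> {\<eta> \<in> tight. Id_on (Domain (s\<inverse>)) \<in> \<eta> \<and> act \<Lambda> (s\<inverse>) \<eta> \<in> N X Y}"
        using e by (simp add: GP_iff dom_filters_def)
    next
      fix \<theta> assume th: "\<theta> \<in> {\<eta> \<in> tight. Id_on (Domain (s\<inverse>)) \<in> \<eta> \<and> act \<Lambda> (s\<inverse>) \<eta> \<in> N X Y}"
      then have "(s\<inverse>, \<theta>) \<in> GP" using s' by (simp add: GP_iff dom_filters_def)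
      from GP_inv(2)[OF this] have "\<theta> = act \<Lambda> s (act \<Lambda> (s\<inverse>) \<theta>)" by simp
      then show "\<theta> \<in> act \<Lambda> s ` N X Y" using th by (metis (mono_tags, lifting) image_eqI mem_Collect_eq)
    qed
    also have "\<dots> = N ?X (push (s\<inverse>) Y)" by (rule act_N[OF s' conjunct2[OF s(3)] conjunct2[OF s(4)]])
    finally have eq: "ginv TG ` U = \<Theta> (s\<inverse>) (N ?X (push (s\<inverse>) Y))"
      unfolding s(1) \<Theta>_inv[OF s(2) N_dom[OF s(5)]] by simp
    have f: "fin ?X" "fin (push (s\<inverse>) Y)" using push_fin[OF s' s(3)] push_fin[OF s' s(4)] DD_Domain[OF s'] by auto
    show ?thesis unfolding eq by (rule basicI[OF s' f]) simp
  qed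
  show "\<exists>V W. openin (gtop TG) V \<and> openin (gtop TG) W \<and> g \<in> V \<and> h \<in> W \<and> V \<inter> W = {}"
    if g: "g \<in> arrows TG" and h: "h \<in> arrows TG" and ne: "gdom TG g \<noteq> gdom TG h" for g h
  proof -
    obtain s \<eta> where s: "g = germ \<Lambda> s \<eta>" "(s, \<eta>) \<in> GP" using g by (elim arrowsE)
    obtain t \<theta> where t: "h = germ \<Lambda> t \<theta>" "(t, \<theta>) \<in> GP" using h by (elim arrowsE)
    note s' = GP_D[OF s(2)] and t' = GP_D[OF t(2)]
    have "\<eta> \<noteq> \<theta>" using ne gdom_germ[OF s(2)] gdom_germ[OF t(2)] s(1) t(1) by simp
    then have "\<exists>D\<in>DD. (Id_on D \<in> \<eta>) \<noteq> (Id_on D \<in> \<theta>)" using filt_eqI[OF s'(3) t'(3)] by metis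
    then obtain D where D: "D \<in> DD" "(Id_on D \<in> \<eta>) \<noteq> (Id_on D \<in> \<theta>)" by (elim bexE)
    have key: "\<exists>V\<in>basic. germ \<Lambda> s \<eta> \<in> V \<and> (\<forall>x\<in>V. gdom TG x \<in> tight \<and> (Id_on D \<in> gdom TG x \<longleftrightarrow> Id_on D \<in> \<eta>))"
      if sG: "(s, \<eta>) \<in> GP" for s \<eta>
    proof -
      note s' = GP_D[OF sG]
      define X where "X = (if Id_on D \<in> \<eta> then {Id_on (Domain s), Id_on D} else {Id_on (Domain s)})"
      define Y where "Y = (if Id_on D \<in> \<eta> then {} else {Id_on D})"
      have f: "fin X" "fin Y" "Id_on (Domain s) \<in> X" using D(1) DD_Domain[OF s'(1)] by (auto simp: X_def Y_def)
      have "\<Theta> s (N X Y) \<in> basic" by (rule basicI[OF s'(1) f])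
      moreover have "germ \<Lambda> s \<eta> \<in> \<Theta> s (N X Y)" unfolding \<Theta>_def using s' by (auto simp: N_def FN_def X_def Y_def)
      moreover have "gdom TG x \<in> tight \<and> (Id_on D \<in> gdom TG x \<longleftrightarrow> Id_on D \<in> \<eta>)" if x: "x \<in> \<Theta> s (N X Y)" for x
      proof -
        obtain \<theta> where th: "x = germ \<Lambda> s \<theta>" "\<theta> \<in> N X Y" using x unfolding \<Theta>_def by (elim imageE)
        have "(s, \<theta>) \<in> GP" using th(2) N_dom[OF f(3)] s'(1) by (auto simp: GP_iff)
        then have "gdom TG x = \<theta>" using gdom_germ th(1) by simp
        then show ?thesis using th(2) by (auto simp: N_def FN_def X_def Y_def split: if_splits)
      qed
      ultimately show ?thesis by (intro bexI conjI ballI) auto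
    qed
    obtain V where V: "V \<in> basic" "g \<in> V" "\<forall>x\<in>V. gdom TG x \<in> tight \<and> (Id_on D \<in> gdom TG x \<longleftrightarrow> Id_on D \<in> \<eta>)"
      using key[OF s(2)] s(1) by auto
    obtain W where W: "W \<in> basic" "h \<in> W" "\<forall>x\<in>W. gdom TG x \<in> tight \<and> (Id_on D \<in> gdom TG x \<longleftrightarrow> Id_on D \<in> \<theta>)"
      using key[OF t(2)] t(1) by auto
    have "V \<inter> W = {}" using V(3) W(3) D(2) by auto
    then show ?thesis using basic_open[OF V(1)] basic_open[OF W(1)] V(2) W(2) by (intro exI conjI)
  qed
qed

end

section \<open>Generators of the Steinberg algebra of the tight groupoid\<close>

context lcsc
begin

definition tights :: "'a set \<Rightarrow> 'a pbij set set" where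
  "tights D = {\<eta> \<in> tight. Id_on D \<in> \<eta>}"

text \<open>The unit arrow at a filter, as the germ of an arbitrary idempotent in it; by
  \<open>un_eq\<close> all these idempotents have the same germ.\<close>

definition un :: "'a pbij set \<Rightarrow> 'a germ" where
  "un \<eta> = germ \<Lambda> (Id_on (SOME D. Id_on D \<in> \<eta>)) \<eta>"

lemma un_eq:
  assumes "filt \<eta>" "Id_on D \<in> \<eta>" shows "germ \<Lambda> (Id_on D) \<eta> = un \<eta>"
proof -
  have s: "Id_on (SOME D. Id_on D \<in> \<eta>) \<in> \<eta>" using assms(2) by (rule someI)
  show ?thesis unfolding un_def by (rule germ_eqI[OF assms(1) filtD(4)[OF assms(1,2) s]]) auto
qed

lemma GP_unit:
  assumes "\<eta> \<in> tight" "Id_on D \<in> \<eta>" shows "(Id_on D, \<eta>) \<in> GP"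
  using assms filtD(1)[OF tight_filt[OF assms(1)] assms(2)] by (simp add: GP_iff dom_filters_def DD_def Domain_Id_on)

lemma tight_ex: assumes "\<eta> \<in> tight" shows "\<exists>D. Id_on D \<in> \<eta>"
  using filtD(6)[OF tight_filt[OF assms]] by metis

lemma un_simps [simp]:
  assumes "\<eta> \<in> tight" shows "un \<eta> \<in> arrows TG" "gdom TG (un \<eta>) = \<eta>" "gran TG (un \<eta>) = \<eta>"
proof -
  obtain D where D: "Id_on D \<in> \<eta>" using tight_ex[OF assms] by metis
  note f = tight_filt[OF assms] and G = GP_unit[OF assms D] and u = un_eq[OF tight_filt[OF assms] D]
  show "un \<eta> \<in> arrows TG" using arrowsI[OF G] u by simp
  show "gdom TG (un \<eta>) = \<eta>" using gdom_germ[OF G] u by simp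
  show "gran TG (un \<eta>) = \<eta>" using gran_germ[OF G] act_Id_on[OF f D] u by simp
qed

lemma un_inj: "\<lbrakk>\<eta> \<in> tight; \<theta> \<in> tight; un \<eta> = un \<theta>\<rbrakk> \<Longrightarrow> \<eta> = \<theta>"
  using un_simps(2) by metis

lemma gdom_tight: "c \<in> arrows TG \<Longrightarrow> gdom TG c \<in> tight"
  by (erule arrowsE) (simp add: gdom_germ GP_D)

lemma mul_un: assumes "c \<in> arrows TG" shows "gmul TG c (un (gdom TG c)) = c"
proof -
  obtain s \<eta> where c: "c = germ \<Lambda> s \<eta>" "(s, \<eta>) \<in> GP" using assms by (elim arrowsE)
  note s = GP_D[OF c(2)]
  let ?I = "Id_on (Domain s)"
  note I = GP_unit[OF s(2,4)] and u = un_eq[OF s(3,4)] and a = act_Id_on[OF s(3,4)]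
  have "gmul TG (germ \<Lambda> s (act \<Lambda> ?I \<eta>)) (germ \<Lambda> ?I \<eta>) = germ \<Lambda> (?I O s) \<eta>"
    by (rule gmul_germ) (use a c(2) I in auto)
  moreover have "?I O s = s" by auto
  ultimately show ?thesis using c gdom_germ[OF c(2)] u a by simp
qed

definition diag :: "('a germ \<Rightarrow> 'r::comm_ring) \<Rightarrow> bool" where
  "diag q \<longleftrightarrow> (\<forall>g. q g \<noteq> 0 \<longrightarrow> g \<in> un ` tight)"

text \<open>Only the factorization of \<open>c\<close> with the unit at its domain on the right can
  contribute, so right multiplication by a function on units is pointwise multiplication along the
  domain map.\<close>

lemma convolution_diag:
  assumes "diag q" "c \<in> arrows TG"
  shows "convolution TG f q c = f c * q (un (gdom TG c))"
proof -
  define S where "S = {(\<alpha>, \<beta>). \<alpha> \<in> arrows TG \<and> \<beta> \<in> arrows TG \<and> gdom TG \<alpha> = gran TG \<beta> \<and>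
                        gmul TG \<alpha> \<beta> = c \<and> f \<alpha> \<noteq> 0 \<and> q \<beta> \<noteq> 0}"
  have "p = (c, un (gdom TG c))" if "p \<in> S" for p
  proof -
    obtain a b where p: "p = (a, b)" "a \<in> arrows TG" "gdom TG a = gran TG b" "gmul TG a b = c" "q b \<noteq> 0"
      using \<open>p \<in> S\<close> unfolding S_def by blast
    obtain \<eta> where e: "b = un \<eta>" "\<eta> \<in> tight" using assms(1) p(5) unfolding diag_def by auto
    then have "gdom TG a = \<eta>" using p(3) by simp
    then show ?thesis using mul_un[OF p(2)] p e by simp
  qed
  then have sub: "S \<subseteq> {(c, un (gdom TG c))}" by blast
  show ?thesis
  proof (cases "f c \<noteq> 0 \<and> q (un (gdom TG c)) \<noteq> 0")
    case True
    have "(c, un (gdom TG c)) \<in> S" unfolding S_def mem_Collect_eq case_prod_conv using True assms(2) gdom_tight[OF assms(2)] mul_un[OF assms(2)] by simp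
    then have "S = {(c, un (gdom TG c))}" using sub by (metis subset_singletonD empty_iff)
    then show ?thesis unfolding convolution_def S_def[symmetric] by simp
  next
    case False
    then have "(c, un (gdom TG c)) \<notin> S" unfolding S_def mem_Collect_eq case_prod_conv by metis
    then have "S = {}" using sub by (metis subset_singletonD singletonI)
    then have "convolution TG f q c = 0" unfolding convolution_def S_def[symmetric] by simp
    moreover have "f c * q (un (gdom TG c)) = 0" using False by auto
    ultimately show ?thesis by simp
  qed
qed

lemma diag_ind: "A \<subseteq> tight \<Longrightarrow> diag (ind (un ` A))"
  unfolding diag_def ind_def by auto

lemma convolution_diag2:
  assumes "diag p" "diag q"
  shows "convolution TG p q = (\<lambda>c. p c * q c)"
proof
  fix c
  show "convolution TG p q c = p c * q c"
  proof (cases "p c = 0")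
    case True
    then show ?thesis using convolution_diag[OF assms(2), of c p] G.convolution_off_arrows[of c] by (cases "c \<in> arrows TG") simp_all
  next
    case False
    then obtain \<eta> where "c = un \<eta>" "\<eta> \<in> tight" using assms(1) unfolding diag_def by blast
    then show ?thesis using convolution_diag[OF assms(2), of c p] by simp
  qed
qed

text \<open>Its indicator is the image of the product of \<open>T\<^sub>\<alpha>\<close> and the
  adjoint of \<open>T\<^sub>\<beta>\<close>; for \<beta> the source of \<alpha> this is the image of
  the generator.\<close>

definition F :: "'a \<Rightarrow> 'a \<Rightarrow> 'a germ set" where
  "F \<alpha> \<beta> = \<Theta> (ts \<alpha> \<beta>) (dom_filters (ts \<alpha> \<beta>))"

lemma dom_filters_ts: "so \<alpha> = so \<beta> \<Longrightarrow> dom_filters (ts \<alpha> \<beta>) = tights (RI \<beta>)"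
  unfolding dom_filters_def tights_def by (simp add: ts_Domain)

lemma dom_filters_N: "dom_filters s = N {Id_on (Domain s)} {}"
  unfolding dom_filters_def N_def FN_def using tight_filt by auto

lemma full_cob: "s \<in> S\<^sub>\<Lambda> \<Longrightarrow> cob TG (\<Theta> s (dom_filters s))"
  unfolding dom_filters_N by (rule G.basis_cob, rule basicI) (auto simp: DD_Domain)

lemma full_smul:
  assumes "s \<in> S\<^sub>\<Lambda>" "t \<in> S\<^sub>\<Lambda>"
  shows "smul TG (\<Theta> s (dom_filters s)) (\<Theta> t (dom_filters t)) = \<Theta> (t O s) (dom_filters (t O s))"
proof -
  have "{\<eta> \<in> dom_filters t. act \<Lambda> t \<eta> \<in> dom_filters s} = dom_filters (t O s)"
  proof (intro equalityI subsetI)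
    fix \<eta> assume "\<eta> \<in> {\<eta> \<in> dom_filters t. act \<Lambda> t \<eta> \<in> dom_filters s}"
    then have "(t, \<eta>) \<in> GP" "(s, act \<Lambda> t \<eta>) \<in> GP" using assms by (auto simp: GP_iff)
    from GP_mult(1)[OF this(2,1)] show "\<eta> \<in> dom_filters (t O s)" by (simp add: GP_iff)
  next
    fix \<eta> assume "\<eta> \<in> dom_filters (t O s)"
    then have e: "\<eta> \<in> tight" "Id_on (Domain (t O s)) \<in> \<eta>" by (auto simp: dom_filters_def)
    note f = tight_filt[OF e(1)]
    have t: "Id_on (Domain t) \<in> \<eta>" using filtD(3)[OF f e(2) _ DD_Domain[OF assms(2)]] by auto
    have "Domain (t O s) = t\<inverse> `` Domain s" by auto
    then have "Id_on (Domain s) \<in> act \<Lambda> t \<eta>" using mem_act[OF assms(2) f t] e(2) DD_Domain[OF assms(1)] by simp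
    then show "\<eta> \<in> {\<eta> \<in> dom_filters t. act \<Lambda> t \<eta> \<in> dom_filters s}"
      using t e(1) act_tight[OF assms(2) e(1) t] by (simp add: dom_filters_def)
  qed
  then show ?thesis using \<Theta>_smul[OF assms subset_refl subset_refl] by simp
qed

lemma full_conv:
  assumes "s \<in> S\<^sub>\<Lambda>" "t \<in> S\<^sub>\<Lambda>"
  shows "convolution TG (ind (\<Theta> s (dom_filters s))) (ind (\<Theta> t (dom_filters t))) = ind (\<Theta> (t O s) (dom_filters (t O s)))"
  unfolding full_smul[OF assms, symmetric]
  by (rule G.convolution_ind) (use G.cobD[OF full_cob[OF assms(1)]] G.cobD(5)[OF full_cob[OF assms(2)]] in auto)

lemma full_inv:
  assumes "s \<in> S\<^sub>\<Lambda>" shows "ginv TG ` \<Theta> s (dom_filters s) = \<Theta> (s\<inverse>) (dom_filters (s\<inverse>))"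
proof -
  have s': "s\<inverse> \<in> S\<^sub>\<Lambda>" using S_converse[OF assms] .
  have a: "act \<Lambda> t \<eta> \<in> dom_filters (t\<inverse>)" "act \<Lambda> (t\<inverse>) (act \<Lambda> t \<eta>) = \<eta>" if "t \<in> S\<^sub>\<Lambda>" "\<eta> \<in> dom_filters t" for t \<eta>
    using GP_inv[of t \<eta>] that by (auto simp: GP_iff)
  have "act \<Lambda> s ` dom_filters s = dom_filters (s\<inverse>)"
  proof (intro equalityI subsetI)
    fix \<eta> assume "\<eta> \<in> dom_filters (s\<inverse>)"
    from a[OF s' this] show "\<eta> \<in> act \<Lambda> s ` dom_filters s" by (metis converse_converse image_eqI)
  qed (use a(1)[OF assms] in auto)
  then show ?thesis using \<Theta>_inv[OF assms subset_refl] by simp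
qed

lemma full_gstar:
  assumes "scalar_inv cj" "s \<in> S\<^sub>\<Lambda>"
  shows "G.gstar cj (ind (\<Theta> s (dom_filters s))) = ind (\<Theta> (s\<inverse>) (dom_filters (s\<inverse>)))"
  using G.gstar_ind[OF assms(1) G.cobD(5)[OF full_cob[OF assms(2)]]] full_inv[OF assms(2)] by simp

lemma ts_converse: "(ts \<alpha> \<beta>)\<inverse> = ts \<beta> \<alpha>"
  unfolding ts_def by (simp add: converse_relcomp)

lemma F_cob: "\<lbrakk>\<alpha> \<in> Mo; \<beta> \<in> Mo\<rbrakk> \<Longrightarrow> cob TG (F \<alpha> \<beta>)"
  unfolding F_def by (rule full_cob[OF ts_S])

lemma F_gstar: "\<lbrakk>scalar_inv cj; \<alpha> \<in> Mo; \<beta> \<in> Mo\<rbrakk> \<Longrightarrow> G.gstar cj (ind (F \<alpha> \<beta>)) = ind (F \<beta> \<alpha>)"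
  unfolding F_def using full_gstar[OF _ ts_S] ts_converse by metis

lemma F_conv:
  assumes "\<alpha> \<in> Mo" "\<beta> \<in> Mo" "so \<alpha> = so \<beta>"
  shows "convolution TG (ind (F \<alpha> (so \<alpha>))) (ind (F (so \<beta>) \<beta>)) = ind (F \<alpha> \<beta>)"
proof -
  have "ts (so \<beta>) \<beta> = (tau \<Lambda> \<beta>)\<inverse>" "ts \<alpha> (so \<alpha>) = tau \<Lambda> \<alpha>"
    using tau_ts[OF assms(1)] tau_ts[OF assms(2)] ts_converse by metis+
  then have "ts (so \<beta>) \<beta> O ts \<alpha> (so \<alpha>) = ts \<alpha> \<beta>" by (simp add: ts_def)
  then show ?thesis unfolding F_def using full_conv[of "ts \<alpha> (so \<alpha>)" "ts (so \<beta>) \<beta>"] ts_S assms by simp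
qed

lemma F_mult:
  assumes "\<alpha> \<in> Mo" "\<beta> \<in> Mo" "so \<alpha> = ra \<beta>"
  shows "convolution TG (ind (F \<alpha> (so \<alpha>))) (ind (F \<beta> (so \<beta>))) = ind (F (\<alpha> \<bullet>\<bullet> \<beta>) (so (\<alpha> \<bullet>\<bullet> \<beta>)))"
proof -
  have "tau \<Lambda> \<beta> O tau \<Lambda> \<alpha> = tau \<Lambda> (\<alpha> \<bullet>\<bullet> \<beta>)"
    using assms by (auto simp: tau_iff relcomp_unfold comp_assoc)
  then have "ts \<beta> (so \<beta>) O ts \<alpha> (so \<alpha>) = ts (\<alpha> \<bullet>\<bullet> \<beta>) (so (\<alpha> \<bullet>\<bullet> \<beta>))"
    using tau_ts[OF assms(1)] tau_ts[OF assms(2)] tau_ts[OF comp_simps(1)[OF assms]] by simp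
  then show ?thesis unfolding F_def using full_conv[of "ts \<alpha> (so \<alpha>)" "ts \<beta> (so \<beta>)"] ts_S assms by simp
qed

lemma F_isometry:
  assumes "\<alpha> \<in> Mo"
  shows "convolution TG (ind (F (so \<alpha>) \<alpha>)) (ind (F \<alpha> (so \<alpha>))) = ind (F (so \<alpha>) (so \<alpha>))"
proof -
  have s: "ts \<alpha> (so \<alpha>) \<in> S\<^sub>\<Lambda>" using ts_S assms by simp
  have "ts \<alpha> (so \<alpha>) O ts (so \<alpha>) \<alpha> = ts (so \<alpha>) (so \<alpha>)"
    using S_Domain[OF s] ts_Domain[of \<alpha> "so \<alpha>"] assms by (simp add: ts_converse ts_self)
  then show ?thesis unfolding F_def using full_conv[of "ts (so \<alpha>) \<alpha>" "ts \<alpha> (so \<alpha>)"] ts_S assms by simp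
qed

lemma F_self: "F \<alpha> \<alpha> = un ` tights (RI \<alpha>)"
proof -
  have "F \<alpha> \<alpha> = germ \<Lambda> (Id_on (RI \<alpha>)) ` tights (RI \<alpha>)"
    unfolding F_def \<Theta>_def using dom_filters_ts[of \<alpha> \<alpha>] by (simp add: ts_self)
  also have "\<dots> = un ` tights (RI \<alpha>)"
    by (rule image_cong[OF HOL.refl], rule un_eq[OF tight_filt]) (simp_all add: tights_def)
  finally show ?thesis .
qed

lemma tights_tight: "tights D \<subseteq> tight" unfolding tights_def by auto

lemma un_Int: "\<lbrakk>A \<subseteq> tight; B \<subseteq> tight\<rbrakk> \<Longrightarrow> un ` (A \<inter> B) = un ` A \<inter> un ` B"
  by (rule inj_on_image_Int[of un tight]) (rule inj_onI, rule un_inj)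

lemma ind_diag_mult:
  "\<lbrakk>A \<subseteq> tight; B \<subseteq> tight\<rbrakk> \<Longrightarrow> convolution TG (ind (un ` A)) (ind (un ` B)) = ind (un ` (A \<inter> B))"
  unfolding convolution_diag2[OF diag_ind diag_ind] un_Int by (auto simp: ind_def)

text \<open>The set-theoretic form of relation (iii): the intersection of the two ideals is a finite
  union of ideals, and a tight filter containing a finite union contains one of its members.\<close>

lemma tights_vee:
  assumes "\<alpha> \<in> Mo" "\<beta> \<in> Mo" "is_vee \<Lambda> \<alpha> \<beta> \<Gamma>"
  shows "tights (RI \<alpha>) \<inter> tights (RI \<beta>) = (\<Union>\<gamma>\<in>\<Gamma>. tights (RI \<gamma>))"
proof (intro equalityI subsetI)
  note v = is_veeD[OF assms(3,1)]
  fix \<eta> assume "\<eta> \<in> tights (RI \<alpha>) \<inter> tights (RI \<beta>)"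
  then have e: "\<eta> \<in> tight" "Id_on (RI \<alpha>) \<in> \<eta>" "Id_on (RI \<beta>) \<in> \<eta>" by (auto simp: tights_def)
  have "Id_on (RI \<alpha> \<inter> RI \<beta>) \<in> \<eta>" using filtD(4)[OF tight_filt[OF e(1)] e(2,3)] .
  from tight_Union[OF e(1) this v(1,2)] show "\<eta> \<in> (\<Union>\<gamma>\<in>\<Gamma>. tights (RI \<gamma>))"
    using v(5) e(1) by (auto simp: tights_def)
next
  note v = is_veeD[OF assms(3,1)]
  fix \<eta> assume "\<eta> \<in> (\<Union>\<gamma>\<in>\<Gamma>. tights (RI \<gamma>))"
  then obtain \<gamma> where g: "\<gamma> \<in> \<Gamma>" "\<eta> \<in> tight" "Id_on (RI \<gamma>) \<in> \<eta>" by (auto simp: tights_def)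
  then have "\<gamma> \<in> RI \<alpha>" "\<gamma> \<in> RI \<beta>" using v by auto
  then show "\<eta> \<in> tights (RI \<alpha>) \<inter> tights (RI \<beta>)" unfolding tights_def
    using filtD(3)[OF tight_filt[OF g(2)] g(3)] RI_mono DD_RI assms(1,2) g(2) by auto
qed

text \<open>The set-theoretic form of relation (iv). An exhaustive set need not cover the ideal of
  \<open>v\<close>; it only meets every nonempty set of \<open>DD\<close> below it, and this is
  exactly the hypothesis of \<open>tight_cover\<close>.\<close>

lemma tights_exhaustive:
  assumes "v \<in> Mo" "exhaustive \<Lambda> v E"
  shows "tights (RI v) = (\<Union>\<gamma>\<in>E. tights (RI \<gamma>))"
proof (intro equalityI subsetI)
  have E: "finite E" "E \<subseteq> RI v" "E \<subseteq> Mo" using assms RI_Mo unfolding exhaustive_def by auto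
  { fix \<eta> assume "\<eta> \<in> tights (RI v)"
    then have e: "\<eta> \<in> tight" "Id_on (RI v) \<in> \<eta>" by (auto simp: tights_def)
    have "\<exists>D\<in>RI ` E. Id_on D \<in> \<eta>"
    proof (rule tight_cover[OF e])
      show "finite (RI ` E)" "RI ` E \<subseteq> DD" using E DD_RI by auto
      fix D assume D: "D \<in> DD" "D \<noteq> {}" "D \<subseteq> RI v"
      then obtain x where x: "x \<in> D" by auto
      then have "x \<in> RI v" using D(3) by auto
      then have "\<exists>\<beta>\<in>E. RI \<beta> \<inter> RI x \<noteq> {}" using assms(2) unfolding exhaustive_def by simp
      then obtain \<beta> where "\<beta> \<in> E" "RI \<beta> \<inter> RI x \<noteq> {}" by (elim bexE)
      then show "\<exists>A\<in>RI ` E. D \<inter> A \<noteq> {}" using DD_right_ideal(2)[OF D(1) x] by auto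
    qed
    then show "\<eta> \<in> (\<Union>\<gamma>\<in>E. tights (RI \<gamma>))" using e(1) by (auto simp: tights_def) }
  { fix \<eta> assume "\<eta> \<in> (\<Union>\<gamma>\<in>E. tights (RI \<gamma>))"
    then obtain \<gamma> where g: "\<gamma> \<in> E" "\<eta> \<in> tight" "Id_on (RI \<gamma>) \<in> \<eta>" by (auto simp: tights_def)
    then have "\<gamma> \<in> RI v" using E by auto
    from filtD(3)[OF tight_filt[OF g(2)] g(3) RI_mono[OF this assms(1)] DD_RI[OF assms(1)]]
    show "\<eta> \<in> tights (RI v)" using g(2) by (simp add: tights_def) }
qed

text \<open>The support in the space of tight filters of the projection that is later called
  \<open>cell \<gamma> Q\<close>.\<close>

definition cset :: "'a \<Rightarrow> 'a list \<Rightarrow> 'a pbij set set" where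
  "cset \<gamma> Q = N {Id_on (RI \<gamma>)} ((\<lambda>\<beta>. Id_on (RI \<beta>)) ` set Q)"

lemma cset_iff: "\<eta> \<in> cset \<gamma> Q \<longleftrightarrow> \<eta> \<in> tight \<and> Id_on (RI \<gamma>) \<in> \<eta> \<and> (\<forall>\<beta>\<in>set Q. Id_on (RI \<beta>) \<notin> \<eta>)"
  unfolding cset_def N_def FN_def using tight_filt by auto

lemma cset_tight: "cset \<gamma> Q \<subseteq> tight" using cset_iff by auto

text \<open>As a finite union of maps \<open>ts \<alpha> \<beta>\<close>, \<open>s\<close> has its
  domain covered by the ideals of the \<beta>. The tight filter contains one of them, and on it
  \<open>s\<close> coincides with the corresponding map.\<close>

lemma S_decomp_germ:
  assumes s: "s \<in> S\<^sub>\<Lambda>" and e: "\<eta> \<in> tight" "Id_on (Domain s) \<in> \<eta>"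
  shows "\<exists>\<alpha> \<beta>. (\<alpha>, \<beta>) \<in> pairs \<and> Id_on (RI \<beta>) \<in> \<eta> \<and>
    (\<forall>\<theta>. filt \<theta> \<longrightarrow> Id_on (RI \<beta>) \<in> \<theta> \<longrightarrow> germ \<Lambda> s \<theta> = germ \<Lambda> (ts \<alpha> \<beta>) \<theta>)"
proof -
  obtain P where P: "finite P" "P \<subseteq> pairs" "s = (\<Union>(\<alpha>, \<beta>)\<in>P. ts \<alpha> \<beta>)"
    using S_decomp[OF s] unfolding ts_union_def by (elim exE conjE)
  have sub: "Domain s \<subseteq> (\<Union>\<beta>\<in>snd ` P. RI \<beta>)"
  proof
    fix x assume "x \<in> Domain s"
    then obtain y where "(x, y) \<in> s" by (elim DomainE)
    then obtain p where "p \<in> P" "(x, y) \<in> (case p of (\<alpha>, \<beta>) \<Rightarrow> ts \<alpha> \<beta>)" unfolding P(3) by (elim UN_E)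
    then have p: "p \<in> P" "(x, y) \<in> ts (fst p) (snd p)" by (simp_all add: case_prod_beta)
    then have "x \<in> Domain (ts (fst p) (snd p))" by auto
    moreover have "so (fst p) = so (snd p)" using p(1) P(2) by auto
    ultimately show "x \<in> (\<Union>\<beta>\<in>snd ` P. RI \<beta>)" using p(1) ts_Domain by auto
  qed
  have "snd ` P \<subseteq> Mo" using P(2) by auto
  from tight_Union[OF e finite_imageI[OF P(1)] this sub]
  obtain \<beta> where b: "\<beta> \<in> snd ` P" "Id_on (RI \<beta>) \<in> \<eta>" by (elim bexE)
  obtain \<alpha> where a: "(\<alpha>, \<beta>) \<in> P" using b(1) by auto
  then have ab: "(\<alpha>, \<beta>) \<in> pairs" using P(2) by (rule subsetD[rotated])
  have tsub: "ts \<alpha> \<beta> \<subseteq> s" unfolding P(3) using UN_upper[OF a, of "\<lambda>(\<alpha>, \<beta>). ts \<alpha> \<beta>"] by simp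
  have "Id_on (RI \<beta>) O s = Id_on (RI \<beta>) O ts \<alpha> \<beta>"
    unfolding restrict_iff
  proof (intro ballI allI)
    fix x y assume "x \<in> RI \<beta>"
    then have "x \<in> Domain (ts \<alpha> \<beta>)" using ts_Domain ab by auto
    then obtain z where z: "(x, z) \<in> ts \<alpha> \<beta>" by auto
    then have "(x, y) \<in> s \<Longrightarrow> y = z" using pbijD(1)[OF s] tsub by (metis subsetD)
    then show "(x, y) \<in> s \<longleftrightarrow> (x, y) \<in> ts \<alpha> \<beta>" using z tsub by auto
  qed
  note agree = germ_eqI[OF _ _ this]
  have "\<forall>\<theta>. filt \<theta> \<longrightarrow> Id_on (RI \<beta>) \<in> \<theta> \<longrightarrow> germ \<Lambda> s \<theta> = germ \<Lambda> (ts \<alpha> \<beta>) \<theta>"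
    by (intro allI impI agree)
  then show ?thesis using ab b(2) by (intro exI conjI)
qed

text \<open>A basic neighbourhood is shrunk: all positive conditions are replaced by one ideal
  \<open>RI \<delta>\<close> below them, each forbidden set by the finitely many ideals composing
  it, and \<open>s\<close> by a map \<open>ts \<alpha> \<beta>\<close> with the same germs.\<close>

lemma cset_basis:
  assumes W: "openin (gtop TG) W" "g \<in> W"
  shows "\<exists>\<alpha> \<beta> \<delta> Q. (\<alpha>, \<beta>) \<in> pairs \<and> \<delta> \<in> RI \<beta> \<and> set Q \<subseteq> Mo \<and>
    g \<in> \<Theta> (ts \<alpha> \<beta>) (cset \<delta> Q) \<and> \<Theta> (ts \<alpha> \<beta>) (cset \<delta> Q) \<subseteq> W"
proof -
  obtain C where C: "C \<in> basic" "g \<in> C" "C \<subseteq> W" using W gtop_base by metis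
  obtain s X Y where s: "C = \<Theta> s (N X Y)" "s \<in> S\<^sub>\<Lambda>" "fin X" "fin Y" "Id_on (Domain s) \<in> X" using C(1) by (elim basicE)
  obtain \<eta> where g: "g = germ \<Lambda> s \<eta>" "\<eta> \<in> N X Y" using C(2) s(1) unfolding \<Theta>_def by auto
  have e: "\<eta> \<in> tight" "X \<subseteq> \<eta>" "Y \<inter> \<eta> = {}" using g(2) by (auto simp: N_def FN_def)
  note f = tight_filt[OF e(1)]
  from S_decomp_germ[OF s(2) e(1) subsetD[OF e(2) s(5)]]
  obtain \<alpha> \<beta> where ab': "(\<alpha>, \<beta>) \<in> pairs" "Id_on (RI \<beta>) \<in> \<eta>"
      "\<forall>\<theta>. filt \<theta> \<longrightarrow> Id_on (RI \<beta>) \<in> \<theta> \<longrightarrow> germ \<Lambda> s \<theta> = germ \<Lambda> (ts \<alpha> \<beta>) \<theta>"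
    by (elim exE conjE)
  have ab: "(\<alpha>, \<beta>) \<in> pairs" "Id_on (RI \<beta>) \<in> \<eta>"
      "\<And>\<theta>. \<lbrakk>filt \<theta>; Id_on (RI \<beta>) \<in> \<theta>\<rbrakk> \<Longrightarrow> germ \<Lambda> s \<theta> = germ \<Lambda> (ts \<alpha> \<beta>) \<theta>"
    using ab' by simp_all
  have bM: "\<beta> \<in> Mo" using ab(1) by auto
  let ?K = "insert (RI \<beta>) (Domain ` X)"
  have XI: "x = Id_on (Domain x)" if "x \<in> X" for x using s(3) that by (auto simp: idems_eq Domain_Id_on)
  have "Id_on (\<Inter>?K) \<in> \<eta>"
  proof (rule filt_Inter[OF f])
    fix D assume "D \<in> ?K"
    then show "Id_on D \<in> \<eta>" using ab(2) XI e(2) by auto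
  qed (use s(3) in auto)
  from tight_RI[OF e(1) this]
  obtain \<delta> where d: "\<delta> \<in> Mo" "RI \<delta> \<subseteq> \<Inter>?K" "Id_on (RI \<delta>) \<in> \<eta>" by (elim bexE conjE)
  have d\<beta>: "\<delta> \<in> RI \<beta>" using d(2) RI_self[OF d(1)] by auto
  have YI: "y = Id_on (Domain y)" "Domain y \<in> DD" if "y \<in> Y" for y using s(4) that by (auto simp: idems_eq Domain_Id_on)
  have "\<forall>y\<in>Y. \<exists>H. finite H \<and> H \<subseteq> Mo \<and> Domain y = (\<Union>\<alpha>\<in>H. RI \<alpha>)"
    by (rule ballI) (rule DD_decomp[OF YI(2)])
  from bchoice[OF this] obtain H where "\<forall>y\<in>Y. finite (H y) \<and> H y \<subseteq> Mo \<and> Domain y = (\<Union>\<alpha>\<in>H y. RI \<alpha>)" by (elim exE)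
  then have H: "finite (H y)" "H y \<subseteq> Mo" "Domain y = (\<Union>\<alpha>\<in>H y. RI \<alpha>)" if "y \<in> Y" for y using that by simp_all
  have "finite (\<Union>y\<in>Y. H y)" using s(4) H by auto
  then obtain Q where Q: "set Q = (\<Union>y\<in>Y. H y)" using finite_list by metis
  have QM: "set Q \<subseteq> Mo" using Q H by auto
  have "\<eta> \<in> cset \<delta> Q" unfolding cset_iff
  proof (intro conjI ballI e(1) d(3))
    fix \<epsilon> assume "\<epsilon> \<in> set Q"
    then obtain y where y: "y \<in> Y" "\<epsilon> \<in> H y" using Q by auto
    show "Id_on (RI \<epsilon>) \<notin> \<eta>"
    proof
      assume a: "Id_on (RI \<epsilon>) \<in> \<eta>"
      have "RI \<epsilon> \<subseteq> Domain y" using H[OF y(1)] y(2) by auto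
      from filtD(3)[OF f a this YI(2)[OF y(1)]] have "y \<in> \<eta>" using YI(1)[OF y(1)] by simp
      then show False using e(3) y(1) by auto
    qed
  qed
  moreover have "\<theta> \<in> N X Y" if t: "\<theta> \<in> cset \<delta> Q" for \<theta>
  proof -
    have t: "\<theta> \<in> tight" "Id_on (RI \<delta>) \<in> \<theta>" "\<And>\<epsilon>. \<epsilon> \<in> set Q \<Longrightarrow> Id_on (RI \<epsilon>) \<notin> \<theta>" using t unfolding cset_iff by auto
    note ft = tight_filt[OF t(1)]
    have "x \<in> \<theta>" if x: "x \<in> X" for x
    proof -
      have "Domain x \<in> DD" using s(3) x by (auto simp: idems_eq Domain_Id_on)
      moreover have "RI \<delta> \<subseteq> Domain x" using d(2) x by auto
      ultimately have "Id_on (Domain x) \<in> \<theta>" using filtD(3)[OF ft t(2)] by simp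
      then show ?thesis using XI[OF x] by simp
    qed
    moreover have "y \<notin> \<theta>" if y: "y \<in> Y" for y
    proof
      assume "y \<in> \<theta>"
      then have "Id_on (Domain y) \<in> \<theta>" using YI(1)[OF y] by simp
      then have "\<exists>\<alpha>\<in>H y. Id_on (RI \<alpha>) \<in> \<theta>" using tight_Union[OF t(1)] H[OF y] by simp
      then show False using t(3) Q y by auto
    qed
    ultimately show ?thesis using t(1) ft by (auto simp: N_def FN_def)
  qed
  moreover have "germ \<Lambda> s \<theta> = germ \<Lambda> (ts \<alpha> \<beta>) \<theta>" if t: "\<theta> \<in> cset \<delta> Q" for \<theta>
  proof -
    have t: "filt \<theta>" "Id_on (RI \<delta>) \<in> \<theta>" using t tight_filt unfolding cset_iff by auto
    show ?thesis by (rule ab(3)[OF t(1) filtD(3)[OF t RI_mono[OF d\<beta> bM] DD_RI[OF bM]]])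
  qed
  ultimately have "g \<in> \<Theta> (ts \<alpha> \<beta>) (cset \<delta> Q)" "\<Theta> (ts \<alpha> \<beta>) (cset \<delta> Q) \<subseteq> C"
    unfolding g(1) s(1) \<Theta>_def by auto
  then show ?thesis using ab(1) d\<beta> QM C(3) by (intro exI conjI) (assumption | rule order_trans)+
qed

lemma cset_cob:
  assumes "(\<alpha>, \<beta>) \<in> pairs" "\<delta> \<in> RI \<beta>" "set Q \<subseteq> Mo"
  shows "cob TG (\<Theta> (ts \<alpha> \<beta>) (cset \<delta> Q))" "cset \<delta> Q \<subseteq> tights (RI \<beta>)"
proof -
  have M: "\<alpha> \<in> Mo" "\<beta> \<in> Mo" "so \<alpha> = so \<beta>" "\<delta> \<in> Mo" using assms RI_Mo by auto
  have up: "Id_on (RI \<beta>) \<in> \<eta>" if "filt \<eta>" "Id_on (RI \<delta>) \<in> \<eta>" for \<eta>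
    using filtD(3)[OF that RI_mono[OF assms(2) M(2)] DD_RI[OF M(2)]] .
  have "cset \<delta> Q = N {Id_on (Domain (ts \<alpha> \<beta>)), Id_on (RI \<delta>)} ((\<lambda>\<beta>. Id_on (RI \<beta>)) ` set Q)"
    using up unfolding cset_def N_def FN_def ts_Domain[OF M(3)] by auto
  moreover have "\<Theta> (ts \<alpha> \<beta>) (N {Id_on (Domain (ts \<alpha> \<beta>)), Id_on (RI \<delta>)} ((\<lambda>\<beta>. Id_on (RI \<beta>)) ` set Q)) \<in> basic"
    using M assms(3) DD_RI by (intro basicI ts_S) (auto simp: ts_Domain)
  ultimately show "cob TG (\<Theta> (ts \<alpha> \<beta>) (cset \<delta> Q))" using G.basis_cob by simp
  show "cset \<delta> Q \<subseteq> tights (RI \<beta>)" using up tight_filt cset_iff by (auto simp: tights_def)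
qed

lemma ind_\<Theta>_conv:
  assumes "\<alpha> \<in> Mo" "\<beta> \<in> Mo" "so \<alpha> = so \<beta>" "V \<subseteq> tights (RI \<beta>)"
  shows "convolution TG (ind (F \<alpha> \<beta>)) (ind (un ` V)) = ind (\<Theta> (ts \<alpha> \<beta>) V)"
proof
  fix c
  have V: "V \<subseteq> tight" "V \<subseteq> dom_filters (ts \<alpha> \<beta>)" using assms(4) dom_filters_ts[OF assms(3)] by (auto simp: tights_def)
  have GP: "(ts \<alpha> \<beta>, \<eta>) \<in> GP" if "\<eta> \<in> tights (RI \<beta>)" for \<eta>
    using that ts_S[OF assms(1,2)] dom_filters_ts[OF assms(3)] by (simp add: GP_iff)
  show "convolution TG (ind (F \<alpha> \<beta>)) (ind (un ` V)) c = ind (\<Theta> (ts \<alpha> \<beta>) V) c"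
  proof (cases "c \<in> arrows TG")
    case True
    have "c \<in> F \<alpha> \<beta> \<and> un (gdom TG c) \<in> un ` V \<longleftrightarrow> c \<in> \<Theta> (ts \<alpha> \<beta>) V"
    proof
      assume "c \<in> F \<alpha> \<beta> \<and> un (gdom TG c) \<in> un ` V"
      then obtain \<eta> \<theta> where e: "\<eta> \<in> tights (RI \<beta>)" "c = germ \<Lambda> (ts \<alpha> \<beta>) \<eta>" "un (gdom TG c) = un \<theta>" "\<theta> \<in> V"
        unfolding F_def \<Theta>_def dom_filters_ts[OF assms(3)] by auto
      have "\<eta> = \<theta>" using un_inj[of "gdom TG c" \<theta>] e V gdom_tight[OF True] gdom_germ[OF GP[OF e(1)]] by auto
      then show "c \<in> \<Theta> (ts \<alpha> \<beta>) V" using e unfolding \<Theta>_def by auto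
    next
      assume "c \<in> \<Theta> (ts \<alpha> \<beta>) V"
      then obtain \<eta> where e: "\<eta> \<in> V" "c = germ \<Lambda> (ts \<alpha> \<beta>) \<eta>" unfolding \<Theta>_def by auto
      then have "\<eta> \<in> tights (RI \<beta>)" using assms(4) by auto
      then show "c \<in> F \<alpha> \<beta> \<and> un (gdom TG c) \<in> un ` V"
        using e gdom_germ[OF GP] unfolding F_def \<Theta>_def dom_filters_ts[OF assms(3)] by auto
    qed
    then show ?thesis using convolution_diag[OF diag_ind[OF V(1)] True, of "ind (F \<alpha> \<beta>)"] by (auto simp: ind_def)
  next
    case False
    then show ?thesis using \<Theta>_arrows[OF ts_S[OF assms(1,2)] V(2)] G.convolution_off_arrows[OF False] by (auto simp: ind_def)
  qed
qed

text \<open>The sets \<open>\<Theta> (ts \<alpha> \<beta>) (cset \<delta> Q)\<close> form a base.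
  Their indicators are products of \<open>ind (F \<alpha> \<beta>)\<close> with indicators on units,
  and the latter arise from \<open>F \<delta> \<delta>\<close> by removing the members of
  \<open>Q\<close> one by one.\<close>

lemma steinberg_generated_F:
  fixes H :: "('a germ \<Rightarrow> 'r::{comm_ring, comm_monoid_mult}) set"
  assumes cj: "scalar_inv cj" and gen: "\<And>\<alpha>. \<alpha> \<in> Mo \<Longrightarrow> ind (F \<alpha> (so \<alpha>)) \<in> H"
    and zero: "(\<lambda>x. 0) \<in> H"
    and add: "\<And>f g. \<lbrakk>f \<in> H; g \<in> H\<rbrakk> \<Longrightarrow> (\<lambda>x. f x + g x) \<in> H"
    and scale: "\<And>f c. f \<in> H \<Longrightarrow> (\<lambda>x. c * f x) \<in> H"
    and conv: "\<And>f g. \<lbrakk>f \<in> H; g \<in> H\<rbrakk> \<Longrightarrow> convolution TG f g \<in> H"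
    and star: "\<And>f. f \<in> H \<Longrightarrow> G.gstar cj f \<in> H"
  shows "fun_span G.SB \<subseteq> H"
proof -
  have F: "ind (F \<alpha> \<beta>) \<in> H" if "\<alpha> \<in> Mo" "\<beta> \<in> Mo" "so \<alpha> = so \<beta>" for \<alpha> \<beta>
  proof -
    have "ind (F (so \<beta>) \<beta>) \<in> H" using star[OF gen[OF that(2)]] that by (simp add: F_gstar[OF cj])
    from conv[OF gen[OF that(1)] this] show ?thesis unfolding F_conv[OF that] .
  qed
  have cs: "ind (un ` cset \<delta> Q) \<in> H" if d: "\<delta> \<in> Mo" "set Q \<subseteq> Mo" for \<delta> Q
    using d(2)
  proof (induction Q)
    case Nil
    have "cset \<delta> [] = tights (RI \<delta>)" using cset_iff by (auto simp: tights_def)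
    then show ?case using F[OF d(1,1) HOL.refl] F_self by simp
  next
    case (Cons \<beta> Q)
    let ?A = "cset \<delta> Q" and ?B = "tights (RI \<beta>)"
    have AB: "?A \<subseteq> tight" "?B \<subseteq> tight" using cset_tight tights_tight by auto
    have "cset \<delta> (\<beta> # Q) = ?A - ?B" unfolding set_eq_iff Diff_iff cset_iff by (auto simp: tights_def)
    then have im: "un ` cset \<delta> (\<beta> # Q) = un ` ?A - un ` (?A \<inter> ?B)" using un_inj AB by (auto 4 3)
    have A: "ind (un ` ?A) \<in> H" using Cons by simp
    have "ind (un ` ?B) \<in> H" using F[of \<beta> \<beta>] F_self Cons.prems by simp
    from conv[OF A this] have "ind (un ` (?A \<inter> ?B)) \<in> H" unfolding ind_diag_mult[OF AB] .
    from add[OF A scale[OF this, of "- 1"]]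
    have "(\<lambda>x. ind (un ` ?A) x + - 1 * ind (un ` (?A \<inter> ?B)) x) \<in> H" .
    moreover have "ind (un ` cset \<delta> (\<beta> # Q)) = (\<lambda>x. ind (un ` ?A) x + - 1 * (ind (un ` (?A \<inter> ?B)) x :: 'r))"
      unfolding im ind_def by (rule ext) auto
    ultimately show ?case by simp
  qed
  let ?B = "{\<Theta> (ts \<alpha> \<beta>) (cset \<delta> Q) | \<alpha> \<beta> \<delta> Q. (\<alpha>, \<beta>) \<in> pairs \<and> \<delta> \<in> RI \<beta> \<and> set Q \<subseteq> Mo}"
  show ?thesis
  proof (rule G.steinberg_generated[where B = ?B, OF cj])
    fix W g assume "openin (gtop TG) W" "g \<in> W"
    from cset_basis[OF this] obtain \<alpha> \<beta> \<delta> Q where "(\<alpha>, \<beta>) \<in> pairs" "\<delta> \<in> RI \<beta>" "set Q \<subseteq> Mo"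
      "g \<in> \<Theta> (ts \<alpha> \<beta>) (cset \<delta> Q)" "\<Theta> (ts \<alpha> \<beta>) (cset \<delta> Q) \<subseteq> W" by (elim exE conjE)
    note U = this
    have "\<Theta> (ts \<alpha> \<beta>) (cset \<delta> Q) \<in> ?B" unfolding mem_Collect_eq
      by (rule exI[of _ \<alpha>], rule exI[of _ \<beta>], rule exI[of _ \<delta>], rule exI[of _ Q]) (use U(1-3) in simp)
    then show "\<exists>U\<in>?B. g \<in> U \<and> U \<subseteq> W" using U(4,5) by (intro bexI conjI)
  next
    fix U assume "U \<in> ?B"
    from CollectD[OF this] obtain \<alpha> \<beta> \<delta> Q where U: "U = \<Theta> (ts \<alpha> \<beta>) (cset \<delta> Q)" "(\<alpha>, \<beta>) \<in> pairs" "\<delta> \<in> RI \<beta>" "set Q \<subseteq> Mo"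
      by (elim exE conjE)
    have M: "\<alpha> \<in> Mo" "\<beta> \<in> Mo" "so \<alpha> = so \<beta>" "\<delta> \<in> Mo" using U(2,3) RI_Mo by auto
    show "cob TG U \<and> ind U \<in> H"
      using cset_cob(1)[OF U(2-4)] conv[OF F[OF M(1-3)] cs[OF M(4) U(4)]] U(1)
      by (simp add: ind_\<Theta>_conv[OF M(1-3) cset_cob(2)[OF U(2-4)]])
  next
    show "(\<lambda>x. 0) \<in> H" by (rule zero)
    show "(\<lambda>x. f x + g x) \<in> H" "convolution TG f g \<in> H" if "f \<in> H" "g \<in> H" for f g
      using add[OF that] conv[OF that] .
    show "(\<lambda>x. c * f x) \<in> H" "G.gstar cj f \<in> H" if "f \<in> H" for f c
      using scale[OF that] star[OF that] .
  qed
qed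

text \<open>The default \<open>0\<close> off the category keeps all values in the carrier, since
  \<open>eval_term_star_cong\<close> evaluates terms in arbitrary generators.\<close>

definition gen_ind :: "'a \<Rightarrow> 'a germ \<Rightarrow> 'r::{comm_ring, comm_monoid_mult}" where
  "gen_ind \<alpha> = (if \<alpha> \<in> Mo then ind (F \<alpha> (so \<alpha>)) else (\<lambda>_. 0))"

lemma gen_ind_SB: "gen_ind \<alpha> \<in> fun_span G.SB"
  unfolding gen_ind_def using F_cob[of \<alpha> "so \<alpha>"] by (auto intro!: fun_span.zero fun_span_base)

lemma eval_relations:
  fixes cj :: "'r::{comm_ring, comm_monoid_mult} \<Rightarrow> 'r"
  assumes cj: "scalar_inv cj" and st: "(s, t) \<in> cat_relations \<Lambda>"
  shows "eval_term (groupoid_alg cj TG G.SB) gen_ind s = eval_term (groupoid_alg cj TG G.SB) gen_ind t"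
proof -
  let ?ev = "eval_term (groupoid_alg cj TG G.SB) gen_ind"
  note ga = G.groupoid_alg_simps
  have rp: "?ev (range_proj \<alpha>) = ind (un ` tights (RI \<alpha>))" if "\<alpha> \<in> Mo" for \<alpha>
    using that by (simp add: range_proj_def ga gen_ind_def F_gstar[OF cj] F_conv F_self)
  have join: "?ev (join_term (map range_proj xs)) = ind (un ` (\<Union>\<gamma>\<in>set xs. tights (RI \<gamma>)))" if "set xs \<subseteq> Mo" for xs
    using that
  proof (induction xs)
    case Nil
    show ?case by (simp add: ga ind_def)
  next
    case (Cons x xs)
    let ?A = "tights (RI x)" and ?B = "\<Union>\<gamma>\<in>set xs. tights (RI \<gamma>)"
    have AB: "?A \<subseteq> tight" "?B \<subseteq> tight" using tights_tight by auto
    have "?ev (join_term (map range_proj (x # xs))) =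
        (\<lambda>c. (ind (un ` ?A) c + ind (un ` ?B) c) + - 1 * convolution TG (ind (un ` ?A)) (ind (un ` ?B)) c)"
      using Cons rp by (simp add: ga)
    also have "\<dots> = ind (un ` ?A \<union> un ` ?B)"
      unfolding ind_diag_mult[OF AB] un_Int[OF AB] by (auto simp: ind_def fun_eq_iff)
    also have "un ` ?A \<union> un ` ?B = un ` (\<Union>\<gamma>\<in>set (x # xs). tights (RI \<gamma>))" by (simp add: image_Un)
    finally show ?case .
  qed
  from st consider
      (1) \<alpha> where "s = Mul (Star (Gen \<alpha>)) (Gen \<alpha>)" "t = Gen (so \<alpha>)" "\<alpha> \<in> Mo"
    | (2) \<alpha> \<beta> where "s = Mul (Gen \<alpha>) (Gen \<beta>)" "t = Gen (\<alpha> \<bullet>\<bullet> \<beta>)" "\<alpha> \<in> Mo" "\<beta> \<in> Mo" "so \<alpha> = ra \<beta>"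
    | (3) \<alpha> \<beta> \<gamma>s where "s = Mul (range_proj \<alpha>) (range_proj \<beta>)" "t = join_term (map range_proj \<gamma>s)" "\<alpha> \<in> Mo" "\<beta> \<in> Mo" "is_vee \<Lambda> \<alpha> \<beta> (set \<gamma>s)"
    | (4) v xs where "s = Gen v" "t = join_term (map range_proj xs)" "v \<in> Obj \<Lambda>" "exhaustive \<Lambda> v (set xs)"
    unfolding cat_relations_def by blast
  then show ?thesis
  proof cases
    case 1
    then show ?thesis by (simp add: ga gen_ind_def F_gstar[OF cj] F_isometry)
  next
    case 2
    then show ?thesis by (simp add: ga gen_ind_def F_mult[OF 2(3-5), unfolded 2(5)])
  next
    case 3
    have "set \<gamma>s \<subseteq> Mo" using is_veeD[OF 3(5,3)] by simp
    then show ?thesis using 3(1-4) by (simp add: ga join rp ind_diag_mult[OF tights_tight tights_tight] tights_vee[OF 3(3-5)])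
  next
    case 4
    then have v: "v \<in> Mo" "so v = v" unfolding Obj_def by auto
    have "set xs \<subseteq> Mo" using 4(4) RI_Mo[OF v(1)] unfolding exhaustive_def by auto
    then show ?thesis using 4(1,2) v by (simp add: ga gen_ind_def join F_self flip: tights_exhaustive[OF v(1) 4(4)])
  qed
qed

end

section \<open>Algebras generated by a representation of the category\<close>

inductive_set fsums :: "'q::comm_monoid_add set \<Rightarrow> 'q set" for A where
  zero: "0 \<in> fsums A"
| step: "x \<in> fsums A \<Longrightarrow> a \<in> A \<Longrightarrow> x + a \<in> fsums A"

lemma fsums_base: "a \<in> A \<Longrightarrow> a \<in> fsums A"
  using fsums.step[OF fsums.zero] by fastforce

lemma fsums_add:
  assumes "x \<in> fsums A" "y \<in> fsums A" shows "x + y \<in> fsums A"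
  using assms(2)
proof (induction rule: fsums.induct)
  case (step y a)
  then show ?case using fsums.step[of "x + y" A a] by (simp add: add.assoc)
qed (use assms(1) in simp)

lemma fsums_map:
  assumes x: "x \<in> fsums A" and f: "f 0 = 0" "\<And>x y. f (x + y) = f x + f y" and A: "\<And>a. a \<in> A \<Longrightarrow> f a \<in> fsums B"
  shows "f x \<in> fsums B"
  using x by (induction rule: fsums.induct) (auto simp: f intro: fsums.zero fsums_add A)

lemma fsums_bind: "x \<in> fsums A \<Longrightarrow> (\<And>a. a \<in> A \<Longrightarrow> a \<in> fsums B) \<Longrightarrow> x \<in> fsums B"
  using fsums_map[of x A "\<lambda>x. x"] by simp

lemma fsums_mult_left: "x \<in> fsums A \<Longrightarrow> (\<And>a. a \<in> A \<Longrightarrow> y * a \<in> fsums B) \<Longrightarrow> (y::'q::ring) * x \<in> fsums B"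
  using fsums_map[of x A "\<lambda>x. y * x"] by (simp add: distrib_left)

text \<open>Summands belonging to the same index are merged, so a finite sum of any length is
  rewritten with one term for each of the \<open>n\<close> indices.\<close>

lemma fsums_indexed:
  assumes "x \<in> fsums (\<Union>i<n. X i)" "\<And>i. 0 \<in> X i" "\<And>i a b. \<lbrakk>a \<in> X i; b \<in> X i\<rbrakk> \<Longrightarrow> a + b \<in> X i"
  shows "\<exists>y. (\<forall>i<n. y i \<in> X i) \<and> x = (\<Sum>i<(n::nat). y i)"
  using assms(1)
proof (induction rule: fsums.induct)
  case zero
  show ?case using assms(2) by (intro exI[of _ "\<lambda>_. 0"]) simp
next
  case (step x a)
  obtain y where y: "\<And>i. i < n \<Longrightarrow> y i \<in> X i" "x = (\<Sum>i<n. y i)" using step.IH by blast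
  obtain i where i: "i < n" "a \<in> X i" using step.hyps(2) by blast
  have "(\<Sum>j<n. (y(i := y i + a)) j) = (\<Sum>j<n. y j + (if j = i then a else 0))"
    by (rule sum.cong) auto
  also have "\<dots> = x + a" using i(1) y(2) by (simp add: sum.distrib)
  finally show ?case using y(1) i assms(3) by (intro exI[of _ "y(i := y i + a)"]) auto
qed

primrec qjoin :: "'q::ring list \<Rightarrow> 'q" where
  "qjoin [] = 0"
| "qjoin (p # ps) = p + qjoin ps - p * qjoin ps"

text \<open>An abstract ring with two families replaces the algebra with involution:
  \<open>Ts\<close> stands for the adjoints, and the adjoint forms of the relations are listed as
  axioms. Normal forms and cells then need only ring operations.\<close>

locale cat_family = lcsc \<Lambda> for \<Lambda> :: "'a small_cat" +
  fixes sc :: "'r::{comm_ring, comm_monoid_mult} \<Rightarrow> 'q::ring \<Rightarrow> 'q" and T Ts :: "'a \<Rightarrow> 'q"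
  assumes sc_add: "sc c (x + y) = sc c x + sc c y" and add_sc: "sc (c + d) x = sc c x + sc d x"
    and sc_sc: "sc (c * d) x = sc c (sc d x)" and sc_one: "sc 1 x = x"
    and sc_left: "sc c x * y = sc c (x * y)" and sc_right: "x * sc c y = sc c (x * y)"
    and Ts_T: "\<alpha> \<in> Mo \<Longrightarrow> Ts \<alpha> * T \<alpha> = T (so \<alpha>)"
    and T_T: "\<lbrakk>\<alpha> \<in> Mo; \<beta> \<in> Mo; so \<alpha> = ra \<beta>\<rbrakk> \<Longrightarrow> T \<alpha> * T \<beta> = T (\<alpha> \<bullet>\<bullet> \<beta>)"
    and Ts_Ts: "\<lbrakk>\<alpha> \<in> Mo; \<beta> \<in> Mo; so \<alpha> = ra \<beta>\<rbrakk> \<Longrightarrow> Ts \<beta> * Ts \<alpha> = Ts (\<alpha> \<bullet>\<bullet> \<beta>)"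
    and Ts_obj: "\<alpha> \<in> Mo \<Longrightarrow> Ts (so \<alpha>) = T (so \<alpha>)"
    and vee: "\<lbrakk>\<alpha> \<in> Mo; \<beta> \<in> Mo; distinct \<gamma>s; is_vee \<Lambda> \<alpha> \<beta> (set \<gamma>s)\<rbrakk> \<Longrightarrow>
      (T \<alpha> * Ts \<alpha>) * (T \<beta> * Ts \<beta>) = qjoin (map (\<lambda>\<gamma>. T \<gamma> * Ts \<gamma>) \<gamma>s)"
    and exh: "\<lbrakk>v \<in> Obj \<Lambda>; distinct \<gamma>s; exhaustive \<Lambda> v (set \<gamma>s)\<rbrakk> \<Longrightarrow> T v = qjoin (map (\<lambda>\<gamma>. T \<gamma> * Ts \<gamma>) \<gamma>s)"
begin

definition e :: "'a \<Rightarrow> 'q" where "e \<alpha> = T \<alpha> * Ts \<alpha>"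

lemma sc_zero [simp]: "sc 0 x = 0" "sc c 0 = 0"
  using add_sc[of 0 0 x] sc_add[of c 0 0] by simp_all

lemma sc_minus: "sc (- 1) x = - x"
  using add_sc[of "- 1" 1 x] by (simp add: sc_one eq_neg_iff_add_eq_0)

lemma vee_e: "\<lbrakk>\<alpha> \<in> Mo; \<beta> \<in> Mo; distinct \<gamma>s; is_vee \<Lambda> \<alpha> \<beta> (set \<gamma>s)\<rbrakk> \<Longrightarrow> e \<alpha> * e \<beta> = qjoin (map e \<gamma>s)"
  using vee[of \<alpha> \<beta> \<gamma>s] unfolding e_def .

lemma e_commute: assumes "\<alpha> \<in> Mo" "\<beta> \<in> Mo" shows "e \<alpha> * e \<beta> = e \<beta> * e \<alpha>"
proof -
  obtain \<gamma>s where g: "distinct \<gamma>s" "is_vee \<Lambda> \<alpha> \<beta> (set \<gamma>s)" using vee_exists[OF assms] by metis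
  show ?thesis using vee_e[OF assms g] vee_e[OF assms(2,1) g(1) is_vee_commute[OF g(2)]] by simp
qed

lemma T_so: "\<alpha> \<in> Mo \<Longrightarrow> T \<alpha> * T (so \<alpha>) = T \<alpha>" "\<alpha> \<in> Mo \<Longrightarrow> T (ra \<alpha>) * T \<alpha> = T \<alpha>"
  using T_T[of \<alpha> "so \<alpha>"] T_T[of "ra \<alpha>" \<alpha>] by simp_all

lemma Ts_so: "\<alpha> \<in> Mo \<Longrightarrow> T (so \<alpha>) * Ts \<alpha> = Ts \<alpha>"
  using Ts_Ts[of \<alpha> "so \<alpha>"] Ts_obj[of \<alpha>] by simp

lemma Ts_ra: "\<alpha> \<in> Mo \<Longrightarrow> Ts \<alpha> * T (ra \<alpha>) = Ts \<alpha>"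
  using Ts_Ts[of "ra \<alpha>" \<alpha>] Ts_obj[of "ra \<alpha>"] by simp

lemma e_obj: "\<alpha> \<in> Mo \<Longrightarrow> e (so \<alpha>) = T (so \<alpha>)"
  unfolding e_def using Ts_obj[of \<alpha>] T_so(1)[of "so \<alpha>"] by simp

lemma e_T: "\<alpha> \<in> Mo \<Longrightarrow> e \<alpha> * T \<alpha> = T \<alpha>"
  unfolding e_def by (simp add: mult.assoc Ts_T T_so)

lemma Ts_e: "\<alpha> \<in> Mo \<Longrightarrow> Ts \<alpha> * e \<alpha> = Ts \<alpha>"
  unfolding e_def by (simp add: mult.assoc[symmetric] Ts_T Ts_so)

lemma e_idem: "\<alpha> \<in> Mo \<Longrightarrow> e \<alpha> * e \<alpha> = e \<alpha>"
  using Ts_e[of \<alpha>] unfolding e_def by (simp add: mult.assoc)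

lemma e_RI: assumes "\<delta> \<in> RI \<alpha>" "\<alpha> \<in> Mo" shows "e \<alpha> * e \<delta> = e \<delta>"
proof -
  obtain x where x: "x \<in> Mo" "ra x = so \<alpha>" "\<delta> = \<alpha> \<bullet>\<bullet> x" using assms by (elim RI_E)
  then have "T \<delta> = T \<alpha> * T x" using T_T[of \<alpha> x] assms(2) by simp
  then have "e \<alpha> * T \<delta> = T \<delta>" using e_T[OF assms(2)] by (simp add: mult.assoc[symmetric])
  then show ?thesis unfolding e_def[of \<delta>] by (simp add: mult.assoc[symmetric])
qed

text \<open>Different objects have disjoint ideals, so their set of minimal common extensions is
  empty. Relation (iii) with the empty join makes the two projections orthogonal.\<close>

lemma T_T_zero: assumes "\<alpha> \<in> Mo" "\<beta> \<in> Mo" "so \<alpha> \<noteq> ra \<beta>" shows "T \<alpha> * T \<beta> = 0" "Ts \<beta> * Ts \<alpha> = 0"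
proof -
  have disj: "RI (so \<alpha>) \<inter> RI (ra \<beta>) = {}"
  proof (rule ccontr)
    assume "\<not> ?thesis"
    then obtain x where "x \<in> RI (so \<alpha>)" "x \<in> RI (ra \<beta>)" by auto
    then show False using assms by (elim RI_E) auto
  qed
  have "is_vee \<Lambda> (so \<alpha>) (ra \<beta>) (set [])" "is_vee \<Lambda> (ra \<beta>) (so \<alpha>) (set [])" unfolding is_vee_def using disj by auto
  then have "e (so \<alpha>) * e (ra \<beta>) = 0" "e (ra \<beta>) * e (so \<alpha>) = 0"
    using vee_e[of "so \<alpha>" "ra \<beta>" "[]"] vee_e[of "ra \<beta>" "so \<alpha>" "[]"] assms by auto
  then have z: "T (so \<alpha>) * T (ra \<beta>) = 0" "T (ra \<beta>) * T (so \<alpha>) = 0"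
    using e_obj[OF assms(1)] e_obj[of "ra \<beta>"] assms(2) by simp_all
  have "T \<alpha> * T \<beta> = T \<alpha> * (T (so \<alpha>) * T (ra \<beta>)) * T \<beta>"
    using T_so(1)[OF assms(1)] T_so(2)[OF assms(2)] by (simp add: mult.assoc) (simp add: mult.assoc[symmetric])
  then show "T \<alpha> * T \<beta> = 0" using z by simp
  have "Ts \<beta> * Ts \<alpha> = Ts \<beta> * (T (ra \<beta>) * T (so \<alpha>)) * Ts \<alpha>"
    using Ts_so[OF assms(1)] Ts_ra[OF assms(2)] by (simp add: mult.assoc) (simp add: mult.assoc[symmetric])
  then show "Ts \<beta> * Ts \<alpha> = 0" using z by simp
qed

lemma Ts_T_comp:
  assumes "\<beta> \<in> Mo" "x \<in> Mo" "ra x = so \<beta>"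
  shows "Ts \<beta> * T (\<beta> \<bullet>\<bullet> x) = T x" "Ts (\<beta> \<bullet>\<bullet> x) * T \<beta> = Ts x"
proof -
  have "Ts \<beta> * T (\<beta> \<bullet>\<bullet> x) = (Ts \<beta> * T \<beta>) * T x" using T_T[of \<beta> x] assms by (simp add: mult.assoc)
  then show "Ts \<beta> * T (\<beta> \<bullet>\<bullet> x) = T x" using Ts_T[OF assms(1)] T_so(2)[OF assms(2)] assms(3) by simp
  have "Ts (\<beta> \<bullet>\<bullet> x) * T \<beta> = Ts x * (Ts \<beta> * T \<beta>)" using Ts_Ts[of \<beta> x] assms by (simp add: mult.assoc[symmetric])
  then show "Ts (\<beta> \<bullet>\<bullet> x) * T \<beta> = Ts x" using Ts_T[OF assms(1)] Ts_ra[OF assms(2)] assms(3) by simp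
qed

subsection \<open>The diagonal\<close>

inductive_set Dg :: "'q set" where
  gen: "\<alpha> \<in> Mo \<Longrightarrow> e \<alpha> \<in> Dg"
| add: "x \<in> Dg \<Longrightarrow> y \<in> Dg \<Longrightarrow> x + y \<in> Dg"
| mult: "x \<in> Dg \<Longrightarrow> y \<in> Dg \<Longrightarrow> x * y \<in> Dg"
| sc: "x \<in> Dg \<Longrightarrow> sc c x \<in> Dg"

lemma Dg_zero: "\<alpha> \<in> Mo \<Longrightarrow> 0 \<in> Dg"
  using Dg.sc[OF Dg.gen, of \<alpha> 0] by simp

lemma Dg_diff: "\<lbrakk>x \<in> Dg; y \<in> Dg\<rbrakk> \<Longrightarrow> x - y \<in> Dg"
  using Dg.add[OF _ Dg.sc[of y "- 1"], of x] by (simp add: sc_minus)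

lemma Dg_commute: assumes "x \<in> Dg" "y \<in> Dg" shows "x * y = y * x"
proof -
  have 1: "e \<alpha> * y = y * e \<alpha>" if \<alpha>: "\<alpha> \<in> Mo" for \<alpha>
    using assms(2)
  proof (induction rule: Dg.induct)
    case (mult x y)
    have "e \<alpha> * (x * y) = x * (e \<alpha> * y)" using mult.IH(1) by (simp add: mult.assoc[symmetric])
    then show ?case using mult.IH(2) by (simp add: mult.assoc)
  qed (auto simp: e_commute[OF \<alpha>] distrib_left distrib_right sc_left sc_right)
  show ?thesis
    using assms(1)
  proof (induction rule: Dg.induct)
    case (mult a b)
    have "(a * b) * y = a * (y * b)" using mult.IH(2) by (simp add: mult.assoc)
    then show ?case using mult.IH(1) by (simp add: mult.assoc[symmetric])
  qed (auto simp: 1 distrib_left distrib_right sc_left sc_right)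
qed

lemma qjoin_Dg: "\<lbrakk>\<alpha> \<in> Mo; set \<gamma>s \<subseteq> Mo\<rbrakk> \<Longrightarrow> qjoin (map e \<gamma>s) \<in> Dg"
  by (induction \<gamma>s) (auto intro: Dg_zero Dg.intros Dg_diff)

lemma conj_T: assumes "\<gamma> \<in> Mo" "x \<in> Dg" shows "T \<gamma> * x * Ts \<gamma> \<in> Dg"
  using assms(2)
proof (induction rule: Dg.induct)
  case (gen \<beta>)
  show ?case
  proof (cases "so \<gamma> = ra \<beta>")
    case True
    have "T \<gamma> * e \<beta> * Ts \<gamma> = (T \<gamma> * T \<beta>) * (Ts \<beta> * Ts \<gamma>)" by (simp add: e_def mult.assoc)
    also have "\<dots> = e (\<gamma> \<bullet>\<bullet> \<beta>)" using T_T[OF assms(1) gen True] Ts_Ts[OF assms(1) gen True] by (simp add: e_def)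
    finally show ?thesis using gen assms(1) True by (simp add: Dg.gen)
  next
    case False
    have "T \<gamma> * e \<beta> * Ts \<gamma> = (T \<gamma> * T \<beta>) * (Ts \<beta> * Ts \<gamma>)" by (simp add: e_def mult.assoc)
    then show ?thesis using T_T_zero[OF assms(1) gen False] Dg_zero[OF assms(1)] by simp
  qed
next
  case (mult x y)
  have "x * T (so \<gamma>) = T (so \<gamma>) * x"
    using Dg_commute[OF mult.hyps(1) Dg.gen[of "so \<gamma>"]] assms(1) e_obj[OF assms(1)] by simp
  then have "(T \<gamma> * x * Ts \<gamma>) * (T \<gamma> * y * Ts \<gamma>) = T \<gamma> * (T (so \<gamma>) * x) * y * Ts \<gamma>"
    using Ts_T[OF assms(1)] by (simp add: mult.assoc) (simp add: mult.assoc[symmetric])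
  also have "\<dots> = T \<gamma> * (x * y) * Ts \<gamma>" using T_so(1)[OF assms(1)] by (simp add: mult.assoc[symmetric])
  finally show ?case using Dg.mult[OF mult.IH] by simp
qed (auto simp: distrib_left distrib_right sc_left sc_right intro: Dg.intros)

text \<open>The middle factor \<open>T \<gamma> * Ts \<gamma>\<close> is \<open>e \<gamma>\<close>;
  being allowed to pass \<open>x\<close>, it is absorbed by \<open>Ts \<gamma>\<close> on the
  left.\<close>

lemma conj_Ts_mult:
  assumes "\<gamma> \<in> Mo" "x * e \<gamma> = e \<gamma> * x"
  shows "(Ts \<gamma> * x * T \<gamma>) * (Ts \<gamma> * y * T \<gamma>) = Ts \<gamma> * (x * y) * T \<gamma>"
proof -
  have "(Ts \<gamma> * x * T \<gamma>) * (Ts \<gamma> * y * T \<gamma>) = Ts \<gamma> * (x * e \<gamma>) * y * T \<gamma>" by (simp add: e_def mult.assoc)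
  also have "\<dots> = (Ts \<gamma> * e \<gamma>) * x * y * T \<gamma>" by (simp add: assms(2) mult.assoc)
  finally show ?thesis using Ts_e[OF assms(1)] by (simp add: mult.assoc)
qed

text \<open>\<open>Ts \<gamma>\<close> absorbs \<open>e \<gamma>\<close>, so
  \<open>e \<beta>\<close> may be replaced by \<open>e \<gamma> * e \<beta>\<close>, a join of
  projections \<open>e \<epsilon>\<close> with
  \<open>\<epsilon> = \<gamma> \<bullet>\<bullet> y\<close>. Conjugation sends
  \<open>e \<epsilon>\<close> to \<open>e y\<close> and respects the products in the join.\<close>

lemma conj_Ts: assumes \<gamma>: "\<gamma> \<in> Mo" and x: "x \<in> Dg" shows "Ts \<gamma> * x * T \<gamma> \<in> Dg"
  using x
proof (induction rule: Dg.induct)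
  case (gen \<beta>)
  obtain \<epsilon>s where v: "distinct \<epsilon>s" "is_vee \<Lambda> \<gamma> \<beta> (set \<epsilon>s)" using vee_exists[OF \<gamma> gen] by metis
  have "set \<epsilon>s \<subseteq> RI \<gamma>" using is_veeD[OF v(2) \<gamma>] by simp
  then have "Ts \<gamma> * qjoin (map e \<epsilon>s) * T \<gamma> \<in> Dg"
  proof (induction \<epsilon>s)
    case Nil
    then show ?case using Dg_zero[OF \<gamma>] by simp
  next
    case (Cons \<epsilon> \<epsilon>s)
    have "\<epsilon> \<in> RI \<gamma>" using Cons.prems by simp
    then obtain y where y: "y \<in> Mo" "ra y = so \<gamma>" "\<epsilon> = \<gamma> \<bullet>\<bullet> y" "\<epsilon> \<in> Mo" using \<gamma> by (elim RI_E)
    have "Ts \<gamma> * e \<epsilon> * T \<gamma> = (Ts \<gamma> * T \<epsilon>) * (Ts \<epsilon> * T \<gamma>)" by (simp add: e_def mult.assoc)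
    also have "\<dots> = e y" using Ts_T_comp[OF \<gamma> y(1,2)] y(3) by (simp add: e_def)
    finally have 1: "Ts \<gamma> * e \<epsilon> * T \<gamma> \<in> Dg" using Dg.gen[OF y(1)] by simp
    have 2: "Ts \<gamma> * qjoin (map e \<epsilon>s) * T \<gamma> \<in> Dg" using Cons by simp
    have "Ts \<gamma> * (e \<epsilon> * qjoin (map e \<epsilon>s)) * T \<gamma> \<in> Dg"
      using conj_Ts_mult[OF \<gamma> e_commute[OF y(4) \<gamma>], of "qjoin (map e \<epsilon>s)"] Dg.mult[OF 1 2] by simp
    then show ?case using Dg_diff[OF Dg.add[OF 1 2]] by (simp add: algebra_simps)
  qed
  also have "qjoin (map e \<epsilon>s) = e \<gamma> * e \<beta>" using vee_e[OF \<gamma> gen v] by simp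
  also have "Ts \<gamma> * (e \<gamma> * e \<beta>) * T \<gamma> = Ts \<gamma> * e \<beta> * T \<gamma>" using Ts_e[OF \<gamma>] by (simp add: mult.assoc[symmetric])
  finally show ?case .
next
  case (mult x y)
  have "x * e \<gamma> = e \<gamma> * x" using Dg_commute[OF mult.hyps(1) Dg.gen[OF \<gamma>]] .
  from conj_Ts_mult[OF \<gamma> this, of y] show ?case using Dg.mult[OF mult.IH] by simp
qed (auto simp: distrib_left distrib_right sc_left sc_right intro: Dg.intros)

text \<open>Diagonal elements move across generators at the price of a conjugation that stays in the
  diagonal. This is how words are brought to the form with the diagonal factor on the right.\<close>

lemma Dg_T: assumes "\<gamma> \<in> Mo" "d \<in> Dg" shows "d * T \<gamma> = T \<gamma> * (Ts \<gamma> * d * T \<gamma>)"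
proof -
  have "d * T \<gamma> = d * e \<gamma> * T \<gamma>" using e_T[OF assms(1)] by (simp add: mult.assoc)
  also have "\<dots> = e \<gamma> * d * T \<gamma>" using Dg_commute[OF assms(2) Dg.gen[OF assms(1)]] by simp
  finally show ?thesis by (simp add: e_def mult.assoc)
qed

lemma Dg_Ts: assumes "\<gamma> \<in> Mo" "d \<in> Dg" shows "d * Ts \<gamma> = Ts \<gamma> * (T \<gamma> * d * Ts \<gamma>)"
proof -
  have "d * Ts \<gamma> = d * e (so \<gamma>) * Ts \<gamma>" using Ts_so[OF assms(1)] e_obj[OF assms(1)] by (simp add: mult.assoc)
  also have "\<dots> = T (so \<gamma>) * d * Ts \<gamma>"
    using Dg_commute[OF assms(2) Dg.gen[of "so \<gamma>"]] e_obj[OF assms(1)] assms(1) by simp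
  finally show ?thesis using Ts_T[OF assms(1)] by (simp add: mult.assoc[symmetric])
qed

subsection \<open>The spanning set\<close>

definition X :: "'a \<times> 'a \<Rightarrow> 'q set" where
  "X p = {T (fst p) * Ts (snd p) * d | d. d \<in> Dg}"

definition Sp :: "'q set" where
  "Sp = fsums (\<Union>p\<in>pairs. X p)"

lemma X_I: "d \<in> Dg \<Longrightarrow> T \<alpha> * Ts \<beta> * d \<in> X (\<alpha>, \<beta>)"
  by (auto simp: X_def)

lemma X_Sp: "\<lbrakk>x \<in> X p; p \<in> pairs\<rbrakk> \<Longrightarrow> x \<in> Sp"
  unfolding Sp_def by (rule fsums_base) blast

lemma X_add: "\<lbrakk>x \<in> X p; y \<in> X p\<rbrakk> \<Longrightarrow> x + y \<in> X p"
  unfolding X_def using Dg.add by (auto simp: distrib_left[symmetric])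

lemma X_zero: "\<alpha> \<in> Mo \<Longrightarrow> 0 \<in> X p"
  unfolding X_def using Dg_zero by force

lemma Sp_add: "\<lbrakk>x \<in> Sp; y \<in> Sp\<rbrakk> \<Longrightarrow> x + y \<in> Sp"
  unfolding Sp_def by (rule fsums_add)

lemma Sp_map:
  assumes "x \<in> Sp" "f 0 = 0" "\<And>x y. f (x + y) = f x + f y"
    and "\<And>\<alpha> \<beta> d. \<lbrakk>\<alpha> \<in> Mo; \<beta> \<in> Mo; so \<alpha> = so \<beta>; d \<in> Dg\<rbrakk> \<Longrightarrow> f (T \<alpha> * Ts \<beta> * d) \<in> Sp"
  shows "f x \<in> Sp"
  using assms(1) unfolding Sp_def
proof (rule fsums_map)
  fix a assume "a \<in> (\<Union>p\<in>pairs. X p)"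
  then obtain p where p: "p \<in> pairs" "a \<in> X p" by (elim UN_E)
  then obtain d where d: "a = T (fst p) * Ts (snd p) * d" "d \<in> Dg" unfolding X_def by auto
  have "fst p \<in> Mo" "snd p \<in> Mo" "so (fst p) = so (snd p)" using p(1) by (auto simp: case_prod_beta)
  from assms(4)[OF this d(2)] show "f a \<in> fsums (\<Union>p\<in>pairs. X p)" unfolding d(1) Sp_def .
qed (use assms in auto)

lemma Sp_zero: "0 \<in> Sp" unfolding Sp_def by (rule fsums.zero)

lemma Sp_sc: "x \<in> Sp \<Longrightarrow> sc c x \<in> Sp"
  by (erule Sp_map) (auto simp: sc_add sc_right[symmetric] intro!: X_Sp[OF X_I] Dg.sc)

lemma Sp_Dg: "\<lbrakk>x \<in> Sp; d \<in> Dg\<rbrakk> \<Longrightarrow> x * d \<in> Sp"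
  by (erule Sp_map[where f = "\<lambda>x. x * d"]) (auto simp: distrib_right mult.assoc[of "T _ * Ts _"] intro!: X_Sp[OF X_I] Dg.mult)

text \<open>Inserting \<open>e \<beta> * e \<gamma>\<close> and expanding it over the minimal common
  extensions \<open>\<epsilon> = \<beta> \<bullet>\<bullet> x = \<gamma> \<bullet>\<bullet>
  y\<close> turns each piece into \<open>T (\<alpha> \<bullet>\<bullet> x) * Ts y\<close> times a
  diagonal element.\<close>

lemma Sp_T_mult:
  assumes \<gamma>: "\<gamma> \<in> Mo" and x: "x \<in> Sp" shows "x * T \<gamma> \<in> Sp"
  using x
proof (rule Sp_map[where f = "\<lambda>x. x * T \<gamma>"])
  fix \<alpha> \<beta> d assume a: "\<alpha> \<in> Mo" "\<beta> \<in> Mo" "so \<alpha> = so \<beta>" "d \<in> Dg"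
  obtain \<epsilon>s where v: "distinct \<epsilon>s" "is_vee \<Lambda> \<beta> \<gamma> (set \<epsilon>s)" using vee_exists[OF a(2) \<gamma>] by metis
  note vD = is_veeD[OF v(2) a(2)]
  have piece: "T \<alpha> * Ts \<beta> * e \<epsilon> * d * T \<gamma> \<in> Sp" if \<epsilon>: "\<epsilon> \<in> set \<epsilon>s" and d: "d \<in> Dg" for \<epsilon> d
  proof -
    have "\<epsilon> \<in> RI \<beta>" "\<epsilon> \<in> RI \<gamma>" using vD \<epsilon> by auto
    obtain x where x: "x \<in> Mo" "ra x = so \<beta>" "\<epsilon> = \<beta> \<bullet>\<bullet> x" "so \<epsilon> = so x" using \<open>\<epsilon> \<in> RI \<beta>\<close> a(2) by (elim RI_E)
    obtain y where y: "y \<in> Mo" "ra y = so \<gamma>" "\<epsilon> = \<gamma> \<bullet>\<bullet> y" "so \<epsilon> = so y" using \<open>\<epsilon> \<in> RI \<gamma>\<close> \<gamma> by (elim RI_E)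
    let ?d = "Ts \<gamma> * d * T \<gamma>"
    have "Ts \<beta> * T \<epsilon> = T x" using Ts_T_comp(1)[OF a(2) x(1,2)] x(3) by simp
    moreover have "Ts \<epsilon> * T \<gamma> = Ts y" using Ts_T_comp(2)[OF \<gamma> y(1,2)] y(3) by simp
    moreover have "T \<alpha> * T x = T (\<alpha> \<bullet>\<bullet> x)" using T_T[OF a(1) x(1)] x(2) a(3) by simp
    moreover have "T \<alpha> * Ts \<beta> * e \<epsilon> * d * T \<gamma> = T \<alpha> * (Ts \<beta> * T \<epsilon>) * (Ts \<epsilon> * T \<gamma>) * ?d"
      using Dg_T[OF \<gamma> d] by (simp add: e_def mult.assoc)
    ultimately have "T \<alpha> * Ts \<beta> * e \<epsilon> * d * T \<gamma> = T (\<alpha> \<bullet>\<bullet> x) * Ts y * ?d" by simp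
    then show ?thesis using X_Sp[OF X_I[OF conj_Ts[OF \<gamma> d]], of "\<alpha> \<bullet>\<bullet> x" y] a x y by simp
  qed
  have "T \<alpha> * Ts \<beta> * qjoin (map e \<gamma>s) * d * T \<gamma> \<in> Sp" if "set \<gamma>s \<subseteq> set \<epsilon>s" "d \<in> Dg" for \<gamma>s d
    using that
  proof (induction \<gamma>s arbitrary: d)
    case Nil
    then show ?case by (simp add: Sp_zero)
  next
    case (Cons \<epsilon> \<gamma>s)
    have E: "e \<epsilon> \<in> Dg" "qjoin (map e \<gamma>s) \<in> Dg" using Cons.prems vD(2) \<gamma> by (auto intro!: Dg.gen qjoin_Dg)
    have 1: "T \<alpha> * Ts \<beta> * e \<epsilon> * d * T \<gamma> \<in> Sp" using piece Cons.prems by simp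
    have 2: "T \<alpha> * Ts \<beta> * qjoin (map e \<gamma>s) * d * T \<gamma> \<in> Sp" using Cons by simp
    have 3: "T \<alpha> * Ts \<beta> * e \<epsilon> * (qjoin (map e \<gamma>s) * d) * T \<gamma> \<in> Sp" using piece Cons.prems Dg.mult[OF E(2)] by simp
    have "T \<alpha> * Ts \<beta> * qjoin (map e (\<epsilon> # \<gamma>s)) * d * T \<gamma> =
        T \<alpha> * Ts \<beta> * e \<epsilon> * d * T \<gamma> + T \<alpha> * Ts \<beta> * qjoin (map e \<gamma>s) * d * T \<gamma> +
        sc (- 1) (T \<alpha> * Ts \<beta> * e \<epsilon> * (qjoin (map e \<gamma>s) * d) * T \<gamma>)"
      by (simp add: sc_minus algebra_simps)
    then show ?case using Sp_add[OF Sp_add[OF 1 2] Sp_sc[OF 3, of "- 1"]] by simp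
  qed
  from this[OF subset_refl a(4)] have "T \<alpha> * Ts \<beta> * (e \<beta> * e \<gamma>) * d * T \<gamma> \<in> Sp" using vee_e[OF a(2) \<gamma> v] by simp
  moreover have "T \<alpha> * Ts \<beta> * (e \<beta> * e \<gamma>) * d * T \<gamma> = T \<alpha> * (Ts \<beta> * e \<beta>) * d * (e \<gamma> * T \<gamma>)"
    using Dg_commute[OF a(4) Dg.gen[OF \<gamma>]] by (simp add: mult.assoc) (simp add: mult.assoc[symmetric])
  ultimately show "T \<alpha> * Ts \<beta> * d * T \<gamma> \<in> Sp" using Ts_e[OF a(2)] e_T[OF \<gamma>] by simp
qed (auto simp: distrib_right)

lemma Sp_Ts_mult:
  assumes \<gamma>: "\<gamma> \<in> Mo" and x: "x \<in> Sp" shows "x * Ts \<gamma> \<in> Sp"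
  using x
proof (rule Sp_map[where f = "\<lambda>x. x * Ts \<gamma>"])
  fix \<alpha> \<beta> d assume a: "\<alpha> \<in> Mo" "\<beta> \<in> Mo" "so \<alpha> = so \<beta>" "d \<in> Dg"
  have "T \<alpha> * Ts \<beta> * d * Ts \<gamma> = T \<alpha> * (Ts \<beta> * Ts \<gamma>) * (T \<gamma> * d * Ts \<gamma>)"
    using Dg_Ts[OF \<gamma> a(4)] by (simp add: mult.assoc)
  then show "T \<alpha> * Ts \<beta> * d * Ts \<gamma> \<in> Sp"
    using X_Sp[OF X_I[OF conj_T[OF \<gamma> a(4)]], of \<alpha> "\<gamma> \<bullet>\<bullet> \<beta>"] Ts_Ts[OF \<gamma> a(2)] T_T_zero(2)[OF \<gamma> a(2)] a \<gamma> Sp_zero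
    by (cases "so \<gamma> = ra \<beta>") simp_all
qed (auto simp: distrib_right)

lemma Sp_mult: assumes x: "x \<in> Sp" and y: "y \<in> Sp" shows "x * y \<in> Sp"
  using y
proof (rule Sp_map[where f = "\<lambda>y. x * y"])
  fix \<alpha> \<beta> d assume a: "\<alpha> \<in> Mo" "\<beta> \<in> Mo" "so \<alpha> = so \<beta>" "d \<in> Dg"
  from Sp_Dg[OF Sp_Ts_mult[OF a(2) Sp_T_mult[OF a(1) x]] a(4)]
  show "x * (T \<alpha> * Ts \<beta> * d) \<in> Sp" by (simp add: mult.assoc)
qed (auto simp: distrib_left)

lemma Sp_T: assumes "\<alpha> \<in> Mo" shows "T \<alpha> \<in> Sp" "Ts \<alpha> \<in> Sp"
proof -
  have "T \<alpha> * Ts (so \<alpha>) * e (so \<alpha>) = T \<alpha>" using assms by (simp add: Ts_obj e_obj T_so)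
  then show "T \<alpha> \<in> Sp" using X_Sp[OF X_I[OF Dg.gen[of "so \<alpha>"]], of \<alpha> "so \<alpha>"] assms by simp
  have "T (so \<alpha>) * Ts \<alpha> * e \<alpha> = Ts \<alpha>" using assms by (simp add: Ts_e Ts_so)
  then show "Ts \<alpha> \<in> Sp" using X_Sp[OF X_I[OF Dg.gen[of \<alpha>]], of "so \<alpha>" \<alpha>] assms by simp
qed

subsection \<open>Cells\<close>

text \<open>The product of \<open>e \<gamma>\<close> with the complements of the
  \<open>e \<beta>\<close> for \<beta> in \<open>Q\<close>. The ring need not have a unit, so
  complements are taken by subtraction below \<open>e \<gamma>\<close>.\<close>

primrec cell :: "'a \<Rightarrow> 'a list \<Rightarrow> 'q" where
  "cell \<gamma> [] = e \<gamma>"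
| "cell \<gamma> (\<beta> # Q) = cell \<gamma> Q - cell \<gamma> Q * e \<beta>"

lemma cell_Dg: "\<lbrakk>\<gamma> \<in> Mo; set Q \<subseteq> Mo\<rbrakk> \<Longrightarrow> cell \<gamma> Q \<in> Dg"
  by (induction Q) (auto intro: Dg.intros Dg_diff)

lemma cell_RI: "\<lbrakk>\<gamma> \<in> Mo; set Q \<subseteq> Mo; \<epsilon> \<in> RI \<gamma>\<rbrakk> \<Longrightarrow> cell \<gamma> Q * e \<epsilon> = cell \<epsilon> Q"
proof (induction Q)
  case (Cons \<beta> Q)
  have M: "\<epsilon> \<in> Mo" "\<beta> \<in> Mo" using Cons.prems RI_Mo by auto
  have "cell \<gamma> (\<beta> # Q) * e \<epsilon> = cell \<gamma> Q * e \<epsilon> - cell \<gamma> Q * (e \<epsilon> * e \<beta>)"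
    using e_commute[OF M] by (simp add: left_diff_distrib mult.assoc)
  then show ?case using Cons by (simp add: mult.assoc[symmetric])
qed (simp add: e_RI)

lemma cell_base: "\<lbrakk>\<gamma> \<in> Mo; set Q \<subseteq> Mo; \<delta> \<in> Mo; \<gamma> \<in> RI \<delta>\<rbrakk> \<Longrightarrow> cell \<gamma> Q * e \<delta> = cell \<gamma> Q"
proof (induction Q)
  case Nil
  then show ?case using e_RI[of \<gamma> \<delta>] e_commute[of \<gamma> \<delta>] by simp
next
  case (Cons \<beta> Q)
  have "cell \<gamma> (\<beta> # Q) * e \<delta> = cell \<gamma> Q * e \<delta> - cell \<gamma> Q * e \<delta> * e \<beta>"
    using e_commute[of \<beta> \<delta>] Cons.prems by (simp add: left_diff_distrib mult.assoc)
  then show ?case using Cons by simp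
qed

lemma cell_idem: "\<lbrakk>\<gamma> \<in> Mo; set Q \<subseteq> Mo\<rbrakk> \<Longrightarrow> cell \<gamma> Q * cell \<gamma> Q = cell \<gamma> Q"
proof (induction Q)
  case (Cons \<beta> Q)
  let ?q = "cell \<gamma> Q"
  have b: "?q * ?q = ?q" "?q * e \<beta> = e \<beta> * ?q" "e \<beta> * e \<beta> = e \<beta>"
    using Cons Dg_commute[OF cell_Dg[of \<gamma> Q] Dg.gen[of \<beta>]] e_idem[of \<beta>] by auto
  have "?q * (?q * e \<beta>) = ?q * e \<beta>" using b(1) by (metis mult.assoc)
  moreover have 2: "(?q * e \<beta>) * ?q = ?q * e \<beta>" using b(1,2) by (metis mult.assoc)
  moreover have "(?q * e \<beta>) * (?q * e \<beta>) = ?q * e \<beta>" using 2 b(3) by (metis mult.assoc)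
  ultimately show ?case using b(1) by (simp add: left_diff_distrib right_diff_distrib)
qed (simp add: e_idem)

lemma cell_kills: "\<lbrakk>\<gamma> \<in> Mo; set Q \<subseteq> Mo; \<beta> \<in> set Q\<rbrakk> \<Longrightarrow> cell \<gamma> Q * e \<beta> = 0"
proof (induction Q)
  case (Cons x Q)
  show ?case
  proof (cases "\<beta> = x")
    case True
    then show ?thesis using Cons.prems e_idem[of x] by (simp add: left_diff_distrib mult.assoc)
  next
    case False
    then have "cell \<gamma> Q * e \<beta> = 0" using Cons by simp
    moreover have "cell \<gamma> Q * e x * e \<beta> = cell \<gamma> Q * e \<beta> * e x" using e_commute[of x \<beta>] Cons.prems by (auto simp: mult.assoc)
    ultimately show ?thesis by (simp add: left_diff_distrib)
  qed
qed simp

definition iscell :: "'q \<Rightarrow> bool" where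
  "iscell q \<longleftrightarrow> (\<exists>\<gamma> Q. \<gamma> \<in> Mo \<and> set Q \<subseteq> Mo \<and> q = cell \<gamma> Q)"

text \<open>The join is made disjoint: on the cell \<open>q\<close>, joining
  \<open>e \<epsilon>\<close> to \<open>J\<close> gives the cell of \<epsilon> plus \<open>J\<close>
  restricted to the cell that also excludes \<epsilon>. The list of excluded elements grows, hence
  the generalisation over \<open>Q\<close>.\<close>

lemma cell_qjoin:
  assumes "\<gamma> \<in> Mo" "set Q \<subseteq> Mo" "set \<epsilon>s \<subseteq> RI \<gamma>"
  shows "cell \<gamma> Q * qjoin (map e \<epsilon>s) \<in>
    fsums {q. \<exists>\<epsilon>\<in>set \<epsilon>s. \<exists>Q'. set Q' \<subseteq> Mo \<and> q = cell \<epsilon> Q' \<and> cell \<gamma> Q * q = q}"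
  using assms(2,3)
proof (induction \<epsilon>s arbitrary: Q)
  case Nil
  then show ?case by (simp add: fsums.zero)
next
  case (Cons \<epsilon> \<epsilon>s)
  let ?q = "cell \<gamma> Q" and ?J = "qjoin (map e \<epsilon>s)"
  let ?A = "{q. \<exists>\<delta>\<in>set (\<epsilon> # \<epsilon>s). \<exists>Q'. set Q' \<subseteq> Mo \<and> q = cell \<delta> Q' \<and> ?q * q = q}"
  have M: "\<epsilon> \<in> Mo" "set (\<epsilon> # Q) \<subseteq> Mo" using Cons.prems RI_Mo[OF assms(1)] by auto
  have qe: "?q * e \<epsilon> = cell \<epsilon> Q" using cell_RI[OF assms(1) Cons.prems(1)] Cons.prems by simp
  have idem: "?q * ?q = ?q" using cell_idem[OF assms(1) Cons.prems(1)] .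
  have "?q * cell \<epsilon> Q = cell \<epsilon> Q" unfolding qe[symmetric] using idem by (simp add: mult.assoc[symmetric])
  then have 1: "cell \<epsilon> Q \<in> ?A" using Cons.prems by auto
  have sub: "?q * cell \<gamma> (\<epsilon> # Q) = cell \<gamma> (\<epsilon> # Q)" using idem by (simp add: right_diff_distrib mult.assoc[symmetric])
  have "cell \<gamma> (\<epsilon> # Q) * ?J \<in> fsums ?A"
  proof (rule fsums_bind[OF Cons.IH[OF M(2)]])
    show "set \<epsilon>s \<subseteq> RI \<gamma>" using Cons.prems by simp
    fix q assume "q \<in> {q. \<exists>\<delta>\<in>set \<epsilon>s. \<exists>Q'. set Q' \<subseteq> Mo \<and> q = cell \<delta> Q' \<and> cell \<gamma> (\<epsilon> # Q) * q = q}"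
    then obtain \<delta> Q' where q: "\<delta> \<in> set \<epsilon>s" "set Q' \<subseteq> Mo" "q = cell \<delta> Q'" "cell \<gamma> (\<epsilon> # Q) * q = q" by auto
    have "?q * q = q" using sub q(4) by (metis mult.assoc)
    then have "q \<in> ?A" using q by auto
    then show "q \<in> fsums ?A" by (rule fsums_base)
  qed
  from fsums_add[OF fsums_base[OF 1] this] have "cell \<epsilon> Q + cell \<gamma> (\<epsilon> # Q) * ?J \<in> fsums ?A" .
  also have "cell \<epsilon> Q + cell \<gamma> (\<epsilon> # Q) * ?J = ?q * qjoin (map e (\<epsilon> # \<epsilon>s))"
    unfolding qe[symmetric] by (simp add: algebra_simps)
  finally show ?case .
qed

text \<open>For a generator, \<open>q\<close> splits into its part outside \<alpha>, where the
  scalar is \<open>0\<close>, and its part below \<alpha>, where it is \<open>1\<close>. For sums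
  and products the cells found for \<open>x\<close> are split again for \<open>y\<close>; the
  condition \<open>q * q' = q'\<close> makes scalars persist on subcells.\<close>

lemma cell_split:
  assumes "d \<in> Dg" "iscell q"
  shows "q \<in> fsums {q'. iscell q' \<and> q * q' = q' \<and> (\<exists>c. q' * d = sc c q')}"
  using assms
proof (induction arbitrary: q rule: Dg.induct)
  case (gen \<alpha>)
  let ?A = "{q'. iscell q' \<and> q * q' = q' \<and> (\<exists>c. q' * e \<alpha> = sc c q')}"
  obtain \<gamma> Q where q: "\<gamma> \<in> Mo" "set Q \<subseteq> Mo" "q = cell \<gamma> Q" using gen.prems unfolding iscell_def by auto
  have idem: "q * q = q" using cell_idem[OF q(1,2)] q(3) by simp
  obtain \<epsilon>s where v: "distinct \<epsilon>s" "is_vee \<Lambda> \<gamma> \<alpha> (set \<epsilon>s)" using vee_exists[OF q(1) gen.hyps] by metis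
  note vD = is_veeD[OF v(2) q(1)]
  have "cell \<gamma> (\<alpha> # Q) \<in> ?A"
  proof -
    have Q: "set (\<alpha> # Q) \<subseteq> Mo" using q(2) gen.hyps by simp
    then have "iscell (cell \<gamma> (\<alpha> # Q))" unfolding iscell_def using q(1) by blast
    moreover have "q * cell \<gamma> (\<alpha> # Q) = cell \<gamma> (\<alpha> # Q)" using idem q(3) by (simp add: right_diff_distrib mult.assoc[symmetric])
    moreover have "cell \<gamma> (\<alpha> # Q) * e \<alpha> = sc 0 (cell \<gamma> (\<alpha> # Q))" using cell_kills[OF q(1) Q, of \<alpha>] by simp
    ultimately show ?thesis unfolding mem_Collect_eq by blast
  qed
  moreover have "q * e \<alpha> \<in> fsums ?A"
  proof -
    have "q * e \<gamma> = q" using cell_base[OF q(1,2,1) RI_self[OF q(1)]] q(3) by simp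
    then have "q * e \<alpha> = cell \<gamma> Q * qjoin (map e \<epsilon>s)"
      using vee_e[OF q(1) gen.hyps v] q(3) by (metis mult.assoc)
    moreover have "cell \<gamma> Q * qjoin (map e \<epsilon>s) \<in> fsums ?A"
    proof (rule fsums_bind[OF cell_qjoin[OF q(1,2) vD(3)]])
      fix q' assume "q' \<in> {q. \<exists>\<epsilon>\<in>set \<epsilon>s. \<exists>Q'. set Q' \<subseteq> Mo \<and> q = cell \<epsilon> Q' \<and> cell \<gamma> Q * q = q}"
      then obtain \<epsilon> Q' where q': "\<epsilon> \<in> set \<epsilon>s" "set Q' \<subseteq> Mo" "q' = cell \<epsilon> Q'" "cell \<gamma> Q * q' = q'" by auto
      have \<epsilon>: "\<epsilon> \<in> Mo" "\<epsilon> \<in> RI \<alpha>" using q'(1) vD by auto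
      have "iscell q'" unfolding iscell_def using \<epsilon>(1) q'(2,3) by (intro exI conjI)
      moreover have "q' * e \<alpha> = sc 1 q'" using cell_base[OF \<epsilon>(1) q'(2) gen.hyps \<epsilon>(2)] q'(3) by (simp add: sc_one)
      ultimately have "q' \<in> ?A" using q'(4) q(3) by auto
      then show "q' \<in> fsums ?A" by (rule fsums_base)
    qed
    ultimately show ?thesis by simp
  qed
  ultimately have "cell \<gamma> (\<alpha> # Q) + q * e \<alpha> \<in> fsums ?A" by (rule fsums_add[OF fsums_base])
  then show ?case using q(3) by simp
next
  case (add x y)
  show ?case
  proof (rule fsums_bind[OF add.IH(1)[OF add.prems]])
    fix q1 assume "q1 \<in> {q'. iscell q' \<and> q * q' = q' \<and> (\<exists>c. q' * x = sc c q')}"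
    then obtain c where q1: "iscell q1" "q * q1 = q1" "q1 * x = sc c q1" by auto
    show "q1 \<in> fsums {q'. iscell q' \<and> q * q' = q' \<and> (\<exists>c. q' * (x + y) = sc c q')}"
    proof (rule fsums_bind[OF add.IH(2)[OF q1(1)]])
      fix q2 assume "q2 \<in> {q'. iscell q' \<and> q1 * q' = q' \<and> (\<exists>c. q' * y = sc c q')}"
      then obtain d where q2: "iscell q2" "q1 * q2 = q2" "q2 * y = sc d q2" by auto
      have "q1 \<in> Dg" "q2 \<in> Dg" using q1(1) q2(1) cell_Dg unfolding iscell_def by auto
      then have "q2 * q1 = q2" using q2(2) Dg_commute by metis
      then have "q2 * x = sc c q2" using q1(3) by (metis mult.assoc sc_right)
      then have "q2 * (x + y) = sc (c + d) q2" using q2(3) by (simp add: distrib_left add_sc)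
      moreover have "q * q2 = q2" using q1(2) q2(2) by (metis mult.assoc)
      ultimately have "q2 \<in> {q'. iscell q' \<and> q * q' = q' \<and> (\<exists>c. q' * (x + y) = sc c q')}" using q2(1) by auto
      then show "q2 \<in> fsums {q'. iscell q' \<and> q * q' = q' \<and> (\<exists>c. q' * (x + y) = sc c q')}" by (rule fsums_base)
    qed
  qed
next
  case (mult x y)
  show ?case
  proof (rule fsums_bind[OF mult.IH(1)[OF mult.prems]])
    fix q1 assume "q1 \<in> {q'. iscell q' \<and> q * q' = q' \<and> (\<exists>c. q' * x = sc c q')}"
    then obtain c where q1: "iscell q1" "q * q1 = q1" "q1 * x = sc c q1" by auto
    show "q1 \<in> fsums {q'. iscell q' \<and> q * q' = q' \<and> (\<exists>c. q' * (x * y) = sc c q')}"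
    proof (rule fsums_bind[OF mult.IH(2)[OF q1(1)]])
      fix q2 assume "q2 \<in> {q'. iscell q' \<and> q1 * q' = q' \<and> (\<exists>c. q' * y = sc c q')}"
      then obtain d where q2: "iscell q2" "q1 * q2 = q2" "q2 * y = sc d q2" by auto
      have "q1 \<in> Dg" "q2 \<in> Dg" using q1(1) q2(1) cell_Dg unfolding iscell_def by auto
      then have "q2 * q1 = q2" using q2(2) Dg_commute by metis
      then have "q2 * x = sc c q2" using q1(3) by (metis mult.assoc sc_right)
      then have "q2 * (x * y) = sc (c * d) q2" using q2(3) by (simp add: mult.assoc[symmetric] sc_left sc_sc)
      moreover have "q * q2 = q2" using q1(2) q2(2) by (metis mult.assoc)
      ultimately have "q2 \<in> {q'. iscell q' \<and> q * q' = q' \<and> (\<exists>c. q' * (x * y) = sc c q')}" using q2(1) by auto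
      then show "q2 \<in> fsums {q'. iscell q' \<and> q * q' = q' \<and> (\<exists>c. q' * (x * y) = sc c q')}" by (rule fsums_base)
    qed
  qed
next
  case (sc x k)
  show ?case
  proof (rule fsums_bind[OF sc.IH[OF sc.prems]])
    fix q1 assume "q1 \<in> {q'. iscell q' \<and> q * q' = q' \<and> (\<exists>c. q' * x = sc c q')}"
    then obtain c where q1: "iscell q1" "q * q1 = q1" "q1 * x = sc c q1" by auto
    have "q1 * sc k x = sc (k * c) q1" using q1(3) by (simp add: sc_right sc_sc)
    then have "q1 \<in> {q'. iscell q' \<and> q * q' = q' \<and> (\<exists>c. q' * sc k x = sc c q')}" using q1 by auto
    then show "q1 \<in> fsums {q'. iscell q' \<and> q * q' = q' \<and> (\<exists>c. q' * sc k x = sc c q')}" by (rule fsums_base)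
  qed
qed

text \<open>Telescoping: excluding one more \<delta> changes the cell by a diagonal element
  multiplied by \<open>e \<delta>\<close>.\<close>

lemma cell_remove:
  assumes "\<gamma> \<in> Mo" "set Q \<subseteq> Mo" "set \<delta>s \<subseteq> Mo"
  shows "cell \<gamma> Q - cell \<gamma> (\<delta>s @ Q) \<in> fsums {e \<delta> * d | \<delta> d. \<delta> \<in> set \<delta>s \<and> d \<in> Dg}"
  using assms(3)
proof (induction \<delta>s)
  case (Cons \<delta> \<delta>s)
  let ?A = "{e \<delta>' * d | \<delta>' d. \<delta>' \<in> set (\<delta> # \<delta>s) \<and> d \<in> Dg}"
  have c: "cell \<gamma> (\<delta>s @ Q) \<in> Dg" using assms Cons.prems by (intro cell_Dg) auto
  have "cell \<gamma> (\<delta>s @ Q) * e \<delta> = e \<delta> * cell \<gamma> (\<delta>s @ Q)" using Dg_commute[OF c Dg.gen[of \<delta>]] Cons.prems by simp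
  then have 1: "cell \<gamma> (\<delta>s @ Q) * e \<delta> \<in> ?A" using c by auto
  have 2: "cell \<gamma> Q - cell \<gamma> (\<delta>s @ Q) \<in> fsums ?A"
  proof (rule fsums_bind[OF Cons.IH])
    show "set \<delta>s \<subseteq> Mo" using Cons.prems by simp
    fix a assume "a \<in> {e \<delta> * d | \<delta> d. \<delta> \<in> set \<delta>s \<and> d \<in> Dg}"
    then have "a \<in> ?A" by auto
    then show "a \<in> fsums ?A" by (rule fsums_base)
  qed
  from fsums_add[OF 2 fsums_base[OF 1]]
  have "(cell \<gamma> Q - cell \<gamma> (\<delta>s @ Q)) + cell \<gamma> (\<delta>s @ Q) * e \<delta> \<in> fsums ?A" .
  then show ?case by (simp add: algebra_simps)
qed (simp add: fsums.zero)

text \<open>Without a tight filter in the cell, every extension of \<gamma> is compatible with some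
  \<beta> in \<open>Q\<close>. Left division by \<gamma> of the minimal common extensions gives a
  finite exhaustive set at the source of \<gamma>. Relation (iv), conjugated by
  \<open>T \<gamma>\<close>, writes \<open>e \<gamma>\<close> as a join of projections below the
  \<open>e \<beta>\<close>, all annihilated by the cell.\<close>

lemma cell_empty:
  assumes g: "\<gamma> \<in> Mo" and Q: "set Q \<subseteq> Mo" and empty: "cset \<gamma> Q = {}"
  shows "cell \<gamma> Q = 0"
proof -
  have "\<forall>\<beta>\<in>set Q. \<exists>\<gamma>s. is_vee \<Lambda> \<gamma> \<beta> (set \<gamma>s)" using vee_exists[OF g] Q by (meson subsetD)
  then obtain f where f: "\<And>\<beta>. \<beta> \<in> set Q \<Longrightarrow> is_vee \<Lambda> \<gamma> \<beta> (set (f \<beta>))" by metis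
  define F where "F = (\<Union>\<beta>\<in>set Q. set (f \<beta>))"
  have F: "\<delta> \<in> RI \<gamma> \<and> (\<exists>\<beta>\<in>set Q. \<delta> \<in> RI \<beta>)" if "\<delta> \<in> F" for \<delta>
  proof -
    obtain \<beta> where b: "\<beta> \<in> set Q" "\<delta> \<in> set (f \<beta>)" using \<open>\<delta> \<in> F\<close> unfolding F_def by (elim UN_E)
    then show ?thesis using is_veeD(3,4)[OF f[OF b(1)] g] by auto
  qed
  \<comment> \<open>Left cancellation makes multiplication by \<gamma> injective, so the set of
    quotients inherits finiteness from \<open>F\<close>.\<close>
  define F' where "F' = {x \<in> Mo. ra x = so \<gamma> \<and> \<gamma> \<bullet>\<bullet> x \<in> F}"
  have "finite F" unfolding F_def by simp
  have inj: "inj_on ((\<bullet>\<bullet>) \<gamma>) F'"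
    by (rule inj_onI) (use g comp_cancel in \<open>auto simp: F'_def\<close>)
  have "(\<bullet>\<bullet>) \<gamma> ` F' \<subseteq> F" unfolding F'_def by auto
  then have finF': "finite F'" using \<open>finite F\<close> inj by (metis finite_imageD finite_subset)
  have FF': "\<exists>x\<in>F'. \<delta> = \<gamma> \<bullet>\<bullet> x" if d: "\<delta> \<in> F" for \<delta>
  proof -
    obtain x where "x \<in> Mo" "ra x = so \<gamma>" "\<delta> = \<gamma> \<bullet>\<bullet> x" using F[OF d] g by (elim conjE RI_E)
    then show ?thesis using d unfolding F'_def by auto
  qed
  have ex: "exhaustive \<Lambda> (so \<gamma>) F'"
    unfolding exhaustive_def
  proof (intro conjI ballI)
    show "F' \<subseteq> RI (so \<gamma>)"
    proof
      fix x assume "x \<in> F'"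
      then have x: "x \<in> Mo" "ra x = so \<gamma>" unfolding F'_def by simp_all
      then have "x \<in> Mo" "ra x = so (so \<gamma>)" "so \<gamma> \<bullet>\<bullet> x = x" using g x(2)[THEN HOL.sym] by simp_all
      then show "x \<in> RI (so \<gamma>)" using RI_I[of x "so \<gamma>"] by simp
    qed
    fix y assume "y \<in> RI (so \<gamma>)"
    then have y: "y \<in> Mo" "ra y = so \<gamma>" using g by (auto elim: RI_E)
    have gy: "\<gamma> \<bullet>\<bullet> y \<in> RI \<gamma>" "\<gamma> \<bullet>\<bullet> y \<in> Mo" using RI_I[OF y] g y by auto
    have "RI (\<gamma> \<bullet>\<bullet> y) \<noteq> {}" using RI_self[OF gy(2)] by auto
    \<comment> \<open>An ultrafilter through \<open>\<gamma> \<bullet>\<bullet> y\<close> is tight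
      and contains \<open>RI \<gamma>\<close>; as the cell has no tight filter, it contains some
      \<open>RI \<beta>\<close>, which forces the two ideals to meet.\<close>
    then obtain \<zeta> where z: "ultra \<zeta>" "Id_on (RI (\<gamma> \<bullet>\<bullet> y)) \<in> \<zeta>" using ultra_exists[OF DD_RI[OF gy(2)]] by metis
    note fz = ultra_filt[OF z(1)]
    have "Id_on (RI \<gamma>) \<in> \<zeta>" using filtD(3)[OF fz z(2) RI_mono[OF gy(1) g] DD_RI[OF g]] .
    then obtain \<beta> where b: "\<beta> \<in> set Q" "Id_on (RI \<beta>) \<in> \<zeta>"
      using empty cset_iff[of \<zeta> \<gamma> Q] ultra_tight[OF z(1)] by auto
    have "RI (\<gamma> \<bullet>\<bullet> y) \<inter> RI \<beta> \<noteq> {}" using filtD(2)[OF fz filtD(4)[OF fz z(2) b(2)]] .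
    then obtain w where w: "w \<in> RI (\<gamma> \<bullet>\<bullet> y)" "w \<in> RI \<beta>" by auto
    then have "w \<in> RI \<gamma> \<inter> RI \<beta>" using RI_mono[OF gy(1) g] by auto
    then obtain \<delta> where d: "\<delta> \<in> set (f \<beta>)" "w \<in> RI \<delta>" using is_veeD(5)[OF f[OF b(1)] g] by auto
    have dF: "\<delta> \<in> F" using d(1) b(1) unfolding F_def by auto
    obtain x where x: "x \<in> F'" "\<delta> = \<gamma> \<bullet>\<bullet> x" using FF'[OF dF] by auto
    have xM: "x \<in> Mo" "ra x = so \<gamma>" using x(1) unfolding F'_def by auto
    obtain u where u: "u \<in> Mo" "ra u = so y" "w = (\<gamma> \<bullet>\<bullet> y) \<bullet>\<bullet> u" using w(1) gy(2) g y by (elim RI_E) auto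
    obtain v where v: "v \<in> Mo" "ra v = so x" "w = (\<gamma> \<bullet>\<bullet> x) \<bullet>\<bullet> v" using d(2) x(2) xM g by (elim RI_E) auto
    have "\<gamma> \<bullet>\<bullet> (y \<bullet>\<bullet> u) = \<gamma> \<bullet>\<bullet> (x \<bullet>\<bullet> v)" using u v y xM g comp_assoc[of \<gamma> y u] comp_assoc[of \<gamma> x v] by simp
    then have "y \<bullet>\<bullet> u = x \<bullet>\<bullet> v" by (rule comp_cancel) (use u v y xM g in auto)
    then have "y \<bullet>\<bullet> u \<in> RI x \<inter> RI y" using RI_I[of v x] RI_I[of u y] u v by auto
    then show "\<exists>x\<in>F'. RI x \<inter> RI y \<noteq> {}" using x(1) by auto
  qed (rule finF')
  obtain xs where xs: "set xs = F'" "distinct xs" using finite_distinct_list[OF finF'] by auto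
  have "so \<gamma> \<in> Obj \<Lambda>" using g unfolding Obj_def by auto
  then have Tj: "T (so \<gamma>) = qjoin (map e xs)" using exh[of "so \<gamma>" xs] xs ex unfolding e_def by simp
  \<comment> \<open>Conjugation by \<open>T \<gamma>\<close> carries joins to joins: between two
    conjugates \<open>Ts \<gamma> * T \<gamma>\<close> is the projection of the source, which
    commutes with \<open>e y\<close> and is absorbed by \<open>T \<gamma>\<close>.\<close>
  have *: "T \<gamma> * qjoin (map e ys) * Ts \<gamma> = qjoin (map (\<lambda>x. e (\<gamma> \<bullet>\<bullet> x)) ys)" if "set ys \<subseteq> F'" for ys
    using that
  proof (induction ys)
    case (Cons y ys)
    have y: "y \<in> Mo" "ra y = so \<gamma>" and ys: "set ys \<subseteq> Mo" using Cons.prems unfolding F'_def by auto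
    let ?J = "qjoin (map e ys)"
    have ey: "T \<gamma> * e y * Ts \<gamma> = e (\<gamma> \<bullet>\<bullet> y)"
    proof -
      have "T \<gamma> * e y * Ts \<gamma> = (T \<gamma> * T y) * (Ts y * Ts \<gamma>)" by (simp add: e_def mult.assoc)
      then show ?thesis using T_T[OF g y(1)] Ts_Ts[OF g y(1)] y(2) by (simp add: e_def)
    qed
    have "(T \<gamma> * e y * Ts \<gamma>) * (T \<gamma> * ?J * Ts \<gamma>) = T \<gamma> * (e y * e (so \<gamma>)) * ?J * Ts \<gamma>"
      using Ts_T[OF g] e_obj[OF g] by (simp add: mult.assoc) (simp add: mult.assoc[symmetric])
    also have "e y * e (so \<gamma>) = e (so \<gamma>) * e y" using e_commute[OF y(1)] g by simp
    also have "T \<gamma> * (e (so \<gamma>) * e y) * ?J * Ts \<gamma> = T \<gamma> * (e y * ?J) * Ts \<gamma>"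
      using T_so(1)[OF g] e_obj[OF g] by (simp add: mult.assoc[symmetric])
    finally have "T \<gamma> * (e y * ?J) * Ts \<gamma> = e (\<gamma> \<bullet>\<bullet> y) * (T \<gamma> * ?J * Ts \<gamma>)" using ey by simp
    then show ?case using Cons ey by (simp add: distrib_left distrib_right left_diff_distrib right_diff_distrib)
  qed simp
  have "e \<gamma> = T \<gamma> * T (so \<gamma>) * Ts \<gamma>" using T_so(1)[OF g] by (simp add: e_def)
  then have eg: "e \<gamma> = qjoin (map (\<lambda>x. e (\<gamma> \<bullet>\<bullet> x)) xs)" using Tj *[of xs] xs(1) by simp
  have kill: "cell \<gamma> Q * e \<delta> = 0" if d: "\<delta> \<in> F" for \<delta>
  proof -
    obtain \<beta> where b: "\<beta> \<in> set Q" "\<delta> \<in> RI \<beta>" using F[OF d] by auto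
    then have "e \<delta> = e \<beta> * e \<delta>" using e_RI Q by auto
    then show ?thesis using cell_kills[OF g Q b(1)] by (metis mult.assoc mult_zero_left)
  qed
  have "cell \<gamma> Q * qjoin (map (\<lambda>x. e (\<gamma> \<bullet>\<bullet> x)) ys) = 0" if "set ys \<subseteq> F'" for ys
    using that
  proof (induction ys)
    case (Cons y ys)
    then have "cell \<gamma> Q * e (\<gamma> \<bullet>\<bullet> y) = 0" using kill unfolding F'_def by auto
    then show ?case using Cons by (simp add: distrib_left right_diff_distrib mult.assoc[symmetric])
  qed simp
  from this[of xs] have "cell \<gamma> Q * e \<gamma> = 0" using eg xs(1) by simp
  then show ?thesis using cell_base[OF g Q g RI_self[OF g]] by simp
qed

end

section \<open>Injectivity of representations by germs\<close>

context cat_family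
begin

lemma TTs_e:
  assumes "\<alpha> \<in> Mo" "\<beta> \<in> Mo" "so \<alpha> = so \<beta>" "y \<in> Mo" "ra y = so \<beta>"
  shows "T \<alpha> * Ts \<beta> * e (\<beta> \<bullet>\<bullet> y) = T (\<alpha> \<bullet>\<bullet> y) * Ts (\<beta> \<bullet>\<bullet> y)"
proof -
  have "T \<alpha> * Ts \<beta> * e (\<beta> \<bullet>\<bullet> y) = T \<alpha> * (Ts \<beta> * T (\<beta> \<bullet>\<bullet> y)) * Ts (\<beta> \<bullet>\<bullet> y)"
    by (simp add: e_def mult.assoc)
  then show ?thesis using Ts_T_comp(1)[OF assms(2,4,5)] T_T[OF assms(1,4)] assms(3,5) by simp
qed

text \<open>By compactness of the cell, it is covered by finitely many \<open>RI \<delta>\<close> on each of which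
  \<open>ts \<alpha> \<beta>\<close> coincides with one of the other maps; the rest of the cell is \<open>0\<close> by relation (iv).\<close>

lemma germ_cover:
  assumes M: "\<alpha> \<in> Mo" "\<beta> \<in> Mo" "so \<alpha> = so \<beta>" "\<gamma> \<in> Mo" "set Q \<subseteq> Mo" and J: "J \<subseteq> pairs"
    and \<beta>: "\<And>\<eta>. \<eta> \<in> cset \<gamma> Q \<Longrightarrow> Id_on (RI \<beta>) \<in> \<eta>"
    and cov: "\<And>\<eta>. \<eta> \<in> cset \<gamma> Q \<Longrightarrow> \<exists>p\<in>J. germ \<Lambda> (ts \<alpha> \<beta>) \<eta> \<in> F (fst p) (snd p)"
  shows "T \<alpha> * Ts \<beta> * cell \<gamma> Q \<in> fsums (\<Union>p\<in>J. X p)"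
proof -
  define ok where "ok \<delta> \<longleftrightarrow> (\<exists>p\<in>J. T \<alpha> * Ts \<beta> * e \<delta> = T (fst p) * Ts (snd p) * e \<delta>)" for \<delta>
  have loc: "\<exists>\<delta>\<in>Mo. ok \<delta> \<and> Id_on (RI \<delta>) \<in> \<eta>" if \<eta>: "\<eta> \<in> cset \<gamma> Q" for \<eta>
  proof -
    have t: "\<eta> \<in> tight" using \<eta> cset_iff by simp
    note f = tight_filt[OF t]
    obtain p where p: "p \<in> J" "germ \<Lambda> (ts \<alpha> \<beta>) \<eta> \<in> F (fst p) (snd p)" using cov[OF \<eta>] by (elim bexE)
    define \<alpha>' \<beta>' where "\<alpha>' = fst p" and "\<beta>' = snd p"
    have "p \<in> pairs" using p(1) J by (rule subsetD[rotated])
    then have M': "\<alpha>' \<in> Mo" "\<beta>' \<in> Mo" "so \<alpha>' = so \<beta>'" unfolding \<alpha>'_def \<beta>'_def by (simp_all add: case_prod_beta)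
    have g: "germ \<Lambda> (ts \<alpha> \<beta>) \<eta> \<in> germ \<Lambda> (ts \<alpha>' \<beta>') ` tights (RI \<beta>')"
      using p(2) unfolding F_def \<Theta>_def \<alpha>'_def[symmetric] \<beta>'_def[symmetric] dom_filters_ts[OF M'(3)] .
    then obtain \<theta> where th: "germ \<Lambda> (ts \<alpha> \<beta>) \<eta> = germ \<Lambda> (ts \<alpha>' \<beta>') \<theta>" "\<theta> \<in> tights (RI \<beta>')" by (elim imageE)
    have GP1: "(ts \<alpha> \<beta>, \<eta>) \<in> GP" using \<beta>[OF \<eta>] t ts_S[OF M(1,2)] dom_filters_ts[OF M(3)] by (simp add: GP_iff tights_def)
    have GP2: "(ts \<alpha>' \<beta>', \<theta>) \<in> GP" using th(2) ts_S[OF M'(1,2)] dom_filters_ts[OF M'(3)] by (simp add: GP_iff)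
    note D = germ_eqD[OF th(1) GP1 GP2]
    obtain E where E: "Id_on E \<in> \<eta>" "Id_on E O ts \<alpha> \<beta> = Id_on E O ts \<alpha>' \<beta>'" using D(2) by (elim exE conjE)
    have "Id_on (RI \<beta>') \<in> \<eta>" using th(2) D(1) by (simp add: tights_def)
    from filtD(4)[OF f filtD(4)[OF f E(1) \<beta>[OF \<eta>]] this]
    have "Id_on (E \<inter> RI \<beta> \<inter> RI \<beta>') \<in> \<eta>" .
    from tight_RI[OF t this] obtain \<delta> where d: "\<delta> \<in> Mo" "RI \<delta> \<subseteq> E \<inter> RI \<beta> \<inter> RI \<beta>'" "Id_on (RI \<delta>) \<in> \<eta>" by (elim bexE conjE)
    have "\<delta> \<in> E \<inter> RI \<beta> \<inter> RI \<beta>'" using subsetD[OF d(2) RI_self[OF d(1)]] .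
    then have dE: "\<delta> \<in> E" "\<delta> \<in> RI \<beta>" by simp_all
    obtain y where y: "y \<in> Mo" "ra y = so \<beta>" "\<delta> = \<beta> \<bullet>\<bullet> y" using dE(2) M(2) by (elim RI_E)
    \<comment> \<open>Agreement at the single point \<delta> suffices: by \<open>TTs_e\<close>,
      multiplying by \<open>e \<delta>\<close> turns either product into \<open>T\<close> of the
      common value at \<delta> times \<open>Ts \<delta>\<close>.\<close>
    have "(\<delta>, \<alpha> \<bullet>\<bullet> y) \<in> ts \<alpha> \<beta>" unfolding y(3) by (rule ts_I[OF y(1) _ M(3)]) (simp add: y(2) M(3))
    then have "(\<delta>, \<alpha> \<bullet>\<bullet> y) \<in> ts \<alpha>' \<beta>'" using E(2) dE(1) unfolding restrict_iff by simp
    then obtain y' where y': "y' \<in> Mo" "ra y' = so \<beta>'" "\<delta> = \<beta>' \<bullet>\<bullet> y'" "\<alpha> \<bullet>\<bullet> y = \<alpha>' \<bullet>\<bullet> y'"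
      unfolding ts_iff by (elim bexE conjE)
    have "T \<alpha> * Ts \<beta> * e \<delta> = T \<alpha>' * Ts \<beta>' * e \<delta>"
      using TTs_e[OF M(1-3) y(1,2)] TTs_e[OF M' y'(1,2)] y(3) y'(3,4) by metis
    then have "ok \<delta>" unfolding ok_def \<alpha>'_def \<beta>'_def using p(1) by (rule bexI)
    then show ?thesis using d(1,3) by (intro bexI conjI)
  qed
  let ?U = "\<lambda>\<delta>. FN {Id_on (RI \<delta>)} {}"
  have comp: "compactin (filter_top \<Lambda>) (cset \<gamma> Q)"
    unfolding cset_def by (rule compact_N) (use M(4,5) DD_RI in auto)
  have op: "openin (filter_top \<Lambda>) U" if U: "U \<in> ?U ` {\<delta> \<in> Mo. ok \<delta>}" for U
  proof -
    obtain \<delta> where "U = ?U \<delta>" "\<delta> \<in> Mo" using U by auto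
    then show ?thesis using openin_FN[of "{Id_on (RI \<delta>)}" "{}"] DD_RI by simp
  qed
  have sub: "cset \<gamma> Q \<subseteq> \<Union>(?U ` {\<delta> \<in> Mo. ok \<delta>})"
  proof
    fix \<eta> assume \<eta>: "\<eta> \<in> cset \<gamma> Q"
    from loc[OF this] obtain \<delta> where d: "\<delta> \<in> Mo" "ok \<delta>" "Id_on (RI \<delta>) \<in> \<eta>" by (elim bexE conjE)
    have "filt \<eta>" using \<eta> tight_filt unfolding cset_iff by simp
    then have 1: "\<eta> \<in> ?U \<delta>" using d(3) by (simp add: FN_def)
    have "?U \<delta> \<in> ?U ` {\<delta> \<in> Mo. ok \<delta>}" using d(1,2) by (intro imageI CollectI conjI)
    then show "\<eta> \<in> \<Union>(?U ` {\<delta> \<in> Mo. ok \<delta>})" using 1 by (rule UnionI)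
  qed
  have "\<exists>\<F>. finite \<F> \<and> \<F> \<subseteq> ?U ` {\<delta> \<in> Mo. ok \<delta>} \<and> cset \<gamma> Q \<subseteq> \<Union>\<F>"
    by (rule compactinD[OF comp _ sub]) (rule op)
  then obtain \<F> where \<F>: "finite \<F>" "\<F> \<subseteq> ?U ` {\<delta> \<in> Mo. ok \<delta>}" "cset \<gamma> Q \<subseteq> \<Union>\<F>"
    by (elim exE conjE)
  obtain D where D: "D \<subseteq> {\<delta> \<in> Mo. ok \<delta>}" "finite D" "\<F> = ?U ` D"
    using finite_subset_image[OF \<F>(1,2)] by (elim exE conjE)
  obtain \<delta>s where ds: "set \<delta>s = D" using finite_list[OF D(2)] by (elim exE)
  have dM: "set \<delta>s \<subseteq> Mo" using ds D(1) by auto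
  have "cset \<gamma> (\<delta>s @ Q) = {}"
  proof (rule equals0I)
    fix \<eta> assume \<eta>: "\<eta> \<in> cset \<gamma> (\<delta>s @ Q)"
    then have "\<eta> \<in> cset \<gamma> Q" unfolding cset_iff by simp
    then have "\<eta> \<in> \<Union>(?U ` D)" using \<F>(3) D(3) by (metis subsetD)
    then obtain \<delta> where "\<delta> \<in> D" "\<eta> \<in> ?U \<delta>" by (elim UnionE imageE) simp
    then have "\<delta> \<in> set \<delta>s" "Id_on (RI \<delta>) \<in> \<eta>" using ds by (simp_all add: FN_def)
    then show False using \<eta> unfolding cset_iff by simp
  qed
  then have "cell \<gamma> (\<delta>s @ Q) = 0" using cell_empty[OF M(4), of "\<delta>s @ Q"] M(5) dM by simp
  then have "cell \<gamma> Q \<in> fsums {e \<delta> * d | \<delta> d. \<delta> \<in> set \<delta>s \<and> d \<in> Dg}" using cell_remove[OF M(4,5) dM] by simp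
  then show ?thesis
  proof (rule fsums_mult_left)
    fix a assume "a \<in> {e \<delta> * d | \<delta> d. \<delta> \<in> set \<delta>s \<and> d \<in> Dg}"
    from CollectD[OF this] obtain \<delta> d where a: "a = e \<delta> * d" "\<delta> \<in> set \<delta>s" "d \<in> Dg" by (elim exE conjE)
    have dl: "\<delta> \<in> Mo" "ok \<delta>" using a(2) ds D(1) by auto
    obtain p where p: "p \<in> J" "T \<alpha> * Ts \<beta> * e \<delta> = T (fst p) * Ts (snd p) * e \<delta>" using dl(2) unfolding ok_def by (elim bexE)
    have "T \<alpha> * Ts \<beta> * a = T (fst p) * Ts (snd p) * (e \<delta> * d)" unfolding a(1) using p(2) by (simp add: mult.assoc[symmetric])
    moreover have "e \<delta> * d \<in> Dg" using Dg.mult[OF Dg.gen[OF dl(1)] a(3)] .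
    ultimately have "T \<alpha> * Ts \<beta> * a \<in> X p" unfolding X_def by (intro CollectI exI conjI)
    then show "T \<alpha> * Ts \<beta> * a \<in> fsums (\<Union>p\<in>J. X p)" using p(1) by (intro fsums_base UN_I)
  qed
qed

end

locale cat_rep = cat_family \<Lambda> sc T Ts
  for \<Lambda> :: "'a small_cat" and sc :: "'r::{comm_ring, comm_monoid_mult} \<Rightarrow> 'q::ring \<Rightarrow> 'q" and T Ts :: "'a \<Rightarrow> 'q" +
  fixes \<Phi> :: "'q \<Rightarrow> 'a germ \<Rightarrow> 'r"
  assumes \<Phi>_add: "\<Phi> (x + y) = (\<lambda>g. \<Phi> x g + \<Phi> y g)" and \<Phi>_sc: "\<Phi> (sc c x) = (\<lambda>g. c * \<Phi> x g)"
    and \<Phi>_mult: "\<Phi> (x * y) = convolution TG (\<Phi> x) (\<Phi> y)" and \<Phi>_span: "\<Phi> x \<in> fun_span G.SB"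
    and \<Phi>_T: "\<alpha> \<in> Mo \<Longrightarrow> \<Phi> (T \<alpha>) = ind (F \<alpha> (so \<alpha>))" and \<Phi>_Ts: "\<alpha> \<in> Mo \<Longrightarrow> \<Phi> (Ts \<alpha>) = ind (F (so \<alpha>) \<alpha>)"
begin

lemma \<Phi>_zero: "\<Phi> 0 = (\<lambda>_. 0)"
  using \<Phi>_sc[of 0 0] by simp

lemma \<Phi>_sum: "\<Phi> (\<Sum>i<(n::nat). y i) = (\<lambda>g. \<Sum>i<n. \<Phi> (y i) g)"
  by (induction n) (simp_all add: \<Phi>_zero \<Phi>_add)

lemma \<Phi>_off: "g \<notin> arrows TG \<Longrightarrow> \<Phi> x g = 0"
  using G.fsupp_span[OF \<Phi>_span G.SB_fsupp] unfolding G.fsupp_def by simp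

lemma \<Phi>_TTs: "\<lbrakk>\<alpha> \<in> Mo; \<beta> \<in> Mo; so \<alpha> = so \<beta>\<rbrakk> \<Longrightarrow> \<Phi> (T \<alpha> * Ts \<beta>) = ind (F \<alpha> \<beta>)"
  using F_conv[of \<alpha> \<beta>] by (simp add: \<Phi>_mult \<Phi>_T \<Phi>_Ts)

lemma \<Phi>_e: "\<alpha> \<in> Mo \<Longrightarrow> \<Phi> (e \<alpha>) = ind (un ` tights (RI \<alpha>))"
  unfolding e_def by (simp add: \<Phi>_TTs F_self)

lemma diag_\<Phi>: "d \<in> Dg \<Longrightarrow> diag (\<Phi> d)"
proof (induction rule: Dg.induct)
  case (gen \<alpha>)
  show ?case unfolding \<Phi>_e[OF gen] by (rule diag_ind[OF tights_tight])
next
  case (add x y)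
  show ?case unfolding diag_def \<Phi>_add
  proof (intro allI impI)
    fix g assume "\<Phi> x g + \<Phi> y g \<noteq> 0"
    then have "\<Phi> x g \<noteq> 0 \<or> \<Phi> y g \<noteq> 0" by auto
    then show "g \<in> un ` tight" using add.IH unfolding diag_def by metis
  qed
next
  case (mult x y)
  show ?case unfolding diag_def \<Phi>_mult convolution_diag2[OF mult.IH]
  proof (intro allI impI)
    fix g assume "\<Phi> x g * \<Phi> y g \<noteq> 0"
    then have "\<Phi> x g \<noteq> 0" by auto
    then show "g \<in> un ` tight" using mult.IH(1) unfolding diag_def by metis
  qed
next
  case (sc x c)
  show ?case unfolding diag_def \<Phi>_sc
  proof (intro allI impI)
    fix g assume "c * \<Phi> x g \<noteq> 0"
    then have "\<Phi> x g \<noteq> 0" by auto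
    then show "g \<in> un ` tight" using sc.IH unfolding diag_def by metis
  qed
qed

lemma \<Phi>_cell:
  assumes "\<gamma> \<in> Mo" "set Q \<subseteq> Mo" "\<eta> \<in> tight"
  shows "\<Phi> (cell \<gamma> Q) (un \<eta>) = (if \<eta> \<in> cset \<gamma> Q then 1 else 0)"
  using assms(2)
proof (induction Q)
  have u: "un \<eta> \<in> un ` tights D \<longleftrightarrow> Id_on D \<in> \<eta>" for D
    using un_inj assms(3) tights_tight by (auto simp: tights_def)
  case Nil
  show ?case using u assms(3) by (simp add: \<Phi>_e assms(1) ind_def cset_iff)
next
  have u: "un \<eta> \<in> un ` tights D \<longleftrightarrow> Id_on D \<in> \<eta>" for D
    using un_inj assms(3) tights_tight by (auto simp: tights_def)
  case (Cons \<beta> Q)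
  have q: "cell \<gamma> Q \<in> Dg" and b: "\<beta> \<in> Mo" using cell_Dg[OF assms(1)] Cons.prems by simp_all
  have eq: "cell \<gamma> (\<beta> # Q) = cell \<gamma> Q + sc (- 1) (cell \<gamma> Q * e \<beta>)" by (simp add: sc_minus)
  have "\<Phi> (cell \<gamma> (\<beta> # Q)) (un \<eta>) = \<Phi> (cell \<gamma> Q) (un \<eta>) + - 1 * (\<Phi> (cell \<gamma> Q) (un \<eta>) * \<Phi> (e \<beta>) (un \<eta>))"
    unfolding eq by (simp add: \<Phi>_add \<Phi>_sc \<Phi>_mult convolution_diag2[OF diag_\<Phi>[OF q] diag_\<Phi>[OF Dg.gen[OF b]]])
  then show ?case using Cons u by (simp add: \<Phi>_e[OF b] ind_def cset_iff)
qed

lemma \<Phi>_mult_Dg: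
  assumes "d \<in> Dg" "c \<in> arrows TG" shows "\<Phi> (x * d) c = \<Phi> x c * \<Phi> d (un (gdom TG c))"
  unfolding \<Phi>_mult by (rule convolution_diag[OF diag_\<Phi>[OF assms(1)] assms(2)])

lemma \<Phi>_X:
  assumes "p \<in> pairs" "x \<in> X p" "\<Phi> x c \<noteq> 0" shows "c \<in> F (fst p) (snd p)"
proof -
  obtain d where d: "x = T (fst p) * Ts (snd p) * d" "d \<in> Dg" using assms(2) unfolding X_def by auto
  have p: "fst p \<in> Mo" "snd p \<in> Mo" "so (fst p) = so (snd p)" using assms(1) by (simp_all add: case_prod_beta)
  have "c \<in> arrows TG" using assms(3) \<Phi>_off by metis
  from \<Phi>_mult_Dg[OF d(2) this] have "ind (F (fst p) (snd p)) c * \<Phi> d (un (gdom TG c)) \<noteq> 0"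
    using assms(3) d(1) \<Phi>_TTs[OF p] by metis
  then show ?thesis unfolding ind_def by (metis mult_zero_left)
qed

text \<open>This eliminates one pair: the last summand is rewritten over the remaining ones. It is
  resolved cell by cell, because a coefficient in \<open>R\<close> that is nonzero on a cell cannot
  be divided out.\<close>

lemma reduce:
  fixes n :: nat
  assumes p: "\<And>i. i \<le> n \<Longrightarrow> p i \<in> pairs" and y: "\<And>i. i \<le> n \<Longrightarrow> y i \<in> X (p i)"
    and z: "\<And>g. (\<Sum>i\<le>n. \<Phi> (y i) g) = 0"
  shows "y n \<in> fsums (\<Union>i<n. X (p i))"
proof -
  define \<alpha> \<beta> where "\<alpha> = fst (p n)" and "\<beta> = snd (p n)"
  have M: "\<alpha> \<in> Mo" "\<beta> \<in> Mo" "so \<alpha> = so \<beta>" using p[OF le_refl] unfolding \<alpha>_def \<beta>_def by (simp_all add: case_prod_beta)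
  obtain d where d: "y n = T \<alpha> * Ts \<beta> * d" "d \<in> Dg" using y[OF le_refl] unfolding X_def \<alpha>_def \<beta>_def by auto
  have "iscell (e \<beta>)" unfolding iscell_def using M(2) by (intro exI[of _ \<beta>] exI[of _ "[]"]) simp
  from cell_split[OF d(2) this]
  have sp: "e \<beta> \<in> fsums {q'. iscell q' \<and> e \<beta> * q' = q' \<and> (\<exists>c. q' * d = sc c q')}" .
  have "T \<alpha> * Ts \<beta> * e \<beta> * d \<in> fsums (\<Union>i<n. X (p i))"
    using sp
  proof (rule fsums_map[where f = "\<lambda>q. T \<alpha> * Ts \<beta> * q * d"])
    fix q assume "q \<in> {q'. iscell q' \<and> e \<beta> * q' = q' \<and> (\<exists>c. q' * d = sc c q')}"
    then obtain c where q: "iscell q" "e \<beta> * q = q" "q * d = sc c q" by auto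
    obtain \<gamma> Q where g: "\<gamma> \<in> Mo" "set Q \<subseteq> Mo" "q = cell \<gamma> Q" using q(1) unfolding iscell_def by (elim exE conjE)
    have qD: "q \<in> Dg" unfolding g(3) by (rule cell_Dg[OF g(1,2)])
    have eq: "T \<alpha> * Ts \<beta> * q * d = sc c (T \<alpha> * Ts \<beta> * q)" using q(3) by (simp add: mult.assoc sc_right)
    show "T \<alpha> * Ts \<beta> * q * d \<in> fsums (\<Union>i<n. X (p i))"
    proof (cases "c = 0")
      case True
      then show ?thesis using eq by (simp add: fsums.zero)
    next
      case False
      \<comment> \<open>A nonzero scalar exists, so the ring is not the zero ring and an indicator
        value \<open>1\<close> really detects membership.\<close>
      then have one: "(1::'r) \<noteq> 0" by (metis mult_1 mult_zero_left)
      have beta: "Id_on (RI \<beta>) \<in> \<eta>" if \<eta>: "\<eta> \<in> cset \<gamma> Q" for \<eta>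
      proof -
        have t: "\<eta> \<in> tight" using \<eta> cset_iff by simp
        have "\<Phi> (e \<beta> * q) (un \<eta>) = \<Phi> (e \<beta>) (un \<eta>) * \<Phi> q (un \<eta>)"
          using \<Phi>_mult_Dg[OF qD, of "un \<eta>" "e \<beta>"] t by simp
        moreover have "\<Phi> q (un \<eta>) = 1" using \<Phi>_cell[OF g(1,2) t] \<eta> g(3) by simp
        ultimately have "\<Phi> (e \<beta>) (un \<eta>) \<noteq> 0" using q(2) one by auto
        then have "\<eta> \<in> cset \<beta> []" using \<Phi>_cell[OF M(2) _ t, of "[]"] by (simp split: if_splits)
        then show ?thesis unfolding cset_iff by simp
      qed
      have cov: "\<exists>r\<in>p ` {..<n}. germ \<Lambda> (ts \<alpha> \<beta>) \<eta> \<in> F (fst r) (snd r)" if \<eta>: "\<eta> \<in> cset \<gamma> Q" for \<eta>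
      proof -
        let ?g = "germ \<Lambda> (ts \<alpha> \<beta>) \<eta>"
        have t: "\<eta> \<in> tight" using \<eta> cset_iff by simp
        have tr: "\<eta> \<in> tights (RI \<beta>)" using t beta[OF \<eta>] by (simp add: tights_def)
        have GP: "(ts \<alpha> \<beta>, \<eta>) \<in> GP" using tr ts_S[OF M(1,2)] dom_filters_ts[OF M(3)] by (simp add: GP_iff)
        have gF: "?g \<in> F \<alpha> \<beta>" unfolding F_def \<Theta>_def dom_filters_ts[OF M(3)] using tr by (rule imageI)
        have ga: "?g \<in> arrows TG" using arrowsI[OF GP] .
        have gd: "gdom TG ?g = \<eta>" using gdom_germ[OF GP] .
        have q1: "\<Phi> q (un \<eta>) = 1" using \<Phi>_cell[OF g(1,2) t] \<eta> g(3) by simp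
        have dq: "d * q = q * d" using Dg_commute[OF d(2) qD] .
        have "y n * q = sc c (T \<alpha> * Ts \<beta> * q)" unfolding d(1) using dq q(3) by (simp add: mult.assoc sc_right)
        \<comment> \<open>On germs over the cell, the image of \<open>y n\<close> has the constant
          value \<open>c\<close>. As it is nonzero and the total is zero, some other term is nonzero
          at the same germ.\<close>
        then have "\<Phi> (y n) ?g * \<Phi> q (un \<eta>) = c * (ind (F \<alpha> \<beta>) ?g * \<Phi> q (un \<eta>))"
          using \<Phi>_mult_Dg[OF qD ga, of "y n"] \<Phi>_mult_Dg[OF qD ga, of "T \<alpha> * Ts \<beta>"] \<Phi>_TTs[OF M] gd \<Phi>_sc by simp
        then have nz: "\<Phi> (y n) ?g \<noteq> 0" using q1 gF False by (simp add: ind_def)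
        have "(\<Sum>i<n. \<Phi> (y i) ?g) + \<Phi> (y n) ?g = 0" using z[of ?g] by (simp add: lessThan_Suc_atMost[symmetric])
        then have "(\<Sum>i<n. \<Phi> (y i) ?g) \<noteq> 0" using nz by auto
        then obtain i where i: "i < n" "\<Phi> (y i) ?g \<noteq> 0" by (metis (no_types, lifting) lessThan_iff sum.neutral)
        have "?g \<in> F (fst (p i)) (snd (p i))" using \<Phi>_X[OF p y i(2)] i(1) by simp
        then show ?thesis using i(1) by (intro bexI[of _ "p i"] imageI lessThan_iff[THEN iffD2])
      qed
      have "p ` {..<n} \<subseteq> pairs" using p by (intro image_subsetI) simp
      from germ_cover[OF M g(1,2) this beta cov]
      have "T \<alpha> * Ts \<beta> * q \<in> fsums (\<Union>r\<in>p ` {..<n}. X r)" using g(3) by simp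
      then have "sc c (T \<alpha> * Ts \<beta> * q) \<in> fsums (\<Union>i<n. X (p i))"
      proof (rule fsums_map[where f = "sc c"])
        fix a assume "a \<in> (\<Union>r\<in>p ` {..<n}. X r)"
        then obtain i where i: "i < n" "a \<in> X (p i)" by auto
        then obtain d' where d': "a = T (fst (p i)) * Ts (snd (p i)) * d'" "d' \<in> Dg" unfolding X_def by auto
        have "sc c a = T (fst (p i)) * Ts (snd (p i)) * sc c d'" by (simp add: d'(1) sc_right)
        then have "sc c a \<in> X (p i)" unfolding X_def using Dg.sc[OF d'(2), of c] by (intro CollectI exI conjI)
        then show "sc c a \<in> fsums (\<Union>i<n. X (p i))" using i(1) by (intro fsums_base UN_I) simp_all
      qed (simp_all add: sc_add)
      then show ?thesis unfolding eq .
    qed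
  qed (simp_all add: distrib_left distrib_right)
  moreover have "T \<alpha> * Ts \<beta> * e \<beta> * d = y n" using Ts_e[OF M(2)] by (simp add: d(1) mult.assoc)
  ultimately show ?thesis by simp
qed

text \<open>Induction on the number of pairs, which need not be distinct: after
  \<open>reduce\<close> the last summand is merged into the earlier ones, leaving a sum over one
  pair fewer with the same image.\<close>

lemma inj_sum:
  assumes "\<And>i. i < n \<Longrightarrow> p i \<in> pairs" "\<And>i. i < n \<Longrightarrow> y i \<in> X (p i)" "\<Phi> (\<Sum>i<n. y i) = (\<lambda>_. 0)"
  shows "(\<Sum>i<(n::nat). y i) = 0"
  using assms
proof (induction n arbitrary: y)
  case (Suc n)
  have X0: "0 \<in> X (p i)" if "i < n" for i using X_zero[of "fst (p i)" "p i"] Suc.prems(1)[of i] that by (simp add: case_prod_beta)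
  have z: "(\<Sum>i\<le>n. \<Phi> (y i) g) = 0" for g
    using fun_cong[OF Suc.prems(3), of g, unfolded \<Phi>_sum] by (simp only: lessThan_Suc_atMost)
  have "y n \<in> fsums (\<Union>i<n. X (p i))"
    by (rule reduce[OF _ _ z]) (use Suc.prems(1,2) in auto)
  \<comment> \<open>The conditional is a harmless extension beyond \<open>n\<close>:
    \<open>fsums_indexed\<close> asks for closure under zero and addition at every index.\<close>
  then have mem: "y n \<in> fsums (\<Union>i<n. if i < n then X (p i) else {0})" by simp
  have c0: "0 \<in> (if i < n then X (p i) else {0})" for i by (cases "i < n") (simp_all only: if_True if_False X0 singletonI)
  have ca: "a + b \<in> (if i < n then X (p i) else {0})"
    if "a \<in> (if i < n then X (p i) else {0})" "b \<in> (if i < n then X (p i) else {0})" for i a b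
    using that X_add[of a "p i" b] by (cases "i < n") (simp_all only: if_True if_False, simp)
  have "\<exists>w. (\<forall>i<n. w i \<in> (if i < n then X (p i) else {0})) \<and> y n = (\<Sum>i<n. w i)"
    by (rule fsums_indexed[OF mem c0]) (rule ca)
  then obtain w where w: "\<forall>i<n. w i \<in> (if i < n then X (p i) else {0})" "y n = (\<Sum>i<n. w i)"
    by (elim exE conjE)
  have eq: "(\<Sum>i<Suc n. y i) = (\<Sum>i<n. y i + w i)" using w(2) by (simp add: sum.distrib)
  have "(\<Sum>i<n. y i + w i) = 0"
  proof (rule Suc.IH)
    show "\<And>i. i < n \<Longrightarrow> p i \<in> pairs" using Suc.prems(1) by simp
    show "y i + w i \<in> X (p i)" if "i < n" for i using X_add[OF Suc.prems(2)[of i], of "w i"] w(1) that by simp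
    show "\<Phi> (\<Sum>i<n. y i + w i) = (\<lambda>_. 0)" using Suc.prems(3) eq by simp
  qed
  then show ?case using eq by simp
qed simp

lemma Sp_sum:
  assumes "x \<in> Sp"
  shows "\<exists>n p y. (\<forall>i<(n::nat). p i \<in> pairs \<and> y i \<in> X (p i)) \<and> x = (\<Sum>i<n. y i)"
  using assms unfolding Sp_def
proof (induction rule: fsums.induct)
  case zero
  show ?case by (intro exI[of _ 0]) simp
next
  case (step x a)
  obtain n p y where n: "\<forall>i<(n::nat). p i \<in> pairs \<and> y i \<in> X (p i)" "x = (\<Sum>i<n. y i)" using step.IH by (elim exE conjE)
  obtain r where r: "r \<in> pairs" "a \<in> X r" using step.hyps(2) by (elim UN_E)
  have "(\<Sum>i<Suc n. (y(n := a)) i) = (\<Sum>i<n. y i) + a" by simp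
  moreover have "\<forall>i<Suc n. (p(n := r)) i \<in> pairs \<and> (y(n := a)) i \<in> X ((p(n := r)) i)"
  proof (intro allI impI)
    fix i assume i: "i < Suc n"
    show "(p(n := r)) i \<in> pairs \<and> (y(n := a)) i \<in> X ((p(n := r)) i)"
    proof (cases "i = n")
      case True
      then show ?thesis using r by (simp only: fun_upd_same)
    next
      case False
      then have "i < n" using i by simp
      then have "p i \<in> pairs \<and> y i \<in> X (p i)" using n(1) by simp
      then show ?thesis using False unfolding fun_upd_apply by (simp only: if_False)
    qed
  qed
  ultimately show ?case using n(2) by (intro exI[of _ "Suc n"] exI[of _ "p(n := r)"] exI[of _ "y(n := a)"]) (simp only:)
qed

theorem \<Phi>_inj: assumes "x \<in> Sp" "\<Phi> x = (\<lambda>_. 0)" shows "x = 0"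
proof -
  obtain n p y where n: "\<forall>i<(n::nat). p i \<in> pairs \<and> y i \<in> X (p i)" "x = (\<Sum>i<n. y i)"
    using Sp_sum[OF assms(1)] by (elim exE conjE)
  have "p i \<in> pairs" "y i \<in> X (p i)" if "i < n" for i using n(1) that by simp_all
  from inj_sum[OF this] show ?thesis using n(2) assms(2) by simp
qed

end

section \<open>The universal algebra realised in a type of class \<open>ring\<close>\<close>

definition cong_fun :: "((('r::{comm_ring, comm_monoid_mult} \<Rightarrow> 'r) \<times> (('r, 'a) star_term \<times> ('r, 'a) star_term) set) \<Rightarrow> ('r, 'a) star_term) \<Rightarrow> _ \<Rightarrow> bool" where
  "cong_fun f g \<longleftrightarrow> (\<forall>p. star_cong (fst p) (snd p) (f p) (g p))"

\<comment> \<open>A quotient type cannot depend on the involution \<open>cj\<close> and the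
  relations. Its elements are therefore families of terms indexed by all such pairs, modulo
  congruence in each component: the product of all term quotients. This makes the reasoning for
  class \<open>ring\<close> available.\<close>
quotient_type (overloaded) ('r, 'a) ualg =
  "(('r::{comm_ring, comm_monoid_mult} \<Rightarrow> 'r) \<times> (('r, 'a) star_term \<times> ('r, 'a) star_term) set) \<Rightarrow> ('r, 'a) star_term" / cong_fun
proof (rule equivpI)
  show "reflp cong_fun" by (rule reflpI) (simp add: cong_fun_def star_cong.refl)
  show "symp cong_fun" by (rule sympI) (simp add: cong_fun_def star_cong.sym)
  show "transp cong_fun" by (rule transpI) (unfold cong_fun_def, meson star_cong.trans)
qed

lemmas cong_funI = cong_fun_def[THEN iffD2, rule_format]
lemmas cong_funD = cong_fun_def[THEN iffD1, rule_format]

instantiation ualg :: ("{comm_ring, comm_monoid_mult}", type) ring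
begin

lift_definition zero_ualg :: "('a, 'b) ualg" is "\<lambda>_. Zero" .
lift_definition plus_ualg :: "('a, 'b) ualg \<Rightarrow> ('a, 'b) ualg \<Rightarrow> ('a, 'b) ualg" is "\<lambda>f g p. Add (f p) (g p)"
  by (simp add: cong_fun_def star_cong.cong_add)
lift_definition times_ualg :: "('a, 'b) ualg \<Rightarrow> ('a, 'b) ualg \<Rightarrow> ('a, 'b) ualg" is "\<lambda>f g p. Mul (f p) (g p)"
  by (simp add: cong_fun_def star_cong.cong_mul)
lift_definition uminus_ualg :: "('a, 'b) ualg \<Rightarrow> ('a, 'b) ualg" is "\<lambda>f p. Scale (- 1) (f p)"
  by (simp add: cong_fun_def star_cong.cong_scale)
definition minus_ualg :: "('a, 'b) ualg \<Rightarrow> ('a, 'b) ualg \<Rightarrow> ('a, 'b) ualg" where "minus_ualg x y = x + - y"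

instance
proof
  fix x y z :: "('a, 'b) ualg"
  show "x + y + z = x + (y + z)" by transfer (intro cong_funI star_axioms)
  show xy: "x + y = y + x" for x y :: "('a, 'b) ualg" by transfer (intro cong_funI star_axioms)
  show "0 + x = x" unfolding xy[of 0 x] by transfer (intro cong_funI star_axioms)
  show "- x + x = 0" unfolding xy[of "- x" x] by transfer (intro cong_funI star_axioms)
  show "x * y * z = x * (y * z)" by transfer (intro cong_funI star_axioms)
  show "(x + y) * z = x * z + y * z" by transfer (intro cong_funI star_axioms)
  show "x * (y + z) = x * y + x * z" by transfer (intro cong_funI star_axioms)
qed (simp add: minus_ualg_def)

end

lift_definition uscale :: "'r::{comm_ring, comm_monoid_mult} \<Rightarrow> ('r, 'a) ualg \<Rightarrow> ('r, 'a) ualg" is "\<lambda>c f p. Scale c (f p)"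
  by (simp add: cong_fun_def star_cong.cong_scale)

lemma uscale_simps:
  "uscale c (x + y) = uscale c x + uscale c y" "uscale (c + d) x = uscale c x + uscale d x"
  "uscale (c * d) x = uscale c (uscale d x)" "uscale 1 x = x"
  "uscale c x * y = uscale c (x * y)" "x * uscale c y = uscale c (x * y)"
  by (transfer, intro cong_funI star_axioms)+

lemma uscale_zero: "uscale c 0 = 0"
  using uscale_simps(1)[of c 0 0] by simp

text \<open>A term is placed in the component of the given parameters, with \<open>Zero\<close> in
  all others, so equality of embedded terms is congruence for these parameters alone.\<close>

lift_definition embed :: "('r \<Rightarrow> 'r) \<Rightarrow> (('r, 'a) star_term \<times> ('r, 'a) star_term) set \<Rightarrow> ('r, 'a) star_term \<Rightarrow> ('r::{comm_ring, comm_monoid_mult}, 'a) ualg"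
  is "\<lambda>cj R t p. if p = (cj, R) then t else Zero" .

text \<open>These laws are not among the rules of \<open>star_cong\<close>; they hold in
  \<open>ualg\<close> by ring reasoning and are read back as congruences.\<close>

lemma star_cong_Zero: "star_cong cj R Zero (Mul Zero Zero)" "star_cong cj R Zero (Scale c Zero)"
proof -
  have "(0 :: ('a, 'b) ualg) = 0 * 0" by simp
  then have "cong_fun (\<lambda>_. Zero :: ('a, 'b) star_term) (\<lambda>_. Mul Zero Zero)" by transfer
  from cong_funD[OF this, of "(cj, R)"] show "star_cong cj R Zero (Mul Zero Zero)" by simp
  have "(0 :: ('a, 'b) ualg) = uscale c 0" by (simp add: uscale_zero)
  then have "cong_fun (\<lambda>_. Zero :: ('a, 'b) star_term) (\<lambda>_. Scale c Zero)" by transfer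
  from cong_funD[OF this, of "(cj, R)"] show "star_cong cj R Zero (Scale c Zero)" by simp
qed

lemma embed_simps:
  "embed cj R (Add s t) = embed cj R s + embed cj R t" "embed cj R (Mul s t) = embed cj R s * embed cj R t"
  "embed cj R (Scale c t) = uscale c (embed cj R t)" "embed cj R Zero = 0"
  by (transfer, auto intro!: cong_funI intro: star_cong.refl star_cong.sym[OF star_cong.add_zero] star_cong_Zero)+

lemma embed_eq_iff: "embed cj R s = embed cj R t \<longleftrightarrow> star_cong cj R s t"
proof transfer
  fix cj :: "'a \<Rightarrow> 'a" and R :: "(('a, 'b) star_term \<times> ('a, 'b) star_term) set" and s t
  show "cong_fun (\<lambda>p. if p = (cj, R) then s else Zero) (\<lambda>p. if p = (cj, R) then t else Zero) \<longleftrightarrow> star_cong cj R s t"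
  proof
    assume "cong_fun (\<lambda>p. if p = (cj, R) then s else Zero) (\<lambda>p. if p = (cj, R) then t else Zero)"
    from cong_funD[OF this, of "(cj, R)"] show "star_cong cj R s t" by simp
  next
    assume "star_cong cj R s t"
    then show "cong_fun (\<lambda>p. if p = (cj, R) then s else Zero) (\<lambda>p. if p = (cj, R) then t else Zero)"
      by (auto intro!: cong_funI star_cong.refl)
  qed
qed

text \<open>Evaluation of the component with the given parameters. The choice of a representing
  family is immaterial when the target satisfies the relations, by
  \<open>eval_term_star_cong\<close>.\<close>

definition ueval :: "('r \<Rightarrow> 'r) \<Rightarrow> (('r, 'a) star_term \<times> ('r, 'a) star_term) set \<Rightarrow> ('r, 'b, 'm) star_alg_scheme \<Rightarrow> ('a \<Rightarrow> 'b)
    \<Rightarrow> ('r::{comm_ring, comm_monoid_mult}, 'a) ualg \<Rightarrow> 'b" where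
  "ueval cj R A V x = eval_term A V (rep_ualg x (cj, R))"

lemma ueval_abs:
  assumes A: "star_algebra cj A" and T: "\<And>x. V x \<in> carr A"
    and R: "\<And>s t. (s, t) \<in> R \<Longrightarrow> eval_term A V s = eval_term A V t"
  shows "ueval cj R A V (abs_ualg f) = eval_term A V (f (cj, R))"
proof -
  have "cong_fun (rep_ualg (abs_ualg f)) f"
    by (rule Quotient3_rep_abs[OF Quotient3_ualg]) (rule cong_funI, rule star_cong.refl)
  from cong_funD[OF this, of "(cj, R)"] have "star_cong cj R (rep_ualg (abs_ualg f) (cj, R)) (f (cj, R))" by simp
  from eval_term_star_cong[OF A T R this] show ?thesis unfolding ueval_def .
qed

lemma ueval_simps:
  assumes A: "star_algebra cj A" and T: "\<And>x. V x \<in> carr A"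
    and R': "\<forall>(s, t)\<in>R. eval_term A V s = eval_term A V t"
  shows "ueval cj R A V (x + y) = aadd A (ueval cj R A V x) (ueval cj R A V y)"
    "ueval cj R A V (x * y) = amul A (ueval cj R A V x) (ueval cj R A V y)"
    "ueval cj R A V (uscale c x) = ascale A c (ueval cj R A V x)"
    "ueval cj R A V (embed cj R t) = eval_term A V t"
    "ueval cj R A V x \<in> carr A"
proof -
  have R: "eval_term A V s = eval_term A V t" if "(s, t) \<in> R" for s t using R' that by auto
  note u = ueval_abs[OF A T R]
  define f g where "f = rep_ualg x" and "g = rep_ualg y"
  have f: "x = abs_ualg f" and g: "y = abs_ualg g" unfolding f_def g_def by (simp_all add: Quotient3_abs_rep[OF Quotient3_ualg])
  show "ueval cj R A V (x + y) = aadd A (ueval cj R A V x) (ueval cj R A V y)" unfolding f g plus_ualg.abs_eq by (simp add: u)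
  show "ueval cj R A V (x * y) = amul A (ueval cj R A V x) (ueval cj R A V y)" unfolding f g times_ualg.abs_eq by (simp add: u)
  show "ueval cj R A V (uscale c x) = ascale A c (ueval cj R A V x)" unfolding f uscale.abs_eq by (simp add: u)
  show "ueval cj R A V (embed cj R t) = eval_term A V t" unfolding embed.abs_eq by (simp add: u)
  show "ueval cj R A V x \<in> carr A" unfolding f by (simp add: u eval_term_closed[OF A T])
qed

section \<open>The isomorphisms\<close>

lemma uscale_minus: "uscale (- 1) x = - x"
  by transfer (simp add: cong_fun_def star_cong.refl)

lemma embed_join: "embed cj R (join_term ts) = qjoin (map (embed cj R) ts)"
  by (induction ts) (simp_all add: embed_simps uscale_minus)

lemma scalar_inv_id: "scalar_inv id"
  by (simp add: scalar_inv_def)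

lemma star_alg_homD:
  assumes "star_alg_hom A B h"
  shows "x \<in> carr A \<Longrightarrow> h x \<in> carr B"
    "\<lbrakk>x \<in> carr A; y \<in> carr A\<rbrakk> \<Longrightarrow> h (aadd A x y) = aadd B (h x) (h y)"
    "x \<in> carr A \<Longrightarrow> h (ascale A c x) = ascale B c (h x)"
    "\<lbrakk>x \<in> carr A; y \<in> carr A\<rbrakk> \<Longrightarrow> h (amul A x y) = amul B (h x) (h y)"
    "x \<in> carr A \<Longrightarrow> h (astar A x) = astar B (h x)"
  using assms unfolding star_alg_hom_def by simp_all

lemma star_alg_hom_inv:
  assumes A: "star_algebra cj A" and h: "star_alg_hom A B h" and bij: "bij_betw h (carr A) (carr B)"
  shows "star_alg_hom B A (inv_into (carr A) h)"
proof -
  let ?g = "inv_into (carr A) h"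
  note hD = star_alg_homD[OF h]
  interpret star_alg_on cj A by (rule star_alg_on.intro[OF A])
  have g: "?g y \<in> carr A" "h (?g y) = y" if "y \<in> carr B" for y
    using bij_betw_inv_into_right[OF bij that] that bij by (auto simp: bij_betw_def intro: inv_into_into)
  have gh: "?g (h x) = x" if "x \<in> carr A" for x using bij_betw_inv_into_left[OF bij that] .
  show ?thesis unfolding star_alg_hom_def
  proof (intro conjI ballI allI)
    fix x y assume x: "x \<in> carr B" and y: "y \<in> carr B"
    show "?g (aadd B x y) = aadd A (?g x) (?g y)"
      using gh[of "aadd A (?g x) (?g y)"] hD(2)[of "?g x" "?g y"] g x y by simp
    show "?g (amul B x y) = amul A (?g x) (?g y)"
      using gh[of "amul A (?g x) (?g y)"] hD(4)[of "?g x" "?g y"] g x y by simp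
  next
    fix x assume x: "x \<in> carr B"
    show "?g x \<in> carr A" using g x by simp
    show "?g (astar B x) = astar A (?g x)" using gh[of "astar A (?g x)"] hD(5)[of "?g x"] g x by simp
    show "?g (ascale B c x) = ascale A c (?g x)" for c
      using gh[of "ascale A c (?g x)"] hD(3)[of "?g x" c] g x by simp
  qed
qed

lemma cstar_seminorm_pullback:
  assumes A: "star_algebra cnj A" and h: "star_alg_hom A B h" and p: "cstar_seminorm B p"
  shows "cstar_seminorm A (\<lambda>x. p (h x))"
proof -
  note hD = star_alg_homD[OF h] and pD = cstar_seminormD[OF p]
  interpret star_alg_on cnj A by (rule star_alg_on.intro[OF A])
  show ?thesis unfolding cstar_seminorm_def
    by (simp add: hD(2-5) hD(1) pD(1) pD(2) pD(3) pD(4) pD(5))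
qed

lemma seminorms_iso:
  assumes A: "star_algebra cnj A" and B: "star_algebra cnj B" and h: "star_alg_hom A B h"
    and bij: "bij_betw h (carr A) (carr B)" and x: "x \<in> carr A"
  shows "(\<lambda>p. p (h x)) ` {p. cstar_seminorm B p} = (\<lambda>p. p x) ` {p. cstar_seminorm A p}"
proof (intro equalityI image_subsetI)
  fix p assume "p \<in> {p. cstar_seminorm B p}"
  then show "p (h x) \<in> (\<lambda>p. p x) ` {p. cstar_seminorm A p}"
    using cstar_seminorm_pullback[OF A h] by (intro image_eqI[of _ _ "\<lambda>x. p (h x)"]) simp_all
next
  fix p assume "p \<in> {p. cstar_seminorm A p}"
  then show "p x \<in> (\<lambda>p. p (h x)) ` {p. cstar_seminorm B p}"
    using cstar_seminorm_pullback[OF B star_alg_hom_inv[OF A h bij]] bij_betw_inv_into_left[OF bij x]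
    by (intro image_eqI[of _ _ "\<lambda>y. p (inv_into (carr A) h y)"]) simp_all
qed

context lcsc
begin

lemma relation_embed: "(s, t) \<in> cat_relations \<Lambda> \<Longrightarrow> embed cj (cat_relations \<Lambda>) s = embed cj (cat_relations \<Lambda>) t"
  unfolding embed_eq_iff by (rule star_cong.rel)

text \<open>The relations hold for embedded generators by construction of the congruence, and
  evaluation in the Steinberg algebra plays the part of \<open>\<Phi>\<close>.\<close>

lemma cat_rep_universal:
  fixes cj :: "'r::{comm_ring, comm_monoid_mult} \<Rightarrow> 'r"
  assumes cj: "scalar_inv cj"
  defines "em \<equiv> embed cj (cat_relations \<Lambda>)"
  shows "cat_rep \<Lambda> uscale (\<lambda>\<alpha>. em (Gen \<alpha>)) (\<lambda>\<alpha>. em (Star (Gen \<alpha>)))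
    (ueval cj (cat_relations \<Lambda>) (groupoid_alg cj TG G.SB) gen_ind)"
proof -
  let ?R = "cat_relations \<Lambda> :: (('r, 'a) star_term \<times> ('r, 'a) star_term) set"
  note es = embed_simps[of cj ?R, folded em_def] and rel = relation_embed[of _ _ cj, folded em_def]
  have st: "star_cong cj ?R s t \<Longrightarrow> em s = em t" for s t unfolding em_def embed_eq_iff .
  have iso: "(Mul (Star (Gen \<alpha>)) (Gen \<alpha>), Gen (so \<alpha>)) \<in> ?R" if "\<alpha> \<in> Mo" for \<alpha>
    using that unfolding cat_relations_def by auto
  have cmp: "(Mul (Gen \<alpha>) (Gen \<beta>), Gen (\<alpha> \<bullet>\<bullet> \<beta>)) \<in> ?R" if "\<alpha> \<in> Mo" "\<beta> \<in> Mo" "so \<alpha> = ra \<beta>" for \<alpha> \<beta>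
    using that unfolding cat_relations_def by auto
  have vee: "(Mul (range_proj \<alpha>) (range_proj \<beta>), join_term (map range_proj \<gamma>s)) \<in> ?R"
    if "\<alpha> \<in> Mo" "\<beta> \<in> Mo" "distinct \<gamma>s" "is_vee \<Lambda> \<alpha> \<beta> (set \<gamma>s)" for \<alpha> \<beta> \<gamma>s
    using that unfolding cat_relations_def by blast
  have exh: "(Gen v, join_term (map range_proj \<gamma>s)) \<in> ?R"
    if "v \<in> Obj \<Lambda>" "distinct \<gamma>s" "exhaustive \<Lambda> v (set \<gamma>s)" for v \<gamma>s
    using that unfolding cat_relations_def by blast
  have rp: "em (range_proj \<alpha>) = em (Gen \<alpha>) * em (Star (Gen \<alpha>))" for \<alpha> by (simp add: range_proj_def es)
  have jn: "em (join_term (map range_proj \<gamma>s)) = qjoin (map (\<lambda>\<gamma>. em (Gen \<gamma>) * em (Star (Gen \<gamma>))) \<gamma>s)" for \<gamma>s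
    using embed_join[of cj ?R, folded em_def] rp by (simp add: comp_def)
  interpret cat_family \<Lambda> uscale "\<lambda>\<alpha>. em (Gen \<alpha>)" "\<lambda>\<alpha>. em (Star (Gen \<alpha>))"
  proof unfold_locales
    fix \<alpha> assume a: "\<alpha> \<in> Mo"
    show "em (Star (Gen \<alpha>)) * em (Gen \<alpha>) = em (Gen (so \<alpha>))" using rel[OF iso[OF a]] by (simp add: es)
    let ?m = "Mul (Star (Gen \<alpha>)) (Gen \<alpha>)"
    \<comment> \<open>Taking the adjoint of relation (i) shows that the generator of an object is
      self-adjoint, since the left side of (i) is.\<close>
    have "em (Star (Gen (so \<alpha>))) = em (Star ?m)" by (rule st, rule star_cong.cong_star, rule star_cong.sym, rule star_cong.rel, rule iso[OF a])
    also have "\<dots> = em (Mul (Star (Gen \<alpha>)) (Star (Star (Gen \<alpha>))))" by (intro st star_cong.star_mul)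
    also have "\<dots> = em ?m" by (rule st, rule star_cong.cong_mul, rule star_cong.refl, rule star_cong.star_star)
    also have "\<dots> = em (Gen (so \<alpha>))" by (rule rel[OF iso[OF a]])
    finally show "em (Star (Gen (so \<alpha>))) = em (Gen (so \<alpha>))" .
    fix \<beta> assume b: "\<beta> \<in> Mo"
    {
      assume c: "so \<alpha> = ra \<beta>"
      show "em (Gen \<alpha>) * em (Gen \<beta>) = em (Gen (\<alpha> \<bullet>\<bullet> \<beta>))" using rel[OF cmp[OF a b c]] by (simp add: es)
      have "em (Star (Gen \<beta>)) * em (Star (Gen \<alpha>)) = em (Mul (Star (Gen \<beta>)) (Star (Gen \<alpha>)))" by (simp add: es)
      also have "\<dots> = em (Star (Mul (Gen \<alpha>) (Gen \<beta>)))" by (rule st, rule star_cong.sym, rule star_cong.star_mul)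
      also have "\<dots> = em (Star (Gen (\<alpha> \<bullet>\<bullet> \<beta>)))" by (rule st, rule star_cong.cong_star, rule star_cong.rel, rule cmp[OF a b c])
      finally show "em (Star (Gen \<beta>)) * em (Star (Gen \<alpha>)) = em (Star (Gen (\<alpha> \<bullet>\<bullet> \<beta>)))" .
    }
    fix \<gamma>s assume "distinct \<gamma>s" "is_vee \<Lambda> \<alpha> \<beta> (set \<gamma>s)"
    from rel[OF vee[OF a b this]]
    show "em (Gen \<alpha>) * em (Star (Gen \<alpha>)) * (em (Gen \<beta>) * em (Star (Gen \<beta>))) =
        qjoin (map (\<lambda>\<gamma>. em (Gen \<gamma>) * em (Star (Gen \<gamma>))) \<gamma>s)" by (simp add: es(2) rp jn)
  next
    fix v \<gamma>s assume "v \<in> Obj \<Lambda>" "distinct \<gamma>s" "exhaustive \<Lambda> v (set \<gamma>s)"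
    from rel[OF exh[OF this]] show "em (Gen v) = qjoin (map (\<lambda>\<gamma>. em (Gen \<gamma>) * em (Star (Gen \<gamma>))) \<gamma>s)" by (simp add: jn)
  qed (rule uscale_simps)+
  let ?A = "groupoid_alg cj TG G.SB"
  have sa: "star_algebra cj ?A" by (rule G.star_algebra_steinberg[OF cj])
  have V: "gen_ind \<alpha> \<in> carr ?A" for \<alpha> unfolding G.groupoid_alg_simps by (rule gen_ind_SB)
  have ev_rel: "\<forall>(s, t)\<in>?R. eval_term ?A gen_ind s = eval_term ?A gen_ind t"
    by (clarify, rule eval_relations[OF cj])
  note u = ueval_simps[OF sa V ev_rel, unfolded G.groupoid_alg_simps, folded em_def]
  show ?thesis
  proof unfold_locales
    fix \<alpha> assume a: "\<alpha> \<in> Mo"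
    show "ueval cj ?R ?A gen_ind (em (Gen \<alpha>)) = ind (F \<alpha> (so \<alpha>))"
      unfolding u(4) using a by (simp add: gen_ind_def)
    show "ueval cj ?R ?A gen_ind (em (Star (Gen \<alpha>))) = ind (F (so \<alpha>) \<alpha>)"
      unfolding u(4) using a by (simp add: gen_ind_def G.groupoid_alg_simps F_gstar[OF cj])
  qed (rule u)+
qed

text \<open>The homomorphism from the universal property is onto by
  \<open>steinberg_generated_F\<close>. For injectivity, the difference of two terms with the same
  image is embedded into \<open>ualg\<close>, where it lies in \<open>Sp\<close> and
  \<open>\<Phi>_inj\<close> applies.\<close>

theorem universal_iso:
  fixes cj :: "'r::{comm_ring, comm_monoid_mult} \<Rightarrow> 'r"
  assumes cj: "scalar_inv cj"
  shows "\<exists>h. star_alg_hom (universal_cat_alg cj \<Lambda>) (groupoid_alg cj TG G.SB) h \<and>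
    bij_betw h (carr (universal_cat_alg cj \<Lambda>)) (fun_span G.SB)"
proof -
  let ?R = "cat_relations \<Lambda> :: (('r, 'a) star_term \<times> ('r, 'a) star_term) set"
  let ?A = "groupoid_alg cj TG G.SB" and ?P = "presented_alg cj Mo ?R" and ?c = "term_class cj Mo ?R"
  define em where "em = embed cj ?R"
  define ev where "ev = eval_term ?A gen_ind"
  have sa: "star_algebra cj ?A" by (rule G.star_algebra_steinberg[OF cj])
  have V: "gen_ind \<alpha> \<in> carr ?A" for \<alpha> unfolding G.groupoid_alg_simps by (rule gen_ind_SB)
  have ev_rel: "\<forall>(s, t)\<in>?R. eval_term ?A gen_ind s = eval_term ?A gen_ind t"
    by (clarify, rule eval_relations[OF cj])
  note u = ueval_simps[OF sa V ev_rel, unfolded G.groupoid_alg_simps]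
  have "\<exists>h. star_alg_hom ?P ?A h \<and> (\<forall>x\<in>Mo. h (?c (Gen x)) = gen_ind x) \<and>
    (\<forall>h'. star_alg_hom ?P ?A h' \<and> (\<forall>x\<in>Mo. h' (?c (Gen x)) = gen_ind x) \<longrightarrow> (\<forall>P\<in>carr ?P. h' P = h P))"
    by (rule presented_alg_universal[OF sa V cat_relations_subset[OF cat]]) (rule eval_relations[OF cj])
  then obtain h where h: "star_alg_hom ?P ?A h" "\<forall>x\<in>Mo. h (?c (Gen x)) = gen_ind x" by (elim exE conjE)
  note hD = star_alg_homD[OF h(1)]
  have mem: "?c t \<in> carr ?P" if "t \<in> terms_over Mo" for t using that by (simp add: carr_presented_alg)
  have hc: "h (?c t) = ev t" if "t \<in> terms_over Mo" for t
    using that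
  proof (induction t)
    case (Gen x)
    then show ?case using h(2) by (simp add: ev_def)
  next
    case Zero
    \<comment> \<open>\<open>star_alg_hom\<close> has no clause for the zero element, hence the
      detour through the scalar \<open>0\<close>.\<close>
    have "?c Zero = ?c (Scale 0 Zero)" by (intro term_class_eqI star_cong_Zero)
    also have "h \<dots> = ascale ?A 0 (h (?c Zero))" using hD(3)[OF mem, of Zero 0] by (simp add: presented_alg_scale)
    also have "\<dots> = (\<lambda>_. 0)" by (simp add: G.groupoid_alg_simps)
    finally show ?case by (simp add: ev_def G.groupoid_alg_simps)
  next
    case (Add s t)
    then show ?case using hD(2)[OF mem mem, of s t] by (simp add: presented_alg_add ev_def)
  next
    case (Scale c t)
    then show ?case using hD(3)[OF mem, of t c] by (simp add: presented_alg_scale ev_def)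
  next
    case (Mul s t)
    then show ?case using hD(4)[OF mem mem, of s t] by (simp add: presented_alg_mul ev_def)
  next
    case (Star t)
    then show ?case using hD(5)[OF mem, of t] by (simp add: presented_alg_star ev_def)
  qed
  have img: "h ` carr ?P = ev ` terms_over Mo"
    unfolding carr_presented_alg image_image by (rule image_cong[OF HOL.refl hc])
  have evs: "ev (Add s t) = (\<lambda>x. ev s x + ev t x)" "ev (Mul s t) = convolution TG (ev s) (ev t)"
      "ev (Scale c t) = (\<lambda>x. c * ev t x)" "ev (Star t) = G.gstar cj (ev t)" "ev Zero = (\<lambda>_. 0)" for s t c
    by (simp_all add: ev_def G.groupoid_alg_simps)
  have surj: "fun_span G.SB \<subseteq> ev ` terms_over Mo"
  proof (rule steinberg_generated_F[OF cj])
    show "ind (F \<alpha> (so \<alpha>)) \<in> ev ` terms_over Mo" if "\<alpha> \<in> Mo" for \<alpha>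
      using that by (intro image_eqI[of _ _ "Gen \<alpha>"]) (simp_all add: ev_def gen_ind_def)
    show "(\<lambda>_. 0) \<in> ev ` terms_over Mo" by (intro image_eqI[of _ _ Zero]) (simp_all add: evs)
  next
    fix f g assume "f \<in> ev ` terms_over Mo" "g \<in> ev ` terms_over Mo"
    then obtain s t where s: "f = ev s" "s \<in> terms_over Mo" and t: "g = ev t" "t \<in> terms_over Mo" by (elim imageE)
    show "(\<lambda>x. f x + g x) \<in> ev ` terms_over Mo" using s t by (intro image_eqI[of _ _ "Add s t"]) (simp_all add: evs)
    show "convolution TG f g \<in> ev ` terms_over Mo" using s t by (intro image_eqI[of _ _ "Mul s t"]) (simp_all add: evs)
  next
    fix f c assume "f \<in> ev ` terms_over Mo"
    then obtain s where s: "f = ev s" "s \<in> terms_over Mo" by (elim imageE)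
    show "(\<lambda>x. c * f x) \<in> ev ` terms_over Mo" using s by (intro image_eqI[of _ _ "Scale c s"]) (simp_all add: evs)
    show "G.gstar cj f \<in> ev ` terms_over Mo" using s by (intro image_eqI[of _ _ "Star s"]) (simp_all add: evs)
  qed
  have onto: "h ` carr ?P = fun_span G.SB"
    using surj hD(1) unfolding img[symmetric] G.groupoid_alg_simps by auto
  interpret cat_rep \<Lambda> uscale "\<lambda>\<alpha>. em (Gen \<alpha>)" "\<lambda>\<alpha>. em (Star (Gen \<alpha>))" "ueval cj ?R ?A gen_ind"
    unfolding em_def by (rule cat_rep_universal[OF cj])
  note es = embed_simps[of cj ?R, folded em_def]
  have st: "star_cong cj ?R s t \<Longrightarrow> em s = em t" for s t unfolding em_def embed_eq_iff .
  \<comment> \<open>The adjoint is carried along because the ring \<open>ualg\<close> has no star;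
    the \<open>Star\<close> case of the induction exchanges the two halves.\<close>
  have Sp: "em t \<in> Sp \<and> em (Star t) \<in> Sp" if "t \<in> terms_over Mo" for t
    using that
  proof (induction t)
    case (Gen x)
    then show ?case using Sp_T by simp
  next
    case Zero
    have "em (Star Zero) = em (Star (Scale 0 Zero))" by (rule st, rule star_cong.cong_star, rule star_cong_Zero)
    also have "\<dots> = em (Scale (cj 0) (Star Zero))" by (intro st star_cong.star_scale)
    also have "\<dots> = 0" by (simp add: es scalar_invD(4)[OF cj])
    finally show ?case by (simp add: es Sp_zero)
  next
    case (Add s t)
    have "em (Star (Add s t)) = em (Add (Star s) (Star t))" by (intro st star_cong.star_add)
    then show ?case using Add by (simp add: es Sp_add)
  next
    case (Scale c t)
    have "em (Star (Scale c t)) = em (Scale (cj c) (Star t))" by (intro st star_cong.star_scale)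
    then show ?case using Scale by (simp add: es Sp_sc)
  next
    case (Mul s t)
    have "em (Star (Mul s t)) = em (Mul (Star t) (Star s))" by (intro st star_cong.star_mul)
    then show ?case using Mul by (simp add: es Sp_mult)
  next
    case (Star t)
    have "em (Star (Star t)) = em t" by (intro st star_cong.star_star)
    then show ?case using Star by simp
  qed
  have inj: "inj_on h (carr ?P)"
  proof (rule inj_onI)
    fix x y assume "x \<in> carr ?P" "y \<in> carr ?P" and eq: "h x = h y"
    then obtain s t where s: "x = ?c s" "s \<in> terms_over Mo" and t: "y = ?c t" "t \<in> terms_over Mo"
      unfolding carr_presented_alg by (elim imageE)
    have "ev s = ev t" using eq hc s t by simp
    then have 0: "ev (Add s (Scale (- 1) t)) = (\<lambda>_. 0)" unfolding evs by (simp add: fun_eq_iff)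
    have "ueval cj ?R ?A gen_ind (em (Add s (Scale (- 1) t))) = (\<lambda>_. 0)"
      unfolding em_def u(4) using 0 unfolding ev_def .
    moreover have "em (Add s (Scale (- 1) t)) \<in> Sp" using Sp s(2) t(2) by simp
    ultimately have "em (Add s (Scale (- 1) t)) = 0" by (intro \<Phi>_inj)
    then have "em s = em t" by (simp add: es uscale_minus)
    then show "x = y" unfolding s t em_def embed_eq_iff by (rule term_class_eqI)
  qed
  show ?thesis unfolding universal_cat_alg_def using h(1) inj onto by (intro exI[of _ h] conjI bij_betw_imageI)
qed

theorem steinberg_isomorphism:
  "star_alg_isomorphic (cat_alg \<Lambda> :: ('r::{comm_ring, comm_monoid_mult}, ('r, 'a) star_term set) star_alg) (steinberg_alg TG)"
  unfolding star_alg_isomorphic_def cat_alg_def G.steinberg_alg_eq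
  using universal_iso[OF scalar_inv_id] by (simp add: G.groupoid_alg_simps)

text \<open>The composite of the isomorphism onto the Steinberg algebra with the inclusion into the
  larger convolution algebra preserves the largest seminorm and has dense range, so the completions
  coincide.\<close>

theorem cstar_isomorphism: "cstar_isomorphic (cat_cstar \<Lambda>) (groupoid_cstar TG)"
proof -
  let ?P = "universal_cat_alg cnj \<Lambda>" and ?SA = "groupoid_alg cnj TG G.SB" and ?CA = "groupoid_alg cnj TG (Cc_bisections TG)"
  obtain h where h: "star_alg_hom ?P ?SA h" "bij_betw h (carr ?P) (fun_span G.SB)"
    using universal_iso[OF scalar_inv_cnj] by (elim exE conjE)
  have P: "star_algebra cnj ?P" unfolding universal_cat_alg_def by (rule star_algebra_presented_alg)
  have SA: "star_algebra cnj ?SA" by (rule G.star_algebra_steinberg[OF scalar_inv_cnj])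
  note hD = star_alg_homD[OF h(1), unfolded G.groupoid_alg_simps]
  note iso = seminorms_iso[OF P SA h(1), unfolded G.groupoid_alg_simps(1), OF h(2)]
  have hC: "h x \<in> carr ?CA" if "x \<in> carr ?P" for x
    unfolding G.groupoid_alg_simps by (rule G.SB_Cc[OF hD(1)[OF that]])
  interpret C: bounded_star_alg ?CA
    by (intro bounded_star_alg.intro star_alg_on.intro bounded_star_alg_axioms.intro
        G.star_algebra_CA G.CA_seminorms_bounded)
  have bdd: "\<exists>M. \<forall>p. cstar_seminorm ?P p \<longrightarrow> p x \<le> M" if x: "x \<in> carr ?P" for x
  proof -
    \<comment> \<open>A seminorm on the universal algebra is transported to the Steinberg algebra
      and extended by \<open>pext\<close>; the bound for the larger convolution algebra then applies
      to it.\<close>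
    obtain M where M: "\<And>p. cstar_seminorm ?CA p \<Longrightarrow> p (h x) \<le> M" using C.bounded[OF hC[OF x]] by auto
    have "p x \<le> M" if p: "cstar_seminorm ?P p" for p
    proof -
      have "p x \<in> (\<lambda>p. p x) ` {p. cstar_seminorm ?P p}" using p by simp
      then obtain p' where p': "cstar_seminorm ?SA p'" "p x = p' (h x)" unfolding iso[OF x, symmetric] by auto
      show ?thesis
        using M[OF G.cstar_seminorm_pext[OF p'(1)]] G.pext_eq[OF p'(1) hD(1)[OF x]] p'(2) by simp
    qed
    then show ?thesis by (intro exI[of _ M]) simp
  qed
  have "bounded_star_alg ?P"
    by (intro bounded_star_alg.intro star_alg_on.intro bounded_star_alg_axioms.intro P bdd)
  then have "cstar_isomorphic (enveloping_cstar ?P) (enveloping_cstar ?CA)"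
  proof (rule enveloping_isomorphic[OF _ C.bounded_star_alg_axioms, where \<iota> = h])
    show "star_alg_hom ?P ?CA h"
      unfolding star_alg_hom_def using hD hC by (simp add: G.groupoid_alg_simps)
    fix x assume x: "x \<in> carr ?P"
    show "max_seminorm ?CA (h x) = max_seminorm ?P x"
      unfolding G.max_seminorm_SA_CA[OF hD(1)[OF x]] unfolding max_seminorm_def iso[OF x] ..
  next
    fix y :: "'a germ \<Rightarrow> complex" and \<epsilon> :: real
    assume y: "y \<in> carr ?CA" and e: "\<epsilon> > 0"
    obtain k where k: "k \<in> fun_span G.SB" "\<And>p. cstar_seminorm ?CA p \<Longrightarrow> p (asub ?CA y k) \<le> \<epsilon>"
      using G.SB_dense[of y \<epsilon>] y e unfolding G.groupoid_alg_simps by auto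
    obtain x where x: "x \<in> carr ?P" "k = h x" using k(1) h(2) unfolding bij_betw_def by auto
    show "\<exists>x\<in>carr ?P. max_seminorm ?CA (asub ?CA y (h x)) \<le> \<epsilon>"
      using x(1) C.max_le[OF k(2)] unfolding x(2) by (rule bexI[rotated])
  qed
  then show ?thesis unfolding cat_cstar_def groupoid_cstar_def .
qed

end

theorem theorem4p16:
  fixes \<Lambda> :: "'a small_cat"
  assumes "small_category \<Lambda>"
    and "left_cancellative \<Lambda>"
    and "finitely_aligned \<Lambda>"
    and "countable (Mor \<Lambda>)"
  shows "cstar_isomorphic (cat_cstar \<Lambda>) (groupoid_cstar (tight_groupoid \<Lambda>)) \<and>
    star_alg_isomorphic
      (cat_alg \<Lambda> :: ('r::{comm_ring, comm_monoid_mult}, ('r, 'a) star_term set) star_alg)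
      (steinberg_alg (tight_groupoid \<Lambda>))"
proof -
  interpret lcsc \<Lambda> using assms by unfold_locales
  show ?thesis using cstar_isomorphism steinberg_isomorphism by (rule conjI)
qed

end
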